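(* Suppose $G=\mathsf{SO}(3)$ acts freely on $\mathcal{P}$ in a Hamiltonian way with equivariant momentum map $\mathbf{J}$, and let $H$ be a smooth $G$-invariant Hamiltonian. Suppose that $p_0\in\mathcal{P}_0$ (zero momentum) is a non-degenerate relative equilibrium with non-zero angular velocity $\xi\in\mathfrak{so}(3)$. Then: 1. There is a neighbourhood of $p_0$ in $\mathcal{P}/G$ such that the relative equilibria in the neighbourhood form a smooth curve through $p_0$ intersecting each nearby reduced space $\mathcal{P}_\mu$ ($\mu\neq0$) in precisely 2 points. 2. If the Hessian $d^2H_0(p_0)$ of the reduced Hamiltonian $H_0$ on $\mathcal{P}_0$ is definite, then on one side of $p_0$ on the curve (near $p_0$) the relative equilibria are Lyapunov stable, and if there is no rotation-vibration resonance then on the other side they are elliptic. 3. If $p_0$ is strongly linearly stable and there is no rotation-vibration resonance, then throughout a neighbourhood of $p_0$ on the curve the relative equilibria are elliptic. 4. If $p_0$ is linearly unstable, then throughout the curve (in a neighbourhood of $p_0$) the relative equilibria are all linearly unstable.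
   Context: Setting. $(\mathcal{P},\omega)$ is a symplectic manifold with a free Hamiltonian action of $\mathsf{SO}(3)$ and equivariant momentum map $\mathbf{J}:\mathcal{P}\to\mathfrak{so}(3)^*$. All statements are local near an orbit in $\mathbf{J}^{-1}(0)$, so by the Marle–Guillemin–Sternberg normal form $\mathcal{P}$ may be taken to be an $\mathsf{SO}(3)$-invariant neighbourhood in $\mathsf{SO}(3)\times\mathfrak{so}(3)^*\times\mathcal{S}$, where $\mathcal{S}$ (a slice to the orbit inside $\mathbf{J}^{-1}(0)$) is symplectic, with action $g'\cdot(g,\rho,v)=(g'g,\rho,v)$ and $\mathbf{J}(g,\rho,v)=\mathrm{Coad}_g\rho$. Then $\mathcal{P}/\mathsf{SO}(3)\simeq\mathfrak{so}(3)^*\times\mathcal{S}$ locally, $H$ is identified with a function $H(\mu,s)$ on it, and the reduced space is $\mathcal{P}_\mu=\mathcal{O}_\mu\times\mathcal{S}$, where $\mathcal{O}_\mu\subset\mathfrak{so}(3)^*\simeq\mathbb{R}^3$ is the coadjoint orbit (a sphere centred at $0$, or the point $\{0\}$ if $\mu=0$). $H_\mu$ denotes the restriction of $H$ to $\mathcal{P}_\mu$ (so $H_0$ is the reduced Hamiltonian on $\mathcal{P}_0=\{0\}\times\mathcal{S}$). A relative equilibrium is a point of $\mathcal{P}$ whose Hamiltonian vector field equals $\xi_{\mathcal{P}}$ at that point for some $\xi\in\mathfrak{so}(3)$ (the angular velocity); equivalently its image in $\mathcal{P}_\mu$ is a critical point of $H_\mu$, and relative equilibria are identified with these images in $\mathcal{P}/G$.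 A relative equilibrium at $\bar p\in\mathcal{P}_\mu$ is non-degenerate if $d^2H_\mu(\bar p)$ is non-degenerate. Write $p_0=(0,s_0)$. The angular velocity is $\xi=D_\mu H(0,s_0)$. The dynamics on $\mathcal{P}/G$ is $\dot\mu=-\mathrm{coad}_{D_\mu H}\,\mu$, $\dot s=J\,D_sH$, with $J$ the symplectic structure matrix on $\mathcal{S}$. Put $L_0=J\,D_s^2H(0,s_0)$, the linearization at $p_0$ of the reduced dynamics on $\mathcal{P}_0$. The spectrum of $-\mathrm{coad}_\xi$ is $\{0,\pm \mathsf{i}|\xi|\}$. There is a rotation-vibration resonance if the spectra of $L_0$ and $-\mathrm{coad}_\xi$ are not disjoint. Stability notions for a relative equilibrium with momentum $\mu$ refer to the corresponding equilibrium of the reduced Hamiltonian system on the symplectic manifold $\mathcal{P}_\mu$. Lyapunov stable means this equilibrium is Lyapunov stable on $\mathcal{P}_\mu$. An infinitesimally symplectic matrix is: spectrally stable if its spectrum is purely imaginary; linearly stable, or elliptic, if it is spectrally stable with zero nilpotent part; strongly linearly stable if it lies in the interior (among infinitesimally symplectic matrices) of the set of linearly stable matrices; linearly unstable if it has an eigenvalue with non-zero real part. An equilibrium has one of these properties if the linearization of the reduced Hamiltonian vector field at it does (for $p_0$ this linearization is $L_0$). *)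

theory Defs
  imports "HOL-Analysis.Analysis"
begin

section \<open>Smooth functions and second derivatives\<close>

fun Ck_on :: "nat \<Rightarrow> 'a::real_normed_vector set \<Rightarrow> ('a \<Rightarrow> 'b::real_normed_vector) \<Rightarrow> bool" where
  "Ck_on 0 U f \<longleftrightarrow> continuous_on U f"
| "Ck_on (Suc k) U f \<longleftrightarrow> (\<forall>x\<in>U. f differentiable (at x)) \<and>
     (\<forall>v. Ck_on k U (\<lambda>x. frechet_derivative f (at x) v))"

definition Cinf_on :: "'a::real_normed_vector set \<Rightarrow> ('a \<Rightarrow> 'b::real_normed_vector) \<Rightarrow> bool" where
  "Cinf_on U f \<longleftrightarrow> (\<forall>k. Ck_on k U f)"

text \<open>For an embedded submanifold \<open>A\<close> of a Euclidean space, a function on \<open>A\<close> is smooth iff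
  locally it is the restriction of a smooth function on an open subset of the ambient space.\<close>

definition smooth_on :: "'a::real_normed_vector set \<Rightarrow> ('a \<Rightarrow> 'b::real_normed_vector) \<Rightarrow> bool" where
  "smooth_on A f \<longleftrightarrow> (\<forall>x\<in>A. \<exists>U F. open U \<and> x \<in> U \<and> Cinf_on U F \<and> (\<forall>y\<in>A \<inter> U. F y = f y))"

text \<open>Throughout, the differential of a function \<open>f\<close> on a submanifold \<open>A\<close> is the Frechet derivative of
  \<open>f\<close> within \<open>A\<close>. It is unique only on the tangent space of \<open>A\<close>, and it is only ever evaluated there.\<close>

definition hessian :: "'a::real_normed_vector set \<Rightarrow> ('a \<Rightarrow> real) \<Rightarrow> 'a \<Rightarrow> 'a \<Rightarrow> 'a \<Rightarrow> real" where
  "hessian A f x u v = frechet_derivative (\<lambda>y. frechet_derivative f (at y within A) v) (at x within A) u"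


section \<open>Spectral notions for a linear map on a real subspace\<close>

text \<open>A vector \<open>u + \<i> v\<close> of the complexification of \<open>V\<close> is represented by the pair \<open>(u, v)\<close> in
  \<open>V \<times> V\<close>. The set of all complex eigenvectors is closed under complex scalars, so its real span is
  its complex span, and \<open>semisimple\<close> below says that the complexification of \<open>L\<close> is diagonalizable.\<close>

definition complex_eigenvector ::
    "'a::real_vector set \<Rightarrow> ('a \<Rightarrow> 'a) \<Rightarrow> complex \<Rightarrow> 'a \<times> 'a \<Rightarrow> bool" where
  "complex_eigenvector V L l z \<longleftrightarrow> z \<in> V \<times> V \<and> z \<noteq> 0 \<and>
     L (fst z) = Re l *\<^sub>R fst z - Im l *\<^sub>R snd z \<and>
     L (snd z) = Im l *\<^sub>R fst z + Re l *\<^sub>R snd z"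

definition spectrum_on :: "'a::real_vector set \<Rightarrow> ('a \<Rightarrow> 'a) \<Rightarrow> complex set" where
  "spectrum_on V L = {l. \<exists>z. complex_eigenvector V L l z}"

definition semisimple :: "'a::real_vector set \<Rightarrow> ('a \<Rightarrow> 'a) \<Rightarrow> bool" where
  "semisimple V L \<longleftrightarrow> V \<times> V \<subseteq> span {z. \<exists>l. complex_eigenvector V L l z}"

text \<open>\<open>N\<close> is the nilpotent part of \<open>L\<close> in the Jordan-Chevalley decomposition.\<close>

definition nilpotent_part :: "'a::real_vector set \<Rightarrow> ('a \<Rightarrow> 'a) \<Rightarrow> ('a \<Rightarrow> 'a) \<Rightarrow> bool" where
  "nilpotent_part V L N \<longleftrightarrow> linear N \<and> N ` V \<subseteq> V \<and>
     (\<forall>v\<in>V. L (N v) = N (L v)) \<and> (\<exists>k. \<forall>v\<in>V. (N ^^ k) v = 0) \<and>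
     semisimple V (\<lambda>v. L v - N v)"

definition spectrally_stable :: "'a::real_vector set \<Rightarrow> ('a \<Rightarrow> 'a) \<Rightarrow> bool" where
  "spectrally_stable V L \<longleftrightarrow> (\<forall>l\<in>spectrum_on V L. Re l = 0)"

definition linearly_stable :: "'a::real_vector set \<Rightarrow> ('a \<Rightarrow> 'a) \<Rightarrow> bool" where
  "linearly_stable V L \<longleftrightarrow> spectrally_stable V L \<and> nilpotent_part V L (\<lambda>_. 0)"

definition linearly_unstable :: "'a::real_vector set \<Rightarrow> ('a \<Rightarrow> 'a) \<Rightarrow> bool" where
  "linearly_unstable V L \<longleftrightarrow> (\<exists>l\<in>spectrum_on V L. Re l \<noteq> 0)"

definition inf_symplectic ::
    "'a::real_vector set \<Rightarrow> ('a \<Rightarrow> 'a \<Rightarrow> real) \<Rightarrow> ('a \<Rightarrow> 'a) \<Rightarrow> bool" where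
  "inf_symplectic V \<Omega> L \<longleftrightarrow> linear L \<and> L ` V \<subseteq> V \<and> (\<forall>u\<in>V. \<forall>v\<in>V. \<Omega> (L u) v + \<Omega> u (L v) = 0)"

text \<open>The interior is taken among infinitesimally symplectic maps of \<open>V\<close>, for the operator norm on \<open>V\<close>.\<close>

definition strongly_linearly_stable ::
    "'a::real_normed_vector set \<Rightarrow> ('a \<Rightarrow> 'a \<Rightarrow> real) \<Rightarrow> ('a \<Rightarrow> 'a) \<Rightarrow> bool" where
  "strongly_linearly_stable V \<Omega> L \<longleftrightarrow> inf_symplectic V \<Omega> L \<and>
     (\<exists>\<epsilon>>0. \<forall>M. inf_symplectic V \<Omega> M \<and> (\<forall>v\<in>V. norm (M v - L v) \<le> \<epsilon> * norm v)
        \<longrightarrow> linearly_stable V M)"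


section \<open>The symplectic slice\<close>

text \<open>The slice is an open subset \<open>S\<close> of a linear subspace \<open>W\<close> of a Euclidean space (a chart of the
  slice). Using a subspace instead of the whole space admits the zero-dimensional slice.
  The form \<open>\<omega> s\<close> only matters on \<open>W\<close>; bilinearity on the whole space is a harmless convention.\<close>

definition symplectic_form_on ::
    "'v::euclidean_space set \<Rightarrow> 'v set \<Rightarrow> ('v \<Rightarrow> 'v \<Rightarrow> 'v \<Rightarrow> real) \<Rightarrow> bool" where
  "symplectic_form_on W S \<omega> \<longleftrightarrow>
     (\<forall>s\<in>S. bilinear (\<omega> s)) \<and>
     (\<forall>s\<in>S. \<forall>u\<in>W. \<omega> s u u = 0) \<and>
     (\<forall>s\<in>S. \<forall>u\<in>W. (\<forall>v\<in>W. \<omega> s u v = 0) \<longrightarrow> u = 0) \<and>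
     (\<forall>u\<in>W. \<forall>v\<in>W. smooth_on S (\<lambda>s. \<omega> s u v)) \<and>
     (\<forall>s\<in>S. \<forall>u\<in>W. \<forall>v\<in>W. \<forall>w\<in>W.
        frechet_derivative (\<lambda>x. \<omega> x v w) (at s within S) u +
        frechet_derivative (\<lambda>x. \<omega> x w u) (at s within S) v +
        frechet_derivative (\<lambda>x. \<omega> x u v) (at s within S) w = 0)"


section \<open>The normal form of the phase space\<close>

text \<open>Points of the phase space are triples \<open>(g, \<rho>, s)\<close> with \<open>g\<close> in \<open>SO(3)\<close>, \<open>\<rho>\<close> in the dual of
  \<open>so(3)\<close>, identified with \<open>\<real>\<^sup>3\<close>, and \<open>s\<close> in the slice. Under this identification the coadjoint
  action \<open>Coad\<^sub>g\<close> is rotation by \<open>g\<close> and \<open>coad\<^sub>\<xi> \<mu>\<close> is the cross product of \<open>\<xi>\<close> and \<open>\<mu>\<close>.\<close>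

type_synonym 'v phase = "(real^3^3) \<times> (real^3) \<times> 'v"
type_synonym 'v quot = "(real^3) \<times> 'v"

definition SO3 :: "(real^3^3) set" where
  "SO3 = {g. rotation_matrix g}"

definition hat :: "real^3 \<Rightarrow> real^3^3" where
  "hat \<xi> = matrix (\<lambda>v. cross3 \<xi> v)"

definition vee :: "real^3^3 \<Rightarrow> real^3" where
  "vee A = vector [A$3$2, A$1$3, A$2$1]"

definition act :: "real^3^3 \<Rightarrow> 'v phase \<Rightarrow> 'v phase" where
  "act k = (\<lambda>(g, \<rho>, s). (k ** g, \<rho>, s))"

definition momentum :: "'v phase \<Rightarrow> real^3" where
  "momentum = (\<lambda>(g, \<rho>, s). g *v \<rho>)"

text \<open>The orbit of \<open>(g, \<rho>, s)\<close> is determined by \<open>(\<rho>, s)\<close>: the quotient map is \<open>snd\<close>.\<close>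

definition orbit_space :: "'v phase set \<Rightarrow> 'v quot set" where
  "orbit_space P = snd ` P"

definition reduced_space :: "'v phase set \<Rightarrow> real^3 \<Rightarrow> 'v quot set" where
  "reduced_space P \<mu> = snd ` {p\<in>P. momentum p = \<mu>}"

definition invariant_nbhd :: "'v::euclidean_space set \<Rightarrow> 'v phase set \<Rightarrow> bool" where
  "invariant_nbhd S P \<longleftrightarrow>
     openin (top_of_set (SO3 \<times> (UNIV \<times> S))) P \<and> (\<forall>k\<in>SO3. \<forall>p\<in>P. act k p \<in> P)"

definition phase_tangent :: "'v::euclidean_space set \<Rightarrow> 'v phase \<Rightarrow> 'v phase set" where
  "phase_tangent W p = {(fst p ** hat \<eta>, \<sigma>, v) |\<eta> \<sigma> v. v \<in> W}"

text \<open>The canonical symplectic form of \<open>T\<^sup>*SO(3)\<close> in the left trivialization, plus the form of the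
  slice; \<open>vee (transpose g ** A)\<close> is the body angular velocity of the tangent vector \<open>A\<close> at \<open>g\<close>.\<close>

definition phase_form ::
    "('v \<Rightarrow> 'v \<Rightarrow> 'v \<Rightarrow> real) \<Rightarrow> 'v phase \<Rightarrow> 'v phase \<Rightarrow> 'v phase \<Rightarrow> real" where
  "phase_form \<omega> = (\<lambda>(g, \<rho>, s) (A1, \<sigma>1, v1) (A2, \<sigma>2, v2).
     let \<eta>1 = vee (transpose g ** A1); \<eta>2 = vee (transpose g ** A2)
     in inner \<sigma>2 \<eta>1 - inner \<sigma>1 \<eta>2 + inner \<rho> (cross3 \<eta>1 \<eta>2) + \<omega> s v1 v2)"

text \<open>The infinitesimal generator, the derivative of \<open>exp(t\<xi>)\<cdot>p\<close> at \<open>t = 0\<close>.\<close>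

definition generator :: "real^3 \<Rightarrow> 'v::euclidean_space phase \<Rightarrow> 'v phase" where
  "generator \<xi> p = (hat \<xi> ** fst p, 0, 0)"

definition ham_field ::
    "'v::euclidean_space set \<Rightarrow> ('v \<Rightarrow> 'v \<Rightarrow> 'v \<Rightarrow> real) \<Rightarrow> 'v phase set \<Rightarrow> ('v phase \<Rightarrow> real) \<Rightarrow> 'v phase \<Rightarrow> 'v phase" where
  "ham_field W \<omega> P H p = (THE X. X \<in> phase_tangent W p \<and>
     (\<forall>Y\<in>phase_tangent W p. phase_form \<omega> p X Y = frechet_derivative H (at p within P) Y))"


section \<open>Reduced dynamics and relative equilibria\<close>

text \<open>For invariant \<open>H\<close>, the field \<open>ham_field\<close> is equivariant, so its image on the orbit space may be
  computed at the representative \<open>(1, \<mu>, s)\<close>. It is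
  \<open>\<mu>' = - coad\<^bsub>D\<^sub>\<mu>H\<^esub> \<mu>\<close>, \<open>s' = J D\<^sub>sH\<close>, and its restriction to a reduced space is the Hamiltonian vector
  field of the reduced Hamiltonian there.\<close>

definition reduced_field ::
    "'v::euclidean_space set \<Rightarrow> ('v \<Rightarrow> 'v \<Rightarrow> 'v \<Rightarrow> real) \<Rightarrow> 'v phase set \<Rightarrow> ('v phase \<Rightarrow> real) \<Rightarrow> 'v quot \<Rightarrow> 'v quot" where
  "reduced_field W \<omega> P H x = snd (ham_field W \<omega> P H (mat 1, x))"

text \<open>The relative equilibria, as points of the orbit space.\<close>

definition rel_equilibria ::
    "'v::euclidean_space set \<Rightarrow> ('v \<Rightarrow> 'v \<Rightarrow> 'v \<Rightarrow> real) \<Rightarrow> 'v phase set \<Rightarrow> ('v phase \<Rightarrow> real) \<Rightarrow> 'v quot set" where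
  "rel_equilibria W \<omega> P H = snd ` {p\<in>P. \<exists>\<xi>. ham_field W \<omega> P H p = generator \<xi> p}"

text \<open>The tangent space at \<open>(\<mu>, s)\<close> of the reduced space \<open>O\<^sub>\<mu> \<times> S\<close>; for \<open>\<mu> = 0\<close> the first factor
  is trivial.\<close>

definition reduced_tangent :: "'v::euclidean_space set \<Rightarrow> 'v quot \<Rightarrow> 'v quot set" where
  "reduced_tangent W x = {(cross3 \<eta> (fst x), v) |\<eta> v. v \<in> W}"

text \<open>The linearization of the reduced Hamiltonian vector field at an equilibrium \<open>x\<close> on the reduced
  space through \<open>x\<close>.\<close>

definition linearization ::
    "'v::euclidean_space set \<Rightarrow> ('v \<Rightarrow> 'v \<Rightarrow> 'v \<Rightarrow> real) \<Rightarrow> 'v phase set \<Rightarrow> ('v phase \<Rightarrow> real) \<Rightarrow> 'v quot \<Rightarrow> 'v quot \<Rightarrow> 'v quot" where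
  "linearization W \<omega> P H x =
     frechet_derivative (reduced_field W \<omega> P H) (at x within reduced_space P (fst x))"

definition elliptic ::
    "'v::euclidean_space set \<Rightarrow> ('v \<Rightarrow> 'v \<Rightarrow> 'v \<Rightarrow> real) \<Rightarrow> 'v phase set \<Rightarrow> ('v phase \<Rightarrow> real) \<Rightarrow> 'v quot \<Rightarrow> bool" where
  "elliptic W \<omega> P H x \<longleftrightarrow> linearly_stable (reduced_tangent W x) (linearization W \<omega> P H x)"

definition lin_unstable ::
    "'v::euclidean_space set \<Rightarrow> ('v \<Rightarrow> 'v \<Rightarrow> 'v \<Rightarrow> real) \<Rightarrow> 'v phase set \<Rightarrow> ('v phase \<Rightarrow> real) \<Rightarrow> 'v quot \<Rightarrow> bool" where
  "lin_unstable W \<omega> P H x \<longleftrightarrow> linearly_unstable (reduced_tangent W x) (linearization W \<omega> P H x)"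

text \<open>Strong linear stability at zero momentum, where the reduced symplectic form is the form of the
  slice.\<close>

definition strongly_stable_0 ::
    "'v::euclidean_space set \<Rightarrow> ('v \<Rightarrow> 'v \<Rightarrow> 'v \<Rightarrow> real) \<Rightarrow> 'v phase set \<Rightarrow> ('v phase \<Rightarrow> real) \<Rightarrow> 'v \<Rightarrow> bool" where
  "strongly_stable_0 W \<omega> P H s \<longleftrightarrow>
     strongly_linearly_stable (reduced_tangent W (0, s)) (\<lambda>x y. \<omega> s (snd x) (snd y))
       (linearization W \<omega> P H (0, s))"

text \<open>Solutions on arbitrary intervals \<open>[0, T]\<close> are considered; that solutions starting near \<open>x\<close> exist
  for all forward times then follows, since they stay in a compact part of the reduced space.\<close>

definition lyapunov_stable ::
    "'v::euclidean_space set \<Rightarrow> ('v \<Rightarrow> 'v \<Rightarrow> 'v \<Rightarrow> real) \<Rightarrow> 'v phase set \<Rightarrow> ('v phase \<Rightarrow> real) \<Rightarrow> 'v quot \<Rightarrow> bool" where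
  "lyapunov_stable W \<omega> P H x \<longleftrightarrow>
     (\<forall>\<epsilon>>0. \<exists>\<delta>>0. \<forall>T>0. \<forall>y.
        (\<forall>t\<in>{0..T}. y t \<in> reduced_space P (fst x) \<and>
            (y has_vector_derivative reduced_field W \<omega> P H (y t)) (at t within {0..T})) \<and>
        dist (y 0) x < \<delta>
        \<longrightarrow> (\<forall>t\<in>{0..T}. dist (y t) x < \<epsilon>))"

text \<open>The second derivative at \<open>s\<close> of the reduced Hamiltonian on the reduced space at zero momentum,
  which is identified with an open subset of the slice.\<close>

definition hessian_0 ::
    "'v::euclidean_space phase set \<Rightarrow> ('v phase \<Rightarrow> real) \<Rightarrow> 'v \<Rightarrow> 'v \<Rightarrow> 'v \<Rightarrow> real" where
  "hessian_0 P H = hessian {s. (0, s) \<in> reduced_space P 0} (\<lambda>s. H (mat 1, 0, s))"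

definition nondegenerate_on :: "'v::real_vector set \<Rightarrow> ('v \<Rightarrow> 'v \<Rightarrow> real) \<Rightarrow> bool" where
  "nondegenerate_on W B \<longleftrightarrow> (\<forall>u\<in>W. (\<forall>v\<in>W. B u v = 0) \<longrightarrow> u = 0)"

definition definite_on :: "'v::real_vector set \<Rightarrow> ('v \<Rightarrow> 'v \<Rightarrow> real) \<Rightarrow> bool" where
  "definite_on W B \<longleftrightarrow> (\<forall>u\<in>W. u \<noteq> 0 \<longrightarrow> B u u > 0) \<or> (\<forall>u\<in>W. u \<noteq> 0 \<longrightarrow> B u u < 0)"

definition rv_resonance ::
    "'v::euclidean_space set \<Rightarrow> ('v \<Rightarrow> 'v \<Rightarrow> 'v \<Rightarrow> real) \<Rightarrow> 'v phase set \<Rightarrow> ('v phase \<Rightarrow> real) \<Rightarrow> 'v \<Rightarrow> real^3 \<Rightarrow> bool" where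
  "rv_resonance W \<omega> P H s \<xi> \<longleftrightarrow>
     spectrum_on (reduced_tangent W (0, s)) (linearization W \<omega> P H (0, s)) \<inter>
     spectrum_on UNIV (\<lambda>\<mu>. - cross3 \<xi> \<mu>) \<noteq> {}"

definition smooth_curve :: "real \<Rightarrow> (real \<Rightarrow> 'a::real_normed_vector) \<Rightarrow> bool" where
  "smooth_curve a c \<longleftrightarrow> a > 0 \<and> Cinf_on {-a<..<a} c \<and>
     (\<forall>t\<in>{-a<..<a}. vector_derivative c (at t) \<noteq> 0) \<and>
     (\<exists>d. homeomorphism {-a<..<a} (c ` {-a<..<a}) c d)"

end

theory Submission
  imports Defs "Jordan_Normal_Form.Char_Poly"
begin

text \<open>
  The proof works in the quotient, with coordinates \<open>x = (\<mu>, s)\<close>. Near \<open>(0, s\<^sub>0)\<close> the invariant Hamiltonian is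
  a smooth function \<open>f\<close> of \<open>x\<close>; write \<open>a = D\<^sub>\<mu>f\<close> (the angular velocity, \<open>ang\<close> below) and \<open>a\<^sub>0\<close> for its value at
  \<open>(0, s\<^sub>0)\<close>. The reduced field is \<open>(\<mu> \<times> a, J D\<^sub>sf)\<close>, so the relative equilibria are the solutions of
  \<open>\<mu> \<times> a = 0\<close>, \<open>D\<^sub>sf = 0\<close>.

  Existence of the curve. Since \<open>\<mu> \<times> a\<close> is perpendicular to \<open>a\<close>, the map
  \<open>\<Psi> = (\<mu> \<times> a + (\<mu> \<sqdot> a) a\<^sub>0, D\<^sub>sf)\<close> takes a value in \<open>\<real> (a\<^sub>0, 0)\<close> exactly at the relative equilibria, and its
  derivative at \<open>(0, s\<^sub>0)\<close> is invertible because \<open>a\<^sub>0 \<noteq> 0\<close> and the Hessian of \<open>H\<^sub>0\<close> is nondegenerate. The inverse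
  function theorem turns that line into the curve \<open>c\<close>, with \<open>\<mu> = (t / |a|\<^sup>2) a\<close> at \<open>c t\<close>. So \<open>|\<mu>|\<^sup>2\<close>
  is a function of \<open>t\<close> with a strict minimum \<open>0\<close> at \<open>t = 0\<close> and strictly monotone on either side, which gives two
  points on each nearby reduced space (\<open>curve_exists\<close>).

  Linear stability. The tangent spaces of the reduced spaces jump in dimension at \<open>\<mu> = 0\<close>. Dividing the component tangent
  to the coadjoint orbit by \<open>r = \<surd>|t| / |a|\<close> (\<open>rescaled\<close>) makes the linearizations converge as \<open>t \<rightarrow> 0\<close>, to
  the product of the rotation \<open>\<rho> \<mapsto> \<rho> \<times> a\<^sub>0\<close> and \<open>L\<^sub>0\<close>, and makes the symplectic forms converge as well, up to the sign of
  \<open>t\<close>. Eigenvalues persist under perturbation, which gives linear instability (\<open>lin_unstable_near\<close>). For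
  ellipticity (\<open>resonance_free_perturbation_stable\<close>), absence of resonance forces the eigenvector near
  \<open>\<i> |a\<^sub>0|\<close> to stay close to the rotation plane, where the symplectic area does not vanish; hence its eigenvalue stays
  imaginary, its plane splits off, and on the symplectic complement the map is a small symplectic perturbation of
  \<open>L\<^sub>0\<close>, which is strongly stable. If the Hessian of \<open>H\<^sub>0\<close> is definite then \<open>L\<^sub>0\<close> is strongly stable.

  Lyapunov stability. If the Hessian is definite with sign \<open>\<epsilon>\<close>, the function \<open>\<epsilon> (f - |\<mu>|\<^sup>2 / (2 \<lambda>))\<close> with
  \<open>\<lambda> = t / |a|\<^sup>2\<close> is conserved and critical at \<open>c t\<close>. When \<open>t\<close> has the sign \<open>- \<epsilon>\<close>, the
  quadratic term is large and positive and the function has a strict local minimum (\<open>lyapunov_stable_near\<close>).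
\<close>


section \<open>The spectrum of a linear map on a subspace\<close>

hide_const (open) Matrix.orthogonal Matrix.mat Matrix.vec Matrix.transpose_mat Determinant.det Matrix.row Matrix.rows Matrix.col Matrix.dim_row

lemma orthonormal_enumeration:
  fixes V :: "'a::euclidean_space set"
  assumes "subspace V"
  obtains b :: "nat \<Rightarrow> 'a" where "\<And>i. i < dim V \<Longrightarrow> b i \<in> V"
    "\<And>i j. i < dim V \<Longrightarrow> j < dim V \<Longrightarrow> inner (b i) (b j) = (if i = j then 1 else 0)"
    "\<And>u. u \<in> V \<Longrightarrow> (\<Sum>i<dim V. inner (b i) u *\<^sub>R b i) = u"
proof -
  obtain B where B: "B \<subseteq> V" "pairwise Linear_Algebra.orthogonal B" "\<And>x. x \<in> B \<Longrightarrow> norm x = 1"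
      "independent B" "card B = dim V" "span B = V"
    using orthonormal_basis_subspace[OF assms] by metis
  have fin: "finite B" using B(4) independent_imp_finite by blast
  obtain b where b: "bij_betw b {0..<dim V} B"
    using ex_bij_betw_nat_finite[OF fin] B(5) by auto
  have bB: "b i \<in> B" if "i < dim V" for i
    using b that by (auto simp: bij_betw_def)
  show thesis
  proof
    show "b i \<in> V" if "i < dim V" for i
      using bB that B(1) by blast
    show "inner (b i) (b j) = (if i = j then 1 else 0)" if "i < dim V" "j < dim V" for i j
    proof (cases "i = j")
      case True
      then show ?thesis using B(3)[OF bB[OF that(1)]] by (simp add: dot_square_norm)
    next
      case False
      then have "b i \<noteq> b j"
        using b that by (auto simp: bij_betw_def inj_on_def)
      then show ?thesis
        using False B(2) bB[OF that(1)] bB[OF that(2)]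
        by (auto simp: pairwise_def Linear_Algebra.orthogonal_def)
    qed
    show "(\<Sum>i<dim V. inner (b i) u *\<^sub>R b i) = u" if "u \<in> V" for u
    proof -
      have "(\<Sum>i<dim V. inner (b i) u *\<^sub>R b i) = (\<Sum>v\<in>B. inner v u *\<^sub>R v)"
        using sum.reindex_bij_betw[OF b, of "\<lambda>v. inner v u *\<^sub>R v"]
        by (simp add: lessThan_atLeast0)
      also have "\<dots> = u"
        using orthonormal_basis_expand[OF B(2) B(3) _ fin, of u] that B(6)
        by (simp add: inner_commute)
      finally show ?thesis .
    qed
  qed
qed

text \<open>Complex entries, so that the spectral theory of complex matrices applies to the complexification of the
  map.\<close>

definition coord_mat :: "nat \<Rightarrow> (nat \<Rightarrow> 'a::real_inner) \<Rightarrow> ('a \<Rightarrow> 'a) \<Rightarrow> complex Matrix.mat" where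
  "coord_mat n b f = Matrix.mat n n (\<lambda>(i, j). complex_of_real (inner (b i) (f (b j))))"

lemma coord_mat_carrier [simp]: "coord_mat n b f \<in> carrier_mat n n"
  by (simp add: coord_mat_def)

lemma coord_mat_mult_vec:
  assumes "v \<in> carrier_vec n" "i < n"
  shows "vec_index (coord_mat n b f *\<^sub>v v) i = (\<Sum>j<n. complex_of_real (inner (b i) (f (b j))) * (vec_index v j))"
  using assms by (auto simp: coord_mat_def scalar_prod_def lessThan_atLeast0 intro!: sum.cong)

text \<open>A pair \<open>(u, v)\<close> in \<open>V \<times> V\<close> corresponds to the complex coordinate vector
  of \<open>u + \<i> v\<close>, and the two real equations that define a complex eigenvector are the real and
  imaginary parts of the matrix equation.\<close>

lemma eigenvalue_coord_mat_iff:
  fixes V :: "'a::euclidean_space set"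
  assumes V: "subspace V" and f: "linear f" "f ` V \<subseteq> V"
    and b: "\<And>i. i < dim V \<Longrightarrow> b i \<in> V"
      "\<And>i j. i < dim V \<Longrightarrow> j < dim V \<Longrightarrow> inner (b i) (b j) = (if i = j then 1 else 0)"
      "\<And>u. u \<in> V \<Longrightarrow> (\<Sum>i<dim V. inner (b i) u *\<^sub>R b i) = u"
  shows "eigenvalue (coord_mat (dim V) b f) l \<longleftrightarrow> l \<in> spectrum_on V f"
proof -
  define n where "n = dim V"
  let ?A = "coord_mat n b f"
  interpret f: linear f by fact
  have lincomb: "inner (b i) (\<Sum>j<n. c j *\<^sub>R b j) = c i" if "i < n" for i and c :: "nat \<Rightarrow> real"
  proof -
    have "inner (b i) (\<Sum>j<n. c j *\<^sub>R b j) = (\<Sum>j<n. if i = j then c j else 0)"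
      unfolding inner_sum_right using b(2) that unfolding n_def by (intro sum.cong) auto
    also have "\<dots> = c i" using that by simp
    finally show ?thesis .
  qed
  have inV: "(\<Sum>j<n. c j *\<^sub>R b j) \<in> V" for c :: "nat \<Rightarrow> real"
    using b(1) V unfolding n_def by (intro subspace_sum subspace_scale) auto
  have coords_eq: "x = y" if "x \<in> V" "y \<in> V" "\<And>i. i < n \<Longrightarrow> inner (b i) x = inner (b i) y" for x y
  proof -
    have "x = (\<Sum>i<n. inner (b i) x *\<^sub>R b i)" using b(3) that(1) unfolding n_def by simp
    also have "\<dots> = (\<Sum>i<n. inner (b i) y *\<^sub>R b i)" using that(3) by simp
    also have "\<dots> = y" using b(3) that(2) unfolding n_def by simp
    finally show ?thesis .
  qed
  have fcoord: "inner (b i) (f x) = (\<Sum>j<n. inner (b i) (f (b j)) * inner (b j) x)"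
    if "x \<in> V" for x i
  proof -
    have "f x = f (\<Sum>j<n. inner (b j) x *\<^sub>R b j)" using b(3) that unfolding n_def by simp
    then show ?thesis by (simp add: f.sum f.scale inner_sum_right mult.commute)
  qed
  have "l \<in> spectrum_on V f" if ev: "eigenvalue ?A l"
  proof -
    obtain v where ev': "eigenvector ?A v l"
      using ev unfolding eigenvalue_def by blast
    have v: "v \<in> carrier_vec n" "v \<noteq> 0\<^sub>v n" "?A *\<^sub>v v = l \<cdot>\<^sub>v v"
      using ev' carrier_matD(1)[OF coord_mat_carrier[of n b f]] unfolding eigenvector_def by simp_all
    define x where "x = (\<Sum>j<n. Re (vec_index v j) *\<^sub>R b j)"
    define y where "y = (\<Sum>j<n. Im (vec_index v j) *\<^sub>R b j)"
    have xy: "x \<in> V" "y \<in> V" unfolding x_def y_def by (rule inV)+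
    have cx: "inner (b i) x = Re (vec_index v i)" and cy: "inner (b i) y = Im (vec_index v i)" if "i < n" for i
      using that unfolding x_def y_def by (simp_all add: lincomb)
    have eq: "(\<Sum>j<n. complex_of_real (inner (b i) (f (b j))) * (vec_index v j)) = l * vec_index v i" if "i < n" for i
      using coord_mat_mult_vec[OF v(1) that, of b f] v(1,3) that by simp
    have "(x, y) \<noteq> 0"
    proof
      assume "(x, y) = 0"
      then have "x = 0" "y = 0" by (simp_all add: zero_prod_def)
      then have "vec_index v i = 0" if "i < n" for i
        using cx[OF that] cy[OF that] by (simp add: complex_eq_iff)
      then have "v = 0\<^sub>v n" using v(1) by (intro eq_vecI) auto
      then show False using v(2) by blast
    qed
    moreover have "f x = Re l *\<^sub>R x - Im l *\<^sub>R y"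
    proof (rule coords_eq)
      show "f x \<in> V" using f(2) xy by blast
      show "Re l *\<^sub>R x - Im l *\<^sub>R y \<in> V" using xy V by (intro subspace_diff subspace_scale)
      fix i assume i: "i < n"
      have "inner (b i) (f x) = (\<Sum>j<n. inner (b i) (f (b j)) * Re (vec_index v j))"
        unfolding fcoord[OF xy(1)] by (intro sum.cong) (auto simp: cx)
      also have "\<dots> = Re (\<Sum>j<n. complex_of_real (inner (b i) (f (b j))) * (vec_index v j))" by simp
      also have "\<dots> = Re l * Re (vec_index v i) - Im l * Im (vec_index v i)" using eq[OF i] by simp
      finally show "inner (b i) (f x) = inner (b i) (Re l *\<^sub>R x - Im l *\<^sub>R y)"
        using i by (simp add: inner_diff_right cx cy)
    qed
    moreover have "f y = Im l *\<^sub>R x + Re l *\<^sub>R y"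
    proof (rule coords_eq)
      show "f y \<in> V" using f(2) xy by blast
      show "Im l *\<^sub>R x + Re l *\<^sub>R y \<in> V" using xy V by (intro subspace_add subspace_scale)
      fix i assume i: "i < n"
      have "inner (b i) (f y) = (\<Sum>j<n. inner (b i) (f (b j)) * Im (vec_index v j))"
        unfolding fcoord[OF xy(2)] by (intro sum.cong) (auto simp: cy)
      also have "\<dots> = Im (\<Sum>j<n. complex_of_real (inner (b i) (f (b j))) * (vec_index v j))" by simp
      also have "\<dots> = Im l * Re (vec_index v i) + Re l * Im (vec_index v i)" using eq[OF i] by simp
      finally show "inner (b i) (f y) = inner (b i) (Im l *\<^sub>R x + Re l *\<^sub>R y)"
        using i by (simp add: inner_add_right cx cy)
    qed
    ultimately have "complex_eigenvector V f l (x, y)"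
      using xy unfolding complex_eigenvector_def by simp
    then show ?thesis unfolding spectrum_on_def by blast
  qed
  moreover have "eigenvalue ?A l" if spec: "l \<in> spectrum_on V f"
  proof -
    obtain z where z: "complex_eigenvector V f l z"
      using spec unfolding spectrum_on_def by blast
    define x y where "x = fst z" and "y = snd z"
    have xy: "x \<in> V" "y \<in> V" "(x, y) \<noteq> 0"
        "f x = Re l *\<^sub>R x - Im l *\<^sub>R y" "f y = Im l *\<^sub>R x + Re l *\<^sub>R y"
      using z unfolding complex_eigenvector_def x_def y_def by (auto simp: mem_Times_iff)
    define v where "v = Matrix.vec n (\<lambda>i. Complex (inner (b i) x) (inner (b i) y))"
    have v: "v \<in> carrier_vec n" unfolding v_def by simp
    have vi: "vec_index v i = Complex (inner (b i) x) (inner (b i) y)" if "i < n" for i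
      using that unfolding v_def by simp
    have "v \<noteq> 0\<^sub>v n"
    proof
      assume "v = 0\<^sub>v n"
      then have "Complex (inner (b i) x) (inner (b i) y) = 0" if "i < n" for i
        using vi[OF that] that by simp
      then have "x = 0" "y = 0"
        using coords_eq[of x 0] coords_eq[of y 0] xy(1,2) V
        by (auto simp: complex_eq_iff subspace_0)
      then show False using xy(3) by (simp add: zero_prod_def)
    qed
    moreover have "?A *\<^sub>v v = l \<cdot>\<^sub>v v"
    proof (rule eq_vecI)
      show "dim_vec (?A *\<^sub>v v) = dim_vec (l \<cdot>\<^sub>v v)" using v by (simp add: coord_mat_def)
      fix i assume "i < dim_vec (l \<cdot>\<^sub>v v)"
      then have i: "i < n" using v by simp
      have "Re (\<Sum>j<n. complex_of_real (inner (b i) (f (b j))) * (vec_index v j)) = inner (b i) (f x)"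
        unfolding fcoord[OF xy(1)] by (auto simp: vi intro!: sum.cong)
      moreover have "Im (\<Sum>j<n. complex_of_real (inner (b i) (f (b j))) * (vec_index v j)) = inner (b i) (f y)"
        unfolding fcoord[OF xy(2)] by (auto simp: vi intro!: sum.cong)
      ultimately show "vec_index (?A *\<^sub>v v) i = vec_index (l \<cdot>\<^sub>v v) i"
        unfolding coord_mat_mult_vec[OF v i] using i v xy(4,5)
        by (simp add: complex_eq_iff vi inner_diff_right inner_add_right)
    qed
    ultimately show ?thesis
      using v unfolding eigenvalue_def eigenvector_def by (auto simp: coord_mat_def)
  qed
  ultimately show ?thesis unfolding n_def by blast
qed

text \<open>Existence of an eigenvalue, from the fundamental theorem of algebra through the coordinate matrix.\<close>

lemma spectrum_on_nonempty:
  fixes V :: "'a::euclidean_space set"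
  assumes V: "subspace V" "V \<noteq> {0}" and f: "linear f" "f ` V \<subseteq> V"
  shows "spectrum_on V f \<noteq> {}"
proof -
  obtain b :: "nat \<Rightarrow> 'a" where b: "\<And>i. i < dim V \<Longrightarrow> b i \<in> V"
    "\<And>i j. i < dim V \<Longrightarrow> j < dim V \<Longrightarrow> inner (b i) (b j) = (if i = j then 1 else 0)"
    "\<And>u. u \<in> V \<Longrightarrow> (\<Sum>i<dim V. inner (b i) u *\<^sub>R b i) = u"
    using orthonormal_enumeration[OF V(1)] by blast
  let ?A = "coord_mat (dim V) b f"
  obtain as where as: "char_poly ?A = (\<Prod>a\<leftarrow>as. [:- a, 1:])" "length as = dim V"
    using char_poly_factorized[of ?A "dim V"] by auto
  have "dim V \<noteq> 0" using V subspace_0[OF V(1)] by (auto simp: dim_eq_0)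
  then obtain a as' where "as = a # as'" using as(2) by (cases as) auto
  then have "poly (char_poly ?A) a = 0" using as(1) by simp
  then have "a \<in> spectrum_on V f"
    using eigenvalue_root_char_poly[of ?A "dim V"] eigenvalue_coord_mat_iff[OF V(1) f b] by simp
  then show ?thesis by blast
qed

lemma tendsto_det:
  assumes "\<And>k. A k \<in> carrier_mat n n" "A' \<in> carrier_mat n n"
    "\<And>i j. i < n \<Longrightarrow> j < n \<Longrightarrow> ((\<lambda>k. (A k $$ (i, j) :: complex)) \<longlongrightarrow> A' $$ (i, j)) F"
  shows "((\<lambda>k. Determinant.det (A k)) \<longlongrightarrow> Determinant.det A') F"
proof -
  have "((\<lambda>k. \<Sum>p | p permutes {0..<n}. signof p * (\<Prod>i = 0..<n. A k $$ (i, p i)))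
      \<longlongrightarrow> (\<Sum>p | p permutes {0..<n}. signof p * (\<Prod>i = 0..<n. A' $$ (i, p i)))) F"
  proof (intro tendsto_sum tendsto_mult tendsto_prod)
    fix p i assume "p \<in> {p. p permutes {0..<n}}" "i \<in> {0..<n}"
    then have "i < n" "p i < n" using permutes_in_image[of p "{0..<n}" i] by simp_all
    then show "((\<lambda>k. A k $$ (i, p i)) \<longlongrightarrow> A' $$ (i, p i)) F" by (rule assms(3))
  qed (rule tendsto_const)
  then show ?thesis
    using det_def'[OF assms(1)] det_def'[OF assms(2)] by presburger
qed

text \<open>If a monic polynomial with the listed roots is small at \<open>l\<close>, then some root is close to
  \<open>l\<close>: the distances to the roots multiply to the absolute value at \<open>l\<close>.\<close>

lemma root_of_product_close:
  fixes l :: complex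
  assumes "as \<noteq> []"
  shows "\<exists>a\<in>set as. norm (l - a) ^ length as \<le> norm (poly (\<Prod>a\<leftarrow>as. [:- a, 1:]) l)"
proof -
  obtain a where a: "a \<in> set as" "\<And>c. c \<in> set as \<Longrightarrow> norm (l - a) \<le> norm (l - c)"
    using arg_min_if_finite[of "set as" "\<lambda>c. norm (l - c)"] assms
    by (metis List.finite_set not_le set_empty)
  have "norm (l - a) ^ length cs \<le> norm (poly (\<Prod>a\<leftarrow>cs. [:- a, 1:]) l)" if "set cs \<subseteq> set as" for cs
    using that
  proof (induction cs)
    case (Cons c cs)
    have "norm (l - a) * norm (l - a) ^ length cs \<le> norm (l - c) * norm (poly (\<Prod>a\<leftarrow>cs. [:- a, 1:]) l)"
      using Cons a(2) by (intro mult_mono) auto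
    moreover have "poly (\<Prod>a\<leftarrow>(c # cs). [:- a, 1:]) l = (l - c) * poly (\<Prod>a\<leftarrow>cs. [:- a, 1:]) l"
      by (simp add: left_diff_distrib)
    ultimately show ?case by (simp only: norm_mult) simp
  qed simp
  then show ?thesis using a(1) by blast
qed

text \<open>Every eigenvalue of the limit is a limit of eigenvalues: the characteristic polynomials converge, so
  those of the approximating maps become small at \<open>l\<close>, and \<open>root_of_product_close\<close> gives a
  root nearby.\<close>

lemma spectrum_on_lower_semicontinuous:
  fixes V :: "'a::euclidean_space set"
  assumes V: "subspace V" and f: "linear f" "f ` V \<subseteq> V"
    and fk: "\<And>k. linear (fk k)" "\<And>k. fk k ` V \<subseteq> V"
    and lim: "\<And>v. v \<in> V \<Longrightarrow> (\<lambda>k. fk k v) \<longlonglongrightarrow> f v"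
    and l: "l \<in> spectrum_on V f"
  obtains lk where "\<And>k. lk k \<in> spectrum_on V (fk k)" "lk \<longlonglongrightarrow> l"
proof -
  define n where "n = dim V"
  obtain b :: "nat \<Rightarrow> 'a" where b: "\<And>i. i < dim V \<Longrightarrow> b i \<in> V"
    "\<And>i j. i < dim V \<Longrightarrow> j < dim V \<Longrightarrow> inner (b i) (b j) = (if i = j then 1 else 0)"
    "\<And>u. u \<in> V \<Longrightarrow> (\<Sum>i<dim V. inner (b i) u *\<^sub>R b i) = u"
    using orthonormal_enumeration[OF V] by blast
  let ?A = "coord_mat n b f" and ?Ak = "\<lambda>k. coord_mat n b (fk k)"
  define p where "p k = norm (poly (char_poly (?Ak k)) l)" for k
  have "V \<noteq> {0}"
    using l unfolding spectrum_on_def complex_eigenvector_def by (auto simp: zero_prod_def)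
  then have n0: "n \<noteq> 0" using V subspace_0[OF V] unfolding n_def by (auto simp: dim_eq_0)
  have ex: "\<exists>a\<in>spectrum_on V (fk k). norm (l - a) ^ n \<le> p k" for k
  proof -
    obtain as where as: "char_poly (?Ak k) = (\<Prod>a\<leftarrow>as. [:- a, 1:])" "length as = n"
      using char_poly_factorized[of "?Ak k" n] by auto
    obtain a where a: "a \<in> set as" "norm (l - a) ^ n \<le> p k"
      using root_of_product_close[of as l] as n0 unfolding p_def by auto
    have "poly (char_poly (?Ak k)) a = 0"
      using a(1) unfolding as(1) by (auto simp: poly_prod_list prod_list_zero_iff)
    then have "eigenvalue (?Ak k) a" using eigenvalue_root_char_poly[of "?Ak k" n] by simp
    then have "a \<in> spectrum_on V (fk k)"
      using eigenvalue_coord_mat_iff[OF V fk b] unfolding n_def by simp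
    with a(2) show ?thesis by blast
  qed
  then obtain lk where lk: "\<And>k. lk k \<in> spectrum_on V (fk k)" "\<And>k. norm (l - lk k) ^ n \<le> p k"
    by metis
  have "poly (char_poly ?A) l = 0"
    using l eigenvalue_coord_mat_iff[OF V f b] eigenvalue_root_char_poly[of ?A n] unfolding n_def by simp
  moreover have "(\<lambda>k. poly (char_poly (?Ak k)) l) \<longlonglongrightarrow> poly (char_poly ?A) l"
    unfolding char_poly_matrix[OF coord_mat_carrier]
  proof (rule tendsto_det[where n = n])
    fix i j assume ij: "i < n" "j < n"
    have "(\<lambda>k. complex_of_real (inner (b i) (fk k (b j)))) \<longlonglongrightarrow> complex_of_real (inner (b i) (f (b j)))"
      using ij b(1) unfolding n_def by (intro tendsto_intros lim) auto
    then show "(\<lambda>k. (- char_matrix (?Ak k) l) $$ (i, j)) \<longlonglongrightarrow> (- char_matrix ?A l) $$ (i, j)"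
      using ij by (auto simp: char_matrix_def coord_mat_def intro!: tendsto_intros)
  next
    show "- char_matrix (?Ak k) l \<in> carrier_mat n n" for k by simp
    show "- char_matrix ?A l \<in> carrier_mat n n" by simp
  qed
  ultimately have "p \<longlonglongrightarrow> 0" unfolding p_def using tendsto_norm_zero by fastforce
  then have "(\<lambda>k. root n (p k)) \<longlonglongrightarrow> 0" using tendsto_real_root[of p 0 sequentially n] by simp
  moreover have "\<forall>\<^sub>F k in sequentially. norm (lk k - l) \<le> root n (p k)"
  proof (rule always_eventually, rule allI)
    fix k
    have "norm (l - lk k) = root n (norm (l - lk k) ^ n)"
      using n0 by (simp add: real_root_power_cancel)
    also have "\<dots> \<le> root n (p k)" using lk(2) n0 by simp
    finally show "norm (lk k - l) \<le> root n (p k)" by (simp add: norm_minus_commute)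
  qed
  ultimately have "(\<lambda>k. lk k - l) \<longlonglongrightarrow> 0"
    by (rule Lim_null_comparison[rotated])
  then have "lk \<longlonglongrightarrow> l" using LIM_zero_cancel by blast
  with lk(1) show thesis using that by blast
qed

section \<open>Linear stability: direct sums and conjugation\<close>

text \<open>The nilpotent part vanishes exactly when the map itself is semisimple.\<close>

lemma linearly_stable_iff:
  assumes "subspace V" "linear L"
  shows "linearly_stable V L \<longleftrightarrow> (\<forall>l\<in>spectrum_on V L. Re l = 0) \<and>
     V \<times> V \<subseteq> span {z. \<exists>l. complex_eigenvector V L l z}"
proof -
  have "nilpotent_part V L (\<lambda>_. 0) \<longleftrightarrow> V \<times> V \<subseteq> span {z. \<exists>l. complex_eigenvector V L l z}"
    using assms subspace_0[OF assms(1)] linear_0[OF assms(2)]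
    by (auto simp: nilpotent_part_def semisimple_def linear_zero intro!: exI[of _ 1])
  then show ?thesis unfolding linearly_stable_def spectrally_stable_def by blast
qed

lemma complex_eigenvector_mono:
  "complex_eigenvector V L l z \<Longrightarrow> V \<subseteq> V' \<Longrightarrow> complex_eigenvector V' L l z"
  unfolding complex_eigenvector_def by (auto simp: mem_Times_iff)

lemma complex_eigenvectorI:
  "x \<in> V \<Longrightarrow> y \<in> V \<Longrightarrow> x \<noteq> 0 \<or> y \<noteq> 0 \<Longrightarrow> L x = Re l *\<^sub>R x - Im l *\<^sub>R y \<Longrightarrow>
     L y = Im l *\<^sub>R x + Re l *\<^sub>R y \<Longrightarrow> complex_eigenvector V L l (x, y)"
  unfolding complex_eigenvector_def by (auto simp: zero_prod_def)

lemma complex_eigenvectorE: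
  assumes "complex_eigenvector V L l z"
  obtains x y where "z = (x, y)" "x \<in> V" "y \<in> V" "x \<noteq> 0 \<or> y \<noteq> 0"
    "L x = Re l *\<^sub>R x - Im l *\<^sub>R y" "L y = Im l *\<^sub>R x + Re l *\<^sub>R y"
  using assms that[of "fst z" "snd z"] unfolding complex_eigenvector_def
  by (auto simp: mem_Times_iff zero_prod_def prod_eq_iff)

text \<open>An eigenvector of the sum projects to eigenvectors of the summands, so its eigenvalue is imaginary; and
  the eigenvectors of the summands together span the complexification of the sum.\<close>

lemma linearly_stable_direct_sum:
  assumes E: "subspace E" "L ` E \<subseteq> E" and F: "subspace F" "L ` F \<subseteq> F"
    and EF: "E \<inter> F = {0}" and L: "linear L"
    and st: "linearly_stable E L" "linearly_stable F L"
    and T: "T = {e + f |e f. e \<in> E \<and> f \<in> F}"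
  shows "linearly_stable T L"
proof -
  interpret L: linear L by fact
  let ?G = "span {z. \<exists>l. complex_eigenvector T L l z}"
  have subT: "subspace T" unfolding T using subspace_sums[OF E(1) F(1)] by simp
  have LE: "L u \<in> E" if "u \<in> E" for u using E(2) that by blast
  have LF: "L u \<in> F" if "u \<in> F" for u using F(2) that by blast
  have ET: "E \<subseteq> T"
  proof
    fix x assume "x \<in> E"
    then have "x = x + 0 \<and> x \<in> E \<and> 0 \<in> F" using subspace_0[OF F(1)] by simp
    then show "x \<in> T" unfolding T by blast
  qed
  have FT: "F \<subseteq> T"
  proof
    fix x assume "x \<in> F"
    then have "x = 0 + x \<and> 0 \<in> E \<and> x \<in> F" using subspace_0[OF E(1)] by simp
    then show "x \<in> T" unfolding T by blast
  qed
  have stE: "\<And>l. l \<in> spectrum_on E L \<Longrightarrow> Re l = 0" "E \<times> E \<subseteq> span {z. \<exists>l. complex_eigenvector E L l z}"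
    using st(1) unfolding linearly_stable_iff[OF E(1) L] by simp_all
  have stF: "\<And>l. l \<in> spectrum_on F L \<Longrightarrow> Re l = 0" "F \<times> F \<subseteq> span {z. \<exists>l. complex_eigenvector F L l z}"
    using st(2) unfolding linearly_stable_iff[OF F(1) L] by simp_all
  have Eg: "E \<times> E \<subseteq> ?G"
  proof -
    have "{z. \<exists>l. complex_eigenvector E L l z} \<subseteq> {z. \<exists>l. complex_eigenvector T L l z}"
      using complex_eigenvector_mono[OF _ ET] by blast
    from subset_trans[OF stE(2) span_mono[OF this]] show ?thesis .
  qed
  have Fg: "F \<times> F \<subseteq> ?G"
  proof -
    have "{z. \<exists>l. complex_eigenvector F L l z} \<subseteq> {z. \<exists>l. complex_eigenvector T L l z}"
      using complex_eigenvector_mono[OF _ FT] by blast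
    from subset_trans[OF stF(2) span_mono[OF this]] show ?thesis .
  qed
  have "Re l = 0" if spec: "l \<in> spectrum_on T L" for l
  proof -
    obtain z where "complex_eigenvector T L l z" using spec unfolding spectrum_on_def by blast
    then obtain x y where xy: "x \<in> T" "y \<in> T" "x \<noteq> 0 \<or> y \<noteq> 0"
      "L x = Re l *\<^sub>R x - Im l *\<^sub>R y" "L y = Im l *\<^sub>R x + Re l *\<^sub>R y"
      by (rule complex_eigenvectorE)
    from xy(1) obtain e1 f1 where ef1: "x = e1 + f1" "e1 \<in> E" "f1 \<in> F" unfolding T by blast
    from xy(2) obtain e2 f2 where ef2: "y = e2 + f2" "e2 \<in> E" "f2 \<in> F" unfolding T by blast
    note ef = ef1(1) ef2(1) ef1(2) ef2(2) ef1(3) ef2(3)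
    have zero: "a = 0 \<and> b = 0" if "a \<in> E" "b \<in> F" "a + b = 0" for a b
    proof -
      have "a = - b" using that(3) by (simp add: eq_neg_iff_add_eq_0)
      then have "a \<in> F" using that(2) subspace_neg[OF F(1)] by simp
      then have "a \<in> E \<inter> F" using that(1) by blast
      then show ?thesis using that(3) unfolding EF by simp
    qed
    have 1: "L e1 - (Re l *\<^sub>R e1 - Im l *\<^sub>R e2) = 0 \<and> L f1 - (Re l *\<^sub>R f1 - Im l *\<^sub>R f2) = 0"
    proof (rule zero)
      show "L e1 - (Re l *\<^sub>R e1 - Im l *\<^sub>R e2) \<in> E"
        by (intro subspace_diff[OF E(1)] subspace_scale[OF E(1)] LE ef)
      show "L f1 - (Re l *\<^sub>R f1 - Im l *\<^sub>R f2) \<in> F"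
        by (intro subspace_diff[OF F(1)] subspace_scale[OF F(1)] LF ef)
      show "L e1 - (Re l *\<^sub>R e1 - Im l *\<^sub>R e2) + (L f1 - (Re l *\<^sub>R f1 - Im l *\<^sub>R f2)) = 0"
        using xy(4) unfolding ef(1,2) by (simp add: L.add algebra_simps)
    qed
    have 2: "L e2 - (Im l *\<^sub>R e1 + Re l *\<^sub>R e2) = 0 \<and> L f2 - (Im l *\<^sub>R f1 + Re l *\<^sub>R f2) = 0"
    proof (rule zero)
      show "L e2 - (Im l *\<^sub>R e1 + Re l *\<^sub>R e2) \<in> E"
        by (intro subspace_diff[OF E(1)] subspace_add[OF E(1)] subspace_scale[OF E(1)] LE ef)
      show "L f2 - (Im l *\<^sub>R f1 + Re l *\<^sub>R f2) \<in> F"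
        by (intro subspace_diff[OF F(1)] subspace_add[OF F(1)] subspace_scale[OF F(1)] LF ef)
      show "L e2 - (Im l *\<^sub>R e1 + Re l *\<^sub>R e2) + (L f2 - (Im l *\<^sub>R f1 + Re l *\<^sub>R f2)) = 0"
        using xy(5) unfolding ef(1,2) by (simp add: L.add algebra_simps)
    qed
    have Le: "L e1 = Re l *\<^sub>R e1 - Im l *\<^sub>R e2" "L e2 = Im l *\<^sub>R e1 + Re l *\<^sub>R e2"
      and Lf: "L f1 = Re l *\<^sub>R f1 - Im l *\<^sub>R f2" "L f2 = Im l *\<^sub>R f1 + Re l *\<^sub>R f2"
      using 1 2 by simp_all
    have "(e1 \<noteq> 0 \<or> e2 \<noteq> 0) \<or> (f1 \<noteq> 0 \<or> f2 \<noteq> 0)" using xy(3) unfolding ef(1,2) by auto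
    then show ?thesis
    proof
      assume c1: "e1 \<noteq> 0 \<or> e2 \<noteq> 0"
      have "complex_eigenvector E L l (e1, e2)"
        using c1 Le Lf by (intro complex_eigenvectorI ef(3,4)) simp_all
      then have "l \<in> spectrum_on E L" unfolding spectrum_on_def by (intro CollectI exI)
      then show ?thesis by (rule stE(1))
    next
      assume c2: "f1 \<noteq> 0 \<or> f2 \<noteq> 0"
      have "complex_eigenvector F L l (f1, f2)"
        using c2 Le Lf by (intro complex_eigenvectorI ef(5,6)) simp_all
      then have "l \<in> spectrum_on F L" unfolding spectrum_on_def by (intro CollectI exI)
      then show ?thesis by (rule stF(1))
    qed
  qed
  moreover have "T \<times> T \<subseteq> ?G"
  proof
    fix z assume "z \<in> T \<times> T"
    then obtain x y where z: "z = (x, y)" "x \<in> T" "y \<in> T" by blast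
    from z(2) obtain e1 f1 where ef1: "x = e1 + f1" "e1 \<in> E" "f1 \<in> F" unfolding T by blast
    from z(3) obtain e2 f2 where ef2: "y = e2 + f2" "e2 \<in> E" "f2 \<in> F" unfolding T by blast
    have "(e1, e2) \<in> ?G" using Eg ef1(2) ef2(2) by blast
    moreover have "(f1, f2) \<in> ?G" using Fg ef1(3) ef2(3) by blast
    ultimately have "(e1, e2) + (f1, f2) \<in> ?G" by (rule span_add)
    then show "z \<in> ?G" using z(1) ef1(1) ef2(1) by simp
  qed
  ultimately show ?thesis unfolding linearly_stable_iff[OF subT L] by simp
qed

lemma complex_eigenvector_conjugate:
  assumes "linear j" "inj_on j V" "subspace V" "\<And>v. v \<in> V \<Longrightarrow> L' (j v) = j (L v)" "L ` V \<subseteq> V"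
    "x \<in> V" "y \<in> V"
  shows "complex_eigenvector (j ` V) L' l (j x, j y) \<longleftrightarrow> complex_eigenvector V L l (x, y)"
proof -
  interpret j: linear j by fact
  have in1: "Re l *\<^sub>R x - Im l *\<^sub>R y \<in> V" "Im l *\<^sub>R x + Re l *\<^sub>R y \<in> V" "L x \<in> V" "L y \<in> V"
    using assms(3,5,6,7) by (auto intro: subspace_diff subspace_add subspace_scale)
  have "j u = 0 \<longleftrightarrow> u = 0" if "u \<in> V" for u
    using inj_onD[OF assms(2), of u 0] that subspace_0[OF assms(3)] j.zero by auto
  moreover have "j (L x) = Re l *\<^sub>R j x - Im l *\<^sub>R j y \<longleftrightarrow> L x = Re l *\<^sub>R x - Im l *\<^sub>R y"
    using inj_on_eq_iff[OF assms(2) in1(3) in1(1)] by (simp add: j.diff j.scale)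
  moreover have "j (L y) = Im l *\<^sub>R j x + Re l *\<^sub>R j y \<longleftrightarrow> L y = Im l *\<^sub>R x + Re l *\<^sub>R y"
    using inj_on_eq_iff[OF assms(2) in1(4) in1(2)] by (simp add: j.add j.scale)
  ultimately show ?thesis
    using assms(4,6,7) unfolding complex_eigenvector_def by (auto simp: zero_prod_def)
qed

lemma spectrum_on_conjugate:
  assumes "linear j" "inj_on j V" "subspace V" "\<And>v. v \<in> V \<Longrightarrow> L' (j v) = j (L v)" "L ` V \<subseteq> V"
  shows "spectrum_on (j ` V) L' = spectrum_on V L"
proof (rule subset_antisym; rule subsetI)
  fix l assume "l \<in> spectrum_on (j ` V) L'"
  then obtain z where z: "complex_eigenvector (j ` V) L' l z" unfolding spectrum_on_def by blast
  then obtain a b where "z = (a, b)" "a \<in> j ` V" "b \<in> j ` V" by (rule complex_eigenvectorE)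
  then obtain x y where "z = (j x, j y)" "x \<in> V" "y \<in> V" by blast
  then show "l \<in> spectrum_on V L"
    using z complex_eigenvector_conjugate[OF assms] unfolding spectrum_on_def by blast
next
  fix l assume "l \<in> spectrum_on V L"
  then obtain z where z: "complex_eigenvector V L l z" unfolding spectrum_on_def by blast
  then obtain x y where "z = (x, y)" "x \<in> V" "y \<in> V" by (rule complex_eigenvectorE)
  then show "l \<in> spectrum_on (j ` V) L'"
    using z complex_eigenvector_conjugate[OF assms] unfolding spectrum_on_def by blast
qed

lemma linearly_stable_conjugate:
  assumes j: "linear j" "inj_on j V" "subspace V" "\<And>v. v \<in> V \<Longrightarrow> L' (j v) = j (L v)" "L ` V \<subseteq> V"
    and L: "linear L" "linear L'" and st: "linearly_stable V L"
  shows "linearly_stable (j ` V) L'"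
proof -
  have V': "subspace (j ` V)" using j(1,3) by (simp add: linear_subspace_image)
  have jj: "linear (map_prod j j)"
    using j(1) by (auto intro!: linearI simp: linear_add linear_scale)
  let ?e = "{z. \<exists>l. complex_eigenvector V L l z}" and ?e' = "{z. \<exists>l. complex_eigenvector (j ` V) L' l z}"
  have sub: "map_prod j j ` ?e \<subseteq> ?e'"
  proof
    fix w assume "w \<in> map_prod j j ` ?e"
    then obtain z where "z \<in> ?e" and w: "w = map_prod j j z" by (rule imageE)
    then obtain l where "complex_eigenvector V L l z" by blast
    note z = w this
    from z(2) obtain x y where xy: "z = (x, y)" "x \<in> V" "y \<in> V" by (rule complex_eigenvectorE)
    have "complex_eigenvector (j ` V) L' l (j x, j y)"
      using z(2) xy complex_eigenvector_conjugate[OF j] by blast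
    then show "w \<in> ?e'" unfolding z(1) xy(1) map_prod_simp by (intro CollectI exI)
  qed
  have stV: "\<And>l. l \<in> spectrum_on V L \<Longrightarrow> Re l = 0" "V \<times> V \<subseteq> span ?e"
    using st unfolding linearly_stable_iff[OF j(3) L(1)] by simp_all
  have "j ` V \<times> j ` V = map_prod j j ` (V \<times> V)" by (rule map_prod_surj_on[OF refl refl, symmetric])
  also have "\<dots> \<subseteq> map_prod j j ` span ?e"
    by (rule image_mono[OF stV(2)])
  also have "\<dots> = span (map_prod j j ` ?e)" by (rule linear_span_image[OF jj, symmetric])
  also have "\<dots> \<subseteq> span ?e'" by (rule span_mono[OF sub])
  finally have "j ` V \<times> j ` V \<subseteq> span ?e'" .
  moreover have "\<forall>l\<in>spectrum_on (j ` V) L'. Re l = 0"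
  proof
    fix l assume "l \<in> spectrum_on (j ` V) L'"
    moreover have "spectrum_on (j ` V) L' = spectrum_on V L"
      using j by (rule spectrum_on_conjugate)
    ultimately show "Re l = 0" using stV(1) by simp
  qed
  ultimately show ?thesis unfolding linearly_stable_iff[OF V' L(2)] by simp
qed

text \<open>The map acts on \<open>span {x, y}\<close> as an infinitesimal rotation, possibly degenerate: with
  \<open>\<nu> = 0\<close> it is zero there.\<close>

lemma linearly_stable_rotation_plane:
  assumes L: "linear L" and xy: "x \<noteq> 0 \<or> y \<noteq> 0" "L x = - \<nu> *\<^sub>R y" "L y = \<nu> *\<^sub>R x"
  shows "linearly_stable (span {x, y}) L"
proof -
  interpret L: linear L by fact
  let ?F = "span {x, y}"
  let ?e = "{z. \<exists>l. complex_eigenvector ?F L l z}"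
  have F: "x \<in> ?F" "y \<in> ?F" by (simp_all add: span_base)
  have F': "- x \<in> ?F" "- y \<in> ?F" using F by (simp_all add: span_neg)
  have e: "complex_eigenvector ?F L (Complex 0 \<nu>) (x, y)"
    "complex_eigenvector ?F L (Complex 0 \<nu>) (- y, x)"
    "complex_eigenvector ?F L (Complex 0 (- \<nu>)) (x, - y)"
    "complex_eigenvector ?F L (Complex 0 (- \<nu>)) (y, x)"
    using F F' xy by (auto intro!: complex_eigenvectorI simp: L.neg)
  have e': "(x, y) \<in> span ?e" "(- y, x) \<in> span ?e" "(x, - y) \<in> span ?e" "(y, x) \<in> span ?e"
    using e by (auto intro!: span_base)
  have x0: "(x, 0) \<in> span ?e"
    using span_scale[OF span_add[OF e'(1,3)], of "1/2"] by (simp add: scaleR_2[symmetric])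
  have y1: "(0, y) \<in> span ?e"
    using span_scale[OF span_diff[OF e'(1,3)], of "1/2"] by (simp add: scaleR_2[symmetric])
  have x1: "(0, x) \<in> span ?e"
    using span_scale[OF span_add[OF e'(2,4)], of "1/2"] by (simp add: scaleR_2[symmetric])
  have y0: "(y, 0) \<in> span ?e"
    using span_diff[OF e'(4) x1] by simp
  have "?F \<times> ?F \<subseteq> span ?e"
  proof
    fix z assume "z \<in> ?F \<times> ?F"
    then obtain u v where z: "z = (u, v)" "u \<in> ?F" "v \<in> ?F" by blast
    obtain a b where "u - a *\<^sub>R x = b *\<^sub>R y" using z(2) by (auto simp: span_insert span_singleton)
    then have u: "u = a *\<^sub>R x + b *\<^sub>R y" by (simp add: algebra_simps)
    obtain c d where "v - c *\<^sub>R x = d *\<^sub>R y" using z(3) by (auto simp: span_insert span_singleton)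
    then have v: "v = c *\<^sub>R x + d *\<^sub>R y" by (simp add: algebra_simps)
    have "z = a *\<^sub>R (x, 0) + b *\<^sub>R (y, 0) + c *\<^sub>R (0, x) + d *\<^sub>R (0, y)"
      unfolding z(1) u v by simp
    also have "\<dots> \<in> span ?e" by (intro span_add span_scale x0 y0 x1 y1)
    finally show "z \<in> span ?e" .
  qed
  moreover have "Re l = 0" if spec: "l \<in> spectrum_on ?F L" for l
  proof -
    obtain z where "complex_eigenvector ?F L l z" using spec unfolding spectrum_on_def by blast
    then obtain p q where pq: "p \<in> ?F" "q \<in> ?F" "p \<noteq> 0 \<or> q \<noteq> 0"
      "L p = Re l *\<^sub>R p - Im l *\<^sub>R q" "L q = Im l *\<^sub>R p + Re l *\<^sub>R q"
      by (rule complex_eigenvectorE)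
    have LL: "L (L u) = - (\<nu>\<^sup>2) *\<^sub>R u" if uF: "u \<in> ?F" for u
    proof -
      obtain a b where "u - a *\<^sub>R x = b *\<^sub>R y" using uF by (auto simp: span_insert span_singleton)
      then have u: "u = a *\<^sub>R x + b *\<^sub>R y" by (simp add: algebra_simps)
      show ?thesis unfolding u
        by (simp add: L.add L.diff L.scale L.neg xy(2,3) power2_eq_square scaleR_add_right mult.commute mult.left_commute)
    qed
    define \<alpha> \<beta> where "\<alpha> = (Re l)\<^sup>2 - (Im l)\<^sup>2 + \<nu>\<^sup>2" and "\<beta> = 2 * (Re l * Im l)"
    have \<beta>: "\<beta> *\<^sub>R w = (Re l * Im l) *\<^sub>R w + (Re l * Im l) *\<^sub>R w" for w :: 'a
      unfolding \<beta>_def mult_2 by (rule scaleR_left_distrib)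
    have "L (L p) = Re l *\<^sub>R (Re l *\<^sub>R p - Im l *\<^sub>R q) - Im l *\<^sub>R (Im l *\<^sub>R p + Re l *\<^sub>R q)"
      unfolding pq(4) L.diff L.scale pq(4,5) ..
    then have "\<alpha> *\<^sub>R p - \<beta> *\<^sub>R q = 0"
      unfolding LL[OF pq(1)] \<alpha>_def \<beta> by (simp add: algebra_simps power2_eq_square)
    then have 1: "\<alpha> *\<^sub>R p = \<beta> *\<^sub>R q" by simp
    have "L (L q) = Im l *\<^sub>R (Re l *\<^sub>R p - Im l *\<^sub>R q) + Re l *\<^sub>R (Im l *\<^sub>R p + Re l *\<^sub>R q)"
      unfolding pq(5) L.add L.scale pq(4,5) ..
    then have "\<alpha> *\<^sub>R q + \<beta> *\<^sub>R p = 0"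
      unfolding LL[OF pq(2)] \<alpha>_def \<beta> by (simp add: algebra_simps power2_eq_square)
    then have 2: "\<alpha> *\<^sub>R q = - \<beta> *\<^sub>R p" by (simp add: eq_neg_iff_add_eq_0)
    have "(\<alpha>\<^sup>2 + \<beta>\<^sup>2) *\<^sub>R p = \<alpha> *\<^sub>R (\<alpha> *\<^sub>R p) - \<beta> *\<^sub>R (- \<beta> *\<^sub>R p)"
      by (simp add: algebra_simps power2_eq_square)
    also have "\<dots> = \<alpha> *\<^sub>R (\<beta> *\<^sub>R q) - \<beta> *\<^sub>R (\<alpha> *\<^sub>R q)" by (simp only: 1 2)
    also have "\<dots> = 0" by simp
    finally have p0: "(\<alpha>\<^sup>2 + \<beta>\<^sup>2) *\<^sub>R p = 0" .
    have "(\<alpha>\<^sup>2 + \<beta>\<^sup>2) *\<^sub>R q = \<alpha> *\<^sub>R (\<alpha> *\<^sub>R q) + \<beta> *\<^sub>R (\<beta> *\<^sub>R q)"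
      by (simp add: algebra_simps power2_eq_square)
    also have "\<dots> = \<alpha> *\<^sub>R (- \<beta> *\<^sub>R p) + \<beta> *\<^sub>R (\<alpha> *\<^sub>R p)" by (simp only: 1 2)
    also have "\<dots> = 0" by simp
    finally have "(\<alpha>\<^sup>2 + \<beta>\<^sup>2) *\<^sub>R q = 0" .
    with p0 pq(3) have "\<alpha>\<^sup>2 + \<beta>\<^sup>2 = 0" by auto
    then have \<alpha>\<beta>: "\<alpha> = 0" "\<beta> = 0" using sum_power2_eq_zero_iff[of \<alpha> \<beta>] by blast+
    show ?thesis
    proof (cases "Im l = 0")
      case True
      then have "(Re l)\<^sup>2 + \<nu>\<^sup>2 = 0" using \<alpha>\<beta>(1) unfolding \<alpha>_def by simp
      then show ?thesis using sum_power2_eq_zero_iff[of "Re l" \<nu>] by blast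
    next
      case False
      have "2 * (Re l * Im l) = 0" using \<alpha>\<beta>(2) unfolding \<beta>_def .
      then show ?thesis using False by simp
    qed
  qed
  ultimately show ?thesis unfolding linearly_stable_iff[OF subspace_span L] by simp
qed

section \<open>Limits of linear families and skew maps\<close>

lemma orthogonal_projection_exists:
  fixes V :: "'a::euclidean_space set"
  assumes V: "subspace V"
  obtains \<pi> where "linear \<pi>" "\<And>u. \<pi> u \<in> V" "\<And>u. u \<in> V \<Longrightarrow> \<pi> u = u"
    "\<And>u v. inner (\<pi> u) v = inner u (\<pi> v)" "\<And>u. norm (\<pi> u) \<le> norm u"
proof -
  obtain b :: "nat \<Rightarrow> 'a" where b: "\<And>i. i < dim V \<Longrightarrow> b i \<in> V"
    "\<And>i j. i < dim V \<Longrightarrow> j < dim V \<Longrightarrow> inner (b i) (b j) = (if i = j then 1 else 0)"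
    "\<And>u. u \<in> V \<Longrightarrow> (\<Sum>i<dim V. inner (b i) u *\<^sub>R b i) = u"
    using orthonormal_enumeration[OF V] by blast
  define \<pi> where "\<pi> u = (\<Sum>i<dim V. inner (b i) u *\<^sub>R b i)" for u
  have 1: "linear \<pi>"
    unfolding \<pi>_def
    by (intro linearI) (simp_all add: inner_add_right scaleR_add_left sum.distrib scaleR_sum_right)
  have 2: "\<pi> u \<in> V" for u
    unfolding \<pi>_def using b(1) by (intro subspace_sum[OF V] subspace_scale[OF V]) simp
  have 3: "\<pi> u = u" if "u \<in> V" for u unfolding \<pi>_def by (rule b(3)[OF that])
  have 4: "inner (\<pi> u) v = inner u (\<pi> v)" for u v
    unfolding \<pi>_def by (simp add: inner_sum_left inner_sum_right inner_commute mult.commute)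
  have 5: "norm (\<pi> u) \<le> norm u" for u
  proof -
    have "(norm (\<pi> u))\<^sup>2 = inner u (\<pi> u)"
      using 4[of u "\<pi> u"] 3[OF 2] by (simp add: power2_norm_eq_inner)
    also have "\<dots> \<le> norm u * norm (\<pi> u)" by (rule norm_cauchy_schwarz)
    finally show ?thesis by (cases "\<pi> u = 0") (simp_all add: power2_eq_square)
  qed
  show thesis using that[OF 1 2 3 4 5] .
qed

text \<open>In finite dimension pointwise convergence of linear maps is convergence in operator norm, by expansion in
  a basis.\<close>

lemma linear_tendsto_uniform:
  fixes A :: "'i \<Rightarrow> 'a::euclidean_space \<Rightarrow> 'b::real_normed_vector"
  assumes lin: "\<And>k. linear (A k)" "linear A'"
    and lim: "\<And>v. ((\<lambda>k. A k v) \<longlongrightarrow> A' v) F" and e: "e > 0"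
  shows "\<forall>\<^sub>F k in F. \<forall>v. norm (A k v - A' v) \<le> e * norm v"
proof -
  have "((\<lambda>k. \<Sum>b\<in>Basis. norm (A k b - A' b)) \<longlongrightarrow> (\<Sum>b\<in>Basis. norm (A' b - A' b))) F"
    by (intro tendsto_sum tendsto_norm tendsto_diff lim tendsto_const)
  then have "((\<lambda>k. \<Sum>b\<in>Basis. norm (A k b - A' b)) \<longlongrightarrow> 0) F" by simp
  then have "\<forall>\<^sub>F k in F. (\<Sum>b\<in>Basis. norm (A k b - A' b)) < e"
    using e by (rule order_tendstoD(2))
  then show ?thesis
  proof (rule eventually_mono, intro allI)
    fix k v assume k: "(\<Sum>b\<in>Basis. norm (A k b - A' b)) < e"
    define g where "g u = A k u - A' u" for u
    have g: "linear g" unfolding g_def using lin by (intro linear_compose_sub) auto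
    have "g v = g (\<Sum>b\<in>Basis. inner v b *\<^sub>R b)" by (simp add: euclidean_representation)
    also have "\<dots> = (\<Sum>b\<in>Basis. inner v b *\<^sub>R g b)" using g by (simp add: linear_sum linear_scale)
    finally have "norm (g v) \<le> (\<Sum>b\<in>Basis. norm (inner v b *\<^sub>R g b))" by (simp only: norm_sum)
    also have "\<dots> \<le> (\<Sum>b\<in>Basis. norm v * norm (g b))"
      by (intro sum_mono) (simp add: Basis_le_norm mult_right_mono)
    also have "\<dots> = norm v * (\<Sum>b\<in>Basis. norm (g b))" by (simp add: sum_distrib_left)
    also have "\<dots> \<le> norm v * e" using k unfolding g_def by (intro mult_left_mono) auto
    finally show "norm (A k v - A' v) \<le> e * norm v" unfolding g_def by (simp add: mult.commute)
  qed
qed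

lemma linear_tendsto_uniform_on:
  fixes A :: "'i \<Rightarrow> 'a::euclidean_space \<Rightarrow> 'b::real_normed_vector"
  assumes V: "subspace V" and lin: "\<And>k. linear (A k)" "linear A'"
    and lim: "\<And>v. v \<in> V \<Longrightarrow> ((\<lambda>k. A k v) \<longlongrightarrow> A' v) F" and e: "e > 0"
  shows "\<forall>\<^sub>F k in F. \<forall>v\<in>V. norm (A k v - A' v) \<le> e * norm v"
proof -
  obtain \<pi> where \<pi>: "linear \<pi>" "\<And>u. \<pi> u \<in> V" "\<And>u. u \<in> V \<Longrightarrow> \<pi> u = u"
    using orthogonal_projection_exists[OF V] by metis
  have "\<forall>\<^sub>F k in F. \<forall>v. norm (A k (\<pi> v) - A' (\<pi> v)) \<le> e * norm v"
    using linear_compose[OF \<pi>(1) lin(1)] linear_compose[OF \<pi>(1) lin(2)] lim[OF \<pi>(2)] e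
    unfolding o_def by (rule linear_tendsto_uniform)
  then show ?thesis by (rule eventually_mono) (metis \<pi>(3))
qed

text \<open>The limit map is bounded below on \<open>V\<close>, hence so are the approximating ones, uniformly; this
  turns convergence of the right-hand sides into convergence of the solutions.\<close>

lemma tendsto_linear_family_solution:
  fixes A :: "'i \<Rightarrow> 'a::euclidean_space \<Rightarrow> 'b::euclidean_space"
  assumes V: "subspace V" and lin: "\<And>k. linear (A k)" "linear A'"
    and lim: "\<And>v. v \<in> V \<Longrightarrow> ((\<lambda>k. A k v) \<longlongrightarrow> A' v) F"
    and inj: "\<And>v. v \<in> V \<Longrightarrow> A' v = 0 \<Longrightarrow> v = 0"
    and z: "\<And>k. z k \<in> V" "z' \<in> V" and Az: "((\<lambda>k. A k (z k)) \<longlongrightarrow> A' z') F"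
  shows "(z \<longlongrightarrow> z') F"
proof -
  have "\<exists>m>0. \<forall>v\<in>V. m * norm v \<le> norm (A' v)"
    using injective_imp_isometric[OF closed_subspace[OF V] V linear_conv_bounded_linear[THEN iffD1, OF lin(2)]]
      inj by blast
  then obtain m where m: "m > 0" "\<And>v. v \<in> V \<Longrightarrow> m * norm v \<le> norm (A' v)" by blast
  have "\<forall>\<^sub>F k in F. \<forall>v\<in>V. norm (A k v - A' v) \<le> m / 2 * norm v"
    using m(1) by (intro linear_tendsto_uniform_on[OF V lin lim]) auto
  then have "\<forall>\<^sub>F k in F. norm (z k - z') \<le> 2 / m * norm (A k (z k) - A k z')"
  proof (rule eventually_mono)
    fix k assume k: "\<forall>v\<in>V. norm (A k v - A' v) \<le> m / 2 * norm v"
    define w where "w = z k - z'"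
    have w: "w \<in> V" unfolding w_def using z by (intro subspace_diff[OF V])
    have "norm (A' w) \<le> norm (A k w) + norm (A k w - A' w)"
      by (metis add.commute norm_minus_commute norm_triangle_sub)
    then have "m * norm w \<le> norm (A k w) + m / 2 * norm w"
      using m(2)[OF w] k w by fastforce
    then have "m / 2 * norm w \<le> norm (A k w)" by simp
    then show "norm (z k - z') \<le> 2 / m * norm (A k (z k) - A k z')"
      using m(1) linear_diff[OF lin(1), of k "z k" z'] unfolding w_def by (simp add: field_simps)
  qed
  moreover have "((\<lambda>k. 2 / m * norm (A k (z k) - A k z')) \<longlongrightarrow> 2 / m * norm (A' z' - A' z')) F"
    by (intro tendsto_intros Az lim z)
  ultimately have "((\<lambda>k. z k - z') \<longlongrightarrow> 0) F"
    by (intro Lim_null_comparison[of "\<lambda>k. z k - z'"]) simp_all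
  then show ?thesis by (rule LIM_zero_cancel)
qed

text \<open>A map skew for a positive definite form is semisimple with imaginary spectrum. Induction on the
  dimension: an eigenvector spans an invariant plane (or line), and its orthogonal complement is invariant.\<close>

lemma skew_map_linearly_stable:
  fixes V :: "'a::euclidean_space set" and \<beta> :: "'a \<Rightarrow> 'a \<Rightarrow> real"
  assumes "subspace V" "linear M" "\<And>u. u \<in> V \<Longrightarrow> M u \<in> V" "bilinear \<beta>"
    "\<And>u. u \<in> V \<Longrightarrow> u \<noteq> 0 \<Longrightarrow> \<beta> u u > 0"
    "\<And>u v. u \<in> V \<Longrightarrow> v \<in> V \<Longrightarrow> \<beta> u v = \<beta> v u"
    "\<And>u v. u \<in> V \<Longrightarrow> v \<in> V \<Longrightarrow> \<beta> (M u) v + \<beta> u (M v) = 0"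
  shows "linearly_stable V M"
  using assms
proof (induction "dim V" arbitrary: V rule: less_induct)
  case less
  note V = less.prems(1) and M = less.prems(2) and MV = less.prems(3) and bil = less.prems(4)
  note pos = less.prems(5) and sym = less.prems(6) and skew = less.prems(7)
  interpret M: linear M by (rule M)
  note bl = bilinear_ladd[OF bil] bilinear_radd[OF bil] bilinear_lmul[OF bil] bilinear_rmul[OF bil]
    bilinear_lsub[OF bil] bilinear_rsub[OF bil] bilinear_lneg[OF bil] bilinear_rneg[OF bil]
    bilinear_lzero[OF bil] bilinear_rzero[OF bil]
  show ?case
  proof (cases "V = {0}")
    case True
    have "spectrum_on V M = {}"
      unfolding spectrum_on_def complex_eigenvector_def True by (auto simp: zero_prod_def)
    moreover have "V \<times> V \<subseteq> span A" for A :: "('a \<times> 'a) set"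
      unfolding True using span_zero[of A] by (simp add: zero_prod_def)
    ultimately show ?thesis unfolding linearly_stable_iff[OF V M] by simp
  next
    case False
    have MVi: "M ` V \<subseteq> V" using MV by (rule image_subsetI)
    obtain l where "l \<in> spectrum_on V M" using spectrum_on_nonempty[OF V False M MVi] by blast
    then obtain z where "complex_eigenvector V M l z" unfolding spectrum_on_def by blast
    then obtain x y where xy: "x \<in> V" "y \<in> V" "x \<noteq> 0 \<or> y \<noteq> 0"
      "M x = Re l *\<^sub>R x - Im l *\<^sub>R y" "M y = Im l *\<^sub>R x + Re l *\<^sub>R y"
      by (rule complex_eigenvectorE)
    have "\<beta> (M x) x + \<beta> (M y) y = 0" using skew[OF xy(1,1)] skew[OF xy(2,2)] sym MV xy(1,2) by simp
    then have "Re l * (\<beta> x x + \<beta> y y) = 0"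
      using sym[OF xy(1,2)] unfolding xy(4,5) by (simp add: bl algebra_simps)
    moreover have nn: "\<beta> u u \<ge> 0" if "u \<in> V" for u
      using pos[OF that] by (cases "u = 0") (simp_all add: bl less_imp_le)
    have "\<beta> x x + \<beta> y y > 0"
      using xy(3) pos[OF xy(1)] pos[OF xy(2)] nn[OF xy(1)] nn[OF xy(2)] by fastforce
    ultimately have Rl: "Re l = 0" by simp
    obtain p q \<nu> where pq: "p \<in> V" "q \<in> V" "p \<noteq> 0 \<or> q \<noteq> 0" "M p = - \<nu> *\<^sub>R q" "M q = \<nu> *\<^sub>R p"
        "\<beta> p q = 0"
    proof (cases "Im l = 0")
      case True
      show ?thesis
      proof (cases "x = 0")
        case True
        then show ?thesis using that[of y 0 0] xy \<open>Im l = 0\<close> Rl subspace_0[OF V] by (simp add: bl)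
      next
        case False
        then show ?thesis using that[of x 0 0] xy \<open>Im l = 0\<close> Rl subspace_0[OF V] by (simp add: bl)
      qed
    next
      case False
      have "\<beta> (M x) x = 0" using skew[OF xy(1,1)] sym[OF MV[OF xy(1)] xy(1)] by simp
      then have "\<beta> y x = 0" using False unfolding xy(4) Rl by (simp add: bl)
      then show ?thesis using that[of x y "Im l"] xy Rl sym[OF xy(1,2)] by simp
    qed
    define V' where "V' = {u \<in> V. \<beta> p u = 0 \<and> \<beta> q u = 0}"
    define Fp where "Fp = span {p, q}"
    have V': "subspace V'" unfolding V'_def subspace_def
      using subspace_0[OF V] subspace_add[OF V] subspace_scale[OF V] by (simp add: bl)
    have V'V: "V' \<subseteq> V" unfolding V'_def by blast
    have pV': "p \<notin> V' \<or> q \<notin> V'"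
      using pq(3) pos[OF pq(1)] pos[OF pq(2)] unfolding V'_def by auto
    then have "V' \<subset> V" using V'V pq(1,2) by blast
    then have dim: "dim V' < dim V"
      by (metis V V' dim_psubset span_eq_iff)
    have MV': "M u \<in> V'" if "u \<in> V'" for u
    proof -
      have u: "u \<in> V" "\<beta> p u = 0" "\<beta> q u = 0" using that unfolding V'_def by auto
      have "\<beta> p (M u) = 0" using skew[OF pq(1) u(1)] u unfolding pq(4) by (simp add: bl)
      moreover have "\<beta> q (M u) = 0" using skew[OF pq(2) u(1)] u unfolding pq(5) by (simp add: bl)
      ultimately show ?thesis using MV[OF u(1)] unfolding V'_def by simp
    qed
    have IH: "linearly_stable V' M"
    proof (rule less.hyps[OF dim V' M MV' bil])
      show "0 < \<beta> u u" if "u \<in> V'" "u \<noteq> 0" for u using that V'V pos by blast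
      show "\<beta> u v = \<beta> v u" if "u \<in> V'" "v \<in> V'" for u v using that V'V sym by blast
      show "\<beta> (M u) v + \<beta> u (M v) = 0" if "u \<in> V'" "v \<in> V'" for u v using that V'V skew by blast
    qed
    have Fst: "linearly_stable Fp M"
      unfolding Fp_def using pq(3,4,5) by (rule linearly_stable_rotation_plane[OF M])
    have Frep: "\<exists>a b. u = a *\<^sub>R p + b *\<^sub>R q" if uF: "u \<in> Fp" for u
    proof -
      obtain a b where "u - a *\<^sub>R p = b *\<^sub>R q" using uF unfolding Fp_def by (auto simp: span_insert span_singleton)
      then have "u = a *\<^sub>R p + b *\<^sub>R q" by (simp add: algebra_simps)
      then show ?thesis by blast
    qed
    have Fin: "a *\<^sub>R p + b *\<^sub>R q \<in> Fp" for a b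
      unfolding Fp_def by (intro span_add span_scale span_base) simp_all
    have FV: "Fp \<subseteq> V" unfolding Fp_def using pq(1,2) V by (intro span_minimal) simp_all
    have MF: "M ` Fp \<subseteq> Fp"
    proof (rule image_subsetI)
      fix u assume "u \<in> Fp"
      then obtain a b where u: "u = a *\<^sub>R p + b *\<^sub>R q" using Frep by blast
      have "M u = (b * \<nu>) *\<^sub>R p + (- a * \<nu>) *\<^sub>R q" unfolding u M.add M.scale pq(4,5) by simp
      then show "M u \<in> Fp" using Fin by metis
    qed
    have inter: "Fp \<inter> V' = {0}"
    proof -
      have "u = 0" if u: "u \<in> Fp" "u \<in> V'" for u
      proof -
        obtain a b where ab: "u = a *\<^sub>R p + b *\<^sub>R q" using Frep u(1) by blast
        have "\<beta> u u = a * \<beta> p u + b * \<beta> q u" using ab by (metis bl(1) bl(3) real_scaleR_def)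
        then have "\<beta> u u = 0" using u(2) unfolding V'_def by simp
        then show ?thesis using pos[of u] u(2) V'V by force
      qed
      then show ?thesis using subspace_0[OF V'] subspace_0[OF subspace_span, of "{p, q}"] unfolding Fp_def by blast
    qed
    have sum: "V = {e + f |e f. e \<in> Fp \<and> f \<in> V'}"
    proof (rule subset_antisym; rule subsetI)
      fix u assume u: "u \<in> V"
      define a b where "a = \<beta> p u / \<beta> p p" and "b = \<beta> q u / \<beta> q q"
      define f where "f = u - (a *\<^sub>R p + b *\<^sub>R q)"
      have qp: "\<beta> q p = 0" using sym[OF pq(1,2)] pq(6) by simp
      have "a * \<beta> p p = \<beta> p u" using pos[OF pq(1)] unfolding a_def by (cases "p = 0") (simp_all add: bl)
      moreover have "b * \<beta> q q = \<beta> q u" using pos[OF pq(2)] unfolding b_def by (cases "q = 0") (simp_all add: bl)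
      moreover have "f \<in> V" unfolding f_def using u pq(1,2) by (intro subspace_diff[OF V] subspace_add[OF V] subspace_scale[OF V])
      ultimately have "f \<in> V'" unfolding V'_def f_def by (simp add: bl pq(6) qp)
      moreover have "u = (a *\<^sub>R p + b *\<^sub>R q) + f" unfolding f_def by simp
      ultimately show "u \<in> {e + f |e f. e \<in> Fp \<and> f \<in> V'}" using Fin by blast
    next
      fix u assume "u \<in> {e + f |e f. e \<in> Fp \<and> f \<in> V'}"
      then show "u \<in> V" using FV V'V subspace_add[OF V] by blast
    qed
    have MV'i: "M ` V' \<subseteq> V'" using MV' by (rule image_subsetI)
    have "subspace Fp" unfolding Fp_def by (rule subspace_span)
    then show ?thesis
      by (rule linearly_stable_direct_sum[OF _ MF V' MV'i inter M Fst IH sum])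
  qed
qed

section \<open>Bilinear forms and strong stability of definite Hamiltonians\<close>

text \<open>A nondegenerate form identifies the subspace with its dual; this is what makes the Hamiltonian vector
  field of the slice unique.\<close>

lemma form_representation:
  fixes W :: "'a::euclidean_space set" and B :: "'a \<Rightarrow> 'a \<Rightarrow> real"
  assumes W: "subspace W" and B: "bilinear B" "nondegenerate_on W B" and \<phi>: "linear \<phi>"
  shows "\<exists>!z. z \<in> W \<and> (\<forall>v\<in>W. B z v = \<phi> v)"
proof -
  obtain \<pi> where \<pi>: "linear \<pi>" "\<And>u. \<pi> u \<in> W" "\<And>u. u \<in> W \<Longrightarrow> \<pi> u = u"
    "\<And>u v. inner (\<pi> u) v = inner u (\<pi> v)"
    using orthogonal_projection_exists[OF W] by metis
  interpret \<pi>: linear \<pi> by (rule \<pi>(1))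
  note bl = bilinear_ladd[OF B(1)] bilinear_radd[OF B(1)] bilinear_lmul[OF B(1)] bilinear_rmul[OF B(1)]
    bilinear_lsub[OF B(1)] bilinear_lzero[OF B(1)] bilinear_rzero[OF B(1)]
  have repr: "inner (\<Sum>b\<in>Basis. f b *\<^sub>R b) v = f v" if f: "linear f" for f :: "'a \<Rightarrow> real" and v
  proof -
    have "inner (\<Sum>b\<in>Basis. f b *\<^sub>R b) v = (\<Sum>b\<in>Basis. inner v b * f b)"
      by (simp add: inner_sum_left inner_commute[of v] mult.commute)
    also have "\<dots> = f (\<Sum>b\<in>Basis. inner v b *\<^sub>R b)" using f by (simp add: linear_sum linear_scale)
    finally show ?thesis by (simp add: euclidean_representation)
  qed
  define T where "T u = (\<Sum>b\<in>Basis. B (\<pi> u) (\<pi> b) *\<^sub>R b) + (u - \<pi> u)" for u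
  have BT: "linear (\<lambda>v. B (\<pi> u) (\<pi> v))" for u
    by (intro linearI) (simp_all add: \<pi>.add \<pi>.scale bl)
  have T: "inner (T u) v = B (\<pi> u) (\<pi> v) + inner (u - \<pi> u) v" for u v
    unfolding T_def inner_add_left repr[OF BT] ..
  have linT: "linear T"
    unfolding T_def
    by (intro linearI) (simp_all add: \<pi>.add \<pi>.scale bl scaleR_add_left sum.distrib scaleR_sum_right algebra_simps)
  have "T u = 0 \<Longrightarrow> u = 0" for u
  proof -
    assume 0: "T u = 0"
    have perp: "inner (u - \<pi> u) v = 0" if "v \<in> W" for v
      using \<pi>(4)[of u v] \<pi>(3)[OF that] by (simp add: inner_diff_left)
    have "B (\<pi> u) v = 0" if "v \<in> W" for v
      using T[of u v] 0 perp[OF that] \<pi>(3)[OF that] by simp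
    then have "\<pi> u = 0" using B(2) \<pi>(2) unfolding nondegenerate_on_def by blast
    then show "u = 0" using T[of u u] 0 by (simp add: bl)
  qed
  then have "inj T" using linT by (simp add: linear_injective_0)
  then have "surj T" using linT linear_injective_imp_surjective by blast
  then obtain u where u: "T u = \<pi> (\<Sum>b\<in>Basis. \<phi> b *\<^sub>R b)" by (metis surjD)
  have "\<pi> u \<in> W \<and> (\<forall>v\<in>W. B (\<pi> u) v = \<phi> v)"
  proof (intro conjI ballI)
    fix v assume v: "v \<in> W"
    have "inner (u - \<pi> u) v = 0" using \<pi>(4)[of u v] \<pi>(3)[OF v] by (simp add: inner_diff_left)
    then have "B (\<pi> u) v = inner (T u) v" using T[of u v] \<pi>(3)[OF v] by simp
    also have "\<dots> = \<phi> v" unfolding u \<pi>(4) \<pi>(3)[OF v] by (rule repr[OF \<phi>])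
    finally show "B (\<pi> u) v = \<phi> v" .
  qed (rule \<pi>(2))
  moreover have "z = z'" if "z \<in> W" "\<forall>v\<in>W. B z v = \<phi> v" "z' \<in> W" "\<forall>v\<in>W. B z' v = \<phi> v" for z z'
  proof -
    have "z - z' \<in> W" using that W by (simp add: subspace_diff)
    moreover have "\<forall>v\<in>W. B (z - z') v = 0" using that by (simp add: bl)
    ultimately have "z - z' = 0" using B(2) unfolding nondegenerate_on_def by blast
    then show ?thesis by simp
  qed
  ultimately show ?thesis by (intro ex1I[of _ "\<pi> u"]) blast+
qed

text \<open>Vectors represented by converging functionals with respect to converging nondegenerate forms converge; in
  particular Hamiltonian vectors depend continuously on the base point.\<close>

lemma tendsto_form_solution:
  fixes W :: "'a::euclidean_space set" and B :: "'i \<Rightarrow> 'a \<Rightarrow> 'a \<Rightarrow> real"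
  assumes W: "subspace W" and B: "\<And>k. bilinear (B k)" "bilinear B'" "nondegenerate_on W B'"
    and lim: "\<And>u v. u \<in> W \<Longrightarrow> v \<in> W \<Longrightarrow> ((\<lambda>k. B k u v) \<longlongrightarrow> B' u v) F"
    and z: "\<And>k. z k \<in> W" "z' \<in> W"
    and Bz: "\<And>v. v \<in> W \<Longrightarrow> ((\<lambda>k. B k (z k) v) \<longlongrightarrow> B' z' v) F"
  shows "(z \<longlongrightarrow> z') F"
proof -
  obtain \<pi> where \<pi>: "linear \<pi>" "\<And>u. \<pi> u \<in> W" "\<And>u. u \<in> W \<Longrightarrow> \<pi> u = u"
    using orthogonal_projection_exists[OF W] by metis
  define A where "A k u = (\<Sum>b\<in>Basis. B k u (\<pi> b) *\<^sub>R b)" for k u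
  define A' where "A' u = (\<Sum>b\<in>Basis. B' u (\<pi> b) *\<^sub>R b)" for u
  show ?thesis
  proof (rule tendsto_linear_family_solution[OF W])
    show "linear (A k)" for k unfolding A_def using bilinear_ladd[OF B(1)] bilinear_lmul[OF B(1)]
      by (intro linearI) (simp_all add: scaleR_add_left sum.distrib scaleR_sum_right)
    show "linear A'" unfolding A'_def using bilinear_ladd[OF B(2)] bilinear_lmul[OF B(2)]
      by (intro linearI) (simp_all add: scaleR_add_left sum.distrib scaleR_sum_right)
    show "((\<lambda>k. A k v) \<longlongrightarrow> A' v) F" if "v \<in> W" for v
      unfolding A_def A'_def by (intro tendsto_intros lim that \<pi>(2))
    show "((\<lambda>k. A k (z k)) \<longlongrightarrow> A' z') F"
      unfolding A_def A'_def by (intro tendsto_intros Bz \<pi>(2))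
    show "v = 0" if v: "v \<in> W" "A' v = 0" for v
    proof -
      have "B' v (\<pi> b) = 0" if "b \<in> Basis" for b
      proof -
        have "inner (A' v) b = B' v (\<pi> b)" unfolding A'_def by (rule inner_sum_left_Basis[OF that])
        then show ?thesis using v(2) by simp
      qed
      moreover have "linear (\<lambda>w. B' v (\<pi> w))"
        using bilinear_radd[OF B(2)] bilinear_rmul[OF B(2)] \<pi>(1)
        by (intro linearI) (simp_all add: linear_add linear_scale)
      ultimately have "B' v (\<pi> w) = 0" for w
        using linear_eq_stdbasis[of "\<lambda>w. B' v (\<pi> w)" "\<lambda>w. 0"] by (simp add: linear_zero fun_eq_iff)
      then have "\<forall>w\<in>W. B' v w = 0" using \<pi>(3) by metis
      then show ?thesis using B(3) v(1) unfolding nondegenerate_on_def by blast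
    qed
  qed (rule z)+
qed

lemma alternating_antisymmetric:
  assumes "bilinear B" "subspace W" "\<And>u. u \<in> W \<Longrightarrow> B u u = (0::real)" "u \<in> W" "v \<in> W"
  shows "B u v = - B v u"
proof -
  have "B (u + v) (u + v) = 0" using assms by (simp add: subspace_add)
  then show ?thesis using assms
    by (simp add: bilinear_ladd[OF assms(1)] bilinear_radd[OF assms(1)])
qed

text \<open>The minimum over the unit sphere of the subspace is the constant \<open>m\<close>.\<close>

lemma positive_form_coercive:
  fixes W :: "'a::euclidean_space set" and B :: "'a \<Rightarrow> 'a \<Rightarrow> real"
  assumes W: "subspace W" and B: "bilinear B" and pos: "\<And>u. u \<in> W \<Longrightarrow> u \<noteq> 0 \<Longrightarrow> B u u > 0"
  obtains m where "m > 0" "\<And>u. u \<in> W \<Longrightarrow> m * (norm u)\<^sup>2 \<le> B u u"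
proof (cases "W = {0}")
  case True
  then show thesis using that[of 1] bilinear_lzero[OF B] by simp
next
  case False
  define Sp where "Sp = W \<inter> sphere 0 1"
  have "compact Sp" unfolding Sp_def using closed_subspace[OF W] by (intro closed_Int_compact) simp_all
  moreover have "Sp \<noteq> {}"
  proof -
    obtain w where "w \<in> W" "w \<noteq> 0" using False subspace_0[OF W] by blast
    then have "w /\<^sub>R norm w \<in> Sp" unfolding Sp_def using subspace_scale[OF W] by simp
    then show ?thesis by blast
  qed
  moreover have "continuous_on Sp (\<lambda>u. B u u)"
    by (rule bounded_bilinear.continuous_on[OF bilinear_conv_bounded_bilinear[THEN iffD1, OF B]
          continuous_on_id continuous_on_id])
  ultimately have "\<exists>w\<in>Sp. \<forall>u\<in>Sp. B w w \<le> B u u" by (rule continuous_attains_inf)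
  then obtain w where w: "w \<in> Sp" "\<And>u. u \<in> Sp \<Longrightarrow> B w w \<le> B u u" by blast
  show thesis
  proof
    have "w \<in> W" "norm w = 1" using w(1) unfolding Sp_def by simp_all
    then show "B w w > 0" using pos[of w] by fastforce
    show "B w w * (norm u)\<^sup>2 \<le> B u u" if u: "u \<in> W" for u
    proof (cases "u = 0")
      case True
      then show ?thesis by (simp add: bilinear_lzero[OF B])
    next
      case False
      then have "u /\<^sub>R norm u \<in> Sp" unfolding Sp_def using subspace_scale[OF W u] by simp
      then have "B w w \<le> B (u /\<^sub>R norm u) (u /\<^sub>R norm u)" by (rule w(2))
      also have "\<dots> = B u u / (norm u)\<^sup>2"
        by (simp add: bilinear_lmul[OF B] bilinear_rmul[OF B] power2_eq_square divide_inverse)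
      finally show ?thesis using False by (simp add: field_simps)
    qed
  qed
qed

text \<open>Definiteness of the quadratic Hamiltonian \<open>\<omega> (L u) u\<close> is an open condition, and an
  infinitesimally symplectic map preserves its quadratic Hamiltonian, so every nearby map is skew for a definite
  form.\<close>

lemma definite_imp_strongly_linearly_stable:
  fixes W :: "'a::euclidean_space set" and \<omega> :: "'a \<Rightarrow> 'a \<Rightarrow> real"
  assumes W: "subspace W" and \<omega>: "bilinear \<omega>" "\<And>u. u \<in> W \<Longrightarrow> \<omega> u u = 0"
    and L: "inf_symplectic W \<omega> L" and def: "definite_on W (\<lambda>u v. \<omega> (L u) v)"
  shows "strongly_linearly_stable W \<omega> L"
proof -
  note bl = bilinear_ladd[OF \<omega>(1)] bilinear_radd[OF \<omega>(1)] bilinear_lmul[OF \<omega>(1)] bilinear_rmul[OF \<omega>(1)]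
    bilinear_lsub[OF \<omega>(1)]
  have lin: "linear L" using L unfolding inf_symplectic_def by blast
  obtain s :: real where s: "s = 1 \<or> s = -1" "\<And>u. u \<in> W \<Longrightarrow> u \<noteq> 0 \<Longrightarrow> s * \<omega> (L u) u > 0"
  proof (cases "\<forall>u\<in>W. u \<noteq> 0 \<longrightarrow> \<omega> (L u) u > 0")
    case True
    then show thesis using that[of 1] by simp
  next
    case False
    then have "\<forall>u\<in>W. u \<noteq> 0 \<longrightarrow> \<omega> (L u) u < 0" using def unfolding definite_on_def by blast
    then show thesis using that[of "-1"] by simp
  qed
  have form: "bilinear (\<lambda>u v. s * \<omega> (M u) v)" if "linear M" for M
    unfolding bilinear_def
  proof (intro conjI allI)
    show "linear (\<lambda>v. s * \<omega> (M u) v)" for u by (intro linearI) (simp_all add: bl algebra_simps)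
    show "linear (\<lambda>u. s * \<omega> (M u) v)" for v
      using that by (intro linearI) (simp_all add: linear_add linear_scale bl algebra_simps)
  qed
  obtain m where m: "m > 0" "\<And>u. u \<in> W \<Longrightarrow> m * (norm u)\<^sup>2 \<le> s * \<omega> (L u) u"
    using positive_form_coercive[OF W form[OF lin] s(2)] by blast
  obtain K where K: "K > 0" "\<And>u v. \<bar>\<omega> u v\<bar> \<le> K * norm u * norm v"
    using bilinear_bounded_pos[OF \<omega>(1)] by auto
  \<comment> \<open>Perturbations of this size cost at most half of the coercivity constant.\<close>
  define \<epsilon> where "\<epsilon> = m / (2 * K)"
  have \<epsilon>: "\<epsilon> > 0" unfolding \<epsilon>_def using m K by simp
  have "linearly_stable W M" if M: "inf_symplectic W \<omega> M" "\<forall>v\<in>W. norm (M v - L v) \<le> \<epsilon> * norm v" for M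
  proof (rule skew_map_linearly_stable[OF W, where \<beta> = "\<lambda>u v. s * \<omega> (M u) v"])
    show linM: "linear M" using M(1) unfolding inf_symplectic_def by blast
    show MW: "M u \<in> W" if "u \<in> W" for u using M(1) that unfolding inf_symplectic_def by blast
    have sk: "\<omega> (M u) v = - \<omega> u (M v)" if "u \<in> W" "v \<in> W" for u v
      using M(1) that unfolding inf_symplectic_def by (simp add: eq_neg_iff_add_eq_0)
    show "bilinear (\<lambda>u v. s * \<omega> (M u) v)" by (rule form[OF linM])
    show "0 < s * \<omega> (M u) u" if u: "u \<in> W" "u \<noteq> 0" for u
    proof -
      have "\<bar>s * \<omega> (M u - L u) u\<bar> \<le> K * norm (M u - L u) * norm u"
        using s(1) K(2)[of "M u - L u" u] by (auto simp: abs_mult)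
      also have "\<dots> \<le> K * (\<epsilon> * norm u) * norm u"
        using K(1) M(2) u(1) by (intro mult_right_mono mult_left_mono) simp_all
      also have "\<dots> = m / 2 * (norm u)\<^sup>2" unfolding \<epsilon>_def using K(1) by (simp add: power2_eq_square)
      finally have 1: "\<bar>s * \<omega> (M u - L u) u\<bar> \<le> m / 2 * (norm u)\<^sup>2" .
      have "s * \<omega> (M u) u = s * \<omega> (L u) u + s * \<omega> (M u - L u) u"
        by (simp add: bl right_diff_distrib)
      also have "\<dots> \<ge> m * (norm u)\<^sup>2 - m / 2 * (norm u)\<^sup>2" using m(2)[OF u(1)] 1 by linarith
      finally have "s * \<omega> (M u) u \<ge> m / 2 * (norm u)\<^sup>2" by simp
      moreover have "m / 2 * (norm u)\<^sup>2 > 0" using m(1) u(2) by simp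
      ultimately show ?thesis by linarith
    qed
    show "s * \<omega> (M u) v = s * \<omega> (M v) u" if "u \<in> W" "v \<in> W" for u v
      using sk[OF that] alternating_antisymmetric[OF \<omega>(1) W \<omega>(2) that(1) MW[OF that(2)]] by simp
    show "s * \<omega> (M (M u)) v + s * \<omega> (M u) (M v) = 0" if "u \<in> W" "v \<in> W" for u v
      using sk[OF MW[OF that(1)] that(2)] by simp
  qed
  then show ?thesis unfolding strongly_linearly_stable_def using L \<epsilon> by blast
qed

text \<open>A square root \<open>1 + X\<close> of \<open>1 + D\<close>, obtained as the fixed point of the
  contraction \<open>X \<mapsto> (D - X\<^sup>2) / 2\<close> on the closed set of maps of norm at most \<open>1 /
  2\<close> that are symmetric for the form; that set is mapped to itself because squares of symmetric maps are
  symmetric. It serves as a linear Moser trick: if a form is \<open>(u, v) \<mapsto> \<omega> (u + D u) v\<close>,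
  then \<open>1 + X\<close> carries it to \<open>\<omega>\<close>.\<close>

lemma symmetric_square_root:
  fixes W :: "'a::euclidean_space set" and \<omega> :: "'a \<Rightarrow> 'a \<Rightarrow> real"
  assumes W: "subspace W" and \<omega>: "bilinear \<omega>" and D: "linear D" "\<And>u. u \<in> W \<Longrightarrow> D u \<in> W"
    and sym: "\<And>u v. u \<in> W \<Longrightarrow> v \<in> W \<Longrightarrow> \<omega> (D u) v = \<omega> u (D v)"
    and \<eta>: "\<eta> \<le> 1 / 2" "\<And>u. norm (D u) \<le> \<eta> * norm u"
  obtains X where "linear X" "\<And>u. u \<in> W \<Longrightarrow> X u \<in> W"
    "\<And>u v. u \<in> W \<Longrightarrow> v \<in> W \<Longrightarrow> \<omega> (X u) v = \<omega> u (X v)"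
    "\<And>u. norm (X u) \<le> \<eta> * norm u" "\<And>u. X u + X u + X (X u) = D u"
proof -
  note bl = bilinear_lmul[OF \<omega>] bilinear_rmul[OF \<omega>] bilinear_lsub[OF \<omega>] bilinear_rsub[OF \<omega>]
    bilinear_lzero[OF \<omega>] bilinear_rzero[OF \<omega>]
  define D' where "D' = Blinfun D"
  have D': "blinfun_apply D' = D"
    unfolding D'_def using D(1) by (simp add: bounded_linear_Blinfun_apply linear_conv_bounded_linear)
  have \<eta>0: "\<eta> \<ge> 0"
  proof -
    obtain b :: 'a where "b \<in> Basis" using nonempty_Basis by blast
    then have "0 \<le> \<eta> * norm b" using \<eta>(2)[of b] norm_ge_zero order_trans by blast
    then show ?thesis using \<open>b \<in> Basis\<close> by simp
  qed
  have nD: "norm D' \<le> \<eta>" using \<eta>(2) \<eta>0 by (intro norm_blinfun_bound) (simp_all add: D')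
  define \<S> :: "('a \<Rightarrow>\<^sub>L 'a) set" where
    "\<S> = {X. norm X \<le> 1 / 2} \<inter> (\<Inter>u\<in>W. {X. blinfun_apply X u \<in> W}) \<inter>
      (\<Inter>u\<in>W. \<Inter>v\<in>W. {X. \<omega> (blinfun_apply X u) v = \<omega> u (blinfun_apply X v)})"

  have "closed \<S>"
    unfolding \<S>_def
  proof (intro closed_Int closed_INT ballI)
    show "closed {X :: 'a \<Rightarrow>\<^sub>L 'a. norm X \<le> 1 / 2}" by (intro closed_Collect_le continuous_intros)
    show "closed {X. blinfun_apply X u \<in> W}" for u :: 'a
    proof -
      have "continuous_on UNIV (\<lambda>X :: 'a \<Rightarrow>\<^sub>L 'a. blinfun_apply X u)" by (intro continuous_intros)
      then have "closed ((\<lambda>X. blinfun_apply X u) -` W)" by (rule closed_vimage[OF closed_subspace[OF W]])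
      then show ?thesis unfolding vimage_def .
    qed
    show "closed {X. \<omega> (blinfun_apply X u) v = \<omega> u (blinfun_apply X v)}" for u v
    proof -
      have bb: "bounded_bilinear \<omega>" using \<omega> bilinear_conv_bounded_bilinear by blast
      have ca: "continuous_on UNIV (\<lambda>X :: 'a \<Rightarrow>\<^sub>L 'a. blinfun_apply X w)" for w by (intro continuous_intros)
      show ?thesis
        by (intro closed_Collect_eq bounded_bilinear.continuous_on[OF bb] ca continuous_on_const)
    qed
  qed
  then have comp: "complete \<S>" by (simp add: complete_eq_closed)
  have ne: "0 \<in> \<S>" unfolding \<S>_def using subspace_0[OF W] by (simp add: bl)
  define f where "f X = (1 / 2) *\<^sub>R (D' - (X o\<^sub>L X))" for X
  have f: "blinfun_apply (f X) u = (1 / 2) *\<^sub>R (D u - X (X u))" for X u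
    unfolding f_def by (simp add: blinfun.scaleR_left blinfun.diff_left D')
  have maps: "f ` \<S> \<subseteq> \<S>"
  proof (rule image_subsetI)
    fix X assume X: "X \<in> \<S>"
    have XW: "blinfun_apply X u \<in> W" if "u \<in> W" for u using X that unfolding \<S>_def by blast
    have Xs: "\<omega> (blinfun_apply X u) v = \<omega> u (blinfun_apply X v)" if "u \<in> W" "v \<in> W" for u v
      using X that unfolding \<S>_def by blast
    have nX: "norm X \<le> 1 / 2" using X unfolding \<S>_def by blast
    have "norm (X o\<^sub>L X) \<le> norm X * norm X" by (rule norm_blinfun_compose)
    also have "\<dots> \<le> 1 / 2 * (1 / 2)" using nX by (intro mult_mono) simp_all
    finally have "norm (X o\<^sub>L X) \<le> 1 / 4" by simp
    then have "norm (D' - (X o\<^sub>L X)) \<le> 1"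
      using norm_triangle_ineq4[of D' "X o\<^sub>L X"] nD \<eta>(1) by linarith
    then have "norm (f X) \<le> 1 / 2" unfolding f_def by simp
    moreover have "f X u \<in> W" if "u \<in> W" for u
      unfolding f using that D(2) XW by (intro subspace_scale[OF W] subspace_diff[OF W]) simp_all
    moreover have "\<omega> (f X u) v = \<omega> u (f X v)" if "u \<in> W" "v \<in> W" for u v
      unfolding f bl using sym[OF that] Xs[OF XW[OF that(1)] that(2)] Xs[OF that(1) XW[OF that(2)]] by simp
    ultimately show "f X \<in> \<S>" unfolding \<S>_def by blast
  qed
  have lip: "dist (f X) (f Y) \<le> 1 / 2 * dist X Y" if XY: "X \<in> \<S>" "Y \<in> \<S>" for X Y
  proof -
    have n: "norm X \<le> 1 / 2" "norm Y \<le> 1 / 2" using XY unfolding \<S>_def by blast+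
    have "f X - f Y = (1 / 2) *\<^sub>R ((Y o\<^sub>L (Y - X)) + ((Y - X) o\<^sub>L X))"
      by (rule blinfun_eqI) (simp add: f blinfun.scaleR_left blinfun.diff_left blinfun.add_left
          blinfun.diff_right scaleR_diff_right[symmetric])
    then have "dist (f X) (f Y) = 1 / 2 * norm ((Y o\<^sub>L (Y - X)) + ((Y - X) o\<^sub>L X))"
      by (simp add: dist_norm)
    also have "norm ((Y o\<^sub>L (Y - X)) + ((Y - X) o\<^sub>L X)) \<le> norm Y * norm (Y - X) + norm (Y - X) * norm X"
      by (intro norm_triangle_le add_mono norm_blinfun_compose)
    also have "\<dots> \<le> 1 / 2 * norm (Y - X) + norm (Y - X) * (1 / 2)"
      using n by (intro add_mono mult_mono) simp_all
    finally show ?thesis by (simp add: dist_norm norm_minus_commute)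
  qed
  have "\<S> \<noteq> {}" using ne by blast
  then have "\<exists>!X\<in>\<S>. f X = X"
    using lip by (intro Banach_fix[OF comp _ _ _ maps, of "1 / 2"]) simp_all
  then obtain X where X: "X \<in> \<S>" "f X = X" by blast
  have nX: "norm X \<le> 1 / 2" using X(1) unfolding \<S>_def by blast
  have "norm X \<le> 1 / 2 * (norm D' + norm X * norm X)"
  proof -
    have "norm (f X) = 1 / 2 * norm (D' - (X o\<^sub>L X))" unfolding f_def by simp
    then have "norm X = 1 / 2 * norm (D' - (X o\<^sub>L X))" unfolding X(2) .
    also have "\<dots> \<le> 1 / 2 * (norm D' + norm X * norm X)"
      using norm_triangle_ineq4[of D' "X o\<^sub>L X"] norm_blinfun_compose[of X X] by simp
    finally show ?thesis .
  qed
  also have "\<dots> \<le> 1 / 2 * (\<eta> + 1 / 2 * norm X)"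
    using nX nD by (intro mult_left_mono add_mono mult_right_mono) simp_all
  finally have nX': "norm X \<le> \<eta>" using \<eta>0 by simp
  show thesis
  proof
    show "linear (blinfun_apply X)" by (simp add: blinfun.bounded_linear_right bounded_linear.linear)
    show "X u \<in> W" if "u \<in> W" for u using X(1) that unfolding \<S>_def by blast
    show "\<omega> (X u) v = \<omega> u (X v)" if "u \<in> W" "v \<in> W" for u v
      using X(1) that unfolding \<S>_def by blast
    show "norm (X u) \<le> \<eta> * norm u" for u
      using norm_blinfun[of X u] mult_right_mono[OF nX', of "norm u"] by simp
    show "X u + X u + X (X u) = D u" for u
    proof -
      have "2 *\<^sub>R X u = 2 *\<^sub>R f X u" using X(2) by simp
      also have "\<dots> = D u - X (X u)" unfolding f by simp
      finally show ?thesis by (simp add: scaleR_2 algebra_simps)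
    qed
  qed
qed

section \<open>Persistence of strong stability under perturbation of the symplectic form\<close>

text \<open>Joint convergence of the maps and of their arguments.\<close>

lemma tendsto_linear_apply:
  fixes A :: "'i \<Rightarrow> 'a::euclidean_space \<Rightarrow> 'b::real_normed_vector"
  assumes V: "subspace V" and lin: "\<And>k. linear (A k)" "linear A'"
    and lim: "\<And>v. v \<in> V \<Longrightarrow> ((\<lambda>k. A k v) \<longlongrightarrow> A' v) F"
    and u: "\<And>k. u k \<in> V" "u' \<in> V" "(u \<longlongrightarrow> u') F"
  shows "((\<lambda>k. A k (u k)) \<longlongrightarrow> A' u') F"
proof -
  have "((\<lambda>k. norm (u k - u')) \<longlongrightarrow> norm (u' - u')) F" by (intro tendsto_intros u(3))
  then have n0: "((\<lambda>k. norm (u k - u')) \<longlongrightarrow> 0) F" by simp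
  have "\<forall>\<^sub>F k in F. \<forall>v\<in>V. norm (A k v - A' v) \<le> 1 * norm v"
    by (rule linear_tendsto_uniform_on[OF V lin lim]) simp_all
  moreover obtain C where C: "C > 0" "\<And>v. norm (A' v) \<le> C * norm v"
    using linear_bounded_pos[OF lin(2)] by blast
  ultimately have "\<forall>\<^sub>F k in F. norm (A k (u k) - A k u') \<le> (C + 1) * norm (u k - u')"
  proof (elim eventually_mono)
    fix k assume k: "\<forall>v\<in>V. norm (A k v - A' v) \<le> 1 * norm v"
    define w where "w = u k - u'"
    have "w \<in> V" unfolding w_def using u(1,2) by (intro subspace_diff[OF V])
    then have "norm (A k w) \<le> norm w + C * norm w"
      using k C(2)[of w] norm_triangle_ineq[of "A k w - A' w" "A' w"] by fastforce
    then show "norm (A k (u k) - A k u') \<le> (C + 1) * norm (u k - u')"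
      unfolding w_def linear_diff[OF lin(1)] by (simp add: algebra_simps)
  qed
  moreover have "((\<lambda>k. (C + 1) * norm (u k - u')) \<longlongrightarrow> 0) F"
    using tendsto_mult_left[OF n0, of "C + 1"] by simp
  ultimately have "((\<lambda>k. A k (u k) - A k u') \<longlongrightarrow> 0) F"
    by (rule Lim_null_comparison)
  from tendsto_add[OF this lim[OF u(2)]] show ?thesis by simp
qed

lemma tendsto_bilinear_apply:
  fixes B :: "'i \<Rightarrow> 'a::euclidean_space \<Rightarrow> 'a \<Rightarrow> real"
  assumes W: "subspace W" and B: "\<And>k. bilinear (B k)" "bilinear B'"
    and lim: "\<And>u v. u \<in> W \<Longrightarrow> v \<in> W \<Longrightarrow> ((\<lambda>k. B k u v) \<longlongrightarrow> B' u v) F"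
    and u: "\<And>k. u k \<in> W" "u' \<in> W" "(u \<longlongrightarrow> u') F"
    and v: "\<And>k. v k \<in> W" "v' \<in> W" "(v \<longlongrightarrow> v') F"
  shows "((\<lambda>k. B k (u k) (v k)) \<longlongrightarrow> B' u' v') F"
proof -
  have 1: "((\<lambda>k. B k (u k) w) \<longlongrightarrow> B' u' w) F" if "w \<in> W" for w
    using tendsto_linear_apply[OF W, of "\<lambda>k z. B k z w" "\<lambda>z. B' z w"] B lim that u
    unfolding bilinear_def by blast
  obtain \<pi> where \<pi>: "linear \<pi>" "\<And>u. \<pi> u \<in> W" "\<And>u. u \<in> W \<Longrightarrow> \<pi> u = u"
    using orthogonal_projection_exists[OF W] by metis
  have "((\<lambda>k. B k (u k) (\<pi> (v k))) \<longlongrightarrow> B' u' (\<pi> v')) F"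
  proof (rule tendsto_linear_apply[OF subspace_UNIV, of "\<lambda>k z. B k (u k) (\<pi> z)" "\<lambda>z. B' u' (\<pi> z)"])
    show "linear (\<lambda>z. B k (u k) (\<pi> z))" for k
      using bilinear_radd[OF B(1)] bilinear_rmul[OF B(1)] \<pi>(1)
      by (intro linearI) (simp_all add: linear_add linear_scale)
    show "linear (\<lambda>z. B' u' (\<pi> z))"
      using bilinear_radd[OF B(2)] bilinear_rmul[OF B(2)] \<pi>(1)
      by (intro linearI) (simp_all add: linear_add linear_scale)
    show "((\<lambda>k. B k (u k) (\<pi> z)) \<longlongrightarrow> B' u' (\<pi> z)) F" for z by (rule 1[OF \<pi>(2)])
  qed (simp_all add: v(3))
  then show ?thesis using v(1,2) \<pi>(3) by simp
qed

text \<open>The definition of strong stability allows perturbations that are infinitesimally symplectic for the same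
  form. If the form varies too, a conjugation close to the identity (from \<open>symmetric_square_root\<close>)
  carries the nearby form to the given one and reduces to that case.\<close>

lemma strongly_linearly_stable_perturbation:
  fixes W :: "'a::euclidean_space set" and \<omega> :: "'i \<Rightarrow> 'a \<Rightarrow> 'a \<Rightarrow> real"
  assumes W: "subspace W" and \<omega>': "bilinear \<omega>'" "\<And>u. u \<in> W \<Longrightarrow> \<omega>' u u = 0" "nondegenerate_on W \<omega>'"
    and strong: "strongly_linearly_stable W \<omega>' L"
    and \<omega>: "\<And>k. bilinear (\<omega> k)" "\<And>k u. u \<in> W \<Longrightarrow> \<omega> k u u = 0"
      "\<And>u v. u \<in> W \<Longrightarrow> v \<in> W \<Longrightarrow> ((\<lambda>k. \<omega> k u v) \<longlongrightarrow> \<omega>' u v) F"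
    and M: "\<And>k. linear (M k)" "\<And>k u. u \<in> W \<Longrightarrow> M k u \<in> W"
      "\<And>k u v. u \<in> W \<Longrightarrow> v \<in> W \<Longrightarrow> \<omega> k (M k u) v + \<omega> k u (M k v) = 0"
      "\<And>u. u \<in> W \<Longrightarrow> ((\<lambda>k. M k u) \<longlongrightarrow> L u) F"
  shows "\<forall>\<^sub>F k in F. linearly_stable W (M k)"
proof -
  obtain \<epsilon> where \<epsilon>: "\<epsilon> > 0"
      "\<And>M. inf_symplectic W \<omega>' M \<Longrightarrow> (\<forall>v\<in>W. norm (M v - L v) \<le> \<epsilon> * norm v) \<Longrightarrow> linearly_stable W M"
    using strong unfolding strongly_linearly_stable_def by blast
  have L: "linear L"
    using strong unfolding strongly_linearly_stable_def inf_symplectic_def by blast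
  obtain K where K: "K > 0" "\<And>v. norm (L v) \<le> K * norm v"
    using linear_bounded_pos[OF L] by blast
  obtain \<pi> where \<pi>: "linear \<pi>" "\<And>u. \<pi> u \<in> W" "\<And>u. u \<in> W \<Longrightarrow> \<pi> u = u"
    using orthogonal_projection_exists[OF W] by metis
  note bl' = bilinear_ladd[OF \<omega>'(1)] bilinear_radd[OF \<omega>'(1)] bilinear_lmul[OF \<omega>'(1)] bilinear_rmul[OF \<omega>'(1)]
    bilinear_lsub[OF \<omega>'(1)] bilinear_rsub[OF \<omega>'(1)]
  note bl = bilinear_ladd[OF \<omega>(1)] bilinear_radd[OF \<omega>(1)] bilinear_lmul[OF \<omega>(1)] bilinear_rmul[OF \<omega>(1)]
  have lin\<omega>: "linear (\<omega> k (\<pi> u))" for k u by (intro linearI) (simp_all add: bl)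
  have "\<exists>!z. z \<in> W \<and> (\<forall>v\<in>W. \<omega>' z v = \<omega> k (\<pi> u) v)" for k u
    by (rule form_representation[OF W \<omega>'(1,3) lin\<omega>])
  then obtain C where C: "\<And>k u. C k u \<in> W" "\<And>k u v. v \<in> W \<Longrightarrow> \<omega>' (C k u) v = \<omega> k (\<pi> u) v"
    by metis
  have eqW: "z = z'" if "z \<in> W" "z' \<in> W" "\<And>v. v \<in> W \<Longrightarrow> \<omega>' z v = \<omega>' z' v" for z z'
  proof -
    have "z - z' \<in> W" using that(1,2) by (rule subspace_diff[OF W])
    moreover have "\<forall>v\<in>W. \<omega>' (z - z') v = 0" using that(3) by (simp add: bl')
    ultimately have "z - z' = 0" using \<omega>'(3) unfolding nondegenerate_on_def by blast
    then show ?thesis by simp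
  qed
  have linC: "linear (C k)" for k
  proof (rule linearI)
    show "C k (u + v) = C k u + C k v" for u v
      by (rule eqW) (simp_all add: C subspace_add[OF W] bl bl' linear_add[OF \<pi>(1)])
    show "C k (r *\<^sub>R u) = r *\<^sub>R C k u" for r u
      by (rule eqW) (simp_all add: C subspace_scale[OF W] bl bl' linear_scale[OF \<pi>(1)])
  qed
  have symC: "\<omega>' (C k u) v = \<omega>' u (C k v)" if "u \<in> W" "v \<in> W" for k u v
  proof -
    have "\<omega>' (C k u) v = \<omega> k u v" using C(2)[OF that(2)] \<pi>(3)[OF that(1)] by simp
    also have "\<dots> = - \<omega> k v u" by (rule alternating_antisymmetric[OF \<omega>(1) W \<omega>(2) that])
    also have "\<omega> k v u = \<omega>' (C k v) u" using C(2)[OF that(1)] \<pi>(3)[OF that(2)] by simp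
    also have "- \<dots> = \<omega>' u (C k v)"
      using alternating_antisymmetric[OF \<omega>'(1) W \<omega>'(2) that(1) C(1)] by simp
    finally show ?thesis .
  qed
  have limC: "((\<lambda>k. C k u) \<longlongrightarrow> \<pi> u) F" for u
  proof (rule tendsto_form_solution[OF W, of "\<lambda>k. \<omega>'" \<omega>'])
    show "((\<lambda>k. \<omega>' (C k u) v) \<longlongrightarrow> \<omega>' (\<pi> u) v) F" if "v \<in> W" for v
      unfolding C(2)[OF that] by (rule \<omega>(3)[OF \<pi>(2) that])
  qed (simp_all add: \<omega>' C \<pi>)
  define \<eta> where "\<eta> = min (1 / 2) (\<epsilon> / (12 * K + 6))"
  define \<delta> where "\<delta> = min 1 (\<epsilon> / 6)"
  have \<eta>: "\<eta> > 0" "\<eta> \<le> 1 / 2" "\<eta> * (4 * K + 2) \<le> \<epsilon> / 3"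
  proof -
    show "\<eta> > 0" unfolding \<eta>_def using \<epsilon>(1) K(1) by simp
    show "\<eta> \<le> 1 / 2" unfolding \<eta>_def by (rule min.cobounded1)
    have "\<eta> * (4 * K + 2) \<le> \<epsilon> / (12 * K + 6) * (4 * K + 2)"
      unfolding \<eta>_def using K(1) by (intro mult_right_mono) simp_all
    also have "\<dots> = \<epsilon> / 3" using K(1) by (simp add: field_simps)
    finally show "\<eta> * (4 * K + 2) \<le> \<epsilon> / 3" .
  qed
  have \<delta>: "\<delta> > 0" "\<delta> \<le> 1" "\<delta> \<le> \<epsilon> / 6" unfolding \<delta>_def using \<epsilon>(1) by simp_all
  have "\<forall>\<^sub>F k in F. \<forall>v. norm (C k v - \<pi> v) \<le> \<eta> * norm v"
    by (rule linear_tendsto_uniform[OF linC \<pi>(1) limC \<eta>(1)])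
  moreover have "\<forall>\<^sub>F k in F. \<forall>v\<in>W. norm (M k v - L v) \<le> \<delta> * norm v"
    by (rule linear_tendsto_uniform_on[OF W M(1) L M(4) \<delta>(1)])
  ultimately show ?thesis
  proof eventually_elim
    case (elim k)
    define D where "D u = C k u - \<pi> u" for u
    have linD: "linear D" unfolding D_def by (rule linear_compose_sub[OF linC \<pi>(1)])
    have DW: "D u \<in> W" for u unfolding D_def by (intro subspace_diff[OF W] C(1) \<pi>(2))
    have symD: "\<omega>' (D u) v = \<omega>' u (D v)" if "u \<in> W" "v \<in> W" for u v
      unfolding D_def using symC[OF that] \<pi>(3) that by (simp add: bl')
    have nD: "norm (D u) \<le> \<eta> * norm u" for u unfolding D_def using elim(1) by blast
    obtain X where X: "linear X" "\<And>u. u \<in> W \<Longrightarrow> X u \<in> W"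
        "\<And>u v. u \<in> W \<Longrightarrow> v \<in> W \<Longrightarrow> \<omega>' (X u) v = \<omega>' u (X v)"
        "\<And>u. norm (X u) \<le> \<eta> * norm u" "\<And>u. X u + X u + X (X u) = D u"
      using symmetric_square_root[OF W \<omega>'(1) linD DW symD \<eta>(2) nD] by blast
    interpret X: linear X by (rule X(1))
    interpret Mk: linear "M k" by (rule M(1))
    interpret L: linear L by (rule L)
    define S where "S u = u + X u" for u
    have linS: "linear S" unfolding S_def
      by (intro linearI) (simp_all add: X.add X.scale algebra_simps)
    have SW: "S u \<in> W" if "u \<in> W" for u unfolding S_def by (intro subspace_add[OF W] that X(2))
    have nS: "norm u \<le> 2 * norm (S u)" for u
    proof -
      have "norm u \<le> norm (S u) + norm (X u)" unfolding S_def
        using norm_triangle_ineq4[of "u + X u" "X u"] by simp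
      also have "norm (X u) \<le> 1 / 2 * norm u"
        using X(4)[of u] mult_right_mono[OF \<eta>(2), of "norm u"] by simp
      finally show ?thesis by simp
    qed
    have SS: "\<omega>' (S u) (S v) = \<omega> k u v" if "u \<in> W" "v \<in> W" for u v
    proof -
      have "\<omega>' (S u) (S v) = \<omega>' (S (S u)) v"
        unfolding S_def using X(3)[OF that] X(3)[OF X(2)[OF that(1)] that(2)]
        by (simp add: bl' X.add)
      also have "S (S u) = u + (X u + X u + X (X u))" unfolding S_def by (simp add: X.add algebra_simps)
      also have "\<dots> = C k u" unfolding X(5) D_def using \<pi>(3)[OF that(1)] by simp
      also have "\<omega>' \<dots> v = \<omega> k u v" using C(2)[OF that(2)] \<pi>(3)[OF that(1)] by simp
      finally show ?thesis .
    qed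
    have injS: "inj S" unfolding linear_injective_0[OF linS]
    proof (intro allI impI)
      fix u assume "S u = 0"
      then show "u = 0" using nS[of u] by simp
    qed
    have surjS: "surj S" by (rule linear_injective_imp_surjective[OF linS injS refl])
    define R where "R = inv_into UNIV S"
    have RS: "R (S u) = u" for u unfolding R_def using injS by simp
    have SR: "S (R u) = u" for u unfolding R_def using surjS by (rule surj_f_inv_f)
    have linR: "linear R"
    proof (rule linearI)
      show "R (u + v) = R u + R v" for u v using RS[of "R u + R v"] by (simp add: linear_add[OF linS] SR)
      show "R (r *\<^sub>R u) = r *\<^sub>R R u" for r u using RS[of "r *\<^sub>R R u"] by (simp add: linear_scale[OF linS] SR)
    qed
    have "S ` W = W"
    proof (rule subspace_dim_equal)
      show "subspace (S ` W)" by (rule linear_subspace_image[OF linS W])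
      show "S ` W \<subseteq> W" using SW by (rule image_subsetI)
      show "dim W \<le> dim (S ` W)" using dim_image_eq[OF linS, of W] injS by (simp add: inj_on_subset)
    qed (rule W)
    have RW: "R u \<in> W" if "u \<in> W" for u
    proof -
      have "u \<in> S ` W" using that \<open>S ` W = W\<close> by simp
      then obtain w where "u = S w" "w \<in> W" by (rule imageE)
      then show ?thesis using RS by simp
    qed
    define N where "N u = S (M k (R u))" for u
    have linN: "linear N"
      unfolding N_def using linear_compose[OF linear_compose[OF linR M(1)] linS] by (simp add: o_def)
    have NW: "N u \<in> W" if "u \<in> W" for u unfolding N_def by (intro SW M(2) RW that)
    have "inf_symplectic W \<omega>' N"
      unfolding inf_symplectic_def
    proof (intro conjI ballI linN image_subsetI NW)
      fix u v assume uv: "u \<in> W" "v \<in> W"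
      have "\<omega>' (N u) v = \<omega>' (S (M k (R u))) (S (R v))" unfolding N_def SR ..
      also have "\<dots> = \<omega> k (M k (R u)) (R v)" by (rule SS[OF M(2)[OF RW[OF uv(1)]] RW[OF uv(2)]])
      finally have 1: "\<omega>' (N u) v = \<omega> k (M k (R u)) (R v)" .
      have "\<omega>' u (N v) = \<omega>' (S (R u)) (S (M k (R v)))" unfolding N_def SR ..
      also have "\<dots> = \<omega> k (R u) (M k (R v))" by (rule SS[OF RW[OF uv(1)] M(2)[OF RW[OF uv(2)]]])
      finally show "\<omega>' (N u) v + \<omega>' u (N v) = 0"
        using 1 M(3)[OF RW[OF uv(1)] RW[OF uv(2)]] by simp
    qed
    moreover have "\<forall>v\<in>W. norm (N v - L v) \<le> \<epsilon> * norm v"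
    proof
      fix v assume v: "v \<in> W"
      define b where "b = R v"
      have b: "b \<in> W" "S b = v" unfolding b_def using RW[OF v] SR by simp_all
      have nb: "norm b \<le> 2 * norm v" using nS[of b] b(2) by simp
      have Mb: "norm (M k b - L b) \<le> \<delta> * norm b" using elim(2) b(1) by blast
      have "norm (M k b) \<le> norm (M k b - L b) + norm (L b)" by (metis add.commute norm_triangle_sub)
      also have "\<dots> \<le> (K + 1) * norm b"
        using Mb K(2)[of b] mult_right_mono[OF \<delta>(2), of "norm b"] by (simp add: algebra_simps)
      finally have Mb': "norm (M k b) \<le> (K + 1) * norm b" .
      have "N v = M k b + X (M k b)" unfolding N_def S_def b_def ..
      moreover have "L v = L b + L (X b)" unfolding L.add[symmetric] b(2)[unfolded S_def] ..
      ultimately have "N v - L v = (M k b - L b) + X (M k b) - L (X b)" by simp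
      then have "norm (N v - L v) \<le> norm (M k b - L b) + norm (X (M k b)) + norm (L (X b))"
        using norm_triangle_ineq4[of "M k b - L b + X (M k b)" "L (X b)"]
          norm_triangle_ineq[of "M k b - L b" "X (M k b)"] by simp
      also have "\<dots> \<le> \<delta> * norm b + \<eta> * ((K + 1) * norm b) + K * (\<eta> * norm b)"
      proof (intro add_mono Mb)
        show "norm (X (M k b)) \<le> \<eta> * ((K + 1) * norm b)"
          using X(4)[of "M k b"] mult_left_mono[OF Mb', of \<eta>] \<eta>(1) by linarith
        show "norm (L (X b)) \<le> K * (\<eta> * norm b)"
          using K(2)[of "X b"] mult_left_mono[OF X(4)[of b], of K] K(1) by linarith
      qed
      also have "\<dots> = (\<delta> + \<eta> * (2 * K + 1)) * norm b" by (simp add: algebra_simps)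
      also have "\<dots> \<le> (\<delta> + \<eta> * (2 * K + 1)) * (2 * norm v)"
        using nb \<delta>(1) \<eta>(1) K(1) by (intro mult_left_mono) simp_all
      also have "\<dots> = (2 * \<delta> + \<eta> * (4 * K + 2)) * norm v" by (simp add: algebra_simps)
      also have "\<dots> \<le> \<epsilon> * norm v" using \<delta>(3) \<eta>(3) \<epsilon>(1) by (intro mult_right_mono) simp_all
      finally show "norm (N v - L v) \<le> \<epsilon> * norm v" .
    qed
    ultimately have st: "linearly_stable W N" by (rule \<epsilon>(2))
    have "linearly_stable (R ` W) (M k)"
    proof (rule linearly_stable_conjugate[OF linR _ W _ _ linN M(1) st])
      show "inj_on R W" by (rule inj_onI) (metis SR)
      show "M k (R v) = R (N v)" if "v \<in> W" for v unfolding N_def RS ..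
      show "N ` W \<subseteq> W" using NW by (rule image_subsetI)
    qed
    moreover have "R ` W = W"
    proof
      show "R ` W \<subseteq> W" using RW by (rule image_subsetI)
      show "W \<subseteq> R ` W"
      proof
        fix u assume "u \<in> W"
        then show "u \<in> R ` W" using SW[of u] RS[of u] by (intro image_eqI[of _ _ "S u"]) simp_all
      qed
    qed
    ultimately show ?case by simp
  qed
qed

section \<open>Splitting off a plane of rotation\<close>

text \<open>The form of the slice plus \<open>e\<close> times an area form on the plane perpendicular to
  \<open>a\<close>. This is the symplectic form of the reduced space after rescaling; the sign \<open>e\<close>
  records on which side of zero momentum the point lies.\<close>

definition coupled_form ::
    "('v \<Rightarrow> 'v \<Rightarrow> real) \<Rightarrow> real \<Rightarrow> real^3 \<Rightarrow> (real^3) \<times> 'v \<Rightarrow> (real^3) \<times> 'v \<Rightarrow> real" where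
  "coupled_form \<omega> e a u u' =
     \<omega> (snd u) (snd u') + e * (inner a (cross3 (fst u) (fst u')) / (norm a)\<^sup>2)"

text \<open>Cramer's rule without division: the four vectors \<open>d\<close>, \<open>x\<close>, \<open>y\<close>,
  \<open>a\<close> of a three-dimensional space satisfy this linear relation.\<close>

lemma cramer_cross3:
  fixes x y d a :: "real^3"
  shows "inner a (cross3 x y) *\<^sub>R d =
     inner a (cross3 d y) *\<^sub>R x + inner a (cross3 x d) *\<^sub>R y + inner d (cross3 x y) *\<^sub>R a"
  unfolding Finite_Cartesian_Product.vec_eq_iff forall_3
  by (simp add: cross3_def inner_vec_def sum_3 algebra_simps)

lemma perpendicular_plane_nondegenerate:
  fixes x y d a :: "real^3"
  assumes "inner a (cross3 x y) \<noteq> 0" "inner a d = 0" "inner a (cross3 x d) = 0" "inner a (cross3 y d) = 0"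
  shows "d = 0"
proof -
  have "inner a (cross3 d y) = 0" using assms(4) cross_skew[of d y] by simp
  then have "inner a (cross3 x y) *\<^sub>R d = inner d (cross3 x y) *\<^sub>R a"
    using cramer_cross3[of a x y d] assms(3) by simp
  then have "inner (inner a (cross3 x y) *\<^sub>R d) d = inner (inner d (cross3 x y) *\<^sub>R a) d" by simp
  then have "inner a (cross3 x y) * inner d d = 0" using assms(2) by simp
  then show ?thesis using assms(1) by simp
qed

lemma bilinear_coupled_form:
  assumes "bilinear \<omega>"
  shows "bilinear (coupled_form \<omega> e a)"
proof -
  note bl = bilinear_ladd[OF assms] bilinear_radd[OF assms] bilinear_lmul[OF assms] bilinear_rmul[OF assms]
  show ?thesis
    unfolding bilinear_def
  proof (intro conjI allI)
    show "linear (coupled_form \<omega> e a u)" for u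
      unfolding coupled_form_def
      by (intro linearI) (simp_all add: bl cross_add_right cross_mult_right inner_add_right
          add_divide_distrib algebra_simps)
    show "linear (\<lambda>u. coupled_form \<omega> e a u u')" for u'
      unfolding coupled_form_def
      by (intro linearI) (simp_all add: bl cross_add_left cross_mult_left inner_add_right
          add_divide_distrib algebra_simps)
  qed
qed

text \<open>The plane spanned by \<open>x\<close> and \<open>y\<close> is invariant and symplectic, so the space is
  the sum of this plane and its symplectic complement, which is invariant as well. Because the first components of
  \<open>x\<close> and \<open>y\<close> already span the plane perpendicular to \<open>a\<close>, the complement is
  the graph of the linear map \<open>K\<close> over \<open>W\<close>; the induced map on \<open>W\<close> is
  symplectic for the form pulled back along the graph.\<close>

lemma split_off_rotation_plane:
  fixes W :: "'v::euclidean_space set" and M :: "(real^3) \<times> 'v \<Rightarrow> (real^3) \<times> 'v"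
    and \<omega> :: "'v \<Rightarrow> 'v \<Rightarrow> real"
  defines "T \<equiv> \<lambda>a. {u. inner a (fst u) = 0 \<and> snd u \<in> W}"
    and "area \<equiv> \<lambda>a p q. inner a (cross3 p q) / (norm a)\<^sup>2"
  assumes W: "subspace W" and \<omega>: "bilinear \<omega>" "\<And>u. u \<in> W \<Longrightarrow> \<omega> u u = 0"
    and M: "linear M" "\<And>u. u \<in> T a \<Longrightarrow> M u \<in> T a"
      "\<And>u u'. u \<in> T a \<Longrightarrow> u' \<in> T a \<Longrightarrow> coupled_form \<omega> e a (M u) u' + coupled_form \<omega> e a u (M u') = 0"
    and e: "e = 1 \<or> e = -1"
    and xy: "x \<in> T a" "y \<in> T a" "M x = - \<nu> *\<^sub>R y" "M y = \<nu> *\<^sub>R x"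
    and nz: "area a (fst x) (fst y) \<noteq> 0" "coupled_form \<omega> e a x y \<noteq> 0"
  defines "K \<equiv> \<lambda>v. (e / area a (fst x) (fst y)) *\<^sub>R (\<omega> (snd y) v *\<^sub>R fst x - \<omega> (snd x) v *\<^sub>R fst y)"
  shows "linear (\<lambda>v. snd (M (K v, v)))"
    and "\<And>v. v \<in> W \<Longrightarrow> snd (M (K v, v)) \<in> W"
    and "\<And>v v'. v \<in> W \<Longrightarrow> v' \<in> W \<Longrightarrow>
      coupled_form \<omega> e a (K (snd (M (K v, v))), snd (M (K v, v))) (K v', v') +
      coupled_form \<omega> e a (K v, v) (K (snd (M (K v', v'))), snd (M (K v', v'))) = 0"
    and "linear K"
    and "linearly_stable W (\<lambda>v. snd (M (K v, v))) \<Longrightarrow> linearly_stable (T a) M"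
proof -
  let ?\<Omega> = "coupled_form \<omega> e a"
  interpret M: linear M by (rule M(1))
  note bl = bilinear_ladd[OF \<omega>(1)] bilinear_radd[OF \<omega>(1)] bilinear_lmul[OF \<omega>(1)] bilinear_rmul[OF \<omega>(1)]
  note b\<Omega> = bilinear_coupled_form[OF \<omega>(1), of e a]
  note bl\<Omega> = bilinear_ladd[OF b\<Omega>] bilinear_radd[OF b\<Omega>] bilinear_lmul[OF b\<Omega>] bilinear_rmul[OF b\<Omega>]
    bilinear_lsub[OF b\<Omega>] bilinear_rsub[OF b\<Omega>] bilinear_lneg[OF b\<Omega>] bilinear_rneg[OF b\<Omega>]
  have ee: "e * e = 1" using e by auto
  have T: "subspace (T a)" unfolding T_def subspace_def
    using W by (auto simp: inner_add_right subspace_0 subspace_add subspace_scale)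
  have alt: "?\<Omega> u u = 0" if "u \<in> T a" for u
    using that \<omega>(2) unfolding coupled_form_def T_def by simp
  have anti: "?\<Omega> u w = - ?\<Omega> w u" if "u \<in> T a" "w \<in> T a" for u w
    by (rule alternating_antisymmetric[OF b\<Omega> T alt that])
  show linK: "linear K" unfolding K_def
    by (intro linearI) (simp_all add: bl algebra_simps)
  define j where "j v = (K v, v)" for v
  have linj: "linear j" unfolding j_def
    by (intro linearI) (simp_all add: linear_add[OF linK] linear_scale[OF linK])
  have aK: "inner a (K v) = 0" for v
    using xy(1,2) unfolding K_def T_def by (simp add: inner_diff_right)
  have jT: "j v \<in> T a" if "v \<in> W" for v using that aK unfolding T_def j_def by simp
  have area_bl: "area a p (r *\<^sub>R q) = r * area a p q" "area a p (q - q') = area a p q - area a p q'"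
      "area a p p = 0" for p q q' r
    unfolding area_def
    by (simp_all add: cross_mult_right Cross3.right_diff_distrib inner_diff_right diff_divide_distrib)
  have area_skew: "area a (fst y) (fst x) = - area a (fst x) (fst y)"
    unfolding area_def using cross_skew[of "fst y" "fst x"] by simp
  have xK: "e * area a (fst x) (K v) = - \<omega> (snd x) v" for v
    unfolding K_def area_bl using nz(1) ee by (simp add: algebra_simps)
  have yK: "e * area a (fst y) (K v) = - \<omega> (snd y) v" for v
    unfolding K_def area_bl using nz(1) ee by (simp add: area_skew algebra_simps)
  define E where "E = {u \<in> T a. ?\<Omega> x u = 0 \<and> ?\<Omega> y u = 0}"
  have E: "subspace E" unfolding E_def subspace_def
    using T by (auto simp: bl\<Omega> subspace_0 subspace_add subspace_scale bilinear_rzero[OF b\<Omega>])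
  have \<Omega>_area: "?\<Omega> u w = \<omega> (snd u) (snd w) + e * area a (fst u) (fst w)" for u w
    unfolding coupled_form_def area_def ..
  have jE: "j v \<in> E" if "v \<in> W" for v
    unfolding E_def using jT[OF that] xK[of v] yK[of v] by (simp add: \<Omega>_area j_def)
  have Ej: "u = j (snd u)" if u: "u \<in> E" for u
  proof -
    define d where "d = fst u - K (snd u)"
    have uT: "inner a (fst u) = 0" "snd u \<in> W" "?\<Omega> x u = 0" "?\<Omega> y u = 0"
      using u unfolding E_def T_def by simp_all
    have "e * area a (fst x) d = 0" "e * area a (fst y) d = 0"
      unfolding d_def area_bl right_diff_distrib xK yK using uT(3,4) by (simp_all add: \<Omega>_area)
    then have "area a (fst x) d = 0" "area a (fst y) d = 0" using e by auto
    then have "inner a (cross3 (fst x) d) = 0" "inner a (cross3 (fst y) d) = 0"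
      using nz(1) unfolding area_def by auto
    moreover have "inner a (cross3 (fst x) (fst y)) \<noteq> 0" using nz(1) unfolding area_def by auto
    moreover have "inner a d = 0" unfolding d_def using uT(1) aK by (simp add: inner_diff_right)
    ultimately have "d = 0" by (intro perpendicular_plane_nondegenerate)
    then show ?thesis unfolding j_def d_def by (simp add: prod_eq_iff)
  qed
  have ME: "M u \<in> E" if u: "u \<in> E" for u
  proof -
    have uT: "u \<in> T a" "?\<Omega> x u = 0" "?\<Omega> y u = 0" using u unfolding E_def by simp_all
    have "?\<Omega> x (M u) = 0" using M(3)[OF xy(1) uT(1)] uT(3) unfolding xy(3) by (simp add: bl\<Omega>)
    moreover have "?\<Omega> y (M u) = 0" using M(3)[OF xy(2) uT(1)] uT(2) unfolding xy(4) by (simp add: bl\<Omega>)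
    ultimately show ?thesis unfolding E_def using M(2)[OF uT(1)] by simp
  qed
  define N where "N v = snd (M (j v))" for v
  have Mj: "M (j v) = j (N v)" if "v \<in> W" for v
    unfolding N_def by (rule Ej[OF ME[OF jE[OF that]]])
  have linN: "linear N"
    unfolding N_def using linear_compose[OF linear_compose[OF linj M(1)] linear_snd] by (simp add: o_def)
  then show "linear (\<lambda>v. snd (M (K v, v)))" unfolding N_def j_def .
  have NW: "N v \<in> W" if "v \<in> W" for v
    using ME[OF jE[OF that]] unfolding N_def E_def T_def by simp
  then show "snd (M (K v, v)) \<in> W" if "v \<in> W" for v using that unfolding N_def j_def by blast
  show "?\<Omega> (K (snd (M (K v, v))), snd (M (K v, v))) (K v', v') +
      ?\<Omega> (K v, v) (K (snd (M (K v', v'))), snd (M (K v', v'))) = 0" if "v \<in> W" "v' \<in> W" for v v'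
    using M(3)[OF jT[OF that(1)] jT[OF that(2)]] unfolding Mj[OF that(1)] Mj[OF that(2)]
    unfolding N_def j_def .
  assume "linearly_stable W (\<lambda>v. snd (M (K v, v)))"
  then have st: "linearly_stable W N" unfolding N_def j_def .
  have "linearly_stable (j ` W) M"
  proof (rule linearly_stable_conjugate[OF linj _ W Mj _ linN M(1) st])
    show "inj_on j W" unfolding j_def by (rule inj_onI) simp
    show "N ` W \<subseteq> W" using NW by (rule image_subsetI)
  qed
  moreover have "j ` W = E"
  proof
    show "j ` W \<subseteq> E" using jE by (rule image_subsetI)
    show "E \<subseteq> j ` W"
    proof
      fix u assume u: "u \<in> E"
      then have "snd u \<in> W" unfolding E_def T_def by simp
      then show "u \<in> j ` W" using Ej[OF u] by (rule image_eqI[rotated])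
    qed
  qed
  ultimately have stE: "linearly_stable E M" by simp
  define Fp where "Fp = span {x, y}"
  have "x \<noteq> 0 \<or> y \<noteq> 0" using nz(2) bilinear_lzero[OF b\<Omega>] by metis
  then have stF: "linearly_stable Fp M"
    unfolding Fp_def using xy(3,4) by (rule linearly_stable_rotation_plane[OF M(1)])
  have Fin: "p *\<^sub>R x + q *\<^sub>R y \<in> Fp" for p q
    unfolding Fp_def by (intro span_add span_scale span_base) simp_all
  have Frep: "\<exists>p q. u = p *\<^sub>R x + q *\<^sub>R y" if uF: "u \<in> Fp" for u
  proof -
    obtain p q where "u - p *\<^sub>R x = q *\<^sub>R y" using uF unfolding Fp_def by (auto simp: span_insert span_singleton)
    then have "u = p *\<^sub>R x + q *\<^sub>R y" by (simp add: algebra_simps)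
    then show ?thesis by blast
  qed
  have MF: "M ` Fp \<subseteq> Fp"
  proof (rule image_subsetI)
    fix u assume "u \<in> Fp"
    then obtain p q where u: "u = p *\<^sub>R x + q *\<^sub>R y" using Frep by blast
    have "M u = (q * \<nu>) *\<^sub>R x + (- p * \<nu>) *\<^sub>R y" unfolding u M.add M.scale xy(3,4) by simp
    then show "M u \<in> Fp" using Fin by metis
  qed
  have xx: "?\<Omega> x x = 0" "?\<Omega> y y = 0" "?\<Omega> y x = - ?\<Omega> x y"
    using alt[OF xy(1)] alt[OF xy(2)] anti[OF xy(2,1)] by simp_all
  have inter: "E \<inter> Fp = {0}"
  proof -
    have "u = 0" if u: "u \<in> E" "u \<in> Fp" for u
    proof -
      obtain p q where pq: "u = p *\<^sub>R x + q *\<^sub>R y" using Frep[OF u(2)] by blast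
      have "?\<Omega> x u = 0" "?\<Omega> y u = 0" using u(1) unfolding E_def by simp_all
      then have "q = 0" "p = 0" unfolding pq using nz(2) by (simp_all add: bl\<Omega> xx)
      then show ?thesis using pq by simp
    qed
    then show ?thesis using subspace_0[OF E] subspace_0[OF subspace_span, of "{x, y}"] unfolding Fp_def by blast
  qed
  have sum: "T a = {f + g |f g. f \<in> E \<and> g \<in> Fp}"
  proof (rule subset_antisym; rule subsetI)
    fix u assume u: "u \<in> T a"
    define q p where "q = ?\<Omega> x u / ?\<Omega> x y" and "p = - (?\<Omega> y u / ?\<Omega> x y)"
    define f where "f = u - (p *\<^sub>R x + q *\<^sub>R y)"
    have "f \<in> T a" unfolding f_def
      by (intro subspace_diff[OF T] subspace_add[OF T] subspace_scale[OF T] u xy(1,2))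
    moreover have "?\<Omega> x f = 0" "?\<Omega> y f = 0"
      unfolding f_def q_def p_def using nz(2) by (simp_all add: bl\<Omega> xx)
    ultimately have "f \<in> E" unfolding E_def by simp
    moreover have "u = f + (p *\<^sub>R x + q *\<^sub>R y)" unfolding f_def by simp
    ultimately show "u \<in> {f + g |f g. f \<in> E \<and> g \<in> Fp}" using Fin by blast
  next
    fix u assume "u \<in> {f + g |f g. f \<in> E \<and> g \<in> Fp}"
    then obtain f g where fg: "u = f + g" "f \<in> E" "g \<in> Fp" by blast
    have "Fp \<subseteq> T a" unfolding Fp_def using xy(1,2) T by (intro span_minimal) simp_all
    then have "g \<in> T a" using fg(3) by blast
    moreover have "f \<in> T a" using fg(2) unfolding E_def by simp
    ultimately show "u \<in> T a" unfolding fg(1) using subspace_add[OF T] by blast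
  qed
  have MEi: "M ` E \<subseteq> E" using ME by (rule image_subsetI)
  have "subspace Fp" unfolding Fp_def by (rule subspace_span)
  then show "linearly_stable (T a) M"
    by (intro linearly_stable_direct_sum[OF E MEi _ MF inter M(1) stE stF sum])
qed

section \<open>Non-resonant coupling of a rotation and a strongly stable map\<close>

definition perp_slice :: "'v::real_vector set \<Rightarrow> real^3 \<Rightarrow> ((real^3) \<times> 'v) set" where
  "perp_slice W a = {u. inner a (fst u) = 0 \<and> snd u \<in> W}"

text \<open>The eigenvector plane converges to the rotation plane, so the graph map of its symplectic complement
  converges to \<open>0\<close>; the induced maps on \<open>W\<close> and their symplectic forms converge to
  \<open>L\<close> and \<open>\<omega>'\<close>, and strong stability of \<open>L\<close> applies.\<close>

lemma coupled_stability_near_rotation: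
  fixes W :: "'v::euclidean_space set" and M :: "nat \<Rightarrow> (real^3) \<times> 'v \<Rightarrow> (real^3) \<times> 'v"
  assumes W: "subspace W" and \<omega>': "bilinear \<omega>'" "\<And>u. u \<in> W \<Longrightarrow> \<omega>' u u = 0" "nondegenerate_on W \<omega>'"
    and strong: "strongly_linearly_stable W \<omega>' L"
    and \<omega>: "\<And>k. bilinear (\<omega> k)" "\<And>k u. u \<in> W \<Longrightarrow> \<omega> k u u = 0"
      "\<And>u v. u \<in> W \<Longrightarrow> v \<in> W \<Longrightarrow> (\<lambda>k. \<omega> k u v) \<longlonglongrightarrow> \<omega>' u v"
    and a: "a \<longlonglongrightarrow> a'" "a' \<noteq> 0" and e: "\<And>k. e k = 1 \<or> e k = -1"
    and M: "\<And>k. linear (M k)" "\<And>k u. u \<in> perp_slice W (a k) \<Longrightarrow> M k u \<in> perp_slice W (a k)"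
      "\<And>k u u'. u \<in> perp_slice W (a k) \<Longrightarrow> u' \<in> perp_slice W (a k) \<Longrightarrow>
        coupled_form (\<omega> k) (e k) (a k) (M k u) u' + coupled_form (\<omega> k) (e k) (a k) u (M k u') = 0"
      "\<And>u. snd u \<in> W \<Longrightarrow> (\<lambda>k. M k u) \<longlonglongrightarrow> (cross3 (fst u) a', L (snd u))"
    and xy: "\<And>k. x k \<in> perp_slice W (a k)" "\<And>k. y k \<in> perp_slice W (a k)"
      "\<And>k. M k (x k) = - \<nu> k *\<^sub>R y k" "\<And>k. M k (y k) = \<nu> k *\<^sub>R x k"
    and nz: "\<And>k. inner (a k) (cross3 (fst (x k)) (fst (y k))) / (norm (a k))\<^sup>2 \<noteq> 0"
      "\<And>k. coupled_form (\<omega> k) (e k) (a k) (x k) (y k) \<noteq> 0"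
    and lim: "x \<longlonglongrightarrow> (p, 0)" "y \<longlonglongrightarrow> (q, 0)" "inner a' (cross3 p q) \<noteq> 0"
  shows "\<forall>\<^sub>F k in sequentially. linearly_stable (perp_slice W (a k)) (M k)"
proof -
  define d where "d k = inner (a k) (cross3 (fst (x k)) (fst (y k))) / (norm (a k))\<^sup>2" for k
  define \<kappa> where "\<kappa> k v = (1 / d k) *\<^sub>R (\<omega> k (snd (y k)) v *\<^sub>R fst (x k) - \<omega> k (snd (x k)) v *\<^sub>R fst (y k))" for k v
  define K where "K k v = (e k / d k) *\<^sub>R (\<omega> k (snd (y k)) v *\<^sub>R fst (x k) - \<omega> k (snd (x k)) v *\<^sub>R fst (y k))" for k v
  have K\<kappa>: "K k v = e k *\<^sub>R \<kappa> k v" for k v unfolding K_def \<kappa>_def by simp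
  define N where "N k v = snd (M k (K k v, v))" for k v
  have split: "linear (N k)" "\<And>v. v \<in> W \<Longrightarrow> N k v \<in> W"
    "\<And>v v'. v \<in> W \<Longrightarrow> v' \<in> W \<Longrightarrow>
      coupled_form (\<omega> k) (e k) (a k) (K k (N k v), N k v) (K k v', v') +
      coupled_form (\<omega> k) (e k) (a k) (K k v, v) (K k (N k v'), N k v') = 0"
    "linear (K k)"
    "linearly_stable W (N k) \<Longrightarrow> linearly_stable (perp_slice W (a k)) (M k)" for k
    using split_off_rotation_plane[OF W \<omega>(1)[of k] \<omega>(2) M(1)[of k]
        M(2)[of _ k, unfolded perp_slice_def] M(3)[of _ k, unfolded perp_slice_def] e[of k]
        xy(1)[of k, unfolded perp_slice_def] xy(2)[of k, unfolded perp_slice_def] xy(3)[of k] xy(4)[of k] nz(1)[of k] nz(2)[of k]]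
    unfolding N_def K_def d_def perp_slice_def by blast+
  have fx: "(\<lambda>k. fst (x k)) \<longlonglongrightarrow> p" "(\<lambda>k. snd (x k)) \<longlonglongrightarrow> 0"
    and fy: "(\<lambda>k. fst (y k)) \<longlonglongrightarrow> q" "(\<lambda>k. snd (y k)) \<longlonglongrightarrow> 0"
    using tendsto_fst[OF lim(1)] tendsto_snd[OF lim(1)] tendsto_fst[OF lim(2)] tendsto_snd[OF lim(2)] by simp_all
  have cr: "(\<lambda>k. cross3 (f k) (g k)) \<longlonglongrightarrow> cross3 f' g'" if "f \<longlonglongrightarrow> f'" "g \<longlonglongrightarrow> g'" for f g :: "nat \<Rightarrow> real^3" and f' g'
    using bounded_bilinear.tendsto[OF bilinear_conv_bounded_bilinear[THEN iffD1, OF bilinear_cross] that] .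
  have na: "(norm a')\<^sup>2 \<noteq> 0" using a(2) by simp
  have d: "d \<longlonglongrightarrow> inner a' (cross3 p q) / (norm a')\<^sup>2"
    unfolding d_def by (intro tendsto_intros cr fx(1) fy(1) a na)
  have W0: "(0::'v) \<in> W" by (rule subspace_0[OF W])
  have sx: "snd (x k) \<in> W" "snd (y k) \<in> W" for k using xy(1,2)[of k] unfolding perp_slice_def by simp_all
  have \<omega>x: "(\<lambda>k. \<omega> k (snd (x k)) v) \<longlonglongrightarrow> 0" "(\<lambda>k. \<omega> k (snd (y k)) v) \<longlonglongrightarrow> 0" if v: "v \<in> W" for v
    using tendsto_bilinear_apply[OF W \<omega>(1) \<omega>'(1) \<omega>(3) sx(1) W0 fx(2) v v tendsto_const]
      tendsto_bilinear_apply[OF W \<omega>(1) \<omega>'(1) \<omega>(3) sx(2) W0 fy(2) v v tendsto_const]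
    by (simp_all add: bilinear_lzero[OF \<omega>'(1)])
  have \<kappa>0: "(\<lambda>k. \<kappa> k v) \<longlonglongrightarrow> 0" if v: "v \<in> W" for v
  proof -
    have "(\<lambda>k. \<kappa> k v) \<longlonglongrightarrow> (1 / (inner a' (cross3 p q) / (norm a')\<^sup>2)) *\<^sub>R (0 *\<^sub>R p - 0 *\<^sub>R q)"
      unfolding \<kappa>_def using lim(3) na by (intro tendsto_intros d \<omega>x[OF v] fx fy) simp_all
    then show ?thesis by simp
  qed
  have K0: "(\<lambda>k. K k v) \<longlonglongrightarrow> 0" if v: "v \<in> W" for v
  proof (rule Lim_null_comparison)
    show "(\<lambda>k. norm (\<kappa> k v)) \<longlonglongrightarrow> 0" using \<kappa>0[OF v] by (rule tendsto_norm_zero)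
    show "\<forall>\<^sub>F k in sequentially. norm (K k v) \<le> norm (\<kappa> k v)"
      unfolding K\<kappa> using e by (intro always_eventually allI) (metis abs_minus_cancel abs_one norm_scaleR mult_1 order_refl)
  qed
  have L: "linear L"
    using strong unfolding strongly_linearly_stable_def inf_symplectic_def by blast
  have V: "subspace {u :: (real^3) \<times> 'v. snd u \<in> W}"
    using W unfolding subspace_def by simp
  have linM': "linear (\<lambda>u :: (real^3) \<times> 'v. (cross3 (fst u) a', L (snd u)))"
    using L by (intro linearI) (simp_all add: linear_add linear_scale cross_add_left cross_mult_left)
  have Nlim: "(\<lambda>k. N k v) \<longlonglongrightarrow> L v" if v: "v \<in> W" for v
  proof -
    have "(\<lambda>k. M k (K k v, v)) \<longlonglongrightarrow> (cross3 (fst (0::real^3, v)) a', L (snd (0::real^3, v)))"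
    proof (rule tendsto_linear_apply[OF V M(1) linM'])
      show "(\<lambda>k. (K k v, v)) \<longlonglongrightarrow> (0, v)" by (intro tendsto_intros K0[OF v])
    qed (use v M(4) in simp_all)
    then show ?thesis unfolding N_def using tendsto_snd by fastforce
  qed
  define \<omega>\<^sub>E where "\<omega>\<^sub>E k v v' = coupled_form (\<omega> k) (e k) (a k) (K k v, v) (K k v', v')" for k v v'
  have "\<forall>\<^sub>F k in sequentially. linearly_stable W (N k)"
  proof (rule strongly_linearly_stable_perturbation[OF W \<omega>' strong, where \<omega> = \<omega>\<^sub>E])
    show "bilinear (\<omega>\<^sub>E k)" for k
    proof -
      note b = bilinear_coupled_form[OF \<omega>(1), of k "e k" "a k"]
      have lp: "(K k (v + w), v + w) = (K k v, v) + (K k w, w)" "(K k (r *\<^sub>R v), r *\<^sub>R v) = r *\<^sub>R (K k v, v)" for v w r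
        using split(4)[of k] by (simp_all add: linear_add linear_scale)
      show ?thesis unfolding bilinear_def \<omega>\<^sub>E_def
        by (intro conjI allI linearI)
          (simp_all only: lp bilinear_ladd[OF b] bilinear_radd[OF b] bilinear_lmul[OF b] bilinear_rmul[OF b])
    qed
    show "\<omega>\<^sub>E k u u = 0" if "u \<in> W" for k u
      unfolding \<omega>\<^sub>E_def coupled_form_def using \<omega>(2)[OF that] by simp
    show "(\<lambda>k. \<omega>\<^sub>E k u v) \<longlonglongrightarrow> \<omega>' u v" if uv: "u \<in> W" "v \<in> W" for u v
    proof -
      have "(\<lambda>k. inner (a k) (cross3 (K k u) (K k v)) / (norm (a k))\<^sup>2) \<longlonglongrightarrow> inner a' (cross3 0 0) / (norm a')\<^sup>2"
        by (intro tendsto_intros cr K0 uv a na)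
      then have "(\<lambda>k. norm (inner (a k) (cross3 (K k u) (K k v)) / (norm (a k))\<^sup>2)) \<longlonglongrightarrow> 0"
        by (intro tendsto_norm_zero) simp
      then have "(\<lambda>k. e k * (inner (a k) (cross3 (K k u) (K k v)) / (norm (a k))\<^sup>2)) \<longlonglongrightarrow> 0"
      proof (rule Lim_null_comparison[rotated], intro always_eventually allI)
        fix k
        show "norm (e k * (inner (a k) (cross3 (K k u) (K k v)) / (norm (a k))\<^sup>2))
          \<le> norm (inner (a k) (cross3 (K k u) (K k v)) / (norm (a k))\<^sup>2)"
          using e[of k] by (auto simp: abs_mult)
      qed
      from tendsto_add[OF \<omega>(3)[OF uv] this] show ?thesis
        unfolding \<omega>\<^sub>E_def coupled_form_def by simp
    qed
    show "\<omega>\<^sub>E k (N k u) v + \<omega>\<^sub>E k u (N k v) = 0" if "u \<in> W" "v \<in> W" for k u v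
      unfolding \<omega>\<^sub>E_def by (rule split(3)[OF that])
  qed (use split(1,2) Nlim in blast)+
  then show ?thesis by (rule eventually_mono) (rule split(5))
qed

lemma complex_eigenvector_scaleR:
  assumes "complex_eigenvector V L l z" "linear L" "subspace V" "r \<noteq> 0"
  shows "complex_eigenvector V L l (r *\<^sub>R z)"
  using assms(1)
proof (rule complex_eigenvectorE)
  fix x y assume xy: "z = (x, y)" "x \<in> V" "y \<in> V" "x \<noteq> 0 \<or> y \<noteq> 0"
    "L x = Re l *\<^sub>R x - Im l *\<^sub>R y" "L y = Im l *\<^sub>R x + Re l *\<^sub>R y"
  show ?thesis unfolding xy(1) scaleR_Pair
    using xy(2-4) assms(4) by (intro complex_eigenvectorI)
      (simp_all add: subspace_scale[OF assms(3)] linear_scale[OF assms(2)] xy(5,6) algebra_simps)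
qed

text \<open>Real form of the statement that the rotation \<open>p \<mapsto> p \<times> \<xi>\<close> has the
  eigenvalue \<open>\<i> |\<xi>|\<close>.\<close>

lemma spectrum_on_rotation:
  fixes \<xi> :: "real^3"
  assumes "\<xi> \<noteq> 0"
  obtains p q where "p \<noteq> 0" "cross3 p \<xi> = - norm \<xi> *\<^sub>R q" "cross3 q \<xi> = norm \<xi> *\<^sub>R p"
proof -
  obtain p where p: "p \<noteq> 0" "inner \<xi> p = 0"
    using orthogonal_to_vector_exists[of \<xi>] unfolding Linear_Algebra.orthogonal_def by auto
  define q where "q = (1 / norm \<xi>) *\<^sub>R cross3 \<xi> p"
  have n: "norm \<xi> \<noteq> 0" using assms by simp
  have "cross3 p \<xi> = - cross3 \<xi> p" by (rule cross_skew)
  then have 1: "cross3 p \<xi> = - norm \<xi> *\<^sub>R q" unfolding q_def using n by simp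
  have "cross3 q \<xi> = - cross3 \<xi> q" by (rule cross_skew)
  also have "\<dots> = - ((1 / norm \<xi>) *\<^sub>R cross3 \<xi> (cross3 \<xi> p))" unfolding q_def cross_mult_right ..
  also have "cross3 \<xi> (cross3 \<xi> p) = - ((norm \<xi>)\<^sup>2 *\<^sub>R p)"
    unfolding Lagrange p(2) by (simp add: dot_square_norm)
  finally have "cross3 q \<xi> = norm \<xi> *\<^sub>R p" using n by (simp add: power2_eq_square)
  with 1 p(1) show thesis using that by blast
qed

text \<open>Eigenvalues near \<open>\<i> |a'|\<close> exist by semicontinuity of the spectrum. A limit of their
  normalized eigenvectors is an eigenvector of the uncoupled map; its \<open>W\<close>-component vanishes because
  \<open>\<i> |a'|\<close> is not an eigenvalue of \<open>L\<close>. So it spans the rotation plane, on which the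
  symplectic form is nonzero; since \<open>(\<Re> \<lambda>)\<close> times that value of the form is zero for a skew
  map, the eigenvalues are imaginary.\<close>

lemma coupled_stability_exists:
  fixes W :: "'v::euclidean_space set" and M :: "nat \<Rightarrow> (real^3) \<times> 'v \<Rightarrow> (real^3) \<times> 'v"
  assumes W: "subspace W" and \<omega>': "bilinear \<omega>'" "\<And>u. u \<in> W \<Longrightarrow> \<omega>' u u = 0" "nondegenerate_on W \<omega>'"
    and strong: "strongly_linearly_stable W \<omega>' L" and nonres: "Complex 0 (norm a') \<notin> spectrum_on W L"
    and \<omega>: "\<And>k. bilinear (\<omega> k)" "\<And>k u. u \<in> W \<Longrightarrow> \<omega> k u u = 0"
      "\<And>u v. u \<in> W \<Longrightarrow> v \<in> W \<Longrightarrow> (\<lambda>k. \<omega> k u v) \<longlonglongrightarrow> \<omega>' u v"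
    and a: "a \<longlonglongrightarrow> a'" "a' \<noteq> 0" and e: "\<And>k. e k = 1 \<or> e k = -1"
    and M: "\<And>k. linear (M k)" "\<And>k u. snd u \<in> W \<Longrightarrow> M k u \<in> perp_slice W (a k)"
      "\<And>k u u'. u \<in> perp_slice W (a k) \<Longrightarrow> u' \<in> perp_slice W (a k) \<Longrightarrow>
        coupled_form (\<omega> k) (e k) (a k) (M k u) u' + coupled_form (\<omega> k) (e k) (a k) u (M k u') = 0"
      "\<And>u. snd u \<in> W \<Longrightarrow> (\<lambda>k. M k u) \<longlonglongrightarrow> (cross3 (fst u) a', L (snd u))"
  shows "\<exists>k. linearly_stable (perp_slice W (a k)) (M k)"
proof -
  define V :: "((real^3) \<times> 'v) set" where "V = {u. snd u \<in> W}"
  define \<nu> where "\<nu> = norm a'"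
  have \<nu>: "\<nu> > 0" unfolding \<nu>_def using a(2) by simp
  define M' :: "(real^3) \<times> 'v \<Rightarrow> (real^3) \<times> 'v" where "M' u = (cross3 (fst u) a', L (snd u))" for u
  have L: "linear L" "\<And>u. u \<in> W \<Longrightarrow> L u \<in> W"
    using strong unfolding strongly_linearly_stable_def inf_symplectic_def by blast+
  have V: "subspace V" using W unfolding V_def subspace_def by simp
  have clV: "closed V" by (rule closed_subspace[OF V])
  have linM': "linear M'" unfolding M'_def
    using L by (intro linearI) (simp_all add: linear_add linear_scale cross_add_left cross_mult_left)
  have M'V: "M' ` V \<subseteq> V" unfolding M'_def V_def using L(2) by (intro image_subsetI) simp
  have Mlim: "(\<lambda>k. M k u) \<longlonglongrightarrow> M' u" if "u \<in> V" for u
    using M(4) that unfolding M'_def V_def by simp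
  have MV: "M k ` V \<subseteq> V" for k
    using M(2) unfolding V_def perp_slice_def by (intro image_subsetI) simp
  obtain p0 q0 where pq0: "p0 \<noteq> 0" "cross3 p0 a' = - \<nu> *\<^sub>R q0" "cross3 q0 a' = \<nu> *\<^sub>R p0"
    using spectrum_on_rotation[OF a(2)] unfolding \<nu>_def by blast
  have "complex_eigenvector V M' (Complex 0 \<nu>) ((p0, 0), (q0, 0))"
    using pq0 linear_0[OF L(1)] subspace_0[OF W] unfolding V_def M'_def
    by (intro complex_eigenvectorI) (simp_all add: zero_prod_def)
  then have "Complex 0 \<nu> \<in> spectrum_on V M'" unfolding spectrum_on_def by (intro CollectI exI)
  then obtain lk where lk: "\<And>k. lk k \<in> spectrum_on V (M k)" "lk \<longlonglongrightarrow> Complex 0 \<nu>"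
    using spectrum_on_lower_semicontinuous[OF V linM' M'V M(1) MV Mlim] by blast
  have "\<exists>z. complex_eigenvector V (M k) (lk k) z \<and> norm z = 1" for k
  proof -
    obtain z where z: "complex_eigenvector V (M k) (lk k) z" using lk(1)[of k] unfolding spectrum_on_def by blast
    then have "z \<noteq> 0" unfolding complex_eigenvector_def by blast
    then have "complex_eigenvector V (M k) (lk k) ((1 / norm z) *\<^sub>R z)" "norm ((1 / norm z) *\<^sub>R z) = 1"
      using complex_eigenvector_scaleR[OF z M(1) V, of "1 / norm z"] by simp_all
    then show ?thesis by blast
  qed
  then obtain z where z: "\<And>k. complex_eigenvector V (M k) (lk k) (z k)" "\<And>k. norm (z k) = 1" by metis
  have "compact (sphere (0 :: ((real^3) \<times> 'v) \<times> ((real^3) \<times> 'v)) 1)" by (rule compact_sphere)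
  moreover have "\<forall>k. z k \<in> sphere 0 1" using z(2) by simp
  ultimately obtain z' r where z': "z' \<in> sphere 0 1" "strict_mono r" "(z \<circ> r) \<longlonglongrightarrow> z'"
    unfolding compact_def by metis
  define x y where "x k = fst (z (r k))" and "y k = snd (z (r k))" for k
  define \<alpha> \<beta> where "\<alpha> k = Re (lk (r k))" and "\<beta> k = Im (lk (r k))" for k
  have ev: "x k \<in> V" "y k \<in> V" "M (r k) (x k) = \<alpha> k *\<^sub>R x k - \<beta> k *\<^sub>R y k"
      "M (r k) (y k) = \<beta> k *\<^sub>R x k + \<alpha> k *\<^sub>R y k" for k
    using z(1)[of "r k"] unfolding complex_eigenvector_def x_def y_def \<alpha>_def \<beta>_def
    by (simp_all add: mem_Times_iff)
  define x' y' where "x' = fst z'" and "y' = snd z'"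
  have limxy: "x \<longlonglongrightarrow> x'" "y \<longlonglongrightarrow> y'"
    using tendsto_fst[OF z'(3)] tendsto_snd[OF z'(3)] unfolding x_def y_def x'_def y'_def o_def by simp_all
  have V': "x' \<in> V" "y' \<in> V"
    using closed_sequentially[OF clV _ limxy(1)] closed_sequentially[OF clV _ limxy(2)] ev(1,2) by blast+
  have lkr: "(lk \<circ> r) \<longlonglongrightarrow> Complex 0 \<nu>" by (rule LIMSEQ_subseq_LIMSEQ[OF lk(2) z'(2)])
  have lim\<alpha>: "\<alpha> \<longlonglongrightarrow> 0" using tendsto_Re[OF lkr] unfolding \<alpha>_def o_def by simp
  have lim\<beta>: "\<beta> \<longlonglongrightarrow> \<nu>" using tendsto_Im[OF lkr] unfolding \<beta>_def o_def by simp
  have Mr: "(\<lambda>k. M (r k) u) \<longlonglongrightarrow> M' u" if "u \<in> V" for u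
    using LIMSEQ_subseq_LIMSEQ[OF Mlim[OF that] z'(2)] unfolding o_def .
  have "(\<lambda>k. M (r k) (x k)) \<longlonglongrightarrow> M' x'"
    by (rule tendsto_linear_apply[OF V M(1) linM' Mr ev(1) V'(1) limxy(1)])
  moreover have "(\<lambda>k. M (r k) (x k)) \<longlonglongrightarrow> 0 *\<^sub>R x' - \<nu> *\<^sub>R y'"
    unfolding ev(3) by (intro tendsto_intros lim\<alpha> lim\<beta> limxy)
  ultimately have Mx': "M' x' = - (\<nu> *\<^sub>R y')" using LIMSEQ_unique by fastforce
  have "(\<lambda>k. M (r k) (y k)) \<longlonglongrightarrow> M' y'"
    by (rule tendsto_linear_apply[OF V M(1) linM' Mr ev(2) V'(2) limxy(2)])
  moreover have "(\<lambda>k. M (r k) (y k)) \<longlonglongrightarrow> \<nu> *\<^sub>R x' + 0 *\<^sub>R y'"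
    unfolding ev(4) by (intro tendsto_intros lim\<alpha> lim\<beta> limxy)
  ultimately have My': "M' y' = \<nu> *\<^sub>R x'" using LIMSEQ_unique by fastforce
  define p q where "p = fst x'" and "q = fst y'"
  have pq: "cross3 p a' = - (\<nu> *\<^sub>R q)" "cross3 q a' = \<nu> *\<^sub>R p"
    using arg_cong[OF Mx', of fst] arg_cong[OF My', of fst] unfolding M'_def p_def q_def by simp_all
  have Lxy: "L (snd x') = - (\<nu> *\<^sub>R snd y')" "L (snd y') = \<nu> *\<^sub>R snd x'"
    using arg_cong[OF Mx', of snd] arg_cong[OF My', of snd] unfolding M'_def by simp_all
  have "\<not> (snd x' \<noteq> 0 \<or> snd y' \<noteq> 0)"
  proof
    assume "snd x' \<noteq> 0 \<or> snd y' \<noteq> 0"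
    then have "complex_eigenvector W L (Complex 0 \<nu>) (snd x', snd y')"
      using V' Lxy unfolding V_def by (intro complex_eigenvectorI) simp_all
    then show False using nonres unfolding spectrum_on_def \<nu>_def by blast
  qed
  then have xy'0: "x' = (p, 0)" "y' = (q, 0)" unfolding p_def q_def by (simp_all add: prod_eq_iff)
  have "z' \<noteq> 0" using z'(1) by auto
  then have "p \<noteq> 0 \<or> q \<noteq> 0"
    using xy'0 unfolding x'_def y'_def by (auto simp: prod_eq_iff)
  moreover have det1: "inner a' (cross3 p q) = \<nu> * inner q q"
  proof -
    have "inner a' (cross3 p q) = inner (cross3 a' p) q" using cross_triple[of p q a'] cross_triple[of a' p q]
      by (metis inner_commute)
    also have "cross3 a' p = \<nu> *\<^sub>R q" using pq(1) cross_skew[of a' p] by simp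
    finally show ?thesis by simp
  qed
  moreover have det2: "inner a' (cross3 p q) = \<nu> * inner p p"
  proof -
    have "inner a' (cross3 p q) = inner (cross3 q a') p" using cross_triple[of p q a'] by (metis inner_commute)
    then show ?thesis unfolding pq(2) by simp
  qed
  ultimately have "inner p p > 0 \<or> inner q q > 0" by simp
  then have det: "inner a' (cross3 p q) > 0"
  proof
    assume "inner p p > 0"
    then show ?thesis unfolding det2 using \<nu> by (rule mult_pos_pos[rotated])
  next
    assume "inner q q > 0"
    then show ?thesis unfolding det1 using \<nu> by (rule mult_pos_pos[rotated])
  qed
  have ar: "(\<lambda>k. a (r k)) \<longlonglongrightarrow> a'" using LIMSEQ_subseq_LIMSEQ[OF a(1) z'(2)] unfolding o_def .
  have \<omega>r: "(\<lambda>k. \<omega> (r k) u v) \<longlonglongrightarrow> \<omega>' u v" if "u \<in> W" "v \<in> W" for u v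
    using LIMSEQ_subseq_LIMSEQ[OF \<omega>(3)[OF that] z'(2)] unfolding o_def .
  define d where "d k = inner (a (r k)) (cross3 (fst (x k)) (fst (y k))) / (norm (a (r k)))\<^sup>2" for k
  have na: "(norm a')\<^sup>2 \<noteq> 0" using a(2) by simp
  have cr: "(\<lambda>k. cross3 (fst (x k)) (fst (y k))) \<longlonglongrightarrow> cross3 p q"
    using bounded_bilinear.tendsto[OF bilinear_conv_bounded_bilinear[THEN iffD1, OF bilinear_cross]
        tendsto_fst[OF limxy(1)] tendsto_fst[OF limxy(2)]] unfolding p_def q_def .
  have "d \<longlonglongrightarrow> inner a' (cross3 p q) / (norm a')\<^sup>2"
    unfolding d_def by (intro tendsto_intros cr ar na)
  moreover have sW: "snd (x k) \<in> W" "snd (y k) \<in> W" for k using ev(1,2)[of k] unfolding V_def by simp_all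
  have "(\<lambda>k. \<omega> (r k) (snd (x k)) (snd (y k))) \<longlonglongrightarrow> \<omega>' 0 0"
    using tendsto_snd[OF limxy(1)] tendsto_snd[OF limxy(2)] unfolding xy'0 snd_conv
    by (intro tendsto_bilinear_apply[OF W \<omega>(1) \<omega>'(1) \<omega>r] sW subspace_0[OF W])
  ultimately have "(\<lambda>k. d k - \<bar>\<omega> (r k) (snd (x k)) (snd (y k))\<bar>) \<longlonglongrightarrow> inner a' (cross3 p q) / (norm a')\<^sup>2 - \<bar>\<omega>' 0 0\<bar>"
    by (intro tendsto_intros)
  moreover have "inner a' (cross3 p q) / (norm a')\<^sup>2 - \<bar>\<omega>' 0 0\<bar> > 0"
    using det na by (simp add: bilinear_lzero[OF \<omega>'(1)])
  ultimately have "\<forall>\<^sub>F k in sequentially. d k - \<bar>\<omega> (r k) (snd (x k)) (snd (y k))\<bar> > 0"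
    by (rule order_tendstoD(1))
  moreover have "\<forall>\<^sub>F k in sequentially. \<beta> k > 0" using lim\<beta> \<nu> by (rule order_tendstoD(1))
  ultimately have "\<forall>\<^sub>F k in sequentially. d k - \<bar>\<omega> (r k) (snd (x k)) (snd (y k))\<bar> > 0 \<and> \<beta> k > 0"
    by (rule eventually_conj)
  then obtain n where n: "\<And>k. k \<ge> n \<Longrightarrow> d k - \<bar>\<omega> (r k) (snd (x k)) (snd (y k))\<bar> > 0"
      "\<And>k. k \<ge> n \<Longrightarrow> \<beta> k > 0"
    unfolding eventually_sequentially by blast
  define s where "s k = r (k + n)" for k
  have s: "strict_mono s" using z'(2) unfolding s_def strict_mono_def by simp
  have good: "d (k + n) \<noteq> 0" "coupled_form (\<omega> (s k)) (e (s k)) (a (s k)) (x (k + n)) (y (k + n)) \<noteq> 0"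
      "x (k + n) \<in> perp_slice W (a (s k))" "y (k + n) \<in> perp_slice W (a (s k))" "\<alpha> (k + n) = 0" for k
  proof -
    have pos: "d (k + n) > \<bar>\<omega> (s k) (snd (x (k + n))) (snd (y (k + n)))\<bar>" "\<beta> (k + n) > 0"
      using n[of "k + n"] unfolding s_def by simp_all
    show "d (k + n) \<noteq> 0" using pos(1) by linarith
    have cf: "coupled_form (\<omega> (s k)) (e (s k)) (a (s k)) (x (k + n)) (y (k + n)) =
        \<omega> (s k) (snd (x (k + n))) (snd (y (k + n))) + e (s k) * d (k + n)"
      unfolding coupled_form_def d_def s_def ..
    then show nz: "coupled_form (\<omega> (s k)) (e (s k)) (a (s k)) (x (k + n)) (y (k + n)) \<noteq> 0"
      using pos(1) e[of "s k"] by auto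
    let ?x = "x (k + n)" and ?y = "y (k + n)"
    have T: "subspace (perp_slice W (a (s k)))" unfolding perp_slice_def subspace_def
      using W by (auto simp: inner_add_right subspace_0 subspace_add subspace_scale)
    have Mxy: "M (s k) ?x = \<alpha> (k + n) *\<^sub>R ?x - \<beta> (k + n) *\<^sub>R ?y" "M (s k) ?y = \<beta> (k + n) *\<^sub>R ?x + \<alpha> (k + n) *\<^sub>R ?y"
      using ev(3,4)[of "k + n"] unfolding s_def by simp_all
    have perp: "inner (a (s k)) (fst (M (s k) ?x)) = 0" "inner (a (s k)) (fst (M (s k) ?y)) = 0"
      using M(2)[of ?x "s k"] M(2)[of ?y "s k"] sW[of "k + n"] unfolding perp_slice_def by simp_all
    define A B where "A = inner (a (s k)) (fst ?x)" and "B = inner (a (s k)) (fst ?y)"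
    have AB: "\<alpha> (k + n) * A = \<beta> (k + n) * B" "\<beta> (k + n) * A = - \<alpha> (k + n) * B"
      using perp unfolding Mxy A_def B_def by (simp_all add: inner_diff_right inner_add_right)
    have "((\<alpha> (k + n))\<^sup>2 + (\<beta> (k + n))\<^sup>2) * A = \<alpha> (k + n) * (\<alpha> (k + n) * A) + \<beta> (k + n) * (\<beta> (k + n) * A)"
      by (simp add: power2_eq_square algebra_simps)
    also have "\<dots> = 0" unfolding AB by simp
    finally have "A = 0" using pos(2) by (simp add: sum_power2_eq_zero_iff)
    with AB(1) pos(2) have "B = 0" by simp
    show xT: "?x \<in> perp_slice W (a (s k))" and yT: "?y \<in> perp_slice W (a (s k))"
      using \<open>A = 0\<close> \<open>B = 0\<close> sW[of "k + n"] unfolding perp_slice_def A_def B_def by simp_all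
    note b = bilinear_coupled_form[OF \<omega>(1), of "s k" "e (s k)" "a (s k)"]
    have alt: "coupled_form (\<omega> (s k)) (e (s k)) (a (s k)) u u = 0" if "u \<in> perp_slice W (a (s k))" for u
      using that \<omega>(2) unfolding coupled_form_def perp_slice_def by simp
    have "2 * \<alpha> (k + n) * coupled_form (\<omega> (s k)) (e (s k)) (a (s k)) ?x ?y = 0"
      using M(3)[OF xT yT] alt[OF xT] alt[OF yT] unfolding Mxy
      by (simp add: bilinear_ladd[OF b] bilinear_radd[OF b] bilinear_lmul[OF b] bilinear_rmul[OF b] bilinear_lsub[OF b])
    then show "\<alpha> (k + n) = 0" using nz by simp
  qed
  have lims: "(\<lambda>k. X (s k)) \<longlonglongrightarrow> X'" if "X \<longlonglongrightarrow> X'" for X :: "nat \<Rightarrow> 'z::topological_space" and X'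
    using LIMSEQ_subseq_LIMSEQ[OF that s] unfolding o_def .
  have "\<forall>\<^sub>F k in sequentially. linearly_stable (perp_slice W (a (s k))) (M (s k))"
  proof (rule coupled_stability_near_rotation[OF W \<omega>' strong, where \<omega> = "\<lambda>k. \<omega> (s k)" and a = "\<lambda>k. a (s k)"
        and e = "\<lambda>k. e (s k)" and M = "\<lambda>k. M (s k)" and x = "\<lambda>k. x (k + n)" and y = "\<lambda>k. y (k + n)"
        and \<nu> = "\<lambda>k. \<beta> (k + n)" and p = p and q = q and a' = a'])
    show "(\<lambda>k. x (k + n)) \<longlonglongrightarrow> (p, 0)" "(\<lambda>k. y (k + n)) \<longlonglongrightarrow> (q, 0)"
      using LIMSEQ_ignore_initial_segment[OF limxy(1), of n] LIMSEQ_ignore_initial_segment[OF limxy(2), of n]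
      unfolding xy'0 .
    show "inner a' (cross3 p q) \<noteq> 0" using det by simp
    show "M (s k) (x (k + n)) = - \<beta> (k + n) *\<^sub>R y (k + n)" "M (s k) (y (k + n)) = \<beta> (k + n) *\<^sub>R x (k + n)" for k
      using ev(3,4)[of "k + n"] good(5)[of k] unfolding s_def by simp_all
    show "inner (a (s k)) (cross3 (fst (x (k + n))) (fst (y (k + n)))) / (norm (a (s k)))\<^sup>2 \<noteq> 0" for k
      using good(1)[of k] unfolding d_def s_def .
    show "M (s k) u \<in> perp_slice W (a (s k))" if "u \<in> perp_slice W (a (s k))" for k u
      using M(2) that unfolding perp_slice_def by blast
    show "(\<lambda>k. \<omega> (s k) u v) \<longlonglongrightarrow> \<omega>' u v" if "u \<in> W" "v \<in> W" for u v
      by (rule lims[OF \<omega>(3)[OF that]])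
    show "(\<lambda>k. M (s k) u) \<longlonglongrightarrow> (cross3 (fst u) a', L (snd u))" if "snd u \<in> W" for u
      by (rule lims[OF M(4)[OF that]])
    show "(\<lambda>k. a (s k)) \<longlonglongrightarrow> a'" by (rule lims[OF a(1)])
    show "coupled_form (\<omega> (s k)) (e (s k)) (a (s k)) (M (s k) u) u' +
        coupled_form (\<omega> (s k)) (e (s k)) (a (s k)) u (M (s k) u') = 0"
      if "u \<in> perp_slice W (a (s k))" "u' \<in> perp_slice W (a (s k))" for k u u'
      by (rule M(3)[OF that])
  qed (simp_all add: \<omega>(1,2) a(2) e M(1) good(2-4))
  then obtain k where "linearly_stable (perp_slice W (a (s k))) (M (s k))"
    using eventually_happens'[OF sequentially_bot] by blast
  then show ?thesis by blast
qed

text \<open>A sequence without stable members has a subsequence to which \<open>coupled_stability_exists\<close>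
  applies.\<close>

lemma resonance_free_perturbation_stable:
  fixes W :: "'v::euclidean_space set" and M :: "nat \<Rightarrow> (real^3) \<times> 'v \<Rightarrow> (real^3) \<times> 'v"
  assumes W: "subspace W" and \<omega>': "bilinear \<omega>'" "\<And>u. u \<in> W \<Longrightarrow> \<omega>' u u = 0" "nondegenerate_on W \<omega>'"
    and strong: "strongly_linearly_stable W \<omega>' L" and nonres: "Complex 0 (norm a') \<notin> spectrum_on W L"
    and \<omega>: "\<And>k. bilinear (\<omega> k)" "\<And>k u. u \<in> W \<Longrightarrow> \<omega> k u u = 0"
      "\<And>u v. u \<in> W \<Longrightarrow> v \<in> W \<Longrightarrow> (\<lambda>k. \<omega> k u v) \<longlonglongrightarrow> \<omega>' u v"
    and a: "a \<longlonglongrightarrow> a'" "a' \<noteq> 0" and e: "\<And>k. e k = 1 \<or> e k = -1"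
    and M: "\<And>k. linear (M k)" "\<And>k u. snd u \<in> W \<Longrightarrow> M k u \<in> perp_slice W (a k)"
      "\<And>k u u'. u \<in> perp_slice W (a k) \<Longrightarrow> u' \<in> perp_slice W (a k) \<Longrightarrow>
        coupled_form (\<omega> k) (e k) (a k) (M k u) u' + coupled_form (\<omega> k) (e k) (a k) u (M k u') = 0"
      "\<And>u. snd u \<in> W \<Longrightarrow> (\<lambda>k. M k u) \<longlonglongrightarrow> (cross3 (fst u) a', L (snd u))"
  shows "\<forall>\<^sub>F k in sequentially. linearly_stable (perp_slice W (a k)) (M k)"
proof (rule ccontr)
  assume "\<not> (\<forall>\<^sub>F k in sequentially. linearly_stable (perp_slice W (a k)) (M k))"
  then obtain r :: "nat \<Rightarrow> nat" where r: "strict_mono r" "\<And>k. \<not> linearly_stable (perp_slice W (a (r k))) (M (r k))"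
    using not_eventually_sequentiallyD by blast
  have lims: "(\<lambda>k. X (r k)) \<longlonglongrightarrow> X'" if "X \<longlonglongrightarrow> X'" for X :: "nat \<Rightarrow> 'z::topological_space" and X'
    using LIMSEQ_subseq_LIMSEQ[OF that r(1)] unfolding o_def .
  have "\<exists>k. linearly_stable (perp_slice W (a (r k))) (M (r k))"
    by (rule coupled_stability_exists[OF W \<omega>' strong nonres, where \<omega> = "\<lambda>k. \<omega> (r k)" and a = "\<lambda>k. a (r k)"
        and e = "\<lambda>k. e (r k)" and M = "\<lambda>k. M (r k)"])
      (simp_all add: \<omega>(1,2) lims[OF \<omega>(3)] lims[OF a(1)] a(2) e M(1,2,3) lims[OF M(4)])
  then show False using r(2) by blast
qed

section \<open>Calculus of smooth functions\<close>

lemma has_vector_derivative_iff_quotient: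
  fixes f :: "real \<Rightarrow> 'a::real_normed_vector"
  shows "(f has_vector_derivative D) (at t) \<longleftrightarrow> ((\<lambda>s. (1 / (s - t)) *\<^sub>R (f s - f t)) \<longlongrightarrow> D) (at t)"
proof -
  have "norm (f s - f t - (s - t) *\<^sub>R D) / norm (s - t) = norm ((1 / (s - t)) *\<^sub>R (f s - f t) - D)" if "s \<noteq> t" for s
  proof -
    have "(1 / (s - t)) *\<^sub>R (f s - f t) - D = (1 / (s - t)) *\<^sub>R (f s - f t - (s - t) *\<^sub>R D)"
      using that by (simp add: scaleR_diff_right)
    then show ?thesis by (simp add: divide_inverse mult.commute)
  qed
  then have ev: "\<forall>\<^sub>F s in at t. norm (f s - f t - (s - t) *\<^sub>R D) / norm (s - t) = norm ((1 / (s - t)) *\<^sub>R (f s - f t) - D)"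
    by (simp add: eventually_at_filter)
  have "(f has_vector_derivative D) (at t) \<longleftrightarrow>
      ((\<lambda>s. norm (f s - f t - (s - t) *\<^sub>R D) / norm (s - t)) \<longlongrightarrow> 0) (at t)"
    unfolding has_vector_derivative_def has_derivative_iff_norm by (simp add: bounded_linear_scaleR_left)
  also have "\<dots> \<longleftrightarrow> ((\<lambda>s. norm ((1 / (s - t)) *\<^sub>R (f s - f t) - D)) \<longlongrightarrow> 0) (at t)"
    by (rule tendsto_cong[OF ev])
  also have "\<dots> \<longleftrightarrow> ((\<lambda>s. (1 / (s - t)) *\<^sub>R (f s - f t) - D) \<longlongrightarrow> 0) (at t)"
    by (rule tendsto_norm_zero_iff)
  also have "\<dots> \<longleftrightarrow> ((\<lambda>s. (1 / (s - t)) *\<^sub>R (f s - f t)) \<longlongrightarrow> D) (at t)"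
    by (rule LIM_zero_iff)
  finally show ?thesis .
qed

lemma frechet_derivative_cong_open:
  assumes "open U" "x \<in> U" "\<And>y. y \<in> U \<Longrightarrow> f y = g y"
  shows "frechet_derivative f (at x) = frechet_derivative g (at x)"
    and "f differentiable (at x) \<longleftrightarrow> g differentiable (at x)"
proof -
  have "(f has_derivative D) (at x) \<longleftrightarrow> (g has_derivative D) (at x)" for D
    using has_derivative_transform_within_open[OF _ assms(1,2), of f D UNIV g]
      has_derivative_transform_within_open[OF _ assms(1,2), of g D UNIV f] assms(3) by auto
  then show "frechet_derivative f (at x) = frechet_derivative g (at x)"
    and "f differentiable (at x) \<longleftrightarrow> g differentiable (at x)"
    unfolding frechet_derivative_def differentiable_def by simp_all
qed

lemma Ck_on_cong:
  assumes U: "open U"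
  shows "(\<And>x. x \<in> U \<Longrightarrow> f x = g x) \<Longrightarrow> Ck_on k U f \<Longrightarrow> Ck_on k U g"
proof (induction k arbitrary: f g)
  case 0
  then show ?case using continuous_on_cong[of U U f g] by simp
next
  case (Suc k)
  have "\<forall>x\<in>U. g differentiable (at x)"
    using Suc.prems(2) frechet_derivative_cong_open(2)[OF U _ Suc.prems(1)] by simp
  moreover have "Ck_on k U (\<lambda>x. frechet_derivative g (at x) v)" for v
  proof (rule Suc.IH)
    show "frechet_derivative f (at x) v = frechet_derivative g (at x) v" if "x \<in> U" for x
      using frechet_derivative_cong_open(1)[OF U that Suc.prems(1)] by simp
    show "Ck_on k U (\<lambda>x. frechet_derivative f (at x) v)" using Suc.prems(2) by simp
  qed
  ultimately show ?case by simp
qed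

lemma Ck_on_subset: "Ck_on k U f \<Longrightarrow> U' \<subseteq> U \<Longrightarrow> Ck_on k U' f"
  by (induction k arbitrary: f) (auto intro: continuous_on_subset)

lemma Ck_on_SucD: "open U \<Longrightarrow> Ck_on (Suc k) U f \<Longrightarrow> Ck_on k U f"
proof (induction k arbitrary: f)
  case 0
  then show ?case
    by (auto intro!: continuous_at_imp_continuous_on differentiable_imp_continuous_within)
next
  case (Suc k)
  then show ?case by simp
qed

lemma Ck_on_imp_continuous_on: "open U \<Longrightarrow> Ck_on k U f \<Longrightarrow> continuous_on U f"
proof (induction k)
  case (Suc k)
  show ?case by (rule Suc.IH[OF Suc.prems(1) Ck_on_SucD[OF Suc.prems]])
qed simp

text \<open>It suffices to exhibit the derivative as some function of class \<open>C\<^sup>k\<close> in each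
  direction.\<close>

lemma Ck_on_SucI:
  assumes U: "open U" and D: "\<And>x. x \<in> U \<Longrightarrow> (f has_derivative D x) (at x)"
    and Ck: "\<And>v. Ck_on k U (\<lambda>x. D x v)"
  shows "Ck_on (Suc k) U f"
proof -
  have "D x v = frechet_derivative f (at x) v" if "x \<in> U" for x v
    using frechet_derivative_at[OF D[OF that]] by simp
  then have "Ck_on k U (\<lambda>x. frechet_derivative f (at x) v)" for v
    by (rule Ck_on_cong[OF U _ Ck])
  moreover have "\<forall>x\<in>U. f differentiable (at x)" using D differentiableI by blast
  ultimately show ?thesis by simp
qed

lemma Ck_on_Suc_has_derivative:
  assumes "Ck_on (Suc k) U f" "x \<in> U"
  shows "(f has_derivative frechet_derivative f (at x)) (at x)"
  using assms frechet_derivative_works by auto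

lemma Ck_on_const: "open U \<Longrightarrow> Ck_on k U (\<lambda>x. c)"
proof (induction k arbitrary: c)
  case (Suc k)
  show ?case by (rule Ck_on_SucI[OF Suc.prems, of _ "\<lambda>x v. 0"]) (use Suc in simp_all)
qed simp

lemma Ck_on_bounded_linear:
  assumes L: "bounded_linear L" and U: "open U"
  shows "Ck_on k U f \<Longrightarrow> Ck_on k U (\<lambda>x. L (f x))"
proof (induction k arbitrary: f)
  case 0
  then show ?case using bounded_linear.continuous_on[OF L] by simp
next
  case (Suc k)
  show ?case
    by (rule Ck_on_SucI[OF U bounded_linear.has_derivative[OF L Ck_on_Suc_has_derivative[OF Suc.prems]]])
      (use Suc in simp_all)
qed

lemma Ck_on_id:
  assumes U: "open U"
  shows "Ck_on k U (\<lambda>x. x)"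
proof (cases k)
  case (Suc k')
  show ?thesis unfolding Suc by (rule Ck_on_SucI[OF U, of _ "\<lambda>x v. v"]) (simp_all add: Ck_on_const[OF U])
qed (simp add: continuous_on_id)

lemma Ck_on_add:
  assumes U: "open U"
  shows "Ck_on k U f \<Longrightarrow> Ck_on k U g \<Longrightarrow> Ck_on k U (\<lambda>x. f x + g x)"
proof (induction k arbitrary: f g)
  case 0
  then show ?case by (simp add: continuous_on_add)
next
  case (Suc k)
  show ?case
    by (rule Ck_on_SucI[OF U has_derivative_add[OF Ck_on_Suc_has_derivative[OF Suc.prems(1)]
            Ck_on_Suc_has_derivative[OF Suc.prems(2)]]])
      (use Suc in simp_all)
qed

lemma Ck_on_sum:
  assumes U: "open U"
  shows "(\<And>i. i \<in> I \<Longrightarrow> Ck_on k U (f i)) \<Longrightarrow> Ck_on k U (\<lambda>x. \<Sum>i\<in>I. f i x)"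
  by (induction I rule: infinite_finite_induct) (simp_all add: Ck_on_const[OF U] Ck_on_add[OF U])

lemma Ck_on_bounded_bilinear:
  assumes B: "bounded_bilinear B" and U: "open U"
  shows "Ck_on k U f \<Longrightarrow> Ck_on k U g \<Longrightarrow> Ck_on k U (\<lambda>x. B (f x) (g x))"
proof (induction k arbitrary: f g)
  case 0
  then show ?case using bounded_bilinear.continuous_on[OF B] by simp
next
  case (Suc k)
  have f: "Ck_on k U f" and g: "Ck_on k U g" using Suc.prems Ck_on_SucD[OF U] by blast+
  show ?case
  proof (rule Ck_on_SucI[OF U])
    show "((\<lambda>x. B (f x) (g x)) has_derivative
        (\<lambda>v. B (f x) (frechet_derivative g (at x) v) + B (frechet_derivative f (at x) v) (g x))) (at x)"
      if "x \<in> U" for x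
      by (rule bounded_bilinear.FDERIV[OF B Ck_on_Suc_has_derivative[OF Suc.prems(1) that]
            Ck_on_Suc_has_derivative[OF Suc.prems(2) that]])
    show "Ck_on k U (\<lambda>x. B (f x) (frechet_derivative g (at x) v) + B (frechet_derivative f (at x) v) (g x))" for v
      by (intro Ck_on_add[OF U] Suc.IH f g) (use Suc.prems in simp_all)
  qed
qed

lemma linear_basis_expansion:
  fixes L :: "'a::euclidean_space \<Rightarrow> 'b::real_vector"
  assumes "linear L"
  shows "L v = (\<Sum>b\<in>Basis. inner v b *\<^sub>R L b)"
  using linear_sum[OF assms, of "\<lambda>b. inner v b *\<^sub>R b" Basis]
  by (simp add: euclidean_representation linear_scale[OF assms])

lemma Cinf_on_frechet_derivative: "Cinf_on U f \<Longrightarrow> Cinf_on U (\<lambda>x. frechet_derivative f (at x) v)"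
  unfolding Cinf_on_def by (metis Ck_on.simps(2))

lemma Cinf_on_has_derivative: "Cinf_on U f \<Longrightarrow> x \<in> U \<Longrightarrow> (f has_derivative frechet_derivative f (at x)) (at x)"
  unfolding Cinf_on_def using Ck_on_Suc_has_derivative by blast

text \<open>Induction on \<open>k\<close>: expand the derivative of \<open>g\<close> in the basis, so that the chain
  rule writes the derivative of the composition as a finite sum of products.\<close>

lemma Ck_on_compose:
  fixes c :: "'a::real_normed_vector \<Rightarrow> 'b::euclidean_space" and g :: "'b \<Rightarrow> 'c::real_normed_vector"
  assumes U: "open U" and cV: "c ` U \<subseteq> V"
  shows "Cinf_on V g \<Longrightarrow> Ck_on k U c \<Longrightarrow> Ck_on k U (\<lambda>x. g (c x))"
proof (induction k arbitrary: g)
  case 0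
  then have "continuous_on V g" unfolding Cinf_on_def by (metis Ck_on.simps(1))
  then show ?case using 0 cV continuous_on_compose2[of V g U c] by simp
next
  case (Suc k)
  have c: "Ck_on k U c" using Suc.prems(2) by (rule Ck_on_SucD[OF U])
  have cx: "c x \<in> V" if "x \<in> U" for x using cV that by blast
  show ?case
  proof (rule Ck_on_SucI[OF U])
    fix x assume x: "x \<in> U"
    have Dg: "(g has_derivative frechet_derivative g (at (c x))) (at (c x))"
      by (rule Cinf_on_has_derivative[OF Suc.prems(1) cx[OF x]])
    have "((\<lambda>x. g (c x)) has_derivative (\<lambda>v. frechet_derivative g (at (c x)) (frechet_derivative c (at x) v))) (at x)"
      using diff_chain_at[OF Ck_on_Suc_has_derivative[OF Suc.prems(2) x] Dg] unfolding o_def .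
    also have "(\<lambda>v. frechet_derivative g (at (c x)) (frechet_derivative c (at x) v)) =
        (\<lambda>v. \<Sum>b\<in>Basis. inner (frechet_derivative c (at x) v) b *\<^sub>R frechet_derivative g (at (c x)) b)"
      using linear_basis_expansion[OF has_derivative_linear[OF Dg]] by (intro ext)
    finally show "((\<lambda>x. g (c x)) has_derivative
        (\<lambda>v. \<Sum>b\<in>Basis. inner (frechet_derivative c (at x) v) b *\<^sub>R frechet_derivative g (at (c x)) b)) (at x)" .
  next
    fix v
    have 1: "Ck_on k U (\<lambda>x. inner (frechet_derivative c (at x) v) b)" for b
      by (rule Ck_on_bounded_linear[OF bounded_linear_inner_left U]) (use Suc.prems(2) in simp)
    have 2: "Ck_on k U (\<lambda>x. frechet_derivative g (at (c x)) b)" for b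
      by (rule Suc.IH[OF Cinf_on_frechet_derivative[OF Suc.prems(1)] c])
    show "Ck_on k U (\<lambda>x. \<Sum>b\<in>Basis. inner (frechet_derivative c (at x) v) b *\<^sub>R frechet_derivative g (at (c x)) b)"
      by (intro Ck_on_sum[OF U] Ck_on_bounded_bilinear[OF bounded_bilinear_scaleR U] 1 2)
  qed
qed

text \<open>Differentiating \<open>A y = b\<close> gives \<open>A y' = b' - A' y\<close>, a linear equation of the
  same kind for \<open>y'\<close>, so the claim follows by induction on \<open>k\<close>.\<close>

lemma Ck_on_linear_solution:
  fixes A :: "real \<Rightarrow> 'a::euclidean_space \<Rightarrow> 'a"
  assumes U: "open U" and A: "\<And>t. t \<in> U \<Longrightarrow> linear (A t)" "\<And>t v. t \<in> U \<Longrightarrow> A t v = 0 \<Longrightarrow> v = 0"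
  shows "(\<And>v. Ck_on k U (\<lambda>t. A t v)) \<Longrightarrow> Ck_on k U b \<Longrightarrow> (\<And>t. t \<in> U \<Longrightarrow> A t (y t) = b t) \<Longrightarrow> Ck_on k U y"
proof -
  define A0 where "A0 t = (if t \<in> U then A t else (\<lambda>v. v))" for t
  have "linear (\<lambda>v :: 'a. v)" by (intro linearI) simp_all
  then have A0: "linear (A0 t)" for t unfolding A0_def using A(1) by simp
  have A0U: "A0 t = A t" if "t \<in> U" for t unfolding A0_def using that by simp
  have cl: "(f \<longlongrightarrow> f t) (at t)" if "continuous_on U f" "t \<in> U" for f :: "real \<Rightarrow> 'a" and t
  proof -
    have "isCont f t" using that continuous_on_eq_continuous_at[OF U] by blast
    then show ?thesis unfolding isCont_def .
  qed
  have sol: "(q \<longlongrightarrow> q') (at t)"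
    if t: "t \<in> U" and cont: "\<And>v. continuous_on U (\<lambda>t. A t v)" and lim: "((\<lambda>s. A s (q s)) \<longlongrightarrow> A t q') (at t)" for t q q'
  proof (rule tendsto_linear_family_solution[OF subspace_UNIV A0 A0, of _ t])
    have evU: "\<forall>\<^sub>F s in at t. s \<in> U" using eventually_at_in_open'[OF U t] .
    show "((\<lambda>k. A0 k v) \<longlongrightarrow> A0 t v) (at t)" for v
    proof -
      have "((\<lambda>k. A k v) \<longlongrightarrow> A t v) (at t)"
        by (rule cl[OF cont t])
      then show ?thesis unfolding A0U[OF t]
      proof (rule Lim_transform_eventually)
        show "\<forall>\<^sub>F s in at t. A s v = A0 s v" by (rule eventually_mono[OF evU]) (simp add: A0U)
      qed
    qed
    show "v = 0" if "A0 t v = 0" for v using A(2)[OF t] that unfolding A0U[OF t] by simp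
    show "((\<lambda>k. A0 k (q k)) \<longlongrightarrow> A0 t q') (at t)"
      unfolding A0U[OF t]
    proof (rule Lim_transform_eventually[OF lim])
      show "\<forall>\<^sub>F s in at t. A s (q s) = A0 s (q s)" by (rule eventually_mono[OF evU]) (simp add: A0U)
    qed
  qed simp_all
  show "(\<And>v. Ck_on k U (\<lambda>t. A t v)) \<Longrightarrow> Ck_on k U b \<Longrightarrow> (\<And>t. t \<in> U \<Longrightarrow> A t (y t) = b t) \<Longrightarrow> Ck_on k U y"
  proof (induction k arbitrary: b y)
    case 0
    have "(y \<longlongrightarrow> y t) (at t)" if t: "t \<in> U" for t
    proof (rule sol[OF t])
      show "continuous_on U (\<lambda>t. A t v)" for v using 0(1) by simp
      have "(b \<longlongrightarrow> b t) (at t)" using 0(2) t by (intro cl) simp_all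
      then have "(b \<longlongrightarrow> A t (y t)) (at t)" unfolding 0(3)[OF t] .
      then show "((\<lambda>s. A s (y s)) \<longlongrightarrow> A t (y t)) (at t)"
      proof (rule Lim_transform_eventually)
        show "\<forall>\<^sub>F s in at t. b s = A s (y s)"
          using eventually_at_in_open'[OF U t] by (rule eventually_mono) (simp add: 0(3))
      qed
    qed
    then have "isCont y t" if "t \<in> U" for t using that unfolding isCont_def by blast
    then show ?case by (simp add: continuous_at_imp_continuous_on)
  next
    case (Suc k)
    have Ak: "Ck_on k U (\<lambda>t. A t v)" for v by (rule Ck_on_SucD[OF U Suc.prems(1)])
    have bk: "Ck_on k U b" by (rule Ck_on_SucD[OF U Suc.prems(2)])
    have yk: "Ck_on k U y" by (rule Suc.IH[OF Ak bk Suc.prems(3)])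
    define A' where "A' t v = frechet_derivative (\<lambda>s. A s v) (at t) 1" for t v
    define b' where "b' t = frechet_derivative b (at t) 1" for t
    have vd: "(f has_vector_derivative frechet_derivative f (at t) 1) (at t)"
      if "Ck_on (Suc k) U f" "t \<in> U" for f :: "real \<Rightarrow> 'a" and t
    proof -
      have D: "(f has_derivative frechet_derivative f (at t)) (at t)" by (rule Ck_on_Suc_has_derivative[OF that])
      have "frechet_derivative f (at t) = (\<lambda>v. v *\<^sub>R frechet_derivative f (at t) 1)"
      proof
        fix v :: real
        show "frechet_derivative f (at t) v = v *\<^sub>R frechet_derivative f (at t) 1"
          using linear_scale[OF has_derivative_linear[OF D], of v 1] by (simp only: real_scaleR_def mult_1_right)
      qed
      then show ?thesis using D unfolding has_vector_derivative_def by simp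
    qed
    define r where "r t = b' t - (\<Sum>e\<in>Basis. inner (y t) e *\<^sub>R A' t e)" for t
    have rk: "Ck_on k U r"
    proof -
      have 1: "Ck_on k U b'" unfolding b'_def using Suc.prems(2) by simp
      have 2: "Ck_on k U (\<lambda>t. A' t e)" for e unfolding A'_def using Suc.prems(1)[of e] by simp
      have 3: "Ck_on k U (\<lambda>t. inner (y t) e)" for e
        by (rule Ck_on_bounded_linear[OF bounded_linear_inner_left U yk])
      have "Ck_on k U (\<lambda>t. - (\<Sum>e\<in>Basis. inner (y t) e *\<^sub>R A' t e))"
        by (intro Ck_on_bounded_linear[OF bounded_linear_minus[OF bounded_linear_ident] U] Ck_on_sum[OF U]
            Ck_on_bounded_bilinear[OF bounded_bilinear_scaleR U] 2 3)
      from Ck_on_add[OF U 1 this] show ?thesis unfolding r_def by simp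
    qed
    have "\<exists>w. A t w = r t" if "t \<in> U" for t
    proof -
      have "inj (A t)" using A(2)[OF that] linear_injective_0[OF A(1)[OF that]] by blast
  then have "surj (A t)" by (rule linear_injective_imp_surjective[OF A(1)[OF that] _ refl])
      then show ?thesis by (metis surjD)
    qed
    then obtain y' where y': "\<And>t. t \<in> U \<Longrightarrow> A t (y' t) = r t" by metis
    have yk': "Ck_on k U y'" by (rule Suc.IH[OF Ak rk y'])
    have dy: "(y has_vector_derivative y' t) (at t)" if t: "t \<in> U" for t
      unfolding has_vector_derivative_iff_quotient
    proof (rule sol[OF t])
      show "continuous_on U (\<lambda>t. A t v)" for v
        by (rule Ck_on_imp_continuous_on[OF U Suc.prems(1)])
      have qA: "((\<lambda>s. (1 / (s - t)) *\<^sub>R (A s e - A t e)) \<longlongrightarrow> A' t e) (at t)" for e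
        using vd[OF Suc.prems(1)[of e] t] unfolding A'_def has_vector_derivative_iff_quotient .
      have qb: "((\<lambda>s. (1 / (s - t)) *\<^sub>R (b s - b t)) \<longlongrightarrow> b' t) (at t)"
        using vd[OF Suc.prems(2) t] unfolding b'_def has_vector_derivative_iff_quotient .
      have "((\<lambda>s. (1 / (s - t)) *\<^sub>R (b s - b t) - (\<Sum>e\<in>Basis. inner (y t) e *\<^sub>R ((1 / (s - t)) *\<^sub>R (A s e - A t e))))
          \<longlongrightarrow> r t) (at t)"
        unfolding r_def by (intro tendsto_intros qA qb)
      then show "((\<lambda>s. A s ((1 / (s - t)) *\<^sub>R (y s - y t))) \<longlongrightarrow> A t (y' t)) (at t)"
        unfolding y'[OF t]
      proof (rule Lim_transform_eventually)
        show "\<forall>\<^sub>F s in at t. (1 / (s - t)) *\<^sub>R (b s - b t) - (\<Sum>e\<in>Basis. inner (y t) e *\<^sub>R ((1 / (s - t)) *\<^sub>R (A s e - A t e)))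
            = A s ((1 / (s - t)) *\<^sub>R (y s - y t))"
          using eventually_at_in_open'[OF U t]
        proof (rule eventually_mono)
          fix s assume s: "s \<in> U"
          have "(\<Sum>e\<in>Basis. inner (y t) e *\<^sub>R ((1 / (s - t)) *\<^sub>R (A s e - A t e))) =
              (1 / (s - t)) *\<^sub>R ((\<Sum>e\<in>Basis. inner (y t) e *\<^sub>R A s e) - (\<Sum>e\<in>Basis. inner (y t) e *\<^sub>R A t e))"
            unfolding sum_subtractf[symmetric] scaleR_sum_right
            by (intro sum.cong refl) (simp add: scaleR_diff_right mult.commute)
          also have "\<dots> = (1 / (s - t)) *\<^sub>R (A s (y t) - A t (y t))"
            by (simp only: linear_basis_expansion[OF A(1)[OF s], of "y t"] linear_basis_expansion[OF A(1)[OF t], of "y t"])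
          finally have e: "(\<Sum>e\<in>Basis. inner (y t) e *\<^sub>R ((1 / (s - t)) *\<^sub>R (A s e - A t e))) =
            (1 / (s - t)) *\<^sub>R (A s (y t) - A t (y t))" .
          show "(1 / (s - t)) *\<^sub>R (b s - b t) - (\<Sum>e\<in>Basis. inner (y t) e *\<^sub>R ((1 / (s - t)) *\<^sub>R (A s e - A t e)))
            = A s ((1 / (s - t)) *\<^sub>R (y s - y t))"
            unfolding e Suc.prems(3)[OF s, symmetric] Suc.prems(3)[OF t, symmetric]
              linear_scale[OF A(1)[OF s]] linear_diff[OF A(1)[OF s]]
            by (simp add: scaleR_diff_right)
        qed
      qed
    qed
    show ?case
    proof (rule Ck_on_SucI[OF U])
      show "(y has_derivative (\<lambda>v. v *\<^sub>R y' t)) (at t)" if "t \<in> U" for t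
        using dy[OF that] unfolding has_vector_derivative_def .
      show "Ck_on k U (\<lambda>t. v *\<^sub>R y' t)" for v
        by (rule Ck_on_bounded_linear[OF bounded_linear_scaleR_right U yk'])
    qed
  qed
qed

text \<open>The velocity solves the linear equation \<open>D\<Psi>(c) c' = w\<close>, whose coefficients are as
  smooth as \<open>c\<close>; so \<open>c\<close> gains one derivative at a time.\<close>

lemma Cinf_on_implicit_curve:
  fixes c :: "real \<Rightarrow> 'a::euclidean_space" and \<Psi> :: "'a \<Rightarrow> 'a"
  assumes U: "open U" and cV: "c ` U \<subseteq> V" and \<Psi>: "Cinf_on V \<Psi>"
    and inj: "\<And>x v. x \<in> V \<Longrightarrow> frechet_derivative \<Psi> (at x) v = 0 \<Longrightarrow> v = 0"
    and c: "\<And>t. t \<in> U \<Longrightarrow> (c has_vector_derivative c' t) (at t)"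
      "\<And>t. t \<in> U \<Longrightarrow> frechet_derivative \<Psi> (at (c t)) (c' t) = w"
  shows "Cinf_on U c"
proof -
  have cx: "c t \<in> V" if "t \<in> U" for t using cV that by blast
  have "Ck_on k U c" for k
  proof (induction k)
    case 0
    have "isCont c t" if "t \<in> U" for t by (rule has_vector_derivative_continuous[OF c(1)[OF that]])
    then show ?case by (simp add: continuous_at_imp_continuous_on)
  next
    case (Suc k)
    have "Ck_on k U (\<lambda>t. frechet_derivative \<Psi> (at (c t)) v)" for v
      by (rule Ck_on_compose[OF U cV Cinf_on_frechet_derivative[OF \<Psi>] Suc])
    then have "Ck_on k U c'"
    proof (rule Ck_on_linear_solution[OF U, rotated 2])
      show "linear (frechet_derivative \<Psi> (at (c t)))" if "t \<in> U" for t
        using Cinf_on_has_derivative[OF \<Psi> cx[OF that]] by (rule has_derivative_linear)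
      show "v = 0" if "t \<in> U" "frechet_derivative \<Psi> (at (c t)) v = 0" for t v
        using inj[OF cx[OF that(1)] that(2)] .
    qed (rule Ck_on_const[OF U], rule c(2))
    then have "Ck_on k U (\<lambda>t. v *\<^sub>R c' t)" for v
      by (rule Ck_on_bounded_linear[OF bounded_linear_scaleR_right U])
    then show ?case
      using c(1) unfolding has_vector_derivative_def by (intro Ck_on_SucI[OF U])
  qed
  then show ?thesis unfolding Cinf_on_def by blast
qed

section \<open>Gradients, Hessians and the rotation group\<close>

definition grad :: "('a::euclidean_space \<Rightarrow> real) \<Rightarrow> 'a \<Rightarrow> 'a" where
  "grad f x = (\<Sum>b\<in>Basis. frechet_derivative f (at x) b *\<^sub>R b)"

lemma Cinf_on_grad:
  assumes "open U" "Cinf_on U f"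
  shows "Cinf_on U (grad f)"
proof -
  have "Ck_on k U (\<lambda>x. \<Sum>b\<in>Basis. frechet_derivative f (at x) b *\<^sub>R b)" for k
  proof (rule Ck_on_sum[OF assms(1)])
    fix b :: 'a
    have "Ck_on k U (\<lambda>x. frechet_derivative f (at x) b)"
      using Cinf_on_frechet_derivative[OF assms(2)] unfolding Cinf_on_def by blast
    then show "Ck_on k U (\<lambda>x. frechet_derivative f (at x) b *\<^sub>R b)"
      by (rule Ck_on_bounded_linear[OF bounded_linear_scaleR_left assms(1)])
  qed
  moreover have "grad f = (\<lambda>x. \<Sum>b\<in>Basis. frechet_derivative f (at x) b *\<^sub>R b)"
    by (simp add: grad_def fun_eq_iff)
  ultimately show ?thesis unfolding Cinf_on_def by simp
qed

lemma has_derivative_grad: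
  fixes f :: "'a::euclidean_space \<Rightarrow> real"
  assumes "(f has_derivative D) (at x)"
  shows "(f has_derivative (\<lambda>v. inner (grad f x) v)) (at x)"
proof -
  have "D v = inner (grad f x) v" for v
    using linear_basis_expansion[OF has_derivative_linear[OF assms], of v] frechet_derivative_at[OF assms]
    unfolding grad_def by (simp add: inner_sum_left inner_commute[of v] mult.commute)
  then have "D = (\<lambda>v. inner (grad f x) v)" by (rule ext)
  then show ?thesis using assms by simp
qed

text \<open>The mixed second difference of \<open>f\<close>, which is symmetric in \<open>u\<close> and
  \<open>v\<close>, approximates the derivative of the gradient.\<close>

lemma second_difference_estimate:
  fixes f :: "'a::real_inner \<Rightarrow> real"
  assumes f: "\<And>y. norm (y - x) < \<delta> \<Longrightarrow> (f has_derivative (\<lambda>w. inner (G y) w)) (at y)"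
    and G: "\<And>y. norm (y - x) < \<delta> \<Longrightarrow> norm (G y - G x - B (y - x)) \<le> e * norm (y - x)"
    and B: "linear B" and t: "0 < t" "t * (norm u + norm v) < \<delta>" and e: "e \<ge> 0"
  shows "\<bar>f (x + t *\<^sub>R u + t *\<^sub>R v) - f (x + t *\<^sub>R u) - f (x + t *\<^sub>R v) + f x - t\<^sup>2 * inner (B v) u\<bar>
    \<le> 2 * e * t\<^sup>2 * (norm u + norm v)\<^sup>2"
proof -
  define \<phi> where "\<phi> s = f (x + t *\<^sub>R v + s *\<^sub>R (t *\<^sub>R u)) - f (x + s *\<^sub>R (t *\<^sub>R u))" for s
  let ?\<phi>' = "\<lambda>s. inner (G (x + t *\<^sub>R v + s *\<^sub>R (t *\<^sub>R u))) (t *\<^sub>R u) - inner (G (x + s *\<^sub>R (t *\<^sub>R u))) (t *\<^sub>R u)"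
  have bound: "norm (t *\<^sub>R v + s *\<^sub>R (t *\<^sub>R u)) \<le> t * (norm u + norm v)" "norm (s *\<^sub>R (t *\<^sub>R u)) \<le> t * (norm u + norm v)"
    if "0 \<le> s" "s \<le> 1" for s
  proof -
    have 1: "s * t * norm u \<le> 1 * (t * norm u)"
      using that t(1) mult_right_mono[of s 1 "t * norm u"] by (simp add: mult.assoc)
    have st: "\<bar>s * t\<bar> = s * t" using that t(1) by simp
    have n: "norm (s *\<^sub>R (t *\<^sub>R u)) = s * t * norm u" unfolding scaleR_scaleR norm_scaleR st ..
    have "norm (t *\<^sub>R v + s *\<^sub>R (t *\<^sub>R u)) \<le> t * norm v + s * t * norm u"
      using norm_triangle_ineq[of "t *\<^sub>R v" "s *\<^sub>R (t *\<^sub>R u)"] t(1) unfolding n by simp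
    then show "norm (t *\<^sub>R v + s *\<^sub>R (t *\<^sub>R u)) \<le> t * (norm u + norm v)" using 1 by (simp add: distrib_left)
    have "0 \<le> t * norm v" using t(1) by simp
    then show "norm (s *\<^sub>R (t *\<^sub>R u)) \<le> t * (norm u + norm v)" unfolding n using 1 by (simp add: distrib_left)
  qed
  have "DERIV \<phi> s :> ?\<phi>' s" if s: "0 \<le> s" "s \<le> 1" for s
  proof -
    have 1: "(f has_derivative (\<lambda>w. inner (G (x + t *\<^sub>R v + s *\<^sub>R (t *\<^sub>R u))) w)) (at (x + t *\<^sub>R v + s *\<^sub>R (t *\<^sub>R u)))"
      using bound(1)[OF s] t(2) by (intro f) (simp add: add.assoc)
    have 2: "(f has_derivative (\<lambda>w. inner (G (x + s *\<^sub>R (t *\<^sub>R u))) w)) (at (x + s *\<^sub>R (t *\<^sub>R u)))"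
      using bound(2)[OF s] t(2) by (intro f) simp
    have l1: "((\<lambda>s. x + t *\<^sub>R v + s *\<^sub>R (t *\<^sub>R u)) has_derivative (\<lambda>h. h *\<^sub>R (t *\<^sub>R u))) (at s)"
      by (auto intro!: derivative_eq_intros)
    have l2: "((\<lambda>s. x + s *\<^sub>R (t *\<^sub>R u)) has_derivative (\<lambda>h. h *\<^sub>R (t *\<^sub>R u))) (at s)"
      by (auto intro!: derivative_eq_intros)
    have "(\<phi> has_derivative (\<lambda>h. inner (G (x + t *\<^sub>R v + s *\<^sub>R (t *\<^sub>R u))) (h *\<^sub>R (t *\<^sub>R u))
        - inner (G (x + s *\<^sub>R (t *\<^sub>R u))) (h *\<^sub>R (t *\<^sub>R u)))) (at s)"
      unfolding \<phi>_def using has_derivative_diff[OF diff_chain_at[OF l1 1] diff_chain_at[OF l2 2]]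
      unfolding o_def .
    then show ?thesis unfolding has_field_derivative_def
      by (rule has_derivative_eq_rhs) (simp add: fun_eq_iff algebra_simps)
  qed
  then obtain s where s: "0 < s" "s < 1" "\<phi> 1 - \<phi> 0 = (1 - 0) * ?\<phi>' s"
    using MVT2[of 0 1 \<phi> ?\<phi>'] by auto
  let ?h1 = "t *\<^sub>R v + s *\<^sub>R (t *\<^sub>R u)" and ?h2 = "s *\<^sub>R (t *\<^sub>R u)"
  define r1 r2 where "r1 = G (x + ?h1) - G x - B ?h1" and "r2 = G (x + ?h2) - G x - B ?h2"
  have s': "0 \<le> s" "s \<le> 1" using s by simp_all
  have nr1: "norm r1 \<le> e * (t * (norm u + norm v))"
  proof -
    have "norm r1 \<le> e * norm ?h1" using G[of "x + ?h1"] bound(1)[OF s'] t(2) unfolding r1_def by simp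
    also have "\<dots> \<le> e * (t * (norm u + norm v))" by (rule mult_left_mono[OF bound(1)[OF s'] e])
    finally show ?thesis .
  qed
  have nr2: "norm r2 \<le> e * (t * (norm u + norm v))"
  proof -
    have "norm r2 \<le> e * norm ?h2" using G[of "x + ?h2"] bound(2)[OF s'] t(2) unfolding r2_def by simp
    also have "\<dots> \<le> e * (t * (norm u + norm v))" by (rule mult_left_mono[OF bound(2)[OF s'] e])
    finally show ?thesis .
  qed
  have "B ?h1 = t *\<^sub>R B v + B ?h2" by (simp add: linear_add[OF B] linear_scale[OF B])
  then have GG: "G (x + ?h1) - G (x + ?h2) = t *\<^sub>R B v + (r1 - r2)" unfolding r1_def r2_def by (simp add: algebra_simps)
  have "?\<phi>' s = t * inner (G (x + ?h1) - G (x + ?h2)) u" by (simp add: inner_diff_left algebra_simps)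
  also have "\<dots> = t * inner (t *\<^sub>R B v + (r1 - r2)) u" unfolding GG ..
  also have "\<dots> = t\<^sup>2 * inner (B v) u + t * inner (r1 - r2) u"
    by (simp add: inner_add_left power2_eq_square distrib_left mult.assoc)
  finally have "?\<phi>' s = t\<^sup>2 * inner (B v) u + t * inner (r1 - r2) u" .
  then have "\<phi> 1 - \<phi> 0 - t\<^sup>2 * inner (B v) u = t * inner (r1 - r2) u" using s(3) by simp
  moreover have "\<phi> 1 - \<phi> 0 = f (x + t *\<^sub>R u + t *\<^sub>R v) - f (x + t *\<^sub>R u) - f (x + t *\<^sub>R v) + f x"
    unfolding \<phi>_def by (simp add: algebra_simps)
  moreover have "\<bar>t * inner (r1 - r2) u\<bar> \<le> 2 * e * t\<^sup>2 * (norm u + norm v)\<^sup>2"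
  proof -
    have nn: "0 \<le> e * (t * (norm u + norm v))" using e t(1) by simp
    have "\<bar>inner (r1 - r2) u\<bar> \<le> norm (r1 - r2) * norm u" by (rule Cauchy_Schwarz_ineq2)
    also have "\<dots> \<le> (2 * (e * (t * (norm u + norm v)))) * (norm u + norm v)"
      using nr1 nr2 norm_triangle_ineq4[of r1 r2] nn by (intro mult_mono) simp_all
    finally have "t * \<bar>inner (r1 - r2) u\<bar> \<le> t * ((2 * (e * (t * (norm u + norm v)))) * (norm u + norm v))"
      using t(1) by (intro mult_left_mono) simp_all
    also have "t * \<bar>inner (r1 - r2) u\<bar> = \<bar>t * inner (r1 - r2) u\<bar>" using t(1) by (simp only: abs_mult abs_of_pos)
    finally show ?thesis by (simp only: power2_eq_square mult.assoc mult.left_commute mult.commute)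
  qed
  ultimately show ?thesis by simp
qed

text \<open>The second difference of \<open>f\<close> is symmetric in \<open>u\<close> and \<open>v\<close>, and
  \<open>second_difference_estimate\<close> evaluates it in both orders.\<close>

lemma hessian_symmetric:
  fixes f :: "'a::real_inner \<Rightarrow> real"
  assumes N: "open N" "x \<in> N" and f: "\<And>y. y \<in> N \<Longrightarrow> (f has_derivative (\<lambda>w. inner (G y) w)) (at y)"
    and G: "(G has_derivative B) (at x)"
  shows "inner (B u) v = inner u (B v)"
proof -
  have linB: "linear B" using G by (rule has_derivative_linear)
  define C where "C = (norm u + norm v)\<^sup>2"
  have "\<bar>inner (B u) v - inner (B v) u\<bar> \<le> 4 * e * C" if e: "e > 0" for e
  proof -
    obtain \<delta>1 where \<delta>1: "\<delta>1 > 0" "\<And>y. norm (y - x) < \<delta>1 \<Longrightarrow> y \<in> N"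
      using N unfolding open_dist by (metis dist_norm)
    obtain \<delta>2 where \<delta>2: "\<delta>2 > 0" "\<And>y. norm (y - x) < \<delta>2 \<Longrightarrow> norm (G y - G x - B (y - x)) \<le> e * norm (y - x)"
      using G e unfolding has_derivative_at_alt by blast
    define \<delta> where "\<delta> = min \<delta>1 \<delta>2"
    have \<delta>: "\<delta> > 0" unfolding \<delta>_def using \<delta>1 \<delta>2 by simp
    define n where "n = norm u + norm v + 1"
    define t where "t = \<delta> / (2 * n)"
    have pos: "n > 0" unfolding n_def by (simp add: add_nonneg_pos)
    have t: "t > 0" unfolding t_def using \<delta> pos by simp
    have tb: "t * (norm u + norm v) < \<delta>"
    proof -
      have "t * (norm u + norm v) \<le> t * n" unfolding n_def using t by simp
      also have "\<dots> = \<delta> / 2" unfolding t_def using pos by simp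
      finally show ?thesis using \<delta> by simp
    qed
    have 1: "\<bar>f (x + t *\<^sub>R u + t *\<^sub>R v) - f (x + t *\<^sub>R u) - f (x + t *\<^sub>R v) + f x - t\<^sup>2 * inner (B v) u\<bar> \<le> 2 * e * t\<^sup>2 * C"
      unfolding C_def
      by (rule second_difference_estimate[where G = G and \<delta> = \<delta>]) (use f \<delta>1 \<delta>2 linB t tb e in \<open>simp_all add: \<delta>_def\<close>)
    have 2: "\<bar>f (x + t *\<^sub>R v + t *\<^sub>R u) - f (x + t *\<^sub>R v) - f (x + t *\<^sub>R u) + f x - t\<^sup>2 * inner (B u) v\<bar> \<le> 2 * e * t\<^sup>2 * (norm v + norm u)\<^sup>2"
      by (rule second_difference_estimate[where G = G and \<delta> = \<delta>]) (use f \<delta>1 \<delta>2 linB t tb e in \<open>simp_all add: \<delta>_def add.commute\<close>)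
    have sw: "x + t *\<^sub>R v + t *\<^sub>R u = x + t *\<^sub>R u + t *\<^sub>R v" "norm v + norm u = norm u + norm v" by (simp_all add: algebra_simps)
    have "\<bar>t\<^sup>2 * inner (B u) v - t\<^sup>2 * inner (B v) u\<bar> \<le> 2 * (2 * e * t\<^sup>2 * C)"
      using 1 2[unfolded sw C_def[symmetric]] by linarith
    also have "\<bar>t\<^sup>2 * inner (B u) v - t\<^sup>2 * inner (B v) u\<bar> = t\<^sup>2 * \<bar>inner (B u) v - inner (B v) u\<bar>"
      unfolding right_diff_distrib[symmetric] abs_mult by simp
    finally have "t\<^sup>2 * \<bar>inner (B u) v - inner (B v) u\<bar> \<le> t\<^sup>2 * (4 * e * C)" by (simp add: algebra_simps)
    then show ?thesis using t by simp
  qed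
  note est = this
  have "\<bar>inner (B u) v - inner (B v) u\<bar> \<le> 0"
  proof (rule field_le_epsilon)
    fix e :: real assume e: "e > 0"
    have C: "C \<ge> 0" unfolding C_def by simp
    have "\<bar>inner (B u) v - inner (B v) u\<bar> \<le> 4 * (e / (4 * (C + 1))) * C" by (rule est) (use e C in simp)
    also have "\<dots> = e * (C / (C + 1))" using C by (simp add: field_simps)
    also have "\<dots> \<le> e * 1" using e C by (intro mult_left_mono) simp_all
    finally show "\<bar>inner (B u) v - inner (B v) u\<bar> \<le> 0 + e" by simp
  qed
  then show ?thesis by (simp add: inner_commute)
qed

text \<open>Derivatives within a set are determined on velocities of curves that stay in the set.\<close>

lemma has_derivative_along_curve:
  assumes f: "(f has_derivative D) (at x within A)" and \<gamma>: "\<gamma> 0 = x" "(\<gamma> has_vector_derivative u) (at (0::real))"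
    and A: "\<forall>\<^sub>F t in at 0. \<gamma> t \<in> A"
  shows "((\<lambda>t. f (\<gamma> t)) has_vector_derivative D u) (at 0)"
proof -
  define T where "T = {t. \<gamma> t \<in> A}"
  have T: "at 0 within T = at 0"
  proof (rule filter_eqI)
    fix Q
    show "eventually Q (at 0 within T) \<longleftrightarrow> eventually Q (at 0)"
      using A unfolding eventually_at_filter T_def by (auto elim: eventually_elim2)
  qed
  have "(\<gamma> has_derivative (\<lambda>t. t *\<^sub>R u)) (at 0 within T)"
    using \<gamma>(2) unfolding has_vector_derivative_def by (rule has_derivative_at_withinI)
  moreover have "(f has_derivative D) (at (\<gamma> 0) within \<gamma> ` T)"
    unfolding \<gamma>(1) by (rule has_derivative_subset[OF f]) (auto simp: T_def)
  ultimately have "((f \<circ> \<gamma>) has_derivative (D \<circ> (\<lambda>t. t *\<^sub>R u))) (at 0 within T)"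
    by (rule diff_chain_within)
  moreover have "(D \<circ> (\<lambda>t. t *\<^sub>R u)) = (\<lambda>t. t *\<^sub>R D u)"
    using linear_scale[OF has_derivative_linear[OF f]] by (auto simp: o_def)
  ultimately show ?thesis unfolding has_vector_derivative_def T o_def by simp
qed

lemma hat_mult_vec: "hat \<xi> *v v = cross3 \<xi> v"
proof -
  have "linear (cross3 \<xi>)" by (intro linearI) (simp_all add: cross_add_right cross_mult_right)
  then show ?thesis unfolding hat_def using matrix_vector_mul by metis
qed

lemma vee_hat: "vee (hat \<xi>) = \<xi>"
  unfolding vee_def hat_def matrix_def
  by (simp add: Finite_Cartesian_Product.vec_eq_iff forall_3 vector_3 cross3_def axis_def)

lemma rotation_hat:
  assumes "g \<in> SO3"
  shows "g ** hat \<eta> = hat (g *v \<eta>) ** g"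
proof -
  have "(g ** hat \<eta>) *v v = (hat (g *v \<eta>) ** g) *v v" for v
    using cross_rotation_matrix[of g \<eta> v] assms unfolding SO3_def
    by (simp add: matrix_vector_mul_assoc[symmetric] hat_mult_vec)
  then show ?thesis by (simp add: matrix_eq)
qed

lemma SO3_transpose: "g \<in> SO3 \<Longrightarrow> transpose g ** g = mat 1"
  unfolding SO3_def rotation_matrix_def orthogonal_matrix_def by simp

lemma SO3_mult: "g \<in> SO3 \<Longrightarrow> k \<in> SO3 \<Longrightarrow> g ** k \<in> SO3"
  unfolding SO3_def rotation_matrix_def by (simp add: orthogonal_matrix_mul det_mul)

lemma SO3_inverse: "g \<in> SO3 \<Longrightarrow> transpose g \<in> SO3"
  unfolding SO3_def rotation_matrix_def by (simp add: orthogonal_matrix_transpose det_transpose)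

lemma SO3_one: "mat 1 \<in> SO3"
  unfolding SO3_def rotation_matrix_def by (simp add: orthogonal_matrix_id)

lemma SO3_norm: "g \<in> SO3 \<Longrightarrow> norm (g *v v) = norm v"
  unfolding SO3_def rotation_matrix_def
  using orthogonal_transformation_matrix[of "(*v) g"] orthogonal_transformation_norm[of "(*v) g"]
  by (simp add: matrix_vector_mul_linear matrix_of_matrix_vector_mul)

lemma bounded_bilinear_matrix_mult: "bounded_bilinear ((**) :: real^3^3 \<Rightarrow> real^3^3 \<Rightarrow> real^3^3)"
proof -
  have "(r *\<^sub>R A) ** B = r *\<^sub>R (A ** B)" "A ** (r *\<^sub>R B) = r *\<^sub>R (A ** B)" for r and A B :: "real^3^3"
    by (simp_all add: matrix_eq matrix_vector_mul_assoc[symmetric] scaleR_matrix_vector_assoc[symmetric]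
        matrix_vector_mult_scaleR)
  moreover have "(A + A') ** B = A ** B + A' ** B" for A A' B :: "real^3^3"
    by (simp add: matrix_eq matrix_vector_mul_assoc[symmetric] matrix_vector_mult_add_rdistrib)
  ultimately have "bilinear ((**) :: real^3^3 \<Rightarrow> real^3^3 \<Rightarrow> real^3^3)"
    unfolding bilinear_def by (intro conjI allI linearI) (simp_all add: matrix_add_ldistrib)
  then show ?thesis unfolding bilinear_conv_bounded_bilinear .
qed

text \<open>A rational parametrization of rotations.\<close>

lemma orthogonal_cayley:
  fixes a :: "real^3"
  shows "orthogonal_matrix (mat 1 + (2 / (1 + inner a a)) *\<^sub>R (hat a + hat a ** hat a))"
proof -
  have pos: "1 + inner a a > 0" by (simp add: add_pos_nonneg)
  define s where "s = 2 / (1 + inner a a)"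
  have s2: "s * (1 + inner a a) = 2" unfolding s_def using pos by (simp add: divide_eq_eq)
  let ?s = s
  let ?Q = "mat 1 + ?s *\<^sub>R (hat a + hat a ** hat a)"
  have Q: "?Q *v v = v + ?s *\<^sub>R (cross3 a v + cross3 a (cross3 a v))" for v
    by (simp add: matrix_vector_mult_add_rdistrib scaleR_matrix_vector_assoc[symmetric]
        matrix_vector_mul_assoc[symmetric] hat_mult_vec)
  have "norm (?Q *v v) = norm v" for v
  proof -
    define p where "p = cross3 a v"
    define q where "q = cross3 a p"
    have vp: "inner v p = 0" "inner p q = 0" unfolding p_def q_def by (simp_all add: dot_cross_self)
    have q: "q = inner a v *\<^sub>R a - inner a a *\<^sub>R v" unfolding q_def p_def by (rule Lagrange)
    have ap: "inner a p = 0" unfolding p_def by (simp add: dot_cross_self)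
    have pp: "inner p p = inner a a * inner v v - (inner a v)\<^sup>2"
      unfolding p_def using norm_cross[of a v] by (simp only: power2_norm_eq_inner)
    have vq: "inner v q = - inner p p" unfolding q pp
      by (simp add: inner_diff_right inner_commute power2_eq_square)
    have qq: "inner q q = inner a a * inner p p" unfolding q pp
      by (simp add: inner_diff_right inner_diff_left inner_commute power2_eq_square algebra_simps)
    have "inner (v + ?s *\<^sub>R (p + q)) (v + ?s *\<^sub>R (p + q)) =
        inner v v + 2 * ?s * (inner v p + inner v q) + ?s * ?s * (inner p p + 2 * inner p q + inner q q)"
      by (simp add: inner_add_left inner_add_right inner_commute algebra_simps)
    also have "\<dots> = inner v v + inner p p * (?s * (?s * (1 + inner a a)) - 2 * ?s)"
      unfolding vp vq qq by (simp add: algebra_simps)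
    also have "\<dots> = inner v v" unfolding s2 by simp
    finally have "inner (v + ?s *\<^sub>R (p + q)) (v + ?s *\<^sub>R (p + q)) = inner v v" by simp
    then show ?thesis unfolding Q p_def[symmetric] q_def[symmetric] by (simp add: norm_eq_sqrt_inner)
  qed
  then have "orthogonal_transformation ((*v) ?Q)"
    unfolding orthogonal_transformation by (simp add: matrix_vector_mul_linear)
  then show ?thesis
    using orthogonal_transformation_matrix[of "(*v) ?Q"] unfolding s_def by (simp add: matrix_of_matrix_vector_mul)
qed

text \<open>A curve with prescribed velocity at the identity, so that tangent vectors of the phase space and of the
  coadjoint orbits are velocities of curves. Squaring the orthogonal matrices of \<open>orthogonal_cayley\<close>
  makes the determinant \<open>1\<close>.\<close>

lemma SO3_curve:
  fixes \<eta> :: "real^3"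
  obtains R :: "real \<Rightarrow> real^3^3" where "R 0 = mat 1" "\<And>t. R t \<in> SO3"
    "(R has_vector_derivative hat \<eta>) (at 0)"
proof -
  define a where "a = (1 / 4) *\<^sub>R \<eta>"
  have hs: "hat (t *\<^sub>R w) = t *\<^sub>R hat w" for t w
    by (simp add: matrix_eq hat_mult_vec scaleR_matrix_vector_assoc[symmetric] cross_mult_left)
  define Q where "Q t = mat 1 + (2 / (1 + inner (t *\<^sub>R a) (t *\<^sub>R a))) *\<^sub>R (hat (t *\<^sub>R a) + hat (t *\<^sub>R a) ** hat (t *\<^sub>R a))" for t
  have orth: "orthogonal_matrix (Q t)" for t unfolding Q_def by (rule orthogonal_cayley)
  have hh: "hat (t *\<^sub>R a) ** hat (t *\<^sub>R a) = t\<^sup>2 *\<^sub>R (hat a ** hat a)" for t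
    unfolding hs by (simp add: matrix_eq matrix_vector_mul_assoc[symmetric] scaleR_matrix_vector_assoc[symmetric]
        matrix_vector_mult_scaleR power2_eq_square)
  have Q': "Q t = mat 1 + (2 * t / (1 + t\<^sup>2 * inner a a)) *\<^sub>R hat a + (2 * t\<^sup>2 / (1 + t\<^sup>2 * inner a a)) *\<^sub>R (hat a ** hat a)" for t
    unfolding Q_def hh unfolding hs by (simp add: scaleR_add_right power2_eq_square mult.assoc mult.left_commute add.assoc)
  have p: "1 + t\<^sup>2 * inner a a \<noteq> 0" for t
  proof -
    have "t\<^sup>2 * inner a a \<ge> 0" by simp
    then show ?thesis by linarith
  qed
  have d1: "((\<lambda>t. 2 * t / (1 + t\<^sup>2 * inner a a)) has_real_derivative 2) (at 0)"
    by (auto intro!: derivative_eq_intros simp: p power2_eq_square)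
  have d2: "((\<lambda>t. 2 * t\<^sup>2 / (1 + t\<^sup>2 * inner a a)) has_real_derivative 0) (at 0)"
    by (auto intro!: derivative_eq_intros simp: p power2_eq_square)
  have "(Q has_vector_derivative (0 + 2 *\<^sub>R hat a + 0 *\<^sub>R (hat a ** hat a))) (at 0)"
    unfolding Q'[abs_def]
  proof (intro has_vector_derivative_add has_vector_derivative_const)
    show "((\<lambda>t. (2 * t / (1 + t\<^sup>2 * inner a a)) *\<^sub>R hat a) has_vector_derivative 2 *\<^sub>R hat a) (at 0)"
      using has_vector_derivative_scaleR[OF d1 has_vector_derivative_const[of "hat a"]] by simp
    show "((\<lambda>t. (2 * t\<^sup>2 / (1 + t\<^sup>2 * inner a a)) *\<^sub>R (hat a ** hat a)) has_vector_derivative 0 *\<^sub>R (hat a ** hat a)) (at 0)"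
      using has_vector_derivative_scaleR[OF d2 has_vector_derivative_const[of "hat a ** hat a"]] by simp
  qed
  then have dQ: "(Q has_vector_derivative 2 *\<^sub>R hat a) (at 0)" by simp
  have Q0: "Q 0 = mat 1" unfolding Q' by simp
  show thesis
  proof (rule that[of "\<lambda>t. Q t ** Q t"])
    show "Q 0 ** Q 0 = mat 1" unfolding Q0 by (simp add: matrix_mul_lid)
    show "Q t ** Q t \<in> SO3" for t
      unfolding SO3_def rotation_matrix_def using orth[of t] det_orthogonal_matrix[OF orth[of t]]
      by (auto simp: orthogonal_matrix_mul det_mul)
    have "((\<lambda>t. Q t ** Q t) has_vector_derivative (Q 0 ** (2 *\<^sub>R hat a) + (2 *\<^sub>R hat a) ** Q 0)) (at 0)"
      by (rule bounded_bilinear.has_vector_derivative[OF bounded_bilinear_matrix_mult dQ dQ])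
    moreover have "Q 0 ** (2 *\<^sub>R hat a) + (2 *\<^sub>R hat a) ** Q 0 = hat \<eta>"
      unfolding Q0 matrix_mul_lid matrix_mul_rid a_def hs by (simp add: scaleR_add_left[symmetric])
    ultimately show "((\<lambda>t. Q t ** Q t) has_vector_derivative hat \<eta>) (at 0)" by simp
  qed
qed

section \<open>An equivariant Hamiltonian in a chart of the quotient\<close>

text \<open>Although the derivative within a set is not unique, its value on a tangent vector is.\<close>

lemma frechet_derivative_within_eq:
  assumes f: "(f has_derivative D) (at x within A)" and \<gamma>: "\<gamma> 0 = x" "(\<gamma> has_vector_derivative u) (at (0::real))"
    and A: "\<forall>\<^sub>F t in at 0. \<gamma> t \<in> A"
  shows "frechet_derivative f (at x within A) u = D u"
proof -
  have "(f has_derivative frechet_derivative f (at x within A)) (at x within A)"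
    using f frechet_derivative_works differentiableI by blast
  from vector_derivative_unique_at[OF has_derivative_along_curve[OF this \<gamma> A] has_derivative_along_curve[OF f \<gamma> A]]
  show ?thesis .
qed

lemma line_has_vector_derivative:
  fixes x w :: "'a::real_normed_vector"
  shows "((\<lambda>t. x + t *\<^sub>R w) has_vector_derivative w) (at t)"
  unfolding has_vector_derivative_def by (auto intro!: derivative_eq_intros)

lemma has_derivative_transform_local:
  assumes "(g has_derivative D) (at x within A)" "open T" "x \<in> T" "x \<in> A" "\<And>y. y \<in> A \<inter> T \<Longrightarrow> f y = g y"
  shows "(f has_derivative D) (at x within A)"
proof -
  obtain e where e: "e > 0" "ball x e \<subseteq> T" by (rule openE[OF assms(2,3)])
  show ?thesis
  proof (rule has_derivative_transform_within[OF assms(1) e(1) assms(4)])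
    fix y assume "y \<in> A" "dist y x < e"
    then have "y \<in> A \<inter> T" using e(2) by (auto simp: dist_commute)
    then show "g y = f y" by (rule assms(5)[symmetric])
  qed
qed

text \<open>A product rule at a zero of the first factor: the derivative involves only the value of the second
  factor, which may therefore be merely continuous.\<close>

lemma has_derivative_scaleR_zero:
  fixes \<phi> :: "'a::real_normed_vector \<Rightarrow> real" and \<psi> :: "'a \<Rightarrow> 'b::real_normed_vector"
  assumes \<phi>: "(\<phi> has_derivative \<phi>') (at x within A)" "\<phi> x = 0" and \<psi>: "(\<psi> \<longlongrightarrow> \<psi> x) (at x within A)"
  shows "((\<lambda>y. \<phi> y *\<^sub>R \<psi> y) has_derivative (\<lambda>u. \<phi>' u *\<^sub>R \<psi> x)) (at x within A)"
proof -
  have bl: "bounded_linear \<phi>'" using \<phi>(1) by (rule has_derivative_bounded_linear)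
  obtain C where C: "C > 0" "\<And>u. norm (\<phi>' u) \<le> norm u * C" using bounded_linear.pos_bounded[OF bl] by blast
  have 1: "((\<lambda>y. norm (\<phi> y - \<phi> x - \<phi>' (y - x)) / norm (y - x)) \<longlongrightarrow> 0) (at x within A)"
    using \<phi>(1) unfolding has_derivative_iff_norm by blast
  have 2: "((\<lambda>y. norm (\<psi> y - \<psi> x)) \<longlongrightarrow> 0) (at x within A)"
    using tendsto_norm_zero[OF LIM_zero[OF \<psi>]] .
  have lim: "((\<lambda>y. norm (\<phi> y - \<phi> x - \<phi>' (y - x)) / norm (y - x) * norm (\<psi> y) + C * norm (\<psi> y - \<psi> x)) \<longlongrightarrow> 0 * norm (\<psi> x) + C * 0) (at x within A)"
    by (intro tendsto_intros 1 2 \<psi>)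
  have est: "norm (\<phi> y *\<^sub>R \<psi> y - \<phi> x *\<^sub>R \<psi> x - \<phi>' (y - x) *\<^sub>R \<psi> x) / norm (y - x) \<le>
      norm (\<phi> y - \<phi> x - \<phi>' (y - x)) / norm (y - x) * norm (\<psi> y) + C * norm (\<psi> y - \<psi> x)" for y
  proof (cases "y = x")
    case False
    have "\<phi> y *\<^sub>R \<psi> y - \<phi> x *\<^sub>R \<psi> x - \<phi>' (y - x) *\<^sub>R \<psi> x = (\<phi> y - \<phi> x - \<phi>' (y - x)) *\<^sub>R \<psi> y + \<phi>' (y - x) *\<^sub>R (\<psi> y - \<psi> x)"
      unfolding \<phi>(2) by (simp add: algebra_simps)
    then have "norm (\<phi> y *\<^sub>R \<psi> y - \<phi> x *\<^sub>R \<psi> x - \<phi>' (y - x) *\<^sub>R \<psi> x) \<le>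
        norm (\<phi> y - \<phi> x - \<phi>' (y - x)) * norm (\<psi> y) + norm (\<phi>' (y - x)) * norm (\<psi> y - \<psi> x)"
      using norm_triangle_ineq[of "(\<phi> y - \<phi> x - \<phi>' (y - x)) *\<^sub>R \<psi> y" "\<phi>' (y - x) *\<^sub>R (\<psi> y - \<psi> x)"] by simp
    also have "\<dots> \<le> norm (\<phi> y - \<phi> x - \<phi>' (y - x)) * norm (\<psi> y) + norm (y - x) * C * norm (\<psi> y - \<psi> x)"
      by (intro add_left_mono mult_right_mono C(2)) simp
    finally have "norm (\<phi> y *\<^sub>R \<psi> y - \<phi> x *\<^sub>R \<psi> x - \<phi>' (y - x) *\<^sub>R \<psi> x) / norm (y - x) \<le>
      (norm (\<phi> y - \<phi> x - \<phi>' (y - x)) * norm (\<psi> y) + norm (y - x) * C * norm (\<psi> y - \<psi> x)) / norm (y - x)"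
      by (rule divide_right_mono) simp
    also have "\<dots> = norm (\<phi> y - \<phi> x - \<phi>' (y - x)) / norm (y - x) * norm (\<psi> y) + C * norm (\<psi> y - \<psi> x)"
      using False by (simp add: add_divide_distrib)
    finally show ?thesis .
  qed (use C in simp)
  have "((\<lambda>y. norm (\<phi> y *\<^sub>R \<psi> y - \<phi> x *\<^sub>R \<psi> x - \<phi>' (y - x) *\<^sub>R \<psi> x) / norm (y - x)) \<longlongrightarrow> 0) (at x within A)"
  proof (rule Lim_null_comparison)
    show "\<forall>\<^sub>F y in at x within A. norm (norm (\<phi> y *\<^sub>R \<psi> y - \<phi> x *\<^sub>R \<psi> x - \<phi>' (y - x) *\<^sub>R \<psi> x) / norm (y - x)) \<le>
      norm (\<phi> y - \<phi> x - \<phi>' (y - x)) / norm (y - x) * norm (\<psi> y) + C * norm (\<psi> y - \<psi> x)"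
      using est by (intro always_eventually allI) simp
    show "((\<lambda>y. norm (\<phi> y - \<phi> x - \<phi>' (y - x)) / norm (y - x) * norm (\<psi> y) + C * norm (\<psi> y - \<psi> x)) \<longlongrightarrow> 0) (at x within A)"
      using lim by simp
  qed
  then show ?thesis
    unfolding has_derivative_iff_norm using bounded_linear_scaleR_const[OF bl] by simp
qed

text \<open>The function \<open>f\<close> extends \<open>H\<close>, read on the quotient, to an open set of the
  ambient space. Condition \<open>gradW\<close> holds for an extension that is constant in the directions
  perpendicular to \<open>W\<close>; it lets gradients represent differentials on the slice.\<close>

locale equivariant_chart =
  fixes W S :: "'v::euclidean_space set"
    and \<omega> :: "'v \<Rightarrow> 'v \<Rightarrow> 'v \<Rightarrow> real"
    and P :: "'v phase set"
    and H :: "'v phase \<Rightarrow> real"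
    and N :: "'v quot set" and f :: "'v quot \<Rightarrow> real"
  assumes W: "subspace W" and S: "openin (top_of_set W) S" and symp: "symplectic_form_on W S \<omega>"
    and P: "invariant_nbhd S P" and inv: "\<And>k p. k \<in> SO3 \<Longrightarrow> p \<in> P \<Longrightarrow> H (act k p) = H p"
    and diff: "\<And>p. p \<in> P \<Longrightarrow> H differentiable (at p within P)"
    and N: "open N" and f: "Cinf_on N f"
    and NP: "\<And>x. x \<in> N \<Longrightarrow> snd x \<in> W \<Longrightarrow> (mat 1, x) \<in> P"
    and Hf: "\<And>x. x \<in> N \<Longrightarrow> snd x \<in> W \<Longrightarrow> H (mat 1, x) = f x"
    and gradW: "\<And>x. x \<in> N \<Longrightarrow> snd (grad f x) \<in> W"
begin

definition ang :: "'v quot \<Rightarrow> real^3" where "ang x = fst (grad f x)"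

definition hess :: "'v quot \<Rightarrow> 'v quot \<Rightarrow> 'v quot" where "hess x = frechet_derivative (grad f) (at x)"

text \<open>The Hamiltonian vector \<open>J w\<close>, the action of the symplectic structure matrix of the slice at
  \<open>s\<close>.\<close>

definition sharp :: "'v \<Rightarrow> 'v \<Rightarrow> 'v" where
  "sharp s w = (THE z. z \<in> W \<and> (\<forall>v\<in>W. \<omega> s z v = inner w v))"

lemma PD: "(g, x) \<in> P \<Longrightarrow> g \<in> SO3 \<and> snd x \<in> S"
proof -
  assume gx: "(g, x) \<in> P"
  have "P \<subseteq> SO3 \<times> (UNIV \<times> S)"
    using P openin_imp_subset unfolding invariant_nbhd_def by fast
  then have "(g, x) \<in> SO3 \<times> (UNIV \<times> S)" using gx by (rule subsetD)
  then show "g \<in> SO3 \<and> snd x \<in> S" by (simp add: mem_Times_iff)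
qed

lemma SW: "S \<subseteq> W"
  using S by (rule openin_imp_subset)

lemma P_iff: "g \<in> SO3 \<Longrightarrow> (g, x) \<in> P \<longleftrightarrow> (mat 1, x) \<in> P"
proof
  assume g: "g \<in> SO3"
  have act: "act k p \<in> P" if "k \<in> SO3" "p \<in> P" for k p
    using P that unfolding invariant_nbhd_def by simp
  show "(mat 1, x) \<in> P" if "(g, x) \<in> P"
    using act[OF SO3_inverse[OF g] that] SO3_transpose[OF g] unfolding act_def by (cases x) simp
  show "(g, x) \<in> P" if "(mat 1, x) \<in> P"
    using act[OF g that] unfolding act_def by (cases x) simp
qed

lemma NS: "x \<in> N \<Longrightarrow> snd x \<in> W \<Longrightarrow> snd x \<in> S"
  using PD NP by blast

lemma H_eq:
  assumes "g \<in> SO3" "x \<in> N" "snd x \<in> W"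
  shows "H (g, x) = f x"
  using inv[OF assms(1) NP[OF assms(2,3)]] Hf[OF assms(2,3)] unfolding act_def by (cases x) simp

lemma form:
  assumes "s \<in> S"
  shows "bilinear (\<omega> s)" "\<And>u. u \<in> W \<Longrightarrow> \<omega> s u u = 0" "nondegenerate_on W (\<omega> s)"
proof -
  show "bilinear (\<omega> s)" using symp assms unfolding symplectic_form_on_def by simp
  show "\<omega> s u u = 0" if "u \<in> W" for u using symp assms that unfolding symplectic_form_on_def by simp
  show "nondegenerate_on W (\<omega> s)" using symp assms unfolding symplectic_form_on_def nondegenerate_on_def by simp
qed

lemma form_tendsto:
  assumes s: "(s \<longlongrightarrow> s') F" "\<And>k. s k \<in> S" "s' \<in> S" and uv: "u \<in> W" "v \<in> W"
  shows "((\<lambda>k. \<omega> (s k) u v) \<longlongrightarrow> \<omega> s' u v) F"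
proof -
  have "smooth_on S (\<lambda>s. \<omega> s u v)" using symp uv unfolding symplectic_form_on_def by blast
  then have "\<exists>U G. open U \<and> s' \<in> U \<and> Cinf_on U G \<and> (\<forall>y\<in>S \<inter> U. G y = \<omega> y u v)"
    using s(3) unfolding smooth_on_def by (rule bspec)
  then obtain U G where U: "open U" "s' \<in> U" "Cinf_on U G" and G: "\<forall>y\<in>S \<inter> U. G y = \<omega> y u v"
    by blast
  have "Ck_on 0 U G" using U(3) unfolding Cinf_on_def by (rule spec)
  then have "continuous_on U G" by simp
  then have "isCont G s'" using continuous_on_eq_continuous_at[OF U(1)] U(2) by blast
  then have "((\<lambda>k. G (s k)) \<longlongrightarrow> G s') F" using s(1) by (rule isCont_tendsto_compose)
  moreover have "\<forall>\<^sub>F k in F. s k \<in> U" using s(1) U(1,2) by (rule topological_tendstoD)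
  then have "\<forall>\<^sub>F k in F. G (s k) = \<omega> (s k) u v" by (rule eventually_mono) (simp add: G s(2))
  ultimately have "((\<lambda>k. \<omega> (s k) u v) \<longlongrightarrow> G s') F" by (rule Lim_transform_eventually)
  then show ?thesis using G U(2) s(3) by simp
qed

lemma sharp:
  assumes "s \<in> S"
  shows "sharp s w \<in> W" "\<And>v. v \<in> W \<Longrightarrow> \<omega> s (sharp s w) v = inner w v"
    "\<And>z. z \<in> W \<Longrightarrow> (\<And>v. v \<in> W \<Longrightarrow> \<omega> s z v = inner w v) \<Longrightarrow> z = sharp s w"
proof -
  have "linear (inner w)" by (rule bounded_linear.linear[OF bounded_linear_inner_right])
  from form_representation[OF W form(1,3)[OF assms] this]
  have ex: "\<exists>!z. z \<in> W \<and> (\<forall>v\<in>W. \<omega> s z v = inner w v)" .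
  from theI'[OF ex] show "sharp s w \<in> W" "\<And>v. v \<in> W \<Longrightarrow> \<omega> s (sharp s w) v = inner w v"
    unfolding sharp_def by simp_all
  show "z = sharp s w" if "z \<in> W" "\<And>v. v \<in> W \<Longrightarrow> \<omega> s z v = inner w v" for z
    using the1_equality[OF ex, of z] that unfolding sharp_def by simp
qed

lemma linear_sharp:
  assumes s: "s \<in> S"
  shows "linear (sharp s)"
proof (rule linearI)
  note bl = bilinear_ladd[OF form(1)[OF s]] bilinear_lmul[OF form(1)[OF s]]
  show "sharp s (u + v) = sharp s u + sharp s v" for u v
    by (rule sharp(3)[OF s, symmetric]) (simp_all add: subspace_add[OF W] sharp[OF s] bl inner_add_left)
  show "sharp s (r *\<^sub>R u) = r *\<^sub>R sharp s u" for r u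
    by (rule sharp(3)[OF s, symmetric]) (simp_all add: subspace_scale[OF W] sharp[OF s] bl)
qed

lemma sharp_tendsto:
  assumes s: "(s \<longlongrightarrow> s') F" "\<And>k. s k \<in> S" "s' \<in> S"
  shows "((\<lambda>k. sharp (s k) w) \<longlongrightarrow> sharp s' w) F"
proof (rule tendsto_form_solution[OF W, of "\<lambda>k. \<omega> (s k)" "\<omega> s'"])
  show "((\<lambda>k. \<omega> (s k) u v) \<longlongrightarrow> \<omega> s' u v) F" if "u \<in> W" "v \<in> W" for u v
    by (rule form_tendsto[OF s that])
  show "((\<lambda>k. \<omega> (s k) (sharp (s k) w) v) \<longlongrightarrow> \<omega> s' (sharp s' w) v) F" if "v \<in> W" for v
    unfolding sharp(2)[OF s(2) that] sharp(2)[OF s(3) that] by (rule tendsto_const)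
qed (simp_all add: form[OF s(2)] form[OF s(3)] sharp(1)[OF s(2)] sharp(1)[OF s(3)])

lemma f_deriv: "x \<in> N \<Longrightarrow> (f has_derivative (\<lambda>v. inner (grad f x) v)) (at x)"
  by (rule has_derivative_grad[OF Cinf_on_has_derivative[OF f]])

lemma Cinf_grad: "Cinf_on N (grad f)"
  by (rule Cinf_on_grad[OF N f])

lemma grad_deriv: "x \<in> N \<Longrightarrow> (grad f has_derivative hess x) (at x)"
  unfolding hess_def by (rule Cinf_on_has_derivative[OF Cinf_grad])

lemma linear_hess: "x \<in> N \<Longrightarrow> linear (hess x)"
  using grad_deriv by (rule has_derivative_linear)

lemma hess_sym: "x \<in> N \<Longrightarrow> inner (hess x u) v = inner u (hess x v)"
  by (rule hessian_symmetric[OF N _ f_deriv grad_deriv])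

lemma line_in_chart:
  assumes "x \<in> N" "snd x \<in> W" "snd w \<in> W"
  shows "\<forall>\<^sub>F t in at (0::real). x + t *\<^sub>R w \<in> N \<and> snd (x + t *\<^sub>R w) \<in> W"
proof -
  have "((\<lambda>t::real. x + t *\<^sub>R w) \<longlongrightarrow> x + 0 *\<^sub>R w) (at 0)" by (intro tendsto_intros)
  then have "\<forall>\<^sub>F t in at (0::real). x + t *\<^sub>R w \<in> N" using N assms(1) by (intro topological_tendstoD) auto
  then show ?thesis
    by (rule eventually_mono) (use assms(2,3) W in \<open>simp add: subspace_add subspace_scale\<close>)
qed

lemma dH:
  assumes g: "g \<in> SO3" and x: "x \<in> N" "snd x \<in> W" and w: "snd w \<in> W"
  shows "frechet_derivative H (at (g, x) within P) (g ** hat \<eta>, w) = inner (grad f x) w"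
proof -
  obtain R :: "real \<Rightarrow> real^3^3" where R: "R 0 = mat 1" "\<And>t. R t \<in> SO3" "(R has_vector_derivative hat \<eta>) (at 0)"
    using SO3_curve by blast
  define \<gamma> where "\<gamma> t = (g ** R t, x + t *\<^sub>R w)" for t
  have ev: "\<forall>\<^sub>F t in at 0. \<gamma> t \<in> P \<and> H (\<gamma> t) = f (x + t *\<^sub>R w)"
    using line_in_chart[OF x w]
  proof (rule eventually_mono)
    fix t assume t: "x + t *\<^sub>R w \<in> N \<and> snd (x + t *\<^sub>R w) \<in> W"
    have "g ** R t \<in> SO3" by (rule SO3_mult[OF g R(2)])
    then show "\<gamma> t \<in> P \<and> H (\<gamma> t) = f (x + t *\<^sub>R w)"
      unfolding \<gamma>_def using t NP P_iff[OF \<open>g ** R t \<in> SO3\<close>] H_eq[OF \<open>g ** R t \<in> SO3\<close>] by simp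
  qed
  have PX: "(g, x) \<in> P" using NP[OF x] P_iff[OF g] by blast
  have \<gamma>0: "\<gamma> 0 = (g, x)" unfolding \<gamma>_def R(1) by (simp add: matrix_mul_rid)
  note l = line_has_vector_derivative[of x w 0]
  have \<gamma>': "(\<gamma> has_vector_derivative (g ** hat \<eta>, w)) (at 0)"
    unfolding \<gamma>_def
    by (intro has_vector_derivative_Pair l bounded_linear.has_vector_derivative[OF
          bounded_bilinear.bounded_linear_right[OF bounded_bilinear_matrix_mult] R(3)])
  have "((\<lambda>t. H (\<gamma> t)) has_vector_derivative frechet_derivative H (at (g, x) within P) (g ** hat \<eta>, w)) (at 0)"
  proof (rule has_derivative_along_curve[OF _ \<gamma>0 \<gamma>'])
    show "(H has_derivative frechet_derivative H (at (g, x) within P)) (at (g, x) within P)"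
      using diff[OF PX] frechet_derivative_works by blast
    show "\<forall>\<^sub>F t in at 0. \<gamma> t \<in> P" using ev by (rule eventually_mono) simp
  qed
  moreover have "((\<lambda>t. H (\<gamma> t)) has_vector_derivative inner (grad f x) w) (at 0)"
  proof -
    have "((\<lambda>t. f (x + t *\<^sub>R w)) has_vector_derivative inner (grad f x) w) (at 0)"
      by (rule has_derivative_along_curve[where A = UNIV and x = x, OF f_deriv[OF x(1)] _ l]) simp_all
    then show ?thesis
      unfolding has_vector_derivative_iff_quotient
    proof (rule Lim_transform_eventually)
      show "\<forall>\<^sub>F s in at 0. (1 / (s - 0)) *\<^sub>R (f (x + s *\<^sub>R w) - f (x + 0 *\<^sub>R w)) = (1 / (s - 0)) *\<^sub>R (H (\<gamma> s) - H (\<gamma> 0))"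
        using ev by (rule eventually_mono) (simp add: \<gamma>0 H_eq[OF g x])
    qed
  qed
  ultimately show ?thesis by (rule vector_derivative_unique_at)
qed

lemma phase_form_eval:
  assumes g: "g \<in> SO3"
  shows "phase_form \<omega> (g, x) (g ** hat \<eta>1, w1) (g ** hat \<eta>2, w2) =
    inner (fst w2) \<eta>1 - inner (fst w1) \<eta>2 + inner (fst x) (cross3 \<eta>1 \<eta>2) + \<omega> (snd x) (snd w1) (snd w2)"
proof -
  have "vee (transpose g ** (g ** hat \<eta>)) = \<eta>" for \<eta>
    unfolding matrix_mul_assoc SO3_transpose[OF g] by (simp add: matrix_mul_lid vee_hat)
  then show ?thesis unfolding phase_form_def by (simp add: Let_def split: prod.split)
qed

text \<open>Left-trivialized Hamilton equations on the cotangent bundle of the rotation group; nondegeneracy of the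
  form of the slice gives uniqueness.\<close>

lemma ham_field_eq:
  assumes g: "g \<in> SO3" and x: "x \<in> N" "snd x \<in> W"
  shows "ham_field W \<omega> P H (g, x) = (g ** hat (ang x), cross3 (fst x) (ang x), sharp (snd x) (snd (grad f x)))"
  unfolding ham_field_def
proof (rule the_equality)
  note s = NS[OF x]
  let ?X = "(g ** hat (ang x), cross3 (fst x) (ang x), sharp (snd x) (snd (grad f x)))"
  have tri: "inner a (cross3 b c) = inner (cross3 a b) c" for a b c :: "real^3"
    by (simp only: cross_triple[of a b c] inner_commute[of a])
  have gr: "inner (grad f x) w = inner (ang x) (fst w) + inner (snd (grad f x)) (snd w)" for w
    unfolding ang_def by (simp add: inner_prod_def)
  show "?X \<in> phase_tangent W (g, x) \<and>
    (\<forall>Y\<in>phase_tangent W (g, x). phase_form \<omega> (g, x) ?X Y = frechet_derivative H (at (g, x) within P) Y)"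
  proof (intro conjI ballI)
    show "?X \<in> phase_tangent W (g, x)" unfolding phase_tangent_def fst_conv
      by (rule CollectI, rule exI[of _ "ang x"], rule exI[of _ "cross3 (fst x) (ang x)"],
          rule exI[of _ "sharp (snd x) (snd (grad f x))"]) (simp add: sharp(1)[OF s])
    fix Y assume "Y \<in> phase_tangent W (g, x)"
    then obtain \<eta> \<sigma> v where Y: "Y = (g ** hat \<eta>, (\<sigma>, v))" "v \<in> W" unfolding phase_tangent_def fst_conv by blast
    show "phase_form \<omega> (g, x) ?X Y = frechet_derivative H (at (g, x) within P) Y"
      unfolding Y(1) phase_form_eval[OF g]
      using dH[OF g x, of "(\<sigma>, v)" \<eta>] Y(2) sharp(2)[OF s Y(2)] tri[of "fst x" "ang x" \<eta>]
        inner_commute[of \<sigma> "ang x"] by (simp add: gr)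
  qed
  fix X assume X: "X \<in> phase_tangent W (g, x) \<and>
    (\<forall>Y\<in>phase_tangent W (g, x). phase_form \<omega> (g, x) X Y = frechet_derivative H (at (g, x) within P) Y)"
  from conjunct1[OF this] obtain \<eta> \<sigma> v where Xe: "X = (g ** hat \<eta>, (\<sigma>, v))" "v \<in> W" unfolding phase_tangent_def fst_conv by blast
  have eq: "inner \<sigma>' \<eta> - inner \<sigma> \<eta>' + inner (fst x) (cross3 \<eta> \<eta>') + \<omega> (snd x) v v' =
      inner (ang x) \<sigma>' + inner (snd (grad f x)) v'" if "v' \<in> W" for \<eta>' \<sigma>' v'
  proof -
    have Y: "(g ** hat \<eta>', (\<sigma>', v')) \<in> phase_tangent W (g, x)" unfolding phase_tangent_def fst_conv
      by (rule CollectI, rule exI[of _ \<eta>'], rule exI[of _ \<sigma>'], rule exI[of _ v']) (simp add: that)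
    have "phase_form \<omega> (g, x) X (g ** hat \<eta>', (\<sigma>', v')) =
        frechet_derivative H (at (g, x) within P) (g ** hat \<eta>', (\<sigma>', v'))"
      by (rule bspec[OF conjunct2[OF X] Y])
    also have "\<dots> = inner (grad f x) (\<sigma>', v')" by (rule dH[OF g x]) (simp add: that)
    finally have "phase_form \<omega> (g, x) X (g ** hat \<eta>', (\<sigma>', v')) = inner (grad f x) (\<sigma>', v')" .
    then show ?thesis unfolding Xe(1) phase_form_eval[OF g] gr by simp
  qed
  note bz = bilinear_rzero[OF form(1)[OF s]]
  have W0: "0 \<in> W" by (rule subspace_0[OF W])
  have "inner \<sigma>' \<eta> = inner \<sigma>' (ang x)" for \<sigma>' using eq[OF W0, of \<sigma>' 0] inner_commute[of \<sigma>' "ang x"] by (simp add: bz)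
  then have \<eta>: "\<eta> = ang x" using vector_eq_ldot[of \<eta> "ang x"] by blast
  have "inner \<sigma> \<eta>' = inner (cross3 (fst x) (ang x)) \<eta>'" for \<eta>'
    using eq[OF W0, of 0 \<eta>'] unfolding \<eta> by (simp add: bz tri)
  then have \<sigma>: "\<sigma> = cross3 (fst x) (ang x)" using vector_eq_rdot[of \<sigma> "cross3 (fst x) (ang x)"] by blast
  have "v = sharp (snd x) (snd (grad f x))"
  proof (rule sharp(3)[OF s Xe(2)])
    show "\<omega> (snd x) v v' = inner (snd (grad f x)) v'" if "v' \<in> W" for v'
      using eq[OF that, of 0 0] by simp
  qed
  then show "X = ?X" unfolding Xe(1) \<eta> \<sigma> by simp
qed

lemma reduced_field_eq:
  assumes "x \<in> N" "snd x \<in> W"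
  shows "reduced_field W \<omega> P H x = (cross3 (fst x) (ang x), sharp (snd x) (snd (grad f x)))"
  unfolding reduced_field_def ham_field_eq[OF SO3_one assms] by simp

lemma rel_equilibria_iff:
  assumes x: "x \<in> N" "snd x \<in> W"
  shows "x \<in> rel_equilibria W \<omega> P H \<longleftrightarrow> cross3 (fst x) (ang x) = 0 \<and> snd (grad f x) = 0"
proof
  note s = NS[OF x]
  assume "x \<in> rel_equilibria W \<omega> P H"
  then obtain p \<xi> where p: "p \<in> P" "snd p = x" "ham_field W \<omega> P H p = generator \<xi> p"
    unfolding rel_equilibria_def by blast
  obtain g where g: "p = (g, x)" using p(2) by (cases p) simp
  have "g \<in> SO3" using PD p(1) g by blast
  then have eq: "cross3 (fst x) (ang x) = 0" "sharp (snd x) (snd (grad f x)) = 0"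
    using p(3) ham_field_eq[OF _ x] unfolding g generator_def by simp_all
  have "inner (snd (grad f x)) (snd (grad f x)) = 0"
    using sharp(2)[OF s gradW[OF x(1)], of "snd (grad f x)"] eq(2) by (simp add: bilinear_lzero[OF form(1)[OF s]])
  with eq(1) show "cross3 (fst x) (ang x) = 0 \<and> snd (grad f x) = 0" by simp
next
  note s = NS[OF x]
  assume eq: "cross3 (fst x) (ang x) = 0 \<and> snd (grad f x) = 0"
  have "sharp (snd x) 0 = 0" using linear_0[OF linear_sharp[OF s]] .
  then have "ham_field W \<omega> P H (mat 1, x) = generator (ang x) (mat 1, x)"
    unfolding ham_field_eq[OF SO3_one x] generator_def using eq
    by (simp add: matrix_mul_lid matrix_mul_rid zero_prod_def)
  then have "snd (mat 1 :: real^3^3, x) \<in> rel_equilibria W \<omega> P H"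
    unfolding rel_equilibria_def using NP[OF x] by blast
  then show "x \<in> rel_equilibria W \<omega> P H" by simp
qed

lemma orbit_space_iff: "x \<in> orbit_space P \<longleftrightarrow> (mat 1, x) \<in> P"
proof
  assume "x \<in> orbit_space P"
  then obtain p where p: "p \<in> P" "x = snd p" unfolding orbit_space_def by blast
  obtain g where "p = (g, x)" using p(2) by (cases p) simp
  then show "(mat 1, x) \<in> P" using p(1) P_iff PD by blast
next
  assume "(mat 1, x) \<in> P"
  then show "x \<in> orbit_space P" unfolding orbit_space_def by (rule image_eqI[rotated]) simp
qed

lemma reduced_space_iff: "x \<in> reduced_space P \<mu> \<longleftrightarrow> (mat 1, x) \<in> P \<and> norm (fst x) = norm \<mu>"
proof
  assume "x \<in> reduced_space P \<mu>"
  then obtain p where p: "p \<in> P" "momentum p = \<mu>" "x = snd p" unfolding reduced_space_def by blast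
  obtain g where g: "p = (g, x)" using p(3) by (cases p) simp
  have gS: "g \<in> SO3" using p(1) g PD by blast
  have "g *v fst x = \<mu>" using p(2) unfolding g momentum_def by (cases x) simp
  then show "(mat 1, x) \<in> P \<and> norm (fst x) = norm \<mu>"
    using p(1) SO3_norm[OF gS, of "fst x"] unfolding g P_iff[OF gS] by simp
next
  assume x: "(mat 1, x) \<in> P \<and> norm (fst x) = norm \<mu>"
  obtain h :: "real^3 \<Rightarrow> real^3" where h: "orthogonal_transformation h" "det (matrix h) = 1" "h (fst x) = \<mu>"
  proof -
    have "2 \<le> CARD(3)" "norm (fst x) = norm \<mu>" using x by simp_all
    then show thesis using rotation_exists[of "fst x" \<mu>] that by blast
  qed
  have linh: "linear h" using h(1) by (rule orthogonal_transformation_linear)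
  have "matrix h \<in> SO3" unfolding SO3_def rotation_matrix_def
    using h(2) orthogonal_transformation_matrix[of h] h(1) by simp
  moreover have "matrix h *v fst x = \<mu>"
    using matrix_works[of h "fst x"] linh h(3) by (simp add: linear_matrix_vector_mul_eq)
  ultimately have "(matrix h, x) \<in> {p \<in> P. momentum p = \<mu>}"
    using x P_iff unfolding momentum_def by (cases x) simp
  then show "x \<in> reduced_space P \<mu>" unfolding reduced_space_def by (rule image_eqI[rotated]) simp
qed

end

section \<open>Linearization at relative equilibria\<close>

lemma reduced_tangent_0: "reduced_tangent W (0, s) = {0} \<times> W"
  unfolding reduced_tangent_def by (auto simp: zero_prod_def)

lemma triple_perp:
  fixes a k \<tau> :: "real^3"
  assumes "inner a \<tau> = 0"
  shows "inner a (cross3 (cross3 a k) \<tau>) = - ((norm a)\<^sup>2 * inner k \<tau>)"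
proof -
  have "cross3 (cross3 a k) \<tau> = - cross3 \<tau> (cross3 a k)" by (rule cross_skew)
  then have "inner a (cross3 (cross3 a k) \<tau>) = - inner a (cross3 \<tau> (cross3 a k))" by simp
  also have "cross3 \<tau> (cross3 a k) = inner \<tau> k *\<^sub>R a - inner \<tau> a *\<^sub>R k" by (rule Lagrange)
  also have "inner \<tau> a = 0" using assms by (simp add: inner_commute[of \<tau>])
  finally show ?thesis by (simp add: dot_square_norm inner_commute[of \<tau>])
qed

text \<open>For nonzero momentum the tangent plane of the sphere is the perpendicular plane, by the identity for
  iterated cross products.\<close>

lemma reduced_tangent_nonzero:
  assumes "fst x \<noteq> 0"
  shows "reduced_tangent W x = perp_slice W (fst x)"
proof (rule subset_antisym; rule subsetI)
  fix u assume "u \<in> reduced_tangent W x"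
  then obtain \<eta> v where u: "u = (cross3 \<eta> (fst x), v)" "v \<in> W" unfolding reduced_tangent_def by blast
  show "u \<in> perp_slice W (fst x)" unfolding u(1) perp_slice_def using u(2) by (simp add: dot_cross_self)
next
  fix u assume u: "u \<in> perp_slice W (fst x)"
  then have u': "inner (fst x) (fst u) = 0" "snd u \<in> W" unfolding perp_slice_def by simp_all
  let ?\<rho> = "fst x"
  define \<eta> where "\<eta> = (1 / (norm ?\<rho>)\<^sup>2) *\<^sub>R cross3 ?\<rho> (fst u)"
  have "cross3 (cross3 ?\<rho> (fst u)) ?\<rho> = - cross3 ?\<rho> (cross3 ?\<rho> (fst u))" by (rule cross_skew)
  also have "cross3 ?\<rho> (cross3 ?\<rho> (fst u)) = inner ?\<rho> (fst u) *\<^sub>R ?\<rho> - inner ?\<rho> ?\<rho> *\<^sub>R fst u" by (rule Lagrange)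
  finally have "cross3 \<eta> ?\<rho> = fst u" unfolding \<eta>_def cross_mult_left u'(1) using assms
    by (simp add: dot_square_norm)
  then have "u = (cross3 \<eta> ?\<rho>, snd u)" by simp
  then show "u \<in> reduced_tangent W x" unfolding reduced_tangent_def using u'(2) by blast
qed

lemma bounded_bilinear_cross3: "bounded_bilinear cross3"
  using bilinear_cross bilinear_conv_bounded_bilinear by blast

lemma bounded_linear_matrix_apply: "bounded_linear (\<lambda>M :: real^3^3. M *v w)"
proof -
  have "linear (\<lambda>M :: real^3^3. M *v w)"
    by (intro linearI) (simp_all add: matrix_vector_mult_add_rdistrib scaleR_matrix_vector_assoc[symmetric])
  then show ?thesis by (simp add: linear_conv_bounded_linear)
qed

context equivariant_chart
begin

lemma isCont_hess: "x \<in> N \<Longrightarrow> isCont (\<lambda>y. hess y u) x"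
proof -
  assume x: "x \<in> N"
  have "Cinf_on N (\<lambda>y. hess y u)" unfolding hess_def by (rule Cinf_on_frechet_derivative[OF Cinf_grad])
  then have "Ck_on 0 N (\<lambda>y. hess y u)" unfolding Cinf_on_def by (rule spec)
  then have "continuous_on N (\<lambda>y. hess y u)" by simp
  then show ?thesis using continuous_on_eq_continuous_at[OF N] x by blast
qed

lemma isCont_grad: "x \<in> N \<Longrightarrow> isCont (grad f) x"
  using grad_deriv by (rule has_derivative_continuous)

definition lin_map :: "'v quot \<Rightarrow> 'v quot \<Rightarrow> 'v quot" where
  "lin_map x u = (cross3 (fst u) (ang x) + cross3 (fst x) (fst (hess x u)), sharp (snd x) (snd (hess x u)))"

text \<open>At an equilibrium \<open>D\<^sub>sf = 0\<close>, so continuity of the structure \<open>s \<mapsto>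
  J\<close> suffices to differentiate the product \<open>J D\<^sub>sf\<close>.\<close>

lemma reduced_field_has_derivative:
  assumes x: "x \<in> N" "snd x \<in> W" "snd (grad f x) = 0" and A: "A \<subseteq> {y. snd y \<in> W}" "x \<in> A"
  shows "(reduced_field W \<omega> P H has_derivative lin_map x) (at x within A)"
proof -
  define \<sigma> where "\<sigma> y = (if y \<in> N \<and> snd y \<in> W then snd y else snd x)" for y
  define g where "g y = (cross3 (fst y) (fst (grad f y)), \<Sum>b\<in>Basis. inner (snd (grad f y)) b *\<^sub>R sharp (\<sigma> y) b)" for y
  have \<sigma>S: "\<sigma> y \<in> S" for y unfolding \<sigma>_def using NS x by simp
  have sx: "snd x \<in> S" using NS x by simp
  have "((\<lambda>y. snd y) \<longlongrightarrow> snd x) (at x within A)" by (intro tendsto_intros)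
  moreover have "\<forall>\<^sub>F y in at x within A. snd y = \<sigma> y"
  proof -
    have "\<forall>\<^sub>F y in at x within A. y \<in> N \<inter> A"
      using N x(1) unfolding eventually_at_topological by blast
    then show ?thesis by (rule eventually_mono) (use A(1) in \<open>auto simp: \<sigma>_def\<close>)
  qed
  ultimately have \<sigma>: "(\<sigma> \<longlongrightarrow> snd x) (at x within A)" by (rule Lim_transform_eventually)
  have sh: "((\<lambda>y. sharp (\<sigma> y) b) \<longlongrightarrow> sharp (\<sigma> x) b) (at x within A)" for b
    using sharp_tendsto[OF \<sigma> \<sigma>S sx] x unfolding \<sigma>_def[of x] by simp
  have gr: "(grad f has_derivative hess x) (at x within A)"
    by (rule has_derivative_at_withinI[OF grad_deriv[OF x(1)]])
  have "(g has_derivative (\<lambda>u. (cross3 (fst x) (fst (hess x u)) + cross3 (fst u) (fst (grad f x)),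
      \<Sum>b\<in>Basis. inner (snd (hess x u)) b *\<^sub>R sharp (\<sigma> x) b))) (at x within A)"
    unfolding g_def
  proof (intro has_derivative_Pair has_derivative_sum)
    show "((\<lambda>y. cross3 (fst y) (fst (grad f y))) has_derivative
        (\<lambda>u. cross3 (fst x) (fst (hess x u)) + cross3 (fst u) (fst (grad f x)))) (at x within A)"
      by (rule bounded_bilinear.FDERIV[OF bounded_bilinear_cross3 has_derivative_fst[OF has_derivative_ident]
            has_derivative_fst[OF gr]])
    show "((\<lambda>y. inner (snd (grad f y)) b *\<^sub>R sharp (\<sigma> y) b) has_derivative
        (\<lambda>u. inner (snd (hess x u)) b *\<^sub>R sharp (\<sigma> x) b)) (at x within A)" for b
      by (rule has_derivative_scaleR_zero[OF has_derivative_inner_left[OF has_derivative_snd[OF gr]] _ sh])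
        (simp add: x(3))
  qed
  moreover have "(\<lambda>u. (cross3 (fst x) (fst (hess x u)) + cross3 (fst u) (fst (grad f x)),
      \<Sum>b\<in>Basis. inner (snd (hess x u)) b *\<^sub>R sharp (\<sigma> x) b)) = lin_map x"
  proof
    fix u
    have "(\<Sum>b\<in>Basis. inner (snd (hess x u)) b *\<^sub>R sharp (snd x) b) = sharp (snd x) (snd (hess x u))"
      by (rule linear_basis_expansion[OF linear_sharp[OF sx], symmetric])
    then show "(cross3 (fst x) (fst (hess x u)) + cross3 (fst u) (fst (grad f x)),
      \<Sum>b\<in>Basis. inner (snd (hess x u)) b *\<^sub>R sharp (\<sigma> x) b) = lin_map x u"
      unfolding lin_map_def ang_def using x by (simp add: \<sigma>_def add.commute)
  qed
  ultimately have "(g has_derivative lin_map x) (at x within A)" by simp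
  then show ?thesis
  proof (rule has_derivative_transform_local[OF _ N x(1) A(2)])
    fix y assume "y \<in> A \<inter> N"
    then have y: "y \<in> N" "snd y \<in> W" using A(1) by blast+
    then have sy: "\<sigma> y = snd y" unfolding \<sigma>_def by simp
    show "reduced_field W \<omega> P H y = g y"
      unfolding g_def sy linear_basis_expansion[OF linear_sharp[OF NS[OF y]], symmetric]
        reduced_field_eq[OF y] ang_def ..
  qed
qed

lemma reduced_space_subset: "reduced_space P \<mu> \<subseteq> {y. snd y \<in> W}"
proof
  fix y assume "y \<in> reduced_space P \<mu>"
  then have "(mat 1, y) \<in> P" using reduced_space_iff by blast
  then have "snd y \<in> S" using PD by blast
  then show "y \<in> {y. snd y \<in> W}" using SW by blast
qed

lemma self_in_reduced_space: "x \<in> N \<Longrightarrow> snd x \<in> W \<Longrightarrow> x \<in> reduced_space P (fst x)"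
  using reduced_space_iff NP by blast

lemma linearization_eq:
  assumes x: "x \<in> N" "snd x \<in> W" "snd (grad f x) = 0" and u: "u \<in> reduced_tangent W x"
  shows "linearization W \<omega> P H x u = lin_map x u"
proof -
  obtain \<eta> v where uv: "u = (cross3 \<eta> (fst x), v)" "v \<in> W" using u unfolding reduced_tangent_def by blast
  obtain R :: "real \<Rightarrow> real^3^3" where R: "R 0 = mat 1" "\<And>t. R t \<in> SO3" "(R has_vector_derivative hat \<eta>) (at 0)"
    using SO3_curve by blast
  define \<gamma> where "\<gamma> t = (R t *v fst x, snd x + t *\<^sub>R v)" for t
  have \<gamma>0: "\<gamma> 0 = x" unfolding \<gamma>_def R(1) by (simp add: matrix_vector_mul_lid)
  have \<gamma>': "(\<gamma> has_vector_derivative u) (at 0)"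
    unfolding \<gamma>_def uv(1) hat_mult_vec[symmetric]
    by (intro has_vector_derivative_Pair line_has_vector_derivative
        bounded_linear.has_vector_derivative[OF bounded_linear_matrix_apply R(3)])
  have "(\<gamma> \<longlongrightarrow> \<gamma> 0) (at 0)"
    using has_vector_derivative_continuous[OF \<gamma>'] unfolding isCont_def .
  then have "\<forall>\<^sub>F t in at 0. \<gamma> t \<in> N" using N x(1) unfolding \<gamma>0 by (rule topological_tendstoD)
  then have "\<forall>\<^sub>F t in at 0. \<gamma> t \<in> reduced_space P (fst x)"
  proof (rule eventually_mono)
    fix t assume t: "\<gamma> t \<in> N"
    have "snd (\<gamma> t) \<in> W" unfolding \<gamma>_def using uv(2) x(2) W by (simp add: subspace_add subspace_scale)
    moreover have "norm (fst (\<gamma> t)) = norm (fst x)" unfolding \<gamma>_def using SO3_norm[OF R(2)] by simp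
    ultimately show "\<gamma> t \<in> reduced_space P (fst x)" using reduced_space_iff NP[OF t] by blast
  qed
  then show ?thesis unfolding linearization_def
    by (rule frechet_derivative_within_eq[OF reduced_field_has_derivative[OF x reduced_space_subset
            self_in_reduced_space[OF x(1,2)]] \<gamma>0 \<gamma>'])
qed

lemma linear_linearization:
  assumes x: "x \<in> N" "snd x \<in> W" "snd (grad f x) = 0"
  shows "linear (linearization W \<omega> P H x)"
proof -
  have "reduced_field W \<omega> P H differentiable (at x within reduced_space P (fst x))"
    using reduced_field_has_derivative[OF x reduced_space_subset self_in_reduced_space[OF x(1,2)]]
    by (rule differentiableI)
  then show ?thesis unfolding linearization_def using frechet_derivative_works has_derivative_linear by blast
qed

text \<open>The second derivative within the slice agrees with the Hessian of the chart function on \<open>W\<close>,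
  since derivatives within an open subset of \<open>W\<close> are unique on \<open>W\<close>.\<close>

lemma hessian_0_eq:
  assumes x: "(0, s) \<in> N" "s \<in> W" and uv: "u \<in> W" "v \<in> W"
  shows "hessian_0 P H s u v = inner (snd (hess (0, s) (0, u))) v"
proof -
  define A where "A = {s. (0, s) \<in> reduced_space P 0}"
  define T where "T = {s. (0, s) \<in> N}"
  define h where "h s = H (mat 1, 0, s)" for s
  have "open ((\<lambda>s. (0, s)) -` N)"
    by (rule open_vimage[OF N]) (intro continuous_intros)
  then have T: "open T" unfolding T_def vimage_def .
  have AW: "y \<in> W" if "y \<in> A" for y using that reduced_space_subset unfolding A_def by force
  have TA: "y \<in> A" if "y \<in> T" "y \<in> W" for y
  proof -
    have "(mat 1, (0, y)) \<in> P" using NP[of "(0, y)"] that unfolding T_def by simp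
    then show ?thesis unfolding A_def using reduced_space_iff[of "(0, y)" 0] by simp
  qed
  have line: "\<forall>\<^sub>F t in at (0::real). y + t *\<^sub>R w \<in> A" if "y \<in> T" "y \<in> W" "w \<in> W" for y w
  proof -
    have "\<forall>\<^sub>F t in at (0::real). (0, y) + t *\<^sub>R (0, w) \<in> N \<and> snd ((0::real^3, y) + t *\<^sub>R (0, w)) \<in> W"
      using that unfolding T_def by (intro line_in_chart) simp_all
    then show ?thesis by (rule eventually_mono) (simp add: TA T_def)
  qed
  have inner: "frechet_derivative h (at y within A) v = inner (grad f (0, y)) (0, v)" if y: "y \<in> A" "y \<in> T" for y
  proof -
    have yW: "y \<in> W" by (rule AW[OF y(1)])
    have yN: "(0, y) \<in> N" using y(2) unfolding T_def by simp
    have "((\<lambda>s. f (0, s)) has_derivative (\<lambda>w. inner (grad f (0, y)) (0, w))) (at y)"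
    proof -
      have "((\<lambda>s. (0, s)) has_derivative (\<lambda>w. (0, w))) (at y)"
        by (intro has_derivative_Pair has_derivative_const has_derivative_ident)
      from diff_chain_at[OF this f_deriv[OF yN]] show ?thesis unfolding o_def .
    qed
    from has_derivative_at_withinI[OF this]
    have "(h has_derivative (\<lambda>w. inner (grad f (0, y)) (0, w))) (at y within A)"
    proof (rule has_derivative_transform_local[OF _ T y(2) y(1)])
      fix z assume "z \<in> A \<inter> T"
      then have "(0, z) \<in> N" "z \<in> W" using AW unfolding T_def by auto
      then show "h z = f (0, z)" unfolding h_def using Hf[of "(0, z)"] by simp
    qed
    from frechet_derivative_within_eq[OF this _ line_has_vector_derivative line[OF y(2) yW uv(2)]]
    show ?thesis by simp
  qed
  have sT: "s \<in> T" unfolding T_def using x(1) by simp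
  have sA: "s \<in> A" by (rule TA[OF sT x(2)])
  have "((\<lambda>y. inner (grad f (0, y)) (0, v)) has_derivative (\<lambda>w. inner (hess (0, s) (0, w)) (0, v))) (at s)"
  proof -
    have "((\<lambda>s. (0, s)) has_derivative (\<lambda>w. (0, w))) (at s)"
      by (intro has_derivative_Pair has_derivative_const has_derivative_ident)
    from diff_chain_at[OF this grad_deriv[OF x(1)]]
    have "((\<lambda>y. grad f (0, y)) has_derivative (\<lambda>w. hess (0, s) (0, w))) (at s)" unfolding o_def .
    then show ?thesis by (rule has_derivative_inner_left)
  qed
  from has_derivative_at_withinI[OF this]
  have "((\<lambda>y. frechet_derivative h (at y within A) v) has_derivative (\<lambda>w. inner (hess (0, s) (0, w)) (0, v))) (at s within A)"
    by (rule has_derivative_transform_local[OF _ T sT sA]) (simp add: inner)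
  from frechet_derivative_within_eq[OF this _ line_has_vector_derivative line[OF sT x(2) uv(1)]]
  have "frechet_derivative (\<lambda>y. frechet_derivative h (at y within A) v) (at s within A) u = inner (hess (0, s) (0, u)) (0, v)"
    by simp
  then show ?thesis unfolding hessian_0_def hessian_def A_def[symmetric] h_def[symmetric]
    by (simp add: inner_prod_def)
qed

text \<open>The linearization at \<open>x\<close> conjugated by \<open>(\<rho>, v) \<mapsto> (r \<rho>, v)\<close>,
  for a point with \<open>\<mu> = e r\<^sup>2 a\<close>. It is defined on the fixed plane perpendicular to
  \<open>a\<close>, which has a limit as \<open>r \<rightarrow> 0\<close>, in contrast to the coadjoint orbits.\<close>

definition rescaled :: "'v quot \<Rightarrow> real \<Rightarrow> real \<Rightarrow> 'v quot \<Rightarrow> 'v quot" where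
  "rescaled x r e u = (cross3 (fst u) (ang x) + (e * r) *\<^sub>R cross3 (ang x) (fst (hess x (r *\<^sub>R fst u, snd u))),
     sharp (snd x) (snd (hess x (r *\<^sub>R fst u, snd u))))"

lemma linear_rescaled:
  assumes "x \<in> N" "snd x \<in> W"
  shows "linear (rescaled x r e)"
proof -
  define k where "k u = hess x (r *\<^sub>R fst u, snd u)" for u
  have 1: "k (u + w) = k u + k w" for u w
    unfolding k_def linear_add[OF linear_hess[OF assms(1)], symmetric] by (simp add: scaleR_add_right)
  have 2: "k (c *\<^sub>R u) = c *\<^sub>R k u" for u c
    unfolding k_def linear_scale[OF linear_hess[OF assms(1)], symmetric] by (simp add: mult.commute)
  note s = linear_sharp[OF NS[OF assms]]
  have "rescaled x r e = (\<lambda>u. (cross3 (fst u) (ang x) + (e * r) *\<^sub>R cross3 (ang x) (fst (k u)),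
     sharp (snd x) (snd (k u))))"
    unfolding k_def by (rule ext) (rule rescaled_def)
  then show ?thesis
    by (simp only:, intro linearI) (simp_all add: 1 2 linear_add[OF s] linear_scale[OF s] cross_add_left cross_add_right
        cross_mult_left cross_mult_right scaleR_add_right mult.commute)
qed

lemma rescaled_perp:
  assumes "x \<in> N" "snd x \<in> W"
  shows "rescaled x r e u \<in> perp_slice W (ang x)"
  unfolding rescaled_def perp_slice_def using sharp(1)[OF NS[OF assms]]
  by (simp add: inner_add_right dot_cross_self)

text \<open>The form of the coadjoint orbit through \<open>\<mu> = e r\<^sup>2 a\<close> is, up to sign, the area
  form divided by \<open>\<mu>\<close>; rescaling by \<open>r\<close> removes the factor \<open>r\<^sup>2\<close> and
  leaves the sign \<open>- e\<close>.\<close>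

lemma rescaled_skew:
  assumes x: "x \<in> N" "snd x \<in> W" and e: "e = 1 \<or> e = -1" and a: "ang x \<noteq> 0"
    and u: "u \<in> perp_slice W (ang x)" "u' \<in> perp_slice W (ang x)"
  shows "coupled_form (\<omega> (snd x)) (- e) (ang x) (rescaled x r e u) u' +
    coupled_form (\<omega> (snd x)) (- e) (ang x) u (rescaled x r e u') = 0"
proof -
  let ?a = "ang x"
  let ?\<Omega> = "coupled_form (\<omega> (snd x)) (- e) ?a"
  define Q where "Q u w = inner (hess x (r *\<^sub>R fst u, snd u)) (r *\<^sub>R fst w, snd w) - e * inner (fst u) (fst w)" for u w
  have na: "(norm ?a)\<^sup>2 \<noteq> 0" using a by simp
  have ee: "e * e = 1" using e by auto
  have main: "?\<Omega> (rescaled x r e u) w = Q u w" if w: "w \<in> perp_slice W ?a" for u w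
  proof -
    have w': "inner ?a (fst w) = 0" "snd w \<in> W" using w unfolding perp_slice_def by simp_all
    define k where "k = hess x (r *\<^sub>R fst u, snd u)"
    have "cross3 (fst u) ?a = - cross3 ?a (fst u)" by (rule cross_skew)
    then have t1: "inner ?a (cross3 (cross3 (fst u) ?a) (fst w)) = (norm ?a)\<^sup>2 * inner (fst u) (fst w)"
      using triple_perp[OF w'(1), of "fst u"] by simp
    have t2: "inner ?a (cross3 (cross3 ?a (fst k)) (fst w)) = - ((norm ?a)\<^sup>2 * inner (fst k) (fst w))"
      by (rule triple_perp[OF w'(1)])
    have "?\<Omega> (rescaled x r e u) w = inner (snd k) (snd w) + - e * (((norm ?a)\<^sup>2 * inner (fst u) (fst w)
        + (e * r) * (- ((norm ?a)\<^sup>2 * inner (fst k) (fst w)))) / (norm ?a)\<^sup>2)"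
      unfolding coupled_form_def rescaled_def fst_conv snd_conv k_def[symmetric] sharp(2)[OF NS[OF x] w'(2)]
        cross_add_left cross_mult_left inner_add_right inner_scaleR_right t1 t2 ..
    also have "\<dots> = inner (snd k) (snd w) + - e * (inner (fst u) (fst w) - (e * r) * inner (fst k) (fst w))"
      using na by (simp add: diff_divide_distrib)
    also have "\<dots> = inner (snd k) (snd w) - e * inner (fst u) (fst w) + (e * e) * (r * inner (fst k) (fst w))"
      by (simp add: algebra_simps)
    also have "\<dots> = Q u w" unfolding ee Q_def k_def[symmetric] by (simp add: inner_prod_def)
    finally show ?thesis .
  qed
  have sym: "Q u w = Q w u" for u w
    unfolding Q_def using hess_sym[OF x(1), of "(r *\<^sub>R fst u, snd u)" "(r *\<^sub>R fst w, snd w)"]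
    by (simp add: inner_commute)
  note b = bilinear_coupled_form[OF form(1)[OF NS[OF x]], of "- e" ?a]
  have T: "subspace (perp_slice W ?a)" unfolding perp_slice_def subspace_def
    using W by (auto simp: inner_add_right subspace_0 subspace_add subspace_scale)
  have alt: "?\<Omega> w w = 0" if "w \<in> perp_slice W ?a" for w
    using that form(2)[OF NS[OF x]] unfolding coupled_form_def perp_slice_def by simp
  have "?\<Omega> u (rescaled x r e u') = - ?\<Omega> (rescaled x r e u') u"
    by (rule alternating_antisymmetric[OF b T alt u(1) rescaled_perp[OF x]])
  then show ?thesis unfolding main[OF u(1)] main[OF u(2)] using sym[of u u'] by simp
qed

lemma rescaled_conjugate:
  assumes x: "x \<in> N" "snd x \<in> W" "snd (grad f x) = 0" and a: "ang x \<noteq> 0" and e: "e = 1 \<or> e = -1" and r: "r > 0"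
    and \<rho>: "fst x = (e * r\<^sup>2) *\<^sub>R ang x"
  shows "reduced_tangent W x = (\<lambda>u. (r *\<^sub>R fst u, snd u)) ` perp_slice W (ang x)"
    and "\<And>u. u \<in> perp_slice W (ang x) \<Longrightarrow>
      linearization W \<omega> P H x (r *\<^sub>R fst u, snd u) = (r *\<^sub>R fst (rescaled x r e u), snd (rescaled x r e u))"
proof -
  let ?a = "ang x" and ?j = "\<lambda>u :: 'v quot. (r *\<^sub>R fst u, snd u)"
  have er: "e * r\<^sup>2 \<noteq> 0" using e r by auto
  have \<rho>0: "fst x \<noteq> 0" unfolding \<rho> using er a by simp
  have "perp_slice W (fst x) = perp_slice W ?a" unfolding perp_slice_def \<rho> using er by simp
  then have rt: "reduced_tangent W x = perp_slice W ?a" using reduced_tangent_nonzero[OF \<rho>0] by simp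
  show "reduced_tangent W x = ?j ` perp_slice W ?a"
    unfolding rt
  proof (rule subset_antisym; rule subsetI)
    fix u assume u: "u \<in> perp_slice W ?a"
    have "((1 / r) *\<^sub>R fst u, snd u) \<in> perp_slice W ?a" using u unfolding perp_slice_def by simp
    moreover have "u = ?j ((1 / r) *\<^sub>R fst u, snd u)" using r by simp
    ultimately show "u \<in> ?j ` perp_slice W ?a" by (rule image_eqI[rotated])
  next
    fix u assume "u \<in> ?j ` perp_slice W ?a"
    then obtain w where "w \<in> perp_slice W ?a" "u = ?j w" by blast
    then show "u \<in> perp_slice W ?a" unfolding perp_slice_def by simp
  qed
  fix u assume u: "u \<in> perp_slice W ?a"
  have "?j u \<in> reduced_tangent W x" unfolding rt using u unfolding perp_slice_def by simp
  then have "linearization W \<omega> P H x (?j u) = lin_map x (?j u)" by (rule linearization_eq[OF x])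
  also have "\<dots> = ?j (rescaled x r e u)"
    unfolding lin_map_def rescaled_def \<rho> fst_conv snd_conv cross_mult_left
    by (simp add: scaleR_add_right power2_eq_square mult.assoc mult.left_commute)
  finally show "linearization W \<omega> P H x (?j u) = ?j (rescaled x r e u)" .
qed

lemma elliptic_if_rescaled_stable:
  assumes x: "x \<in> N" "snd x \<in> W" "snd (grad f x) = 0" and a: "ang x \<noteq> 0" and e: "e = 1 \<or> e = -1" and r: "r > 0"
    and \<rho>: "fst x = (e * r\<^sup>2) *\<^sub>R ang x"
    and st: "linearly_stable (perp_slice W (ang x)) (rescaled x r e)"
  shows "elliptic W \<omega> P H x"
proof -
  have T: "subspace (perp_slice W (ang x))" unfolding perp_slice_def subspace_def
    using W by (auto simp: inner_add_right subspace_0 subspace_add subspace_scale)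
  have linj: "linear (\<lambda>u :: 'v quot. (r *\<^sub>R fst u, snd u))"
    by (intro linearI) (simp_all add: scaleR_add_right)
  have inj: "inj_on (\<lambda>u :: 'v quot. (r *\<^sub>R fst u, snd u)) (perp_slice W (ang x))"
    using r by (intro inj_onI) (simp add: prod_eq_iff)
  have sub: "rescaled x r e ` perp_slice W (ang x) \<subseteq> perp_slice W (ang x)"
    using rescaled_perp[OF x(1,2)] by (rule image_subsetI)
  show ?thesis unfolding elliptic_def rescaled_conjugate(1)[OF x a e r \<rho>]
    by (rule linearly_stable_conjugate[OF linj inj T rescaled_conjugate(2)[OF x a e r \<rho>] sub
          linear_rescaled[OF x(1,2)] linear_linearization[OF x] st])
qed

lemma lin_unstable_if_rescaled_unstable:
  assumes x: "x \<in> N" "snd x \<in> W" "snd (grad f x) = 0" and a: "ang x \<noteq> 0" and e: "e = 1 \<or> e = -1" and r: "r > 0"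
    and \<rho>: "fst x = (e * r\<^sup>2) *\<^sub>R ang x"
    and l: "l \<in> spectrum_on (perp_slice W (ang x)) (rescaled x r e)" "Re l \<noteq> 0"
  shows "lin_unstable W \<omega> P H x"
proof -
  have T: "subspace (perp_slice W (ang x))" unfolding perp_slice_def subspace_def
    using W by (auto simp: inner_add_right subspace_0 subspace_add subspace_scale)
  have linj: "linear (\<lambda>u :: 'v quot. (r *\<^sub>R fst u, snd u))"
    by (intro linearI) (simp_all add: scaleR_add_right)
  have inj: "inj_on (\<lambda>u :: 'v quot. (r *\<^sub>R fst u, snd u)) (perp_slice W (ang x))"
    using r by (intro inj_onI) (simp add: prod_eq_iff)
  have sub: "rescaled x r e ` perp_slice W (ang x) \<subseteq> perp_slice W (ang x)"
    using rescaled_perp[OF x(1,2)] by (rule image_subsetI)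
  have "spectrum_on (reduced_tangent W x) (linearization W \<omega> P H x) = spectrum_on (perp_slice W (ang x)) (rescaled x r e)"
    unfolding rescaled_conjugate(1)[OF x a e r \<rho>]
    by (rule spectrum_on_conjugate[OF linj inj T rescaled_conjugate(2)[OF x a e r \<rho>] sub])
  then show ?thesis unfolding lin_unstable_def linearly_unstable_def using l by blast
qed

end

section \<open>The equation of relative equilibria\<close>

lemma has_derivative_in_subspace:
  fixes G :: "'a::euclidean_space \<Rightarrow> 'b::euclidean_space"
  assumes N: "open N" "x \<in> N" and V: "subspace V" and GV: "\<And>y. y \<in> N \<Longrightarrow> G y \<in> V"
    and G: "(G has_derivative B) (at x)"
  shows "B u \<in> V"
proof -
  obtain \<pi> where \<pi>: "linear \<pi>" "\<And>u. \<pi> u \<in> V" "\<And>u. u \<in> V \<Longrightarrow> \<pi> u = u"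
    using orthogonal_projection_exists[OF V] by metis
  have "bounded_linear \<pi>" using \<pi>(1) by (simp add: linear_conv_bounded_linear)
  from bounded_linear.has_derivative[OF this G]
  have "((\<lambda>y. \<pi> (G y)) has_derivative (\<lambda>u. \<pi> (B u))) (at x)" .
  then have "(G has_derivative (\<lambda>u. \<pi> (B u))) (at x)"
    by (rule has_derivative_transform_within_open[OF _ N]) (simp add: \<pi>(3) GV)
  then have "(\<lambda>u. \<pi> (B u)) = B" using G by (rule has_derivative_unique)
  then show ?thesis using \<pi>(2)[of "B u"] by (simp add: fun_eq_iff)
qed

locale relative_equilibrium_chart = equivariant_chart +
  fixes s0 :: "'a"
  assumes p0N: "(0, s0) \<in> N" and s0W: "s0 \<in> W" and p0_crit: "snd (grad f (0, s0)) = 0"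
    and p0_ang: "ang (0, s0) \<noteq> 0" and nondeg: "nondegenerate_on W (hessian_0 P H s0)"
begin

abbreviation a0 :: "real^3" where "a0 \<equiv> ang (0, s0)"

lemma snd_hess_W: "x \<in> N \<Longrightarrow> snd (hess x u) \<in> W"
  by (rule has_derivative_in_subspace[OF N _ W gradW has_derivative_snd[OF grad_deriv]])

lemma norm_a0: "inner a0 a0 > 0" using p0_ang by simp

text \<open>Where the angular velocity has positive component along \<open>a\<^sub>0\<close>, the equation
  \<open>\<mu> \<times> a + (\<mu> \<sqdot> a) a\<^sub>0 = t a\<^sub>0\<close> is equivalent to \<open>\<mu> \<times>
  a = 0\<close> and \<open>\<mu> \<sqdot> a = t\<close>.\<close>

definition regular_nbhd :: "((real^3) \<times> 'a) set" where
  "regular_nbhd = {x \<in> N. inner a0 (ang x) > 0}"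

lemma open_regular_nbhd: "open regular_nbhd"
proof -
  have "continuous_on N (\<lambda>x. inner a0 (fst (grad f x)))"
    by (intro continuous_intros) (simp add: continuous_at_imp_continuous_on isCont_grad)
  then have "open ((\<lambda>x. inner a0 (fst (grad f x))) -` {0<..} \<inter> N)"
    using continuous_on_open_vimage[OF N] open_greaterThan by blast
  moreover have "regular_nbhd = (\<lambda>x. inner a0 (fst (grad f x))) -` {0<..} \<inter> N"
    unfolding regular_nbhd_def ang_def by auto
  ultimately show ?thesis by simp
qed

lemma p0_regular: "(0, s0) \<in> regular_nbhd"
  unfolding regular_nbhd_def using p0N norm_a0 by simp

lemma regular_nbhd_N: "x \<in> regular_nbhd \<Longrightarrow> x \<in> N"
  unfolding regular_nbhd_def by simp

text \<open>Taking the inner product with \<open>a\<close> eliminates \<open>\<mu> \<times> a\<close>.\<close>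

lemma equilibrium_equation:
  assumes x: "inner a0 (ang x) > 0" and eq: "cross3 (fst x) (ang x) + inner (fst x) (ang x) *\<^sub>R a0 = t *\<^sub>R a0"
  shows "cross3 (fst x) (ang x) = 0" "fst x = (t / (norm (ang x))\<^sup>2) *\<^sub>R ang x" "inner (fst x) (ang x) = t"
proof -
  have "inner (cross3 (fst x) (ang x) + inner (fst x) (ang x) *\<^sub>R a0) (ang x) = inner (t *\<^sub>R a0) (ang x)"
    unfolding eq ..
  then have "inner (fst x) (ang x) * inner a0 (ang x) = t * inner a0 (ang x)"
    by (simp add: inner_add_left dot_cross_self)
  then show t: "inner (fst x) (ang x) = t" using x by simp
  then show c: "cross3 (fst x) (ang x) = 0" using eq by simp
  have a: "ang x \<noteq> 0" using x by auto
  have "cross3 (ang x) (cross3 (fst x) (ang x)) = inner (ang x) (ang x) *\<^sub>R fst x - inner (ang x) (fst x) *\<^sub>R ang x"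
    by (rule Lagrange)
  then have "(norm (ang x))\<^sup>2 *\<^sub>R fst x = t *\<^sub>R ang x"
    unfolding c using t by (simp add: dot_square_norm inner_commute)
  then have "(1 / (norm (ang x))\<^sup>2) *\<^sub>R ((norm (ang x))\<^sup>2 *\<^sub>R fst x) = (1 / (norm (ang x))\<^sup>2) *\<^sub>R (t *\<^sub>R ang x)" by simp
  then show "fst x = (t / (norm (ang x))\<^sup>2) *\<^sub>R ang x" using a by simp
qed

text \<open>The second component adds to \<open>D\<^sub>sf\<close> the part of \<open>s\<close> perpendicular to
  \<open>W\<close>; the two lie in complementary subspaces, so the zero set also enforces \<open>s \<in> W\<close>.
  The derivative at \<open>(0, s\<^sub>0)\<close> is block triangular, with diagonal blocks \<open>\<rho> \<mapsto>
  \<rho> \<times> a\<^sub>0 + (\<rho> \<sqdot> a\<^sub>0) a\<^sub>0\<close> and the Hessian on the slice extended by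
  the identity.\<close>

lemma equilibrium_map:
  obtains \<Psi> :: "(real^3) \<times> 'a \<Rightarrow> (real^3) \<times> 'a"
  where "Cinf_on N \<Psi>" "\<And>x. fst (\<Psi> x) = cross3 (fst x) (ang x) + inner (fst x) (ang x) *\<^sub>R a0"
    "\<And>x. x \<in> N \<Longrightarrow> snd (\<Psi> x) = 0 \<longleftrightarrow> snd (grad f x) = 0 \<and> snd x \<in> W" "\<Psi> (0, s0) = 0"
    "\<And>u. frechet_derivative \<Psi> (at (0, s0)) u = 0 \<Longrightarrow> u = 0"
proof -
  obtain \<pi> where \<pi>: "linear \<pi>" "\<And>u. \<pi> u \<in> W" "\<And>u. u \<in> W \<Longrightarrow> \<pi> u = u"
    "\<And>u v. inner (\<pi> u) v = inner u (\<pi> v)"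
    using orthogonal_projection_exists[OF W] by metis
  have bl\<pi>: "bounded_linear \<pi>" using \<pi>(1) by (simp add: linear_conv_bounded_linear)
  define \<Psi> where "\<Psi> x = (cross3 (fst x) (fst (grad f x)) + inner (fst x) (fst (grad f x)) *\<^sub>R a0,
    snd (grad f x) + (snd x - \<pi> (snd x)))" for x
  have perp: "y = 0 \<and> z - \<pi> z = 0" if "y \<in> W" "y + (z - \<pi> z) = 0" for y z
  proof -
    have "inner (z - \<pi> z) y = 0" using \<pi>(4)[of z y] \<pi>(3)[OF that(1)] by (simp add: inner_diff_left)
    moreover have "z - \<pi> z = - y" using that(2) by (simp add: eq_neg_iff_add_eq_0 add.commute)
    ultimately have "inner y y = 0" by simp
    then show ?thesis using that(2) by simp
  qed
  have blf: "bounded_linear (\<lambda>x :: (real^3) \<times> 'a. fst x)" and bls: "bounded_linear (\<lambda>x :: (real^3) \<times> 'a. snd x)"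
    by (rule bounded_linear_fst, rule bounded_linear_snd)
  have bld: "bounded_linear (\<lambda>x :: (real^3) \<times> 'a. snd x - \<pi> (snd x))"
    by (rule bounded_linear_sub[OF bls bounded_linear_compose[OF bl\<pi> bls]])
  have "Ck_on k N \<Psi>" for k
  proof -
    have g: "Ck_on k N (grad f)" using Cinf_grad unfolding Cinf_on_def by (rule spec)
    note i = Ck_on_id[OF N, of k]
    have f1: "Ck_on k N (\<lambda>x. fst x)" by (rule Ck_on_bounded_linear[OF blf N i])
    have g1: "Ck_on k N (\<lambda>x. fst (grad f x))" by (rule Ck_on_bounded_linear[OF bounded_linear_fst N g])
    have g2: "Ck_on k N (\<lambda>x. snd (grad f x))" by (rule Ck_on_bounded_linear[OF bounded_linear_snd N g])
    have 1: "Ck_on k N (\<lambda>x. cross3 (fst x) (fst (grad f x)) + inner (fst x) (fst (grad f x)) *\<^sub>R a0)"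
      by (intro Ck_on_add[OF N] Ck_on_bounded_bilinear[OF bounded_bilinear_cross3 N f1 g1]
          Ck_on_bounded_linear[OF bounded_linear_scaleR_left N]
          Ck_on_bounded_bilinear[OF bounded_bilinear_inner N f1 g1])
    have 2: "Ck_on k N (\<lambda>x. snd (grad f x) + (snd x - \<pi> (snd x)))"
      by (intro Ck_on_add[OF N] g2 Ck_on_bounded_linear[OF bld N i])
    have L1: "bounded_linear (\<lambda>u :: real^3. (u, 0 :: 'a))" and L2: "bounded_linear (\<lambda>v :: 'a. (0 :: real^3, v))"
      by (intro bounded_linear_Pair bounded_linear_ident bounded_linear_zero)+
    have "Ck_on k N (\<lambda>x. (cross3 (fst x) (fst (grad f x)) + inner (fst x) (fst (grad f x)) *\<^sub>R a0, 0)
      + (0, snd (grad f x) + (snd x - \<pi> (snd x))))"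
      by (rule Ck_on_add[OF N Ck_on_bounded_linear[OF L1 N 1] Ck_on_bounded_linear[OF L2 N 2]])
    moreover have "(\<lambda>x. (cross3 (fst x) (fst (grad f x)) + inner (fst x) (fst (grad f x)) *\<^sub>R a0, 0)
      + (0, snd (grad f x) + (snd x - \<pi> (snd x)))) = \<Psi>"
      unfolding \<Psi>_def by (rule ext) simp
    ultimately show ?thesis by simp
  qed
  then have C: "Cinf_on N \<Psi>" unfolding Cinf_on_def by blast
  have D: "(\<Psi> has_derivative (\<lambda>u. (cross3 (fst u) a0 + inner (fst u) a0 *\<^sub>R a0,
      snd (hess (0, s0) u) + (snd u - \<pi> (snd u))))) (at (0, s0))"
  proof -
    note g = grad_deriv[OF p0N]
    have i: "((\<lambda>x. fst x) has_derivative (\<lambda>u. fst u)) (at (0 :: real^3, s0))"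
      by (intro has_derivative_fst has_derivative_ident)
    have 1: "((\<lambda>x. cross3 (fst x) (fst (grad f x))) has_derivative (\<lambda>u. cross3 (fst u) a0)) (at (0, s0))"
      using bounded_bilinear.FDERIV[OF bounded_bilinear_cross3 i has_derivative_fst[OF g]]
      unfolding ang_def by simp
    have 2: "((\<lambda>x. inner (fst x) (fst (grad f x)) *\<^sub>R a0) has_derivative (\<lambda>u. inner (fst u) a0 *\<^sub>R a0)) (at (0, s0))"
      using bounded_linear.has_derivative[OF bounded_linear_scaleR_left
          bounded_bilinear.FDERIV[OF bounded_bilinear_inner i has_derivative_fst[OF g]], of a0]
      unfolding ang_def by simp
    have 3: "((\<lambda>x. snd x - \<pi> (snd x)) has_derivative (\<lambda>u. snd u - \<pi> (snd u))) (at (0 :: real^3, s0))"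
      by (rule bounded_linear_imp_has_derivative[OF bld])
    show ?thesis unfolding \<Psi>_def
      by (intro has_derivative_Pair has_derivative_add 1 2 3 has_derivative_snd[OF g])
  qed
  have inj: "u = 0" if u: "frechet_derivative \<Psi> (at (0, s0)) u = 0" for u
  proof -
    have eq: "cross3 (fst u) a0 + inner (fst u) a0 *\<^sub>R a0 = 0" "snd (hess (0, s0) u) + (snd u - \<pi> (snd u)) = 0"
      using u unfolding frechet_derivative_at[OF D, symmetric] by (simp_all add: zero_prod_def)
    have "inner (cross3 (fst u) a0 + inner (fst u) a0 *\<^sub>R a0) a0 = 0" unfolding eq(1) by simp
    then have i0: "inner (fst u) a0 = 0" using norm_a0 by (simp add: inner_add_left dot_cross_self)
    then have "cross3 (fst u) a0 = 0" using eq(1) by simp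
    then have "cross3 a0 (fst u) = 0" using cross_skew[of a0 "fst u"] by simp
    then have fu: "fst u = 0" using cross_dot_cancel[of a0 "fst u" 0] i0 p0_ang by (simp add: inner_commute)
    from perp[OF snd_hess_W[OF p0N] eq(2)] have h: "snd (hess (0, s0) u) = 0" "snd u - \<pi> (snd u) = 0" by simp_all
    have sW: "snd u \<in> W" using h(2) \<pi>(2)[of "snd u"] by simp
    have "u = (0, snd u)" using fu by (simp add: prod_eq_iff)
    then have "\<forall>v\<in>W. hessian_0 P H s0 (snd u) v = 0"
      using hessian_0_eq[OF p0N s0W sW] h(1) by simp
    then have "snd u = 0" using nondeg sW unfolding nondegenerate_on_def by blast
    then show "u = 0" using fu by (simp add: prod_eq_iff)
  qed
  show thesis
  proof (rule that[OF C _ _ _ inj])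
    show "fst (\<Psi> x) = cross3 (fst x) (ang x) + inner (fst x) (ang x) *\<^sub>R a0" for x
      unfolding \<Psi>_def ang_def by simp
    show "snd (\<Psi> x) = 0 \<longleftrightarrow> snd (grad f x) = 0 \<and> snd x \<in> W" if x: "x \<in> N" for x
    proof
      assume "snd (\<Psi> x) = 0"
      then have "snd (grad f x) + (snd x - \<pi> (snd x)) = 0" unfolding \<Psi>_def by simp
      from perp[OF gradW[OF x] this] have h: "snd (grad f x) = 0" "snd x - \<pi> (snd x) = 0" by simp_all
      have "snd x \<in> W" using h(2) \<pi>(2)[of "snd x"] by simp
      with h(1) show "snd (grad f x) = 0 \<and> snd x \<in> W" by simp
    next
      assume "snd (grad f x) = 0 \<and> snd x \<in> W"
      then show "snd (\<Psi> x) = 0" unfolding \<Psi>_def using \<pi>(3) by simp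
    qed
    show "\<Psi> (0, s0) = 0" unfolding \<Psi>_def using p0_crit \<pi>(3)[OF s0W] by (simp add: zero_prod_def)
  qed
qed

end

text \<open>The neighbourhood is small enough for the derivative to stay invertible on it, as is required to
  bootstrap the smoothness of curves in \<open>U\<close> by \<open>Cinf_on_implicit_curve\<close>.\<close>

lemma smooth_inverse_function:
  fixes \<Psi> :: "'a::euclidean_space \<Rightarrow> 'a"
  assumes N: "open N" "x0 \<in> N" and \<Psi>: "Cinf_on N \<Psi>"
    and inj: "\<And>u. frechet_derivative \<Psi> (at x0) u = 0 \<Longrightarrow> u = 0"
  obtains U V g g' where "open U" "U \<subseteq> N" "x0 \<in> U" "open V" "\<Psi> x0 \<in> V" "homeomorphism U V \<Psi> g"
    "\<And>y. y \<in> V \<Longrightarrow> (g has_derivative g' y) (at y)"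
    "\<And>y w. y \<in> V \<Longrightarrow> frechet_derivative \<Psi> (at (g y)) (g' y w) = w"
    "\<And>x u. x \<in> U \<Longrightarrow> frechet_derivative \<Psi> (at x) u = 0 \<Longrightarrow> u = 0"
proof -
  define D where "D x = Blinfun (frechet_derivative \<Psi> (at x))" for x
  have D: "blinfun_apply (D x) = frechet_derivative \<Psi> (at x)" if "x \<in> N" for x
    unfolding D_def using Cinf_on_has_derivative[OF \<Psi> that]
    by (intro bounded_linear_Blinfun_apply has_derivative_bounded_linear)
  have der: "(\<Psi> has_derivative blinfun_apply (D x)) (at x)" if "x \<in> N" for x
    unfolding D[OF that] by (rule Cinf_on_has_derivative[OF \<Psi> that])
  have cont: "continuous_on N D"
  proof (rule continuous_on_blinfun_componentwise)
    fix i :: 'a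
    have "Ck_on 0 N (\<lambda>x. frechet_derivative \<Psi> (at x) i)"
      using Cinf_on_frechet_derivative[OF \<Psi>] unfolding Cinf_on_def by blast
    then have "continuous_on N (\<lambda>x. frechet_derivative \<Psi> (at x) i)" by simp
    then show "continuous_on N (\<lambda>x. blinfun_apply (D x) i)"
      by (rule continuous_on_eq) (simp add: D)
  qed
  define L where "L = frechet_derivative \<Psi> (at x0)"
  have linL: "linear L" unfolding L_def using Cinf_on_has_derivative[OF \<Psi> N(2)] by (rule has_derivative_linear)
  have "inj L" using inj linear_injective_0[OF linL] unfolding L_def by blast
  then obtain L' where L': "linear L'" "L' \<circ> L = id"
    using linear_injective_left_inverse[OF linL] by blast
  have "Blinfun L' o\<^sub>L D x0 = id_blinfun"
  proof (rule blinfun_eqI)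
    fix v
    have "L' (L v) = v" using L'(2) by (simp add: o_def fun_eq_iff)
    then show "blinfun_apply (Blinfun L' o\<^sub>L D x0) v = blinfun_apply id_blinfun v"
      using L'(1) D[OF N(2)] unfolding L_def
      by (simp add: bounded_linear_Blinfun_apply linear_conv_bounded_linear)
  qed
  from inverse_function_theorem[OF N(1) der cont N(2) this]
  obtain U V g g' where U: "open U" "U \<subseteq> N" "x0 \<in> U" "open V" "\<Psi> x0 \<in> V" "homeomorphism U V \<Psi> g"
    "\<And>y. y \<in> V \<Longrightarrow> (g has_derivative g' y) (at y)"
    "\<And>y. y \<in> V \<Longrightarrow> g' y = inv_into UNIV (blinfun_apply (D (g y)))"
    "\<And>y. y \<in> V \<Longrightarrow> bij (blinfun_apply (D (g y)))"
    by blast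
  have gU: "g y \<in> N" if "y \<in> V" for y
    using U(2,6) that unfolding homeomorphism_def by blast
  show thesis
  proof (rule that[OF U(1-7)])
    show "frechet_derivative \<Psi> (at (g y)) (g' y w) = w" if y: "y \<in> V" for y w
      unfolding U(8)[OF y] D[OF gU[OF y], symmetric] using bij_is_surj[OF U(9)[OF y]] by (rule surj_f_inv_f)
    show "u = 0" if x: "x \<in> U" and u: "frechet_derivative \<Psi> (at x) u = 0" for x u
    proof -
      have y: "\<Psi> x \<in> V" "g (\<Psi> x) = x" using U(6) x unfolding homeomorphism_def by blast+
      have xN: "x \<in> N" using x U(2) by blast
      have "inj (blinfun_apply (D x))" using bij_is_inj[OF U(9)[OF y(1)]] unfolding y(2) .
      moreover have "blinfun_apply (D x) u = blinfun_apply (D x) 0" using u unfolding D[OF xN] 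
        using linear_0[OF has_derivative_linear[OF Cinf_on_has_derivative[OF \<Psi> xN]]] by simp
      ultimately show "u = 0" by (rule injD)
    qed
  qed
qed

section \<open>The curve of relative equilibria\<close>

text \<open>The function is strictly monotone on each side of its minimum \<open>0\<close>; small positive values are
  attained once on either side.\<close>

lemma two_preimages:
  fixes n :: "real \<Rightarrow> real"
  assumes a: "a > 0" and d: "\<And>t. t \<in> {-a<..<a} \<Longrightarrow> (n has_real_derivative n' t) (at t)"
    and pos: "\<And>t. 0 < t \<Longrightarrow> t < a \<Longrightarrow> n' t > 0" and neg: "\<And>t. -a < t \<Longrightarrow> t < 0 \<Longrightarrow> n' t < 0"
    and n0: "n 0 = 0"
  obtains \<delta> where "\<delta> > 0"
    "\<And>m. 0 < m \<Longrightarrow> m < \<delta> \<Longrightarrow> \<exists>t1 t2. t1 \<noteq> t2 \<and> {t \<in> {-a<..<a}. n t = m} = {t1, t2}"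
proof -
  have cont: "continuous_on {s..t} n" if "-a < s" "t < a" for s t
  proof (intro continuous_at_imp_continuous_on ballI)
    fix x assume "x \<in> {s..t}"
    then have "x \<in> {-a<..<a}" using that by simp
    then show "isCont n x" by (rule DERIV_isCont[OF d])
  qed
  have inc: "n s < n t" if st: "0 \<le> s" "s < t" "t < a" for s t
  proof (rule DERIV_pos_imp_increasing_open[OF st(2)])
    show "\<exists>y. (n has_real_derivative y) (at x) \<and> 0 < y" if "s < x" "x < t" for x
      using d[of x] pos[of x] st that by (intro exI[of _ "n' x"]) simp
    show "continuous_on {s..t} n" using cont st a by simp
  qed
  have dec: "n t < n s" if st: "-a < s" "s < t" "t \<le> 0" for s t
  proof (rule DERIV_neg_imp_decreasing_open[OF st(2)])
    show "\<exists>y. (n has_real_derivative y) (at x) \<and> y < 0" if "s < x" "x < t" for x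
      using d[of x] neg[of x] st that by (intro exI[of _ "n' x"]) simp
    show "continuous_on {s..t} n" using cont st a by simp
  qed
  define \<delta> where "\<delta> = min (n (a / 2)) (n (- a / 2))"
  have "\<delta> > 0" unfolding \<delta>_def using inc[of 0 "a / 2"] dec[of "- a / 2" 0] a n0 by simp
  moreover have "\<exists>t1 t2. t1 \<noteq> t2 \<and> {t \<in> {-a<..<a}. n t = m} = {t1, t2}" if m: "0 < m" "m < \<delta>" for m
  proof -
    have ma: "n 0 \<le> m" "m \<le> n (a / 2)" "m \<le> n (- a / 2)" using m n0 unfolding \<delta>_def by simp_all
    obtain t1 where t1: "0 \<le> t1" "t1 \<le> a / 2" "n t1 = m"
      using IVT'[of n 0 m "a / 2", OF ma(1,2)] cont[of 0 "a / 2"] a by auto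
    obtain t2 where t2: "- a / 2 \<le> t2" "t2 \<le> 0" "n t2 = m"
      using IVT2'[of n 0 m "- a / 2", OF ma(1,3)] cont[of "- a / 2" 0] a by auto
    have t1p: "0 < t1" using t1 m(1) n0 by (cases "t1 = 0") simp_all
    have t2n: "t2 < 0" using t2 m(1) n0 by (cases "t2 = 0") simp_all
    have "t = t1 \<or> t = t2" if t: "-a < t" "t < a" "n t = m" for t
    proof (cases "0 \<le> t")
      case True
      show ?thesis
      proof (rule ccontr)
        assume "\<not> ?thesis"
        then have "t < t1 \<or> t1 < t" by linarith
        then show False using inc[of t t1] inc[of t1 t] True t t1 a by auto
      qed
    next
      case False
      show ?thesis
      proof (rule ccontr)
        assume "\<not> ?thesis"
        then have "t < t2 \<or> t2 < t" by linarith
        then show False using dec[of t t2] dec[of t2 t] False t t2 a by auto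
      qed
    qed
    moreover have "-a < t1" "t1 < a" "-a < t2" "t2 < a" using t1 t2 a by linarith+
    ultimately have "t \<in> {t \<in> {-a<..<a}. n t = m} \<longleftrightarrow> t \<in> {t1, t2}" for t
      using t1(3) t2(3) unfolding mem_Collect_eq greaterThanLessThan_iff insert_iff by blast
    then have "{t \<in> {-a<..<a}. n t = m} = {t1, t2}" by blast
    moreover have "t1 \<noteq> t2" using t1p t2n by simp
    ultimately show ?thesis by blast
  qed
  ultimately show thesis using that by blast
qed

context relative_equilibrium_chart
begin

text \<open>The curve is \<open>t \<mapsto> inv \<Psi> (t a\<^sub>0, 0)\<close>. The inverse of \<open>c\<close> on
  its image is \<open>x \<mapsto> \<mu> \<sqdot> a\<close>. The number of points on a reduced space is counted with
  \<open>|\<mu>|\<^sup>2\<close>, whose derivative along the curve is \<open>2 \<mu> \<sqdot> \<mu>' = 2 (t /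
  |a|\<^sup>2) (a \<sqdot> \<mu>')\<close>, where \<open>a \<sqdot> \<mu>'\<close> equals \<open>1\<close> at
  \<open>t = 0\<close>.\<close>

lemma curve_exists:
  obtains U a c where "openin (top_of_set (orbit_space P)) U" "(0, s0) \<in> U" "smooth_curve a c" "c 0 = (0, s0)"
    "rel_equilibria W \<omega> P H \<inter> U = c ` {-a<..<a}"
    "\<exists>\<delta>>0. \<forall>\<mu>. 0 < norm \<mu> \<and> norm \<mu> < \<delta> \<longrightarrow> card (c ` {-a<..<a} \<inter> reduced_space P \<mu>) = 2"
    "\<And>t. t \<in> {-a<..<a} \<Longrightarrow> c t \<in> N \<and> snd (c t) \<in> W \<and> snd (grad f (c t)) = 0 \<and> ang (c t) \<noteq> 0 \<and>
      fst (c t) = (t / (norm (ang (c t)))\<^sup>2) *\<^sub>R ang (c t) \<and> isCont c t"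
proof -
  obtain \<Psi> :: "(real^3) \<times> 'a \<Rightarrow> (real^3) \<times> 'a" where \<Psi>: "Cinf_on N \<Psi>" "\<And>x. fst (\<Psi> x) = cross3 (fst x) (ang x) + inner (fst x) (ang x) *\<^sub>R a0"
    "\<And>x. x \<in> N \<Longrightarrow> snd (\<Psi> x) = 0 \<longleftrightarrow> snd (grad f x) = 0 \<and> snd x \<in> W" "\<Psi> (0, s0) = 0"
    "\<And>u. frechet_derivative \<Psi> (at (0, s0)) u = 0 \<Longrightarrow> u = 0"
    using equilibrium_map by blast
  have \<Psi>r: "Cinf_on regular_nbhd \<Psi>"
    using \<Psi>(1) Ck_on_subset regular_nbhd_N unfolding Cinf_on_def by blast
  obtain U V g g' where U: "open U" "U \<subseteq> regular_nbhd" "(0, s0) \<in> U" "open V" "\<Psi> (0, s0) \<in> V" "homeomorphism U V \<Psi> g"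
    "\<And>y. y \<in> V \<Longrightarrow> (g has_derivative g' y) (at y)"
    "\<And>y w. y \<in> V \<Longrightarrow> frechet_derivative \<Psi> (at (g y)) (g' y w) = w"
    "\<And>x u. x \<in> U \<Longrightarrow> frechet_derivative \<Psi> (at x) u = 0 \<Longrightarrow> u = 0"
    using smooth_inverse_function[OF open_regular_nbhd p0_regular \<Psi>r \<Psi>(5)] by blast
  have g\<Psi>: "g (\<Psi> x) = x" "\<Psi> x \<in> V" if "x \<in> U" for x using U(6) that unfolding homeomorphism_def by blast+
  have \<Psi>g: "\<Psi> (g y) = y" "g y \<in> U" if "y \<in> V" for y using U(6) that unfolding homeomorphism_def by blast+
  have cont\<Psi>: "continuous_on U \<Psi>" using U(6) unfolding homeomorphism_def by blast
  obtain r0 where r0: "r0 > 0" "ball 0 r0 \<subseteq> V" using openE[OF U(4,5)] unfolding \<Psi>(4) by blast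
  define L where "L t = (t *\<^sub>R a0, 0 :: 'a)" for t :: real
  define c where "c t = g (L t)" for t
  define c' where "c' t = g' (L t) (a0, 0)" for t
  have nL: "norm (L t) = \<bar>t\<bar> * norm a0" for t unfolding L_def by (simp add: norm_Pair)
  have na0: "norm a0 > 0" using p0_ang by simp
  define a1 where "a1 = r0 / norm a0"
  have a1: "a1 > 0" unfolding a1_def using r0(1) na0 by simp
  have Lball: "L t \<in> ball 0 (a * norm a0) \<longleftrightarrow> t \<in> {-a<..<a}" for t a
    using na0 by (auto simp: nL abs_less_iff mult_less_cancel_right)
  have LV: "L t \<in> V" if "t \<in> {-a1<..<a1}" for t
  proof -
    have "a1 * norm a0 = r0" unfolding a1_def using na0 by simp
    then show ?thesis using Lball[of t a1] that r0(2) by auto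
  qed
  have cU: "c t \<in> U" "\<Psi> (c t) = L t" if "t \<in> {-a1<..<a1}" for t unfolding c_def using \<Psi>g[OF LV[OF that]] by simp_all
  have cN: "c t \<in> N" "inner a0 (ang (c t)) > 0" if "t \<in> {-a1<..<a1}" for t
    using cU(1)[OF that] U(2) unfolding regular_nbhd_def by blast+
  have dc: "(c has_vector_derivative c' t) (at t)" if t: "t \<in> {-a1<..<a1}" for t
  proof -
    have "L = (\<lambda>t. 0 + t *\<^sub>R (a0, 0))" unfolding L_def by auto
    then have "(L has_vector_derivative (a0, 0)) (at t)" using line_has_vector_derivative[of 0 "(a0, 0)" t] by simp
    then have "(L has_derivative (\<lambda>h. h *\<^sub>R (a0, 0))) (at t)"
      unfolding has_vector_derivative_def .
    from diff_chain_at[OF this U(7)[OF LV[OF t]]]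
    have "((\<lambda>t. g (L t)) has_derivative (\<lambda>h. g' (L t) (h *\<^sub>R (a0, 0)))) (at t)" unfolding o_def .
    moreover have "(\<lambda>h. g' (L t) (h *\<^sub>R (a0, 0))) = (\<lambda>h. h *\<^sub>R c' t)"
      unfolding c'_def using linear_scale[OF has_derivative_linear[OF U(7)[OF LV[OF t]]]] by (intro ext)
    ultimately show ?thesis unfolding has_vector_derivative_def c_def[abs_def] by simp
  qed
  have D\<Psi>: "frechet_derivative \<Psi> (at (c t)) (c' t) = (a0, 0)" if "t \<in> {-a1<..<a1}" for t
    unfolding c_def c'_def by (rule U(8)[OF LV[OF that]])
  have c'0: "c' t \<noteq> 0" if t: "t \<in> {-a1<..<a1}" for t
  proof
    assume "c' t = 0"
    moreover have "linear (frechet_derivative \<Psi> (at (c t)))"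
      using Cinf_on_has_derivative[OF \<Psi>(1) cN(1)[OF t]] by (rule has_derivative_linear)
    ultimately have "frechet_derivative \<Psi> (at (c t)) (c' t) = 0" by (simp add: linear_0)
    then show False using D\<Psi>[OF t] p0_ang by (simp add: zero_prod_def)
  qed
  have \<Psi>U: "Cinf_on U \<Psi>" using \<Psi>r Ck_on_subset U(2) unfolding Cinf_on_def by blast
  have Cinf_c: "Cinf_on {-a1<..<a1} c"
  proof (rule Cinf_on_implicit_curve[OF _ _ \<Psi>U U(9) dc D\<Psi>])
    show "c ` {-a1<..<a1} \<subseteq> U" using cU(1) by (rule image_subsetI)
  qed simp
  have props: "snd (c t) \<in> W" "snd (grad f (c t)) = 0" "cross3 (fst (c t)) (ang (c t)) = 0" "ang (c t) \<noteq> 0"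
      "fst (c t) = (t / (norm (ang (c t)))\<^sup>2) *\<^sub>R ang (c t)" "inner (fst (c t)) (ang (c t)) = t"
    if t: "t \<in> {-a1<..<a1}" for t
  proof -
    have "snd (\<Psi> (c t)) = 0" unfolding cU(2)[OF t] L_def by simp
    then show "snd (c t) \<in> W" "snd (grad f (c t)) = 0" using \<Psi>(3)[OF cN(1)[OF t]] by simp_all
    have "cross3 (fst (c t)) (ang (c t)) + inner (fst (c t)) (ang (c t)) *\<^sub>R a0 = t *\<^sub>R a0"
      using \<Psi>(2)[of "c t"] unfolding cU(2)[OF t] L_def by simp
    from equilibrium_equation[OF cN(2)[OF t] this]
    show "cross3 (fst (c t)) (ang (c t)) = 0" "fst (c t) = (t / (norm (ang (c t)))\<^sup>2) *\<^sub>R ang (c t)"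
      "inner (fst (c t)) (ang (c t)) = t" .
    show "ang (c t) \<noteq> 0" using cN(2)[OF t] by auto
  qed
  have c0: "c 0 = (0, s0)"
  proof -
    have "L 0 = \<Psi> (0, s0)" unfolding L_def \<Psi>(4) by (simp add: zero_prod_def)
    then show ?thesis unfolding c_def using g\<Psi>(1)[OF U(3)] by simp
  qed
  have z1: "0 \<in> {-a1<..<a1}" using a1 by simp
  have isc: "isCont c t" if "t \<in> {-a1<..<a1}" for t using has_vector_derivative_continuous[OF dc[OF that]] .
  define h where "h t = inner (ang (c t)) (fst (c' t))" for t
  have "Ck_on 1 {-a1<..<a1} c" using Cinf_c unfolding Cinf_on_def by (rule spec)
  then have "Ck_on 0 {-a1<..<a1} (\<lambda>t. frechet_derivative c (at t) 1)" unfolding One_nat_def Ck_on.simps(2) by blast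
  then have "continuous_on {-a1<..<a1} (\<lambda>t. frechet_derivative c (at t) 1)" by simp
  moreover have "frechet_derivative c (at t) 1 = c' t" if "t \<in> {-a1<..<a1}" for t
    using frechet_derivative_at[OF dc[OF that, unfolded has_vector_derivative_def], symmetric] by simp
  ultimately have contc': "continuous_on {-a1<..<a1} c'"
    by (rule continuous_on_eq)
  have isa: "isCont (\<lambda>t. ang (c t)) t" if t: "t \<in> {-a1<..<a1}" for t
    unfolding ang_def by (intro continuous_intros isCont_o2[OF isc[OF t] isCont_grad[OF cN(1)[OF t]]])
  have isc': "isCont c' 0" using contc' z1 continuous_on_eq_continuous_at[of "{-a1<..<a1}" c'] by simp
  have "isCont h 0" unfolding h_def by (intro continuous_intros isa[OF z1] isc')
  moreover have "h 0 = 1"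
  proof -
    have d1: "((\<lambda>t. fst (c t)) has_vector_derivative fst (c' 0)) (at 0)"
      using bounded_linear.has_vector_derivative[OF bounded_linear_fst dc[OF z1]] .
    have "((\<lambda>t. ang (c t)) has_derivative (\<lambda>h. fst (hess (c 0) (h *\<^sub>R c' 0)))) (at 0)"
      using has_derivative_fst[OF diff_chain_at[OF dc[OF z1, unfolded has_vector_derivative_def] grad_deriv[OF cN(1)[OF z1]]]]
      unfolding ang_def o_def .
    from bounded_bilinear.FDERIV[OF bounded_bilinear_inner d1[unfolded has_vector_derivative_def] this]
    have "((\<lambda>t. inner (fst (c t)) (ang (c t))) has_derivative (\<lambda>h. h * inner (fst (c' 0)) (ang (c 0)))) (at 0)"
      unfolding c0 by simp
    moreover have "((\<lambda>t. inner (fst (c t)) (ang (c t))) has_derivative (\<lambda>h. h)) (at 0)"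
    proof (rule has_derivative_transform_within_open[OF has_derivative_ident _ z1])
      show "t = inner (fst (c t)) (ang (c t))" if "t \<in> {-a1<..<a1}" for t using props(6)[OF that] by simp
    qed simp
    ultimately have "(\<lambda>h. h * inner (fst (c' 0)) (ang (c 0))) = (\<lambda>h. h)" by (rule has_derivative_unique)
    then have "1 * inner (fst (c' 0)) (ang (c 0)) = (1::real)" by (rule fun_cong)
    then show ?thesis unfolding h_def by (simp add: inner_commute)
  qed
  ultimately have "(h \<longlongrightarrow> 1) (at 0)" unfolding isCont_def by simp
  then have "\<forall>\<^sub>F t in at 0. h t > 0" by (rule order_tendstoD(1)) simp
  then obtain a2 where a2: "a2 > 0" "\<And>t. t \<noteq> 0 \<Longrightarrow> \<bar>t\<bar> < a2 \<Longrightarrow> h t > 0"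
    unfolding eventually_at by (auto simp: dist_real_def)
  define a where "a = min a1 a2"
  have a: "a > 0" "a \<le> a1" "a \<le> a2" unfolding a_def using a1 a2(1) by simp_all
  have aa1: "t \<in> {-a1<..<a1}" if "t \<in> {-a<..<a}" for t using that a(2) by simp
  define n where "n t = inner (fst (c t)) (fst (c t))" for t
  have dn: "(n has_real_derivative 2 * (t / (norm (ang (c t)))\<^sup>2) * h t) (at t)" if t: "t \<in> {-a<..<a}" for t
  proof -
    have d1: "((\<lambda>t. fst (c t)) has_vector_derivative fst (c' t)) (at t)"
      using bounded_linear.has_vector_derivative[OF bounded_linear_fst dc[OF aa1[OF t]]] .
    from bounded_bilinear.FDERIV[OF bounded_bilinear_inner d1[unfolded has_vector_derivative_def] d1[unfolded has_vector_derivative_def]]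
    have hd: "(n has_derivative (\<lambda>x. inner (fst (c t)) (x *\<^sub>R fst (c' t)) + inner (x *\<^sub>R fst (c' t)) (fst (c t)))) (at t)"
      unfolding n_def .
    have i1: "inner (fst (c t)) (fst (c' t)) = (t / (norm (ang (c t)))\<^sup>2) * h t"
      unfolding h_def by (simp only: props(5)[OF aa1[OF t]] inner_scaleR_left)
    have i2: "inner (fst (c' t)) (fst (c t)) = (t / (norm (ang (c t)))\<^sup>2) * h t"
      unfolding i1[symmetric] by (rule inner_commute)
    have "inner (fst (c t)) (x *\<^sub>R fst (c' t)) + inner (x *\<^sub>R fst (c' t)) (fst (c t)) =
        2 * (t / (norm (ang (c t)))\<^sup>2) * h t * x" for x
      unfolding inner_scaleR_left inner_scaleR_right i1 i2 by (simp only: mult_2 ring_distribs mult.commute)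
    then show ?thesis unfolding has_field_derivative_def
      by (intro has_derivative_eq_rhs[OF hd] ext)
  qed
  have "n 0 = 0" unfolding n_def c0 by simp
  have npos: "2 * (t / (norm (ang (c t)))\<^sup>2) * h t > 0" if "0 < t" "t < a" for t
    using that a a2(2)[of t] props(4)[OF aa1, of t] by simp
  have nneg: "2 * (t / (norm (ang (c t)))\<^sup>2) * h t < 0" if "-a < t" "t < 0" for t
  proof -
    have "h t > 0" using that a a2(2)[of t] by simp
    have "t / (norm (ang (c t)))\<^sup>2 < 0" using that a props(4)[OF aa1, of t] by (intro divide_neg_pos) simp_all
    then have "2 * (t / (norm (ang (c t)))\<^sup>2) < 0" by linarith
    then show ?thesis using \<open>h t > 0\<close> by (rule mult_neg_pos)
  qed
  have "\<exists>\<delta>>0. \<forall>m. 0 < m \<longrightarrow> m < \<delta> \<longrightarrow> (\<exists>t1 t2. t1 \<noteq> t2 \<and> {t \<in> {-a<..<a}. n t = m} = {t1, t2})"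
  proof (rule two_preimages[OF a(1) dn npos nneg \<open>n 0 = 0\<close>])
    fix d :: real assume d: "d > 0"
      "\<And>m. 0 < m \<Longrightarrow> m < d \<Longrightarrow> \<exists>t1 t2. t1 \<noteq> t2 \<and> {t \<in> {-a<..<a}. n t = m} = {t1, t2}"
    show "\<exists>\<delta>>0. \<forall>m. 0 < m \<longrightarrow> m < \<delta> \<longrightarrow> (\<exists>t1 t2. t1 \<noteq> t2 \<and> {t \<in> {-a<..<a}. n t = m} = {t1, t2})"
    proof (rule exI[of _ d], rule conjI[OF d(1)], intro allI impI)
      fix m assume "0 < m" "m < d"
      then show "\<exists>t1 t2. t1 \<noteq> t2 \<and> {t \<in> {-a<..<a}. n t = m} = {t1, t2}" by (rule d(2))
    qed
  qed
  then obtain \<delta> where "\<delta> > 0 \<and>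
      (\<forall>m. 0 < m \<longrightarrow> m < \<delta> \<longrightarrow> (\<exists>t1 t2. t1 \<noteq> t2 \<and> {t \<in> {-a<..<a}. n t = m} = {t1, t2}))"
    by (rule exE)
  note \<delta> = conjunct1[OF this] conjunct2[OF this]
  have cinj: "s = t" if "s \<in> {-a1<..<a1}" "t \<in> {-a1<..<a1}" "c s = c t" for s t
  proof -
    have "s = inner (fst (c s)) (ang (c s))" by (rule props(6)[OF that(1), symmetric])
    also have "\<dots> = t" unfolding that(3) by (rule props(6)[OF that(2)])
    finally show ?thesis .
  qed
  have card2: "card (c ` {-a<..<a} \<inter> reduced_space P \<mu>) = 2" if \<mu>: "0 < norm \<mu>" "norm \<mu> < sqrt \<delta>" for \<mu>
  proof -
    have "0 < (norm \<mu>)\<^sup>2" using \<mu>(1) by (rule zero_less_power)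
    moreover have "(norm \<mu>)\<^sup>2 < (sqrt \<delta>)\<^sup>2" using \<mu>(2) norm_ge_zero by (rule power_strict_mono) simp
    then have "(norm \<mu>)\<^sup>2 < \<delta>" using \<delta>(1) by simp
    ultimately have "\<exists>t1 t2. t1 \<noteq> t2 \<and> {t \<in> {-a<..<a}. n t = (norm \<mu>)\<^sup>2} = {t1, t2}" by (rule \<delta>(2)[rule_format])
    then obtain t1 where "\<exists>t2. t1 \<noteq> t2 \<and> {t \<in> {-a<..<a}. n t = (norm \<mu>)\<^sup>2} = {t1, t2}" by (rule exE)
    then obtain t2 where "t1 \<noteq> t2 \<and> {t \<in> {-a<..<a}. n t = (norm \<mu>)\<^sup>2} = {t1, t2}" by (rule exE)
    note t = conjunct1[OF this] conjunct2[OF this]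
    have iff: "c t \<in> reduced_space P \<mu> \<longleftrightarrow> n t = (norm \<mu>)\<^sup>2" if "t \<in> {-a<..<a}" for t
    proof -
      have "(mat 1, c t) \<in> P" by (rule NP[OF cN(1) props(1)]) (use aa1[OF that] in simp_all)
      then have "c t \<in> reduced_space P \<mu> \<longleftrightarrow> norm (fst (c t)) = norm \<mu>" unfolding reduced_space_iff by simp
      also have "\<dots> \<longleftrightarrow> (norm (fst (c t)))\<^sup>2 = (norm \<mu>)\<^sup>2" by simp
      finally show ?thesis unfolding n_def power2_norm_eq_inner .
    qed
    have "c ` {-a<..<a} \<inter> reduced_space P \<mu> = c ` {t \<in> {-a<..<a}. c t \<in> reduced_space P \<mu>}" by blast
    also have "{t \<in> {-a<..<a}. c t \<in> reduced_space P \<mu>} = {t \<in> {-a<..<a}. n t = (norm \<mu>)\<^sup>2}"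
      by (rule Collect_cong, rule conj_cong[OF refl iff])
    finally have "c ` {-a<..<a} \<inter> reduced_space P \<mu> = c ` {t \<in> {-a<..<a}. n t = (norm \<mu>)\<^sup>2}" .
    also have "\<dots> = {c t1, c t2}" unfolding t(2) by simp
    finally have eq: "c ` {-a<..<a} \<inter> reduced_space P \<mu> = {c t1, c t2}" .
    have "t1 \<in> {t \<in> {-a<..<a}. n t = (norm \<mu>)\<^sup>2}" "t2 \<in> {t \<in> {-a<..<a}. n t = (norm \<mu>)\<^sup>2}"
      unfolding t(2) by simp_all
    then have "t1 \<in> {-a<..<a}" "t2 \<in> {-a<..<a}" by simp_all
    then have "c t1 \<noteq> c t2" using cinj[OF aa1 aa1, of t1 t2] t(1) by metis
    then show ?thesis unfolding eq by simp
  qed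
  \<comment> \<open>On the line \<open>\<real> (a\<^sub>0, 0)\<close> the ball of this radius is exactly the parameter interval.\<close>
  define r where "r = a * norm a0"
  define O' where "O' = {x \<in> U. \<Psi> x \<in> ball 0 r}"
  have "open (\<Psi> -` ball 0 r \<inter> U)" using cont\<Psi> continuous_on_open_vimage[OF U(1)] by blast
  moreover have "O' = \<Psi> -` ball 0 r \<inter> U" unfolding O'_def by auto
  ultimately have O': "open O'" by simp
  have Ux: "x \<in> N \<and> inner a0 (ang x) > 0" if xU: "x \<in> U" for x using subsetD[OF U(2) xU] unfolding regular_nbhd_def by simp
  have orb: "x \<in> orbit_space P \<longleftrightarrow> snd x \<in> W" if xN: "x \<in> N" for x
  proof
    assume "x \<in> orbit_space P"
    then have "(mat 1, x) \<in> P" unfolding orbit_space_iff .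
    then have "snd x \<in> S" using PD by simp
    then show "snd x \<in> W" by (rule subsetD[OF SW])
  qed (simp add: orbit_space_iff NP[OF xN])
  show thesis
  proof (rule that[of "orbit_space P \<inter> O'" a c])
    show "openin (top_of_set (orbit_space P)) (orbit_space P \<inter> O')" using O' by (rule openin_open_Int)
    show "(0, s0) \<in> orbit_space P \<inter> O'"
      using orb[OF p0N] s0W U(3) \<Psi>(4) a(1) na0 unfolding O'_def r_def by simp
    show "c 0 = (0, s0)" by (rule c0)
    show "\<exists>\<delta>>0. \<forall>\<mu>. 0 < norm \<mu> \<and> norm \<mu> < \<delta> \<longrightarrow> card (c ` {-a<..<a} \<inter> reduced_space P \<mu>) = 2"
      using card2 \<delta>(1) by (intro exI[of _ "sqrt \<delta>"]) simp
    show "c t \<in> N \<and> snd (c t) \<in> W \<and> snd (grad f (c t)) = 0 \<and> ang (c t) \<noteq> 0 \<and>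
      fst (c t) = (t / (norm (ang (c t)))\<^sup>2) *\<^sub>R ang (c t) \<and> isCont c t" if t: "t \<in> {-a<..<a}" for t
      using cN(1)[OF aa1[OF t]] props(1,2,4,5)[OF aa1[OF t]] isc[OF aa1[OF t]] by blast
    show "smooth_curve a c"
      unfolding smooth_curve_def
    proof (intro conjI ballI)
      show "Cinf_on {-a<..<a} c"
        using Cinf_c Ck_on_subset[of _ "{-a1<..<a1}" c "{-a<..<a}"] aa1 unfolding Cinf_on_def by blast
      show "vector_derivative c (at t) \<noteq> 0" if "t \<in> {-a<..<a}" for t
        using vector_derivative_at[OF dc[OF aa1[OF that]]] c'0[OF aa1[OF that]] by simp
      have "homeomorphism {-a<..<a} (c ` {-a<..<a}) c (\<lambda>x. inner (fst x) (ang x))"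
      proof (rule homeomorphismI)
        show "continuous_on {-a<..<a} c" by (intro continuous_at_imp_continuous_on ballI isc aa1)
        have "isCont (\<lambda>x. inner (fst x) (ang x)) x" if "x \<in> N" for x
          unfolding ang_def using isCont_grad[OF that] by (intro continuous_intros)
        then have "continuous_on N (\<lambda>x. inner (fst x) (ang x))" by (intro continuous_at_imp_continuous_on ballI)
        moreover have "c ` {-a<..<a} \<subseteq> N" by (intro image_subsetI cN(1) aa1)
        ultimately show "continuous_on (c ` {-a<..<a}) (\<lambda>x. inner (fst x) (ang x))" by (rule continuous_on_subset)
        have cback: "inner (fst (c t)) (ang (c t)) = t" if "t \<in> {-a<..<a}" for t by (rule props(6)[OF aa1[OF that]])
        show "(\<lambda>x. inner (fst x) (ang x)) ` c ` {-a<..<a} \<subseteq> {-a<..<a}"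
        proof (rule image_subsetI)
          fix x assume "x \<in> c ` {-a<..<a}"
          then obtain t where "t \<in> {-a<..<a}" "x = c t" by blast
          then show "inner (fst x) (ang x) \<in> {-a<..<a}" using cback by simp
        qed
        show "inner (fst (c t)) (ang (c t)) = t" if "t \<in> {-a<..<a}" for t by (rule cback[OF that])
        show "c (inner (fst x) (ang x)) = x" if x: "x \<in> c ` {-a<..<a}" for x
        proof -
          obtain t where "t \<in> {-a<..<a}" "x = c t" using x by blast
          then show ?thesis using cback by simp
        qed
      qed simp
      then show "\<exists>d. homeomorphism {-a<..<a} (c ` {-a<..<a}) c d" by (rule exI[of _ "\<lambda>x. inner (fst x) (ang x)"])
    qed (rule a(1))
    show "rel_equilibria W \<omega> P H \<inter> (orbit_space P \<inter> O') = c ` {-a<..<a}"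
    proof (rule subset_antisym; rule subsetI)
      fix x assume "x \<in> rel_equilibria W \<omega> P H \<inter> (orbit_space P \<inter> O')"
      then have x: "x \<in> rel_equilibria W \<omega> P H" "x \<in> orbit_space P" "x \<in> U" "\<Psi> x \<in> ball 0 r"
        unfolding O'_def by simp_all
      have xN: "x \<in> N" using Ux[OF x(3)] by simp
      have xW: "snd x \<in> W" using orb[OF xN] x(2) by simp
      have re: "cross3 (fst x) (ang x) = 0" "snd (grad f x) = 0" using rel_equilibria_iff[OF xN xW] x(1) by simp_all
      define t where "t = inner (fst x) (ang x)"
      have "fst (\<Psi> x) = t *\<^sub>R a0" unfolding \<Psi>(2) re(1) t_def by simp
      moreover have "snd (\<Psi> x) = 0" using \<Psi>(3)[OF xN] re(2) xW by simp
      ultimately have Lx: "\<Psi> x = L t" unfolding L_def by (simp add: prod_eq_iff)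
      then have "t \<in> {-a<..<a}" using x(4) Lball[of t a] unfolding r_def by simp
      moreover have "x = c t" unfolding c_def Lx[symmetric] using g\<Psi>(1)[OF x(3)] by simp
      ultimately show "x \<in> c ` {-a<..<a}" by blast
    next
      fix x assume "x \<in> c ` {-a<..<a}"
      then obtain t where t: "t \<in> {-a<..<a}" "x = c t" by blast
      note t1 = aa1[OF t(1)]
      have "x \<in> rel_equilibria W \<omega> P H" unfolding t(2)
        using rel_equilibria_iff[OF cN(1)[OF t1] props(1)[OF t1]] props(2,3)[OF t1] by simp
      moreover have "x \<in> orbit_space P" unfolding t(2) using orb[OF cN(1)[OF t1]] props(1)[OF t1] by simp
      moreover have "x \<in> O'" unfolding t(2) O'_def using cU[OF t1] Lball[of t a] t(1) unfolding r_def by simp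
      ultimately show "x \<in> rel_equilibria W \<omega> P H \<inter> (orbit_space P \<inter> O')" by blast
    qed
  qed
qed

end

section \<open>Lyapunov stability by the energy-Casimir method\<close>

text \<open>Coercivity of the second derivative and the mean value theorem along rays; only directions in the
  subspace matter.\<close>

lemma strict_minimum_on_subspace:
  fixes V :: "'a::euclidean_space \<Rightarrow> real"
  assumes X: "subspace X" and N: "open N" "x \<in> N"
    and V: "\<And>y. y \<in> N \<Longrightarrow> (V has_derivative (\<lambda>u. inner (G y) u)) (at y)"
    and G: "(G has_derivative B) (at x)" "G x = 0"
    and pos: "\<And>u. u \<in> X \<Longrightarrow> u \<noteq> 0 \<Longrightarrow> inner (B u) u > 0"
  obtains r where "r > 0" "ball x r \<subseteq> N" "\<And>u. u \<in> X \<Longrightarrow> u \<noteq> 0 \<Longrightarrow> norm u < r \<Longrightarrow> V x < V (x + u)"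
proof -
  have lin: "linear B" using G(1) by (rule has_derivative_linear)
  have bl: "bilinear (\<lambda>u v. inner (B u) v)"
    unfolding bilinear_def using lin
    by (auto intro!: linearI simp: linear_add linear_scale inner_add_left inner_add_right)
  obtain m where m: "m > 0" "\<And>u. u \<in> X \<Longrightarrow> m * (norm u)\<^sup>2 \<le> inner (B u) u"
    using positive_form_coercive[OF X bl pos] by blast
  have "m / 2 > 0" using m(1) by simp
  then obtain d where d: "d > 0" "\<And>y. norm (y - x) < d \<Longrightarrow> norm (G y - G x - B (y - x)) \<le> m / 2 * norm (y - x)"
    using G(1) unfolding has_derivative_at_alt by blast
  obtain e where e: "e > 0" "ball x e \<subseteq> N" using N by (rule openE)
  show thesis
  proof (rule that[of "min d e"])
    show "min d e > 0" using d e by simp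
    show "ball x (min d e) \<subseteq> N" using e(2) by auto
    fix u assume u: "u \<in> X" "u \<noteq> 0" "norm u < min d e"
    have small: "norm (t *\<^sub>R u) < min d e" if "0 \<le> t" "t \<le> 1" for t
    proof -
      have "norm (t *\<^sub>R u) \<le> norm u" using that by (simp add: mult_left_le_one_le)
      then show ?thesis using u(3) by (rule le_less_trans)
    qed
    have inN: "x + t *\<^sub>R u \<in> N" if "0 \<le> t" "t \<le> 1" for t
    proof -
      have "x + t *\<^sub>R u \<in> ball x e" using small[OF that] by (simp add: dist_norm)
      then show ?thesis using e(2) by (rule rev_subsetD)
    qed
    define \<phi> where "\<phi> t = V (x + t *\<^sub>R u)" for t
    \<comment> \<open>The derivative along a ray is at least half of what the coercive quadratic form gives.\<close>
    have d\<phi>: "(\<phi> has_real_derivative inner (G (x + t *\<^sub>R u)) u) (at t)" if t: "0 \<le> t" "t \<le> 1" for t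
    proof -
      have "((\<lambda>t. x + t *\<^sub>R u) has_derivative (\<lambda>h. h *\<^sub>R u)) (at t)"
        using line_has_vector_derivative[of x u t] unfolding has_vector_derivative_def .
      from diff_chain_at[OF this V[OF inN[OF t]]]
      show ?thesis unfolding has_field_derivative_def \<phi>_def o_def
        by (rule has_derivative_eq_rhs) (simp add: fun_eq_iff mult.commute)
    qed
    have "(0::real) < 1" by simp
    from MVT2[OF this, of \<phi> "\<lambda>t. inner (G (x + t *\<^sub>R u)) u"] d\<phi>
    obtain z where z: "0 < z" "z < 1" "\<phi> 1 - \<phi> 0 = (1 - 0) * inner (G (x + z *\<^sub>R u)) u" by blast
    define R where "R = G (x + z *\<^sub>R u) - z *\<^sub>R B u"
    have "norm R \<le> m / 2 * norm (z *\<^sub>R u)"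
      using d(2)[of "x + z *\<^sub>R u"] small[of z] z unfolding R_def G(2) linear_scale[OF lin, symmetric] by simp
    then have "\<bar>inner R u\<bar> \<le> (m / 2 * norm (z *\<^sub>R u)) * norm u"
      using Cauchy_Schwarz_ineq2[of R u] mult_right_mono[of "norm R" _ "norm u"] by (meson norm_ge_zero order_trans)
    also have "\<dots> = z * (m / 2 * (norm u)\<^sup>2)" using z(1) by (simp add: power2_eq_square)
    finally have 1: "\<bar>inner R u\<bar> \<le> z * (m / 2 * (norm u)\<^sup>2)" .
    have "inner (G (x + z *\<^sub>R u)) u = z * inner (B u) u + inner R u" unfolding R_def by (simp add: inner_diff_left)
    moreover have "2 * (z * (m / 2 * (norm u)\<^sup>2)) \<le> z * inner (B u) u" using m(2)[OF u(1)] z(1) by simp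
    moreover have "z * (m / 2 * (norm u)\<^sup>2) > 0" using z(1) m(1) u(2) by simp
    moreover have "- inner R u \<le> z * (m / 2 * (norm u)\<^sup>2)" using 1 by simp
    moreover have "p > 0" if "- a \<le> q" "p = b + a" "2 * q \<le> b" "q > 0" for p q a b :: real
      using that by linarith
    ultimately have "inner (G (x + z *\<^sub>R u)) u > 0" by blast
    then show "V x < V (x + u)" using z(3) unfolding \<phi>_def by simp
  qed
qed

text \<open>A solution that leaves the ball of radius \<open>\<rho>\<close> must cross the sphere of that radius,
  where the conserved function exceeds its value at the centre by a fixed amount; starting close to the centre it
  does not have enough energy. Conservation is only assumed up to the first exit from the domain of the chart.\<close>

lemma energy_barrier:
  fixes V :: "'a::euclidean_space \<Rightarrow> real"
  assumes X: "subspace X" and r: "r > 0" and cont: "continuous_on (ball x r) V"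
    and min: "\<And>u. u \<in> X \<Longrightarrow> u \<noteq> 0 \<Longrightarrow> norm u < r \<Longrightarrow> V x < V (x + u)" and \<epsilon>: "\<epsilon> > 0"
  obtains \<delta> where "\<delta> > 0"
    "\<And>(T :: real) y t. continuous_on {0..T} y \<Longrightarrow> (\<And>t. t \<in> {0..T} \<Longrightarrow> y t - x \<in> X) \<Longrightarrow>
      (\<And>t. t \<in> {0..T} \<Longrightarrow> (\<And>s. s \<in> {0..t} \<Longrightarrow> y s \<in> ball x r) \<Longrightarrow> V (y t) = V (y 0)) \<Longrightarrow>
      dist (y 0) x < \<delta> \<Longrightarrow> t \<in> {0..T} \<Longrightarrow> dist (y t) x < \<epsilon>"
proof -
  define \<rho> where "\<rho> = min \<epsilon> (r / 2)"
  have \<rho>: "\<rho> > 0" "\<rho> < r" "\<rho> \<le> \<epsilon>" unfolding \<rho>_def using r \<epsilon> by auto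
  define K where "K = (+) x ` (X \<inter> sphere 0 \<rho>)"
  have "compact (X \<inter> sphere 0 \<rho>)" using closed_subspace[OF X] by (intro closed_Int_compact) simp_all
  then have "compact K" unfolding K_def by (rule compact_translation)
  have KI: "z \<in> K" if "z - x \<in> X" "dist z x = \<rho>" for z
    unfolding K_def using that by (intro image_eqI[of _ _ "z - x"]) (simp_all add: dist_norm norm_minus_commute)
  have KV: "V x < V z" if zK: "z \<in> K" for z
  proof -
    obtain u where "z = x + u" "u \<in> X \<inter> sphere 0 \<rho>" using zK unfolding K_def by blast
    then have "z = x + u" "u \<in> X" "norm u = \<rho>" by simp_all
    then show ?thesis using min[of u] \<rho> by auto
  qed
  have "K \<subseteq> ball x r"
  proof
    fix z assume "z \<in> K"
    then obtain u where "z = x + u" "norm u = \<rho>" unfolding K_def by auto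
    then show "z \<in> ball x r" using \<rho>(2) by (simp add: dist_norm)
  qed
  with cont have contK: "continuous_on K V" by (rule continuous_on_subset)
  obtain M where M: "V x < M" "\<And>z. z \<in> K \<Longrightarrow> M \<le> V z"
  proof (cases "K = {}")
    case True
    show thesis by (rule that[of "V x + 1"]) (simp_all add: True)
  next
    case False
    obtain z where z: "z \<in> K" "\<And>w. w \<in> K \<Longrightarrow> V z \<le> V w"
      using continuous_attains_inf[OF \<open>compact K\<close> False contK] by blast
    show thesis by (rule that[of "V z"]) (use KV z in simp_all)
  qed
  have "isCont V x" using cont r continuous_on_eq_continuous_at[of "ball x r" V] by simp
  then have "(V \<longlongrightarrow> V x) (nhds x)" unfolding isCont_def by (simp add: tendsto_at_iff_tendsto_nhds)
  then have "\<forall>\<^sub>F z in nhds x. V z < M" using M(1) by (rule order_tendstoD(2))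
  then obtain d where d: "d > 0" "\<And>z. dist z x < d \<Longrightarrow> V z < M" unfolding eventually_nhds_metric by blast
  show thesis
  proof (rule that[of "min d \<rho>"])
    show "min d \<rho> > 0" using d(1) \<rho>(1) by simp
    fix T :: real and y t
    assume y: "continuous_on {0..T} y" "\<And>t. t \<in> {0..T} \<Longrightarrow> y t - x \<in> X"
      and const: "\<And>t. t \<in> {0..T} \<Longrightarrow> (\<And>s. s \<in> {0..t} \<Longrightarrow> y s \<in> ball x r) \<Longrightarrow> V (y t) = V (y 0)"
      and y0: "dist (y 0) x < min d \<rho>" and t: "t \<in> {0..T}"
    show "dist (y t) x < \<epsilon>"
    proof (rule ccontr)
      assume "\<not> dist (y t) x < \<epsilon>"
      then have far: "\<rho> \<le> dist (y t) x" using \<rho>(3) by linarith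
      define D where "D s = dist (y s) x" for s
      have contD: "continuous_on {0..t} D"
        unfolding D_def using t by (intro continuous_intros continuous_on_subset[OF y(1)]) simp
      define E where "E = {s \<in> {0..t}. \<rho> \<le> D s}"
      have "closed E" unfolding E_def
        by (intro continuous_closed_preimage_constant continuous_on_closed_Collect_le contD continuous_on_const closed_atLeastAtMost)
      moreover have "E \<subseteq> {0..t}" unfolding E_def by blast
      ultimately have "compact E" using compact_Icc closed_Int_compact by (metis inf.absorb1)
      moreover have "t \<in> E" unfolding E_def D_def using far t by simp
      ultimately obtain \<tau> where \<tau>: "\<tau> \<in> E" "\<And>s. s \<in> E \<Longrightarrow> \<tau> \<le> s"
        using compact_attains_inf[of E] by blast
      have \<tau>t: "0 \<le> \<tau>" "\<tau> \<le> t" "\<rho> \<le> D \<tau>" using \<tau>(1) unfolding E_def by simp_all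
      have "D 0 \<le> \<rho>" using y0 unfolding D_def by simp
      moreover have "continuous_on {0..\<tau>} D" by (rule continuous_on_subset[OF contD]) (use \<tau>t in simp)
      ultimately obtain s where s: "0 \<le> s" "s \<le> \<tau>" "D s = \<rho>" using IVT'[of D 0 \<rho> \<tau>] \<tau>t by blast
      then have "s \<in> E" unfolding E_def using \<tau>t by simp
      then have D\<tau>: "D \<tau> = \<rho>" using \<tau>(2)[of s] s by simp
      have "y s \<in> ball x r" if s: "s \<in> {0..\<tau>}" for s
      proof -
        have "D s \<le> \<rho>"
        proof (rule ccontr)
          assume a: "\<not> D s \<le> \<rho>"
          then have "s \<in> E" unfolding E_def using s \<tau>t by simp
          then have "s = \<tau>" using \<tau>(2)[of s] s by simp
          then show False using a D\<tau> by simp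
        qed
        then show ?thesis using \<rho>(2) unfolding D_def by (simp add: dist_commute)
      qed
      then have "V (y \<tau>) = V (y 0)" using const[of \<tau>] \<tau>t t by simp
      also have "\<dots> < M" using d(2) y0 by simp
      also have "M \<le> V (y \<tau>)" by (intro M(2) KI y(2)) (use \<tau>t t D\<tau> in \<open>simp_all add: D_def\<close>)
      finally show False by simp
    qed
  qed
qed

context equivariant_chart
begin

text \<open>The conserved function is \<open>f - |\<mu>|\<^sup>2 / (2 l)\<close>; the Casimir
  \<open>|\<mu>|\<^sup>2\<close> makes the point critical in the whole chart and not just on its reduced space, which
  yields stability without introducing coordinates on the sphere.\<close>

lemma lyapunov_stable_if_definite:
  assumes x: "x \<in> N" "snd x \<in> W" "snd (grad f x) = 0" and l: "fst x = l *\<^sub>R ang x" "l \<noteq> 0"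
    and pos: "\<And>u. snd u \<in> W \<Longrightarrow> u \<noteq> 0 \<Longrightarrow> sg * (inner (hess x u) u - (norm (fst u))\<^sup>2 / l) > 0"
  shows "lyapunov_stable W \<omega> P H x"
proof -
  define X :: "'v quot set" where "X = {u. snd u \<in> W}"
  have X: "subspace X" using W unfolding X_def subspace_def by simp
  define V where "V y = sg * (f y - 1 / (2 * l) * inner (fst y) (fst y))" for y
  define G where "G y = sg *\<^sub>R (grad f y - (1 / l) *\<^sub>R (fst y, 0))" for y
  define B where "B u = sg *\<^sub>R (hess x u - (1 / l) *\<^sub>R (fst u, 0))" for u
  have dV: "(V has_derivative (\<lambda>u. inner (G y) u)) (at y)" if "y \<in> N" for y
  proof -
    have fst: "((\<lambda>y. fst y) has_derivative (\<lambda>u. fst u)) (at y)" by (intro has_derivative_fst has_derivative_ident)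
    have "inner (G y) u = sg * (inner (grad f y) u - 1 / (2 * l) * (inner (fst y) (fst u) + inner (fst u) (fst y)))" for u
      unfolding G_def inner_commute[of "fst u" "fst y"] by (simp add: inner_diff_left inner_prod_def[of "((1 / l) *\<^sub>R fst y, 0)"])
    then show ?thesis unfolding V_def
      by (simp only:)
        (intro has_derivative_mult_right has_derivative_diff f_deriv[OF that] has_derivative_inner fst)
  qed
  have dG: "(G has_derivative B) (at x)"
    unfolding G_def[abs_def] B_def[abs_def]
    by (intro has_derivative_scaleR_right has_derivative_diff grad_deriv[OF x(1)] has_derivative_Pair
        has_derivative_fst has_derivative_ident has_derivative_const)
  have G0: "G x = 0"
    unfolding G_def using x(3) l unfolding ang_def by (simp add: prod_eq_iff)
  have posB: "inner (B u) u > 0" if "u \<in> X" "u \<noteq> 0" for u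
  proof -
    have "inner (B u) u = sg * (inner (hess x u) u - (norm (fst u))\<^sup>2 / l)"
      unfolding B_def by (simp add: inner_diff_left inner_prod_def[of "(_, 0)"] power2_norm_eq_inner)
    then show ?thesis using pos that unfolding X_def by simp
  qed
  obtain r where r: "r > 0" "ball x r \<subseteq> N" "\<And>u. u \<in> X \<Longrightarrow> u \<noteq> 0 \<Longrightarrow> norm u < r \<Longrightarrow> V x < V (x + u)"
    using strict_minimum_on_subspace[OF X N x(1) dV dG G0 posB] by blast
  have contV: "continuous_on (ball x r) V"
  proof (intro continuous_at_imp_continuous_on ballI)
    fix y assume "y \<in> ball x r"
    then have "y \<in> N" using r(2) by blast
    from has_derivative_continuous[OF dV[OF this]] show "isCont V y" .
  qed
  have flow: "inner (G y) (reduced_field W \<omega> P H y) = 0" if y: "y \<in> N" "snd y \<in> W" for y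
  proof -
    note s = NS[OF y]
    let ?d = "snd (grad f y)"
    have "inner ?d (sharp (snd y) ?d) = \<omega> (snd y) (sharp (snd y) ?d) (sharp (snd y) ?d)"
      using sharp(1,2)[OF s] by simp
    then have "inner ?d (sharp (snd y) ?d) = 0" using form(2)[OF s] sharp(1)[OF s] by simp
    then show ?thesis
      unfolding reduced_field_eq[OF y] G_def
      by (simp add: inner_diff_left inner_prod_def dot_cross_self ang_def)
  qed
  show ?thesis
    unfolding lyapunov_stable_def
  proof (intro allI impI)
    fix \<epsilon> :: real assume "\<epsilon> > 0"
    then obtain \<delta> where \<delta>: "\<delta> > 0"
      "\<And>(T :: real) y t. continuous_on {0..T} y \<Longrightarrow> (\<And>t. t \<in> {0..T} \<Longrightarrow> y t - x \<in> X) \<Longrightarrow>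
      (\<And>t. t \<in> {0..T} \<Longrightarrow> (\<And>s. s \<in> {0..t} \<Longrightarrow> y s \<in> ball x r) \<Longrightarrow> V (y t) = V (y 0)) \<Longrightarrow>
      dist (y 0) x < \<delta> \<Longrightarrow> t \<in> {0..T} \<Longrightarrow> dist (y t) x < \<epsilon>"
      using energy_barrier[OF X r(1) contV r(3)] by blast
    show "\<exists>\<delta>>0. \<forall>T>0. \<forall>y. (\<forall>t\<in>{0..T}. y t \<in> reduced_space P (fst x) \<and>
            (y has_vector_derivative reduced_field W \<omega> P H (y t)) (at t within {0..T})) \<and>
        dist (y 0) x < \<delta> \<longrightarrow> (\<forall>t\<in>{0..T}. dist (y t) x < \<epsilon>)"
    proof (intro exI[of _ \<delta>] conjI allI impI ballI \<delta>(1))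
      fix T y t
      assume "(\<forall>t\<in>{0..T}. y t \<in> reduced_space P (fst x) \<and>
            (y has_vector_derivative reduced_field W \<omega> P H (y t)) (at t within {0..T})) \<and> dist (y 0) x < \<delta>"
      then have y: "\<And>t. t \<in> {0..T} \<Longrightarrow> y t \<in> reduced_space P (fst x)"
        "\<And>t. t \<in> {0..T} \<Longrightarrow> (y has_vector_derivative reduced_field W \<omega> P H (y t)) (at t within {0..T})"
        "dist (y 0) x < \<delta>" by blast+
      have yW: "snd (y t) \<in> W" if "t \<in> {0..T}" for t
        using reduced_space_subset[of "fst x"] y(1)[OF that] by (rule CollectD[OF subsetD])
      assume t: "t \<in> {0..T}"
      show "dist (y t) x < \<epsilon>"
      proof (rule \<delta>(2)[of T y, OF _ _ _ y(3) t])
        show "continuous_on {0..T} y"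
          unfolding continuous_on_eq_continuous_within
          by (intro ballI has_vector_derivative_continuous[OF y(2)])
        show "y t - x \<in> X" if "t \<in> {0..T}" for t
          unfolding X_def using subspace_diff[OF W yW[OF that] x(2)] by simp
        fix t assume t: "t \<in> {0..T}" and near: "\<And>s. s \<in> {0..t} \<Longrightarrow> y s \<in> ball x r"
        have "((\<lambda>s. V (y s)) has_derivative (\<lambda>h. 0)) (at s within {0..t})" if s: "s \<in> {0..t}" for s
        proof -
          have sT: "s \<in> {0..T}" using s t by simp
          have sN: "y s \<in> N" using near[OF s] r(2) by blast
          have "(y has_derivative (\<lambda>h. h *\<^sub>R reduced_field W \<omega> P H (y s))) (at s within {0..t})"
            by (rule has_derivative_subset[OF y(2)[OF sT, unfolded has_vector_derivative_def]]) (use t in simp)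
          from has_derivative_compose[OF this dV[OF sN]]
          show ?thesis unfolding inner_scaleR_right flow[OF sN yW[OF sT]] mult_zero_right .
        qed
        then have "\<exists>c. \<forall>s\<in>{0..t}. V (y s) = c" by (intro has_derivative_zero_constant) auto
        then obtain k where k: "\<And>s. s \<in> {0..t} \<Longrightarrow> V (y s) = k" by blast
        show "V (y t) = V (y 0)" using k[of t] k[of 0] t by simp
      qed
    qed
  qed
qed

end

section \<open>Stability near zero momentum\<close>

text \<open>Converts the statements about sequences, for which compactness arguments are convenient, to statements
  about intervals.\<close>

lemma interval_from_sequences:
  fixes a :: real
  assumes a: "a > 0" and Q: "\<And>s. (\<And>k. s k \<in> {0<..<a}) \<Longrightarrow> s \<longlonglongrightarrow> 0 \<Longrightarrow> \<exists>k::nat. Q (s k)"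
  obtains b where "b \<in> {0<..a}" "\<And>t. t \<in> {0<..<b} \<Longrightarrow> Q t"
proof (rule ccontr)
  assume neg: "\<not> thesis"
  have "\<exists>t. t \<in> {0<..<a / real (Suc k)} \<and> \<not> Q t" for k
  proof (rule ccontr)
    assume c: "\<nexists>t. t \<in> {0<..<a / real (Suc k)} \<and> \<not> Q t"
    have "a / real (Suc k) \<in> {0<..a}" using a by (simp add: field_simps)
    then have thesis by (rule that) (use c in blast)
    with neg show False ..
  qed
  then obtain s where s: "\<And>k. s k \<in> {0<..<a / real (Suc k)}" "\<And>k. \<not> Q (s k)" by metis
  have "a / real (Suc k) \<le> a" for k using a by (simp add: field_simps)
  then have in_a: "s k \<in> {0<..<a}" for k
    using s(1)[of k] by (meson greaterThanLessThan_iff less_le_trans)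
  have lim: "(\<lambda>k. a / real (Suc k)) \<longlonglongrightarrow> 0"
    using tendsto_mult_right_zero[OF LIMSEQ_inverse_real_of_nat, of a] by (simp add: divide_inverse)
  have "s \<longlonglongrightarrow> 0"
  proof (rule tendsto_sandwich[OF _ _ tendsto_const lim])
    show "\<forall>\<^sub>F k in sequentially. 0 \<le> s k" using s(1) by (intro always_eventually allI) (simp add: less_imp_le)
    show "\<forall>\<^sub>F k in sequentially. s k \<le> a / real (Suc k)"
      using s(1) by (intro always_eventually allI) (meson greaterThanLessThan_iff less_imp_le)
  qed
  from Q[OF in_a this] s(2) show False by blast
qed

text \<open>An eigenvector with nonzero eigenvalue lies in the range.\<close>

lemma spectrum_on_range:
  assumes T: "subspace T" and L: "\<And>u. u \<in> V \<Longrightarrow> L u \<in> T" and l: "l \<in> spectrum_on V L" "l \<noteq> 0"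
  shows "l \<in> spectrum_on T L"
proof -
  obtain z where z: "complex_eigenvector V L l z" using l(1) unfolding spectrum_on_def by blast
  obtain u v where uv: "z = (u, v)" by (cases z)
  have e: "u \<in> V" "v \<in> V" "L u = Re l *\<^sub>R u - Im l *\<^sub>R v" "L v = Im l *\<^sub>R u + Re l *\<^sub>R v"
    using z unfolding complex_eigenvector_def uv by simp_all
  define n where "n = (Re l)\<^sup>2 + (Im l)\<^sup>2"
  have "n \<noteq> 0" unfolding n_def using l(2) by (simp add: complex_eq_iff sum_power2_eq_zero_iff)
  have "u = (1 / n) *\<^sub>R (Re l *\<^sub>R L u + Im l *\<^sub>R L v)"
  proof -
    have "Re l *\<^sub>R L u + Im l *\<^sub>R L v = n *\<^sub>R u" unfolding e n_def
      by (simp add: algebra_simps power2_eq_square)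
    then show ?thesis using \<open>n \<noteq> 0\<close> by simp
  qed
  moreover have "v = (1 / n) *\<^sub>R (Re l *\<^sub>R L v - Im l *\<^sub>R L u)"
  proof -
    have "Re l *\<^sub>R L v - Im l *\<^sub>R L u = n *\<^sub>R v" unfolding e n_def
      by (simp add: algebra_simps power2_eq_square)
    then show ?thesis using \<open>n \<noteq> 0\<close> by simp
  qed
  moreover have "(1 / n) *\<^sub>R (Re l *\<^sub>R L u + Im l *\<^sub>R L v) \<in> T" "(1 / n) *\<^sub>R (Re l *\<^sub>R L v - Im l *\<^sub>R L u) \<in> T"
    using L[OF e(1)] L[OF e(2)] T by (simp_all add: subspace_add subspace_diff subspace_scale)
  ultimately have "u \<in> T" "v \<in> T" by simp_all
  then have "complex_eigenvector T L l z" using z unfolding complex_eigenvector_def uv by simp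
  then show ?thesis unfolding spectrum_on_def by blast
qed

context relative_equilibrium_chart
begin

text \<open>The linearization at \<open>s\<^sub>0\<close> of the reduced dynamics at zero momentum.\<close>

definition L0 :: "'a \<Rightarrow> 'a" where "L0 v = sharp s0 (snd (hess (0, s0) (0, v)))"

lemma s0S: "s0 \<in> S" using NS[OF p0N] s0W by simp

lemma linear_L0: "linear L0"
proof -
  have "linear (\<lambda>v::'a. (0 :: real^3, v))" by (intro linearI) simp_all
  from linear_compose[OF linear_compose[OF linear_compose[OF this linear_hess[OF p0N]] linear_snd] linear_sharp[OF s0S]]
  show ?thesis unfolding o_def L0_def[abs_def] .
qed

lemma L0_W: "L0 v \<in> W" unfolding L0_def by (rule sharp(1)[OF s0S])

lemma form_L0: "u \<in> W \<Longrightarrow> v \<in> W \<Longrightarrow> \<omega> s0 (L0 u) v = hessian_0 P H s0 u v"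
  unfolding hessian_0_eq[OF p0N s0W] L0_def by (rule sharp(2)[OF s0S])

lemma inf_symplectic_L0: "inf_symplectic W (\<omega> s0) L0"
  unfolding inf_symplectic_def
proof (intro conjI ballI)
  show "L0 ` W \<subseteq> W" by (intro image_subsetI L0_W)
  fix u v assume uv: "u \<in> W" "v \<in> W"
  have "\<omega> s0 u (L0 v) = - \<omega> s0 (L0 v) u"
    by (rule alternating_antisymmetric[OF form(1)[OF s0S] W form(2)[OF s0S]]) (use uv L0_W in simp_all)
  moreover have "inner (snd (hess (0, s0) (0, u))) v = inner (snd (hess (0, s0) (0, v))) u"
    using hess_sym[OF p0N, of "(0, u)" "(0, v)"] by (simp add: inner_prod_def inner_commute[of u])
  ultimately show "\<omega> s0 (L0 u) v + \<omega> s0 u (L0 v) = 0"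
    unfolding L0_def using uv by (simp add: sharp(2)[OF s0S])
qed (rule linear_L0)

lemma linearization_p0:
  assumes "v \<in> W"
  shows "linearization W \<omega> P H (0, s0) (0, v) = (0, L0 v)"
proof -
  have "linearization W \<omega> P H (0, s0) (0, v) = lin_map (0, s0) (0, v)"
    by (rule linearization_eq) (use p0N s0W p0_crit assms in \<open>simp_all add: reduced_tangent_0\<close>)
  then show ?thesis unfolding lin_map_def L0_def by simp
qed

lemma spectrum_p0: "spectrum_on (reduced_tangent W (0, s0)) (linearization W \<omega> P H (0, s0)) = spectrum_on W L0"
proof -
  have "linear (\<lambda>v::'a. (0 :: real^3, v))" by (intro linearI) simp_all
  moreover have "inj_on (\<lambda>v::'a. (0 :: real^3, v)) W" by (intro inj_onI) simp
  moreover have "L0 ` W \<subseteq> W" by (intro image_subsetI L0_W)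
  ultimately have "spectrum_on ((\<lambda>v::'a. (0 :: real^3, v)) ` W) (linearization W \<omega> P H (0, s0)) = spectrum_on W L0"
    using W linearization_p0 by (intro spectrum_on_conjugate)
  moreover have "(\<lambda>v::'a. (0 :: real^3, v)) ` W = {0} \<times> W" by auto
  ultimately show ?thesis unfolding reduced_tangent_0 by simp
qed

text \<open>Transfer from the reduced tangent space \<open>{0} \<times> W\<close> to \<open>W\<close>.\<close>

lemma strongly_stable_L0:
  assumes "strongly_stable_0 W \<omega> P H s0"
  shows "strongly_linearly_stable W (\<omega> s0) L0"
proof -
  let ?\<Omega> = "\<lambda>x y :: 'a quot. \<omega> s0 (snd x) (snd y)" and ?T = "{0 :: real^3} \<times> W"
  obtain \<epsilon> where \<epsilon>: "\<epsilon> > 0" and st: "\<And>M. inf_symplectic ?T ?\<Omega> M \<Longrightarrow>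
      (\<And>v. v \<in> ?T \<Longrightarrow> norm (M v - linearization W \<omega> P H (0, s0) v) \<le> \<epsilon> * norm v) \<Longrightarrow> linearly_stable ?T M"
    using assms unfolding strongly_stable_0_def strongly_linearly_stable_def reduced_tangent_0 by metis
  have "linearly_stable W M" if M: "inf_symplectic W (\<omega> s0) M" "\<And>v. v \<in> W \<Longrightarrow> norm (M v - L0 v) \<le> \<epsilon> * norm v" for M
  proof -
    define M' where "M' u = (0 :: real^3, M (snd u))" for u :: "'a quot"
    have Mp: "linear M" "M ` W \<subseteq> W" "\<And>u v. u \<in> W \<Longrightarrow> v \<in> W \<Longrightarrow> \<omega> s0 (M u) v + \<omega> s0 u (M v) = 0"
      using M(1) unfolding inf_symplectic_def by blast+
    have lin: "linear M'" unfolding M'_def using Mp(1) by (intro linearI) (simp_all add: linear_add linear_scale)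
    have M'T: "M' ` ?T \<subseteq> ?T"
    proof (rule image_subsetI)
      fix u assume "u \<in> ?T"
      then have "M (snd u) \<in> W" using Mp(2) by (simp add: mem_Times_iff image_subset_iff)
      then show "M' u \<in> ?T" unfolding M'_def by simp
    qed
    have "linearly_stable ?T M'"
    proof (rule st)
      show "inf_symplectic ?T ?\<Omega> M'" unfolding inf_symplectic_def
        using lin M'T Mp(3) unfolding M'_def by (simp add: mem_Times_iff)
      fix v assume "v \<in> ?T"
      then obtain w where w: "v = (0, w)" "w \<in> W" by (cases v) simp
      then show "norm (M' v - linearization W \<omega> P H (0, s0) v) \<le> \<epsilon> * norm v"
        using M(2)[OF w(2)] unfolding w(1) linearization_p0[OF w(2)] M'_def by (simp add: norm_Pair)
    qed
    then have "linearly_stable (snd ` ?T) M"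
    proof (rule linearly_stable_conjugate[rotated -1])
      show "inj_on snd ?T" by (rule inj_onI) (simp add: prod_eq_iff mem_Times_iff)
      show "subspace ?T" using W by (intro subspace_Times subspace_single_0)
      show "M (snd v) = snd (M' v)" for v unfolding M'_def by simp
    qed (rule linear_snd M'T lin Mp(1))+
    then show ?thesis by simp
  qed
  then show ?thesis unfolding strongly_linearly_stable_def using inf_symplectic_L0 \<epsilon> by blast
qed

lemma elliptic_p0:
  assumes "strongly_stable_0 W \<omega> P H s0"
  shows "elliptic W \<omega> P H (0, s0)"
proof -
  let ?L = "linearization W \<omega> P H (0, s0)" and ?V = "reduced_tangent W (0, s0)"
  obtain \<epsilon> where "\<epsilon> > 0" "inf_symplectic ?V (\<lambda>x y. \<omega> s0 (snd x) (snd y)) ?L" and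
    st: "\<And>M. inf_symplectic ?V (\<lambda>x y. \<omega> s0 (snd x) (snd y)) M \<Longrightarrow>
      (\<And>v. v \<in> ?V \<Longrightarrow> norm (M v - ?L v) \<le> \<epsilon> * norm v) \<Longrightarrow> linearly_stable ?V M"
    using assms unfolding strongly_stable_0_def strongly_linearly_stable_def by metis
  then show ?thesis unfolding elliptic_def by (intro st) simp_all
qed

lemma definite_L0:
  assumes "definite_on W (hessian_0 P H s0)"
  shows "strongly_linearly_stable W (\<omega> s0) L0"
proof (rule definite_imp_strongly_linearly_stable[OF W form(1,2)[OF s0S] inf_symplectic_L0])
  show "definite_on W (\<lambda>u v. \<omega> s0 (L0 u) v)"
    using assms unfolding definite_on_def by (simp add: form_L0)
qed

text \<open>The angular velocity at the given point and \<open>a\<^sub>0\<close> differ by a rotation, and only their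
  common length enters.\<close>

lemma nonresonant_L0:
  assumes "\<not> rv_resonance W \<omega> P H s0 \<xi>" "norm \<xi> = norm a0"
  shows "Complex 0 (norm a0) \<notin> spectrum_on W L0"
proof -
  have "\<xi> \<noteq> 0" using assms(2) p0_ang by auto
  then obtain p q where pq: "p \<noteq> 0" "cross3 p \<xi> = - norm \<xi> *\<^sub>R q" "cross3 q \<xi> = norm \<xi> *\<^sub>R p"
    by (rule spectrum_on_rotation)
  have "complex_eigenvector UNIV (\<lambda>\<mu>. - cross3 \<xi> \<mu>) (Complex 0 (norm \<xi>)) (p, q)"
    unfolding complex_eigenvector_def using pq(1) pq(2,3) cross_skew[of p \<xi>] cross_skew[of q \<xi>] by (simp add: zero_prod_def)
  then have "Complex 0 (norm \<xi>) \<in> spectrum_on UNIV (\<lambda>\<mu>. - cross3 \<xi> \<mu>)" unfolding spectrum_on_def by blast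
  then show ?thesis using assms(1) unfolding rv_resonance_def spectrum_p0 assms(2)[symmetric] by blast
qed

text \<open>The points of the curve with parameter \<open>t \<noteq> 0\<close>.\<close>

definition branch_point :: "'a quot \<Rightarrow> real \<Rightarrow> bool" where
  "branch_point x t \<longleftrightarrow> x \<in> N \<and> snd x \<in> W \<and> snd (grad f x) = 0 \<and> ang x \<noteq> 0 \<and> t \<noteq> 0 \<and>
     fst x = (t / (norm (ang x))\<^sup>2) *\<^sub>R ang x"

text \<open>The factor \<open>r\<close> for which \<open>\<mu> = \<plusminus> r\<^sup>2 a\<close>.\<close>

definition scale :: "'a quot \<Rightarrow> real \<Rightarrow> real" where "scale x t = sqrt \<bar>t\<bar> / norm (ang x)"

lemma branch_pointD:
  assumes "branch_point x t"
  shows "x \<in> N" "snd x \<in> W" "snd (grad f x) = 0" "ang x \<noteq> 0" "t \<noteq> 0" "sgn t = 1 \<or> sgn t = -1"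
    "scale x t > 0" "fst x = (sgn t * (scale x t)\<^sup>2) *\<^sub>R ang x"
proof -
  show *: "x \<in> N" "snd x \<in> W" "snd (grad f x) = 0" "ang x \<noteq> 0" "t \<noteq> 0"
    using assms unfolding branch_point_def by blast+
  show "sgn t = 1 \<or> sgn t = -1" using * by (simp add: sgn_if)
  show "scale x t > 0" unfolding scale_def using * by simp
  have "sgn t * (scale x t)\<^sup>2 = t / (norm (ang x))\<^sup>2"
    unfolding scale_def power_divide by (simp add: sgn_mult_abs)
  then show "fst x = (sgn t * (scale x t)\<^sup>2) *\<^sub>R ang x" using assms unfolding branch_point_def by simp
qed

lemma hess_tendsto:
  assumes x: "\<And>k. x k \<in> N" "(x \<longlongrightarrow> (0, s0)) F" and u: "(u \<longlongrightarrow> u') F"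
  shows "((\<lambda>k. hess (x k) (u k)) \<longlongrightarrow> hess (0, s0) u') F"
  by (rule tendsto_linear_apply[OF subspace_UNIV linear_hess[OF x(1)] linear_hess[OF p0N]
        isCont_tendsto_compose[OF isCont_hess[OF p0N] x(2)] UNIV_I UNIV_I u])

text \<open>The coupling terms between the rotation and the slice carry a factor \<open>r\<close> and disappear in
  the limit.\<close>

lemma rescaled_tendsto:
  assumes x: "\<And>k. x k \<in> N" "\<And>k. snd (x k) \<in> W" "(x \<longlongrightarrow> (0, s0)) F"
    and r: "(r \<longlongrightarrow> 0) F" and e: "\<And>k. e k = 1 \<or> e k = (-1 :: real)"
  shows "((\<lambda>k. rescaled (x k) (r k) (e k) u) \<longlongrightarrow> (cross3 (fst u) a0, L0 (snd u))) F"
proof -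
  have la: "((\<lambda>k. ang (x k)) \<longlongrightarrow> a0) F"
    unfolding ang_def by (rule tendsto_fst[OF isCont_tendsto_compose[OF isCont_grad[OF p0N] x(3)]])
  have "((\<lambda>k. (r k *\<^sub>R fst u, snd u)) \<longlongrightarrow> (0 *\<^sub>R fst u, snd u)) F" by (intro tendsto_intros r)
  then have lh: "((\<lambda>k. hess (x k) (r k *\<^sub>R fst u, snd u)) \<longlongrightarrow> hess (0, s0) (0, snd u)) F"
    by (intro hess_tendsto[OF x(1,3)]) simp
  have er: "((\<lambda>k. e k * r k) \<longlongrightarrow> 0) F"
  proof (rule Lim_null_comparison[OF _ tendsto_norm_zero[OF r]])
    show "\<forall>\<^sub>F k in F. norm (e k * r k) \<le> norm (r k)"
    proof (intro always_eventually allI)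
      show "norm (e k * r k) \<le> norm (r k)" for k using e[of k] by (elim disjE) simp_all
    qed
  qed
  have lc: "((\<lambda>k. cross3 (fst u) (ang (x k)) + (e k * r k) *\<^sub>R cross3 (ang (x k)) (fst (hess (x k) (r k *\<^sub>R fst u, snd u)))) \<longlongrightarrow>
      cross3 (fst u) a0 + 0 *\<^sub>R cross3 a0 (fst (hess (0, s0) (0, snd u)))) F"
    by (intro tendsto_add tendsto_scaleR er bounded_bilinear.tendsto[OF bounded_bilinear_cross3] tendsto_const la tendsto_fst[OF lh])
  have sS: "snd (x k) \<in> S" for k by (rule NS[OF x(1,2)])
  have "((\<lambda>k. snd (x k)) \<longlongrightarrow> s0) F" using tendsto_snd[OF x(3)] by simp
  from tendsto_linear_apply[OF subspace_UNIV linear_sharp[OF sS] linear_sharp[OF s0S] sharp_tendsto[OF this sS s0S] UNIV_I UNIV_I tendsto_snd[OF lh]]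
  have "((\<lambda>k. sharp (snd (x k)) (snd (hess (x k) (r k *\<^sub>R fst u, snd u)))) \<longlongrightarrow> sharp s0 (snd (hess (0, s0) (0, snd u)))) F" .
  then show ?thesis using tendsto_Pair[OF lc] unfolding rescaled_def L0_def by simp
qed

lemma scale_tendsto:
  assumes x: "(x \<longlongrightarrow> (0, s0)) F" and t: "(t \<longlongrightarrow> 0) F"
  shows "((\<lambda>k. scale (x k) (t k)) \<longlongrightarrow> 0) F"
proof -
  have la: "((\<lambda>k. ang (x k)) \<longlongrightarrow> a0) F"
    unfolding ang_def by (rule tendsto_fst[OF isCont_tendsto_compose[OF isCont_grad[OF p0N] x]])
  have "((\<lambda>k. sqrt \<bar>t k\<bar> / norm (ang (x k))) \<longlongrightarrow> sqrt \<bar>0\<bar> / norm a0) F"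
    by (intro tendsto_intros t la) (simp add: p0_ang)
  then show ?thesis unfolding scale_def by simp
qed

lemma elliptic_near:
  assumes x: "\<And>k. branch_point (x k) (t k)" "x \<longlonglongrightarrow> (0, s0)" "t \<longlonglongrightarrow> 0"
    and strong: "strongly_linearly_stable W (\<omega> s0) L0" and nonres: "Complex 0 (norm a0) \<notin> spectrum_on W L0"
  shows "\<exists>k::nat. elliptic W \<omega> P H (x k)"
proof -
  note b = branch_pointD[OF x(1)]
  have sS: "snd (x k) \<in> S" for k by (rule NS[OF b(1,2)])
  have ls: "(\<lambda>k. snd (x k)) \<longlonglongrightarrow> s0" using tendsto_snd[OF x(2)] by simp
  have la: "(\<lambda>k. ang (x k)) \<longlonglongrightarrow> a0"
    unfolding ang_def by (rule tendsto_fst[OF isCont_tendsto_compose[OF isCont_grad[OF p0N] x(2)]])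
  have me: "- sgn (t k) = 1 \<or> - sgn (t k) = -1" for k using b(6)[of k] by auto
  have "\<forall>\<^sub>F k in sequentially. linearly_stable (perp_slice W (ang (x k))) (rescaled (x k) (scale (x k) (t k)) (sgn (t k)))"
    by (rule resonance_free_perturbation_stable[where \<omega> = "\<lambda>k. \<omega> (snd (x k))" and e = "\<lambda>k. - sgn (t k)",
          OF W form[OF s0S] strong nonres form(1)[OF sS] form(2)[OF sS] form_tendsto[OF ls sS s0S] la p0_ang me
          linear_rescaled[OF b(1,2)] rescaled_perp[OF b(1,2)] rescaled_skew[OF b(1,2,6,4)]
          rescaled_tendsto[OF b(1,2) x(2) scale_tendsto[OF x(2,3)] b(6)]])
  then obtain k where k: "linearly_stable (perp_slice W (ang (x k))) (rescaled (x k) (scale (x k) (t k)) (sgn (t k)))"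
    using eventually_happens trivial_limit_sequentially by blast
  show ?thesis
    by (rule exI, rule elliptic_if_rescaled_stable[OF b(1-4) b(6-8) k])
qed

text \<open>Instability of \<open>L\<^sub>0\<close> passes to the limit of the rescaled maps on the fixed space
  \<open>\<real>\<^sup>3 \<times> W\<close>, where semicontinuity of the spectrum applies. The eigenvectors found lie
  in the tangent space, because the range of the rescaled map does.\<close>

lemma lin_unstable_near:
  assumes x: "\<And>k. branch_point (x k) (t k)" "x \<longlonglongrightarrow> (0, s0)" "t \<longlonglongrightarrow> 0"
    and l: "l \<in> spectrum_on W L0" "Re l \<noteq> 0"
  shows "\<exists>k::nat. lin_unstable W \<omega> P H (x k)"
proof -
  note b = branch_pointD[OF x(1)]
  define V :: "'a quot set" where "V = {u. snd u \<in> W}"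
  have V: "subspace V" using W unfolding V_def subspace_def by simp
  define M where "M k = rescaled (x k) (scale (x k) (t k)) (sgn (t k))" for k
  define M' where "M' u = (cross3 (fst u) a0, L0 (snd u))" for u
  have T: "subspace (perp_slice W a)" for a unfolding perp_slice_def subspace_def
    using W by (auto simp: inner_add_right subspace_0 subspace_add subspace_scale)
  have lM: "linear M'" unfolding M'_def using linear_L0
    by (intro linearI) (simp_all add: linear_add linear_scale cross_add_left cross_mult_left)
  have M'V: "M' ` V \<subseteq> V" unfolding M'_def V_def using L0_W by (intro image_subsetI) simp
  have Mp: "M k u \<in> perp_slice W (ang (x k))" for k u unfolding M_def by (rule rescaled_perp[OF b(1,2)])
  have MV: "M k ` V \<subseteq> V" for k using Mp[of k] unfolding V_def perp_slice_def by (intro image_subsetI) simp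
  have lMk: "linear (M k)" for k unfolding M_def by (rule linear_rescaled[OF b(1,2)])
  have lim: "(\<lambda>k. M k u) \<longlonglongrightarrow> M' u" for u
    unfolding M_def M'_def by (rule rescaled_tendsto[OF b(1,2) x(2) scale_tendsto[OF x(2,3)] b(6)])
  obtain z where "complex_eigenvector W L0 l z" using l(1) unfolding spectrum_on_def by blast
  then have "complex_eigenvector V M' l ((0, fst z), (0, snd z))"
    unfolding complex_eigenvector_def V_def M'_def by (simp add: mem_Times_iff prod_eq_iff)
  then have "l \<in> spectrum_on V M'" unfolding spectrum_on_def by (intro CollectI exI)
  then obtain lk where lk: "\<And>k. lk k \<in> spectrum_on V (M k)" "lk \<longlonglongrightarrow> l"
    using spectrum_on_lower_semicontinuous[OF V lM M'V lMk MV lim] by metis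
  have "\<forall>\<^sub>F k in sequentially. Re (lk k) \<noteq> 0"
    using tendsto_Re[OF lk(2)] l(2) by (rule tendsto_imp_eventually_ne)
  then obtain k where k: "Re (lk k) \<noteq> 0"
    using eventually_happens trivial_limit_sequentially by blast
  then have "lk k \<noteq> 0" by auto
  then have "lk k \<in> spectrum_on (perp_slice W (ang (x k))) (M k)"
    by (intro spectrum_on_range[OF T Mp lk(1)])
  from lin_unstable_if_rescaled_unstable[OF b(1-4) b(6-8) this[unfolded M_def] k]
  show ?thesis by (rule exI)
qed

text \<open>After rescaling by \<open>r\<close>, the second derivative of the conserved function converges to
  \<open>|\<rho>|\<^sup>2 + sg (D\<^sub>s\<^sup>2f) v v\<close>, which is positive definite; the sign of
  \<open>t\<close> makes the first term positive.\<close>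

lemma lyapunov_stable_near:
  assumes x: "\<And>k. branch_point (x k) (t k)" "x \<longlonglongrightarrow> (0, s0)" "t \<longlonglongrightarrow> 0"
    and sg: "\<And>k. sgn (t k) = - sg" "sg = 1 \<or> sg = -1"
    and pos: "\<And>u. u \<in> W \<Longrightarrow> u \<noteq> 0 \<Longrightarrow> sg * hessian_0 P H s0 u u > 0"
  shows "\<exists>k::nat. lyapunov_stable W \<omega> P H (x k)"
proof -
  note b = branch_pointD[OF x(1)]
  define r where "r k = scale (x k) (t k)" for k
  have r: "r k > 0" for k unfolding r_def by (rule b(7))
  define V :: "'a quot set" where "V = {u. snd u \<in> W}"
  have V: "subspace V" using W unfolding V_def subspace_def by simp
  define h where "h k u = hess (x k) (r k *\<^sub>R fst u, snd u)" for k u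
  define A where "A k u = sg *\<^sub>R (r k *\<^sub>R fst (h k u), snd (h k u)) + (fst u, 0)" for k u
  define h0 where "h0 u = hess (0, s0) (0, snd u)" for u :: "'a quot"
  define A' where "A' u = sg *\<^sub>R (0 :: real^3, snd (h0 u)) + (fst u, 0)" for u
  have lin_h: "linear (\<lambda>u. hess y (q *\<^sub>R fst u, snd u))" if "y \<in> N" for y q
  proof -
    have "linear (\<lambda>u :: 'a quot. (q *\<^sub>R fst u, snd u))" by (intro linearI) (simp_all add: scaleR_add_right)
    from linear_compose[OF this linear_hess[OF that]] show ?thesis unfolding o_def .
  qed
  have lA: "linear (A k)" for k
    unfolding A_def using lin_h[OF b(1), of k "r k"] unfolding h_def[symmetric]
    by (intro linearI) (simp_all add: linear_add linear_scale algebra_simps)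
  have lA': "linear A'"
    unfolding A'_def using lin_h[OF p0N, of 0] unfolding scaleR_zero_left h0_def[symmetric]
    by (intro linearI) (simp_all add: linear_add linear_scale algebra_simps)
  have lr: "r \<longlonglongrightarrow> 0" unfolding r_def by (rule scale_tendsto[OF x(2,3)])
  have lim: "(\<lambda>k. A k u) \<longlonglongrightarrow> A' u" for u
  proof -
    have "(\<lambda>k. (r k *\<^sub>R fst u, snd u)) \<longlonglongrightarrow> (0 *\<^sub>R fst u, snd u)" by (intro tendsto_intros lr)
    then have lh: "(\<lambda>k. h k u) \<longlonglongrightarrow> hess (0, s0) (0, snd u)"
      unfolding h_def by (intro hess_tendsto[OF b(1) x(2)]) simp
    have "(\<lambda>k. A k u) \<longlonglongrightarrow> sg *\<^sub>R (0 *\<^sub>R fst (hess (0, s0) (0, snd u)), snd (hess (0, s0) (0, snd u))) + (fst u, 0)"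
      unfolding A_def by (intro tendsto_intros lr lh)
    then show ?thesis unfolding A'_def h0_def by simp
  qed
  have bl: "bilinear (\<lambda>u v. inner (A' u) v)"
    unfolding bilinear_def using lA'
    by (intro conjI allI linearI) (simp_all add: linear_add linear_scale inner_add_left inner_add_right)
  have A'pos: "inner (A' u) u > 0" if u: "u \<in> V" "u \<noteq> 0" for u
  proof -
    have uW: "snd u \<in> W" using u(1) unfolding V_def by simp
    have eq: "inner (A' u) u = inner (fst u) (fst u) + sg * hessian_0 P H s0 (snd u) (snd u)"
      unfolding A'_def h0_def hessian_0_eq[OF p0N s0W uW uW] by (simp add: inner_prod_def)
    show ?thesis
    proof (cases "snd u = 0")
      case True
      then have "fst u \<noteq> 0" using u(2) by (simp add: prod_eq_iff)
      then have "inner (fst u) (fst u) > 0" by simp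
      moreover have "hessian_0 P H s0 (snd u) (snd u) = 0" unfolding hessian_0_eq[OF p0N s0W uW uW] by (simp add: True)
      ultimately show ?thesis unfolding eq by simp
    next
      case False
      then show ?thesis unfolding eq using pos[OF uW] inner_ge_zero[of "fst u"] by linarith
    qed
  qed
  obtain m where m: "m > 0" "\<And>u. u \<in> V \<Longrightarrow> m * (norm u)\<^sup>2 \<le> inner (A' u) u"
    using positive_form_coercive[OF V bl A'pos] by blast
  have "m / 2 > 0" using m(1) by simp
  from linear_tendsto_uniform[OF lA lA' lim this]
  obtain k where k: "\<And>u. norm (A k u - A' u) \<le> m / 2 * norm u"
    using eventually_happens trivial_limit_sequentially by blast
  have Apos: "inner (A k u) u > 0" if u: "u \<in> V" "u \<noteq> 0" for u
  proof -
    have "\<bar>inner (A k u - A' u) u\<bar> \<le> norm (A k u - A' u) * norm u" by (rule Cauchy_Schwarz_ineq2)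
    also have "\<dots> \<le> (m / 2 * norm u) * norm u" by (intro mult_right_mono k norm_ge_zero)
    finally have "\<bar>inner (A k u) u - inner (A' u) u\<bar> \<le> m / 2 * (norm u)\<^sup>2"
      by (simp add: inner_diff_left power2_eq_square)
    moreover have "m / 2 * (norm u)\<^sup>2 > 0" using m(1) u(2) by simp
    moreover have "m * (norm u)\<^sup>2 = 2 * (m / 2 * (norm u)\<^sup>2)" by simp
    ultimately show ?thesis using m(2)[OF u(1)] by linarith
  qed
  have "lyapunov_stable W \<omega> P H (x k)"
  proof (rule lyapunov_stable_if_definite[OF b(1-3) b(8)])
    show "sgn (t k) * (scale (x k) (t k))\<^sup>2 \<noteq> 0" using b(6,7)[of k] by auto
    fix u :: "'a quot" assume u: "snd u \<in> W" "u \<noteq> 0"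
    \<comment> \<open>Undo the rescaling: the second derivative at \<open>u\<close> is the form \<open>A k\<close> at \<open>w\<close>.\<close>
    define w where "w = ((1 / r k) *\<^sub>R fst u, snd u)"
    have wV: "w \<in> V" unfolding w_def V_def using u(1) by simp
    have w0: "w \<noteq> 0" unfolding w_def using u(2) r[of k] by (auto simp: prod_eq_iff)
    have hw: "h k w = hess (x k) u" unfolding h_def w_def using r[of k] by simp
    have "inner (A k w) w = sg * inner (hess (x k) u) u + (norm (fst u))\<^sup>2 / (r k)\<^sup>2"
      unfolding A_def hw unfolding w_def power2_norm_eq_inner using r[of k]
      by (simp add: inner_prod_def algebra_simps power2_eq_square)
    also have "(norm (fst u))\<^sup>2 / (r k)\<^sup>2 = - sg * ((norm (fst u))\<^sup>2 / (sgn (t k) * (scale (x k) (t k))\<^sup>2))"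
      unfolding sg(1) r_def using sg(2) by (elim disjE) simp_all
    finally show "sg * (inner (hess (x k) u) u - (norm (fst u))\<^sup>2 / (sgn (t k) * (scale (x k) (t k))\<^sup>2)) > 0"
      using Apos[OF wV w0] by (simp add: algebra_simps)
  qed
  then show ?thesis by (rule exI)
qed

end

section \<open>Stability along the curve\<close>

context relative_equilibrium_chart
begin

text \<open>Points of the curve with \<open>t\<close> of fixed sign form sequences of branch points that converge to
  \<open>(0, s\<^sub>0)\<close>. For a definite Hessian the side of Lyapunov stability is where the sign of
  \<open>t\<close> is opposite to that of the Hessian.\<close>

lemma stability_along_curve:
  assumes ang: "norm \<xi> = norm a0" and a: "a > 0" and c0: "c 0 = (0, s0)"
    and c: "\<And>t. t \<in> {-a<..<a} \<Longrightarrow> t \<noteq> 0 \<Longrightarrow> branch_point (c t) t" and cont: "isCont c 0"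
  shows "definite_on W (hessian_0 P H s0) \<longrightarrow>
        (\<exists>\<sigma>\<in>{1, -1}. \<exists>b\<in>{0<..a}.
           (\<forall>t\<in>{0<..<b}. lyapunov_stable W \<omega> P H (c (\<sigma> * t))) \<and>
           (\<not> rv_resonance W \<omega> P H s0 \<xi> \<longrightarrow>
              (\<forall>t\<in>{0<..<b}. elliptic W \<omega> P H (c (- \<sigma> * t)))))" (is ?definite)
    "strongly_stable_0 W \<omega> P H s0 \<and> \<not> rv_resonance W \<omega> P H s0 \<xi> \<longrightarrow>
        (\<exists>b\<in>{0<..a}. \<forall>t\<in>{-b<..<b}. elliptic W \<omega> P H (c t))" (is ?strong)
    "lin_unstable W \<omega> P H (0, s0) \<longrightarrow>
        (\<exists>b\<in>{0<..a}. \<forall>t\<in>{-b<..<b}. lin_unstable W \<omega> P H (c t))" (is ?unstable)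
proof -
  have seq: "\<And>k. branch_point (c (\<sigma> * s k)) (\<sigma> * s k)" "(\<lambda>k. c (\<sigma> * s k)) \<longlonglongrightarrow> (0, s0)" "(\<lambda>k. \<sigma> * s k) \<longlonglongrightarrow> 0"
    if s: "\<And>k. s k \<in> {0<..<a}" "s \<longlonglongrightarrow> 0" and \<sigma>: "\<sigma> = 1 \<or> \<sigma> = -1" for \<sigma> and s :: "nat \<Rightarrow> real"
  proof -
    show l: "(\<lambda>k. \<sigma> * s k) \<longlonglongrightarrow> 0" using tendsto_mult_right_zero[OF s(2)] .
    show "branch_point (c (\<sigma> * s k)) (\<sigma> * s k)" for k
      using s(1)[of k] \<sigma> by (intro c) auto
    show "(\<lambda>k. c (\<sigma> * s k)) \<longlonglongrightarrow> (0, s0)"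
      using isCont_tendsto_compose[OF cont l] unfolding c0 .
  qed
  have ell: "\<exists>b\<in>{0<..a}. \<forall>t\<in>{0<..<b}. elliptic W \<omega> P H (c (\<sigma> * t))"
    if \<sigma>: "\<sigma> = 1 \<or> \<sigma> = -1" and st: "strongly_linearly_stable W (\<omega> s0) L0" and nr: "\<not> rv_resonance W \<omega> P H s0 \<xi>" for \<sigma>
  proof -
    show ?thesis
    proof (rule interval_from_sequences[OF a, of "\<lambda>t. elliptic W \<omega> P H (c (\<sigma> * t))"])
      fix s :: "nat \<Rightarrow> real" assume s: "\<And>k. s k \<in> {0<..<a}" "s \<longlonglongrightarrow> 0"
      show "\<exists>k. elliptic W \<omega> P H (c (\<sigma> * s k))"
        by (rule elliptic_near[OF seq[OF s \<sigma>] st nonresonant_L0[OF nr ang]])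
    qed blast
  qed
  have two_sided: "\<exists>b\<in>{0<..a}. \<forall>t\<in>{-b<..<b}. Q t"
    if p: "\<exists>b\<in>{0<..a}. \<forall>t\<in>{0<..<b}. Q (1 * t)" and n: "\<exists>b\<in>{0<..a}. \<forall>t\<in>{0<..<b}. Q (-1 * t)" and z: "Q 0"
    for Q :: "real \<Rightarrow> bool"
  proof -
    obtain b1 b2 where b1: "b1 \<in> {0<..a}" "\<forall>t\<in>{0<..<b1}. Q (1 * t)" and b2: "b2 \<in> {0<..a}" "\<forall>t\<in>{0<..<b2}. Q (-1 * t)"
      using p n by blast
    have "Q t" if t: "t \<in> {- min b1 b2<..<min b1 b2}" for t
    proof -
      have "- min b1 b2 < t" using t by simp
      then have "- t < min b1 b2" by linarith
      moreover have "t < min b1 b2" using t by simp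
      ultimately have t: "- t < b2" "t < b1" by simp_all
      show ?thesis
    proof (cases t "0 :: real" rule: linorder_cases)
      case less
      then show ?thesis using b2(2)[rule_format, of "- t"] t by simp
    next
      case greater
      then show ?thesis using b1(2)[rule_format, of t] t by simp
    qed (use z in simp)
    qed
    moreover have "min b1 b2 \<in> {0<..a}" using b1(1) b2(1) by (simp add: min.coboundedI1)
    ultimately show ?thesis by blast
  qed
  show ?strong
  proof (intro impI, elim conjE)
    assume st: "strongly_stable_0 W \<omega> P H s0" and nr: "\<not> rv_resonance W \<omega> P H s0 \<xi>"
    show "\<exists>b\<in>{0<..a}. \<forall>t\<in>{-b<..<b}. elliptic W \<omega> P H (c t)"
      using elliptic_p0[OF st] unfolding c0[symmetric]
      by (intro two_sided ell strongly_stable_L0 st nr) simp_all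
  qed
  show ?unstable
  proof
    assume u: "lin_unstable W \<omega> P H (0, s0)"
    then obtain l where l: "l \<in> spectrum_on W L0" "Re l \<noteq> 0"
      unfolding lin_unstable_def linearly_unstable_def spectrum_p0 by blast
    have un: "\<exists>b\<in>{0<..a}. \<forall>t\<in>{0<..<b}. lin_unstable W \<omega> P H (c (\<sigma> * t))" if \<sigma>: "\<sigma> = 1 \<or> \<sigma> = -1" for \<sigma>
    proof (rule interval_from_sequences[OF a, of "\<lambda>t. lin_unstable W \<omega> P H (c (\<sigma> * t))"])
      fix s :: "nat \<Rightarrow> real" assume s: "\<And>k. s k \<in> {0<..<a}" "s \<longlonglongrightarrow> 0"
      show "\<exists>k. lin_unstable W \<omega> P H (c (\<sigma> * s k))"
        by (rule lin_unstable_near[OF seq[OF s \<sigma>] l])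
    qed blast
    show "\<exists>b\<in>{0<..a}. \<forall>t\<in>{-b<..<b}. lin_unstable W \<omega> P H (c t)"
      using u unfolding c0[symmetric] by (intro two_sided un) simp_all
  qed
  show ?definite
  proof
    assume d: "definite_on W (hessian_0 P H s0)"
    obtain sg :: real where sg: "sg = 1 \<or> sg = -1" "\<And>u. u \<in> W \<Longrightarrow> u \<noteq> 0 \<Longrightarrow> sg * hessian_0 P H s0 u u > 0"
    proof (cases "\<forall>u\<in>W. u \<noteq> 0 \<longrightarrow> hessian_0 P H s0 u u > 0")
      case True
      show thesis by (rule that[of 1]) (use True in simp_all)
    next
      case False
      then have "\<forall>u\<in>W. u \<noteq> 0 \<longrightarrow> hessian_0 P H s0 u u < 0" using d unfolding definite_on_def by blast
      then show thesis by (intro that[of "-1"]) simp_all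
    qed
    have \<sigma>: "- sg = 1 \<or> - sg = -1" "sg = 1 \<or> sg = -1" using sg(1) by auto
    obtain b1 where b1: "b1 \<in> {0<..a}" "\<And>t. t \<in> {0<..<b1} \<Longrightarrow> lyapunov_stable W \<omega> P H (c (- sg * t))"
    proof (rule interval_from_sequences[OF a, of "\<lambda>t. lyapunov_stable W \<omega> P H (c (- sg * t))"])
      fix s :: "nat \<Rightarrow> real" assume s: "\<And>k. s k \<in> {0<..<a}" "s \<longlonglongrightarrow> 0"
      have sgn: "sgn (- sg * s k) = - sg" for k using sg(1) s(1)[of k] by (elim disjE) simp_all
      show "\<exists>k. lyapunov_stable W \<omega> P H (c (- sg * s k))"
        by (rule lyapunov_stable_near[OF seq[OF s \<sigma>(1)] sgn sg])
    qed blast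
    obtain b2 where b2: "b2 \<in> {0<..a}" "\<not> rv_resonance W \<omega> P H s0 \<xi> \<Longrightarrow> t \<in> {0<..<b2} \<Longrightarrow> elliptic W \<omega> P H (c (sg * t))" for t
    proof (cases "rv_resonance W \<omega> P H s0 \<xi>")
      case True
      show thesis by (rule that[of a]) (use True a in simp_all)
    next
      case False
      show thesis using ell[OF \<sigma>(2) definite_L0[OF d] False] that by blast
    qed
    show "\<exists>\<sigma>\<in>{1, -1}. \<exists>b\<in>{0<..a}.
           (\<forall>t\<in>{0<..<b}. lyapunov_stable W \<omega> P H (c (\<sigma> * t))) \<and>
           (\<not> rv_resonance W \<omega> P H s0 \<xi> \<longrightarrow>
              (\<forall>t\<in>{0<..<b}. elliptic W \<omega> P H (c (- \<sigma> * t))))"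
    proof (rule bexI[of _ "- sg"], rule bexI[of _ "min b1 b2"], intro conjI ballI impI)
      show "lyapunov_stable W \<omega> P H (c (- sg * t))" if "t \<in> {0<..<min b1 b2}" for t
        using b1(2)[of t] that by simp
      show "elliptic W \<omega> P H (c (- (- sg) * t))" if "\<not> rv_resonance W \<omega> P H s0 \<xi>" "t \<in> {0<..<min b1 b2}" for t
        using b2(2)[of t] that by simp
      show "min b1 b2 \<in> {0<..a}" using b1(1) b2(1) by (simp add: min.coboundedI1)
      show "- sg \<in> {1, -1}" using \<sigma>(1) by blast
    qed
  qed
qed

end

section \<open>The theorem\<close>

text \<open>Invariance moves the point to the identity of the group. An ambient extension \<open>F\<close> of
  \<open>H\<close> is composed with the orthogonal projection onto \<open>W\<close> to make it constant in the
  perpendicular directions.\<close>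

lemma equivariant_chart_at_zero_momentum:
  fixes W S :: "'v::euclidean_space set"
  assumes W: "subspace W" and S: "openin (top_of_set W) S" and symp: "symplectic_form_on W S \<omega>"
    and P: "invariant_nbhd S P" and smooth: "smooth_on P H"
    and inv: "\<forall>k\<in>SO3. \<forall>p\<in>P. H (act k p) = H p" and p0: "(g, 0, s0) \<in> P"
  obtains N f where "equivariant_chart W S \<omega> P H N f" "(0, s0) \<in> N"
proof -
  note openP = conjunct1[OF P[unfolded invariant_nbhd_def]] and actP = conjunct2[OF P[unfolded invariant_nbhd_def]]
  obtain O1 where O1: "open O1" "P = SO3 \<times> (UNIV \<times> S) \<inter> O1"
    using openP unfolding openin_open by metis
  obtain O2 where O2: "open O2" "S = W \<inter> O2" using S unfolding openin_open by metis
  have g: "g \<in> SO3" and s0: "s0 \<in> S" using p0 unfolding O1(2) by simp_all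
  have "act (transpose g) (g, 0, s0) \<in> P"
    by (rule bspec[OF bspec[OF actP SO3_inverse[OF g]] p0])
  then have pP: "(mat 1, 0, s0) \<in> P" unfolding act_def by (simp add: SO3_transpose[OF g])
  obtain U F where U: "open U" "(mat 1, 0, s0) \<in> U" "Cinf_on U F" and FH: "\<forall>y\<in>P \<inter> U. F y = H y"
    using smooth[unfolded smooth_on_def, rule_format, OF pP] by blast
  obtain \<pi> where \<pi>: "linear \<pi>" "\<And>u. \<pi> u \<in> W" "\<And>u. u \<in> W \<Longrightarrow> \<pi> u = u" "\<And>u v. inner (\<pi> u) v = inner u (\<pi> v)"
    using orthogonal_projection_exists[OF W] by metis
  define \<iota> where "\<iota> x = (mat 1 :: real^3^3, fst x :: real^3, \<pi> (snd x))" for x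
  define L where "L x = (0 :: real^3^3, fst x :: real^3, \<pi> (snd x))" for x
  have "linear L" unfolding L_def using \<pi>(1) by (intro linearI) (simp_all add: linear_add linear_scale)
  then have L: "bounded_linear L" by (simp add: linear_conv_bounded_linear)
  have \<iota>L: "\<iota> = (\<lambda>x. (mat 1, 0, 0) + L x)" unfolding \<iota>_def L_def by (rule ext) simp
  \<comment> \<open>Ambient open conditions: in the phase space, in the domain of \<open>F\<close>, in the slice.\<close>
  define T where "T = O1 \<inter> U \<inter> UNIV \<times> (UNIV \<times> O2)"
  have T: "open T" unfolding T_def using O1(1) U(1) O2(1) by (intro open_Int open_Times open_UNIV)
  define N where "N = \<iota> -` T"
  have cont: "continuous_on UNIV \<iota>" unfolding \<iota>L
    by (intro continuous_intros linear_continuous_on[OF L])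
  have N: "open N" unfolding N_def using open_vimage[OF T cont] .
  define f where "f x = F (\<iota> x)" for x
  have \<iota>U: "\<iota> ` N \<subseteq> U" unfolding N_def T_def by (rule image_subsetI) simp
  have "Ck_on k N f" for k
    unfolding f_def by (rule Ck_on_compose[OF N \<iota>U U(3)]) (unfold \<iota>L, intro Ck_on_add Ck_on_const Ck_on_bounded_linear[OF L N] Ck_on_id N)
  then have f: "Cinf_on N f" unfolding Cinf_on_def by blast
  have \<iota>W: "\<iota> x = (mat 1, x)" if "snd x \<in> W" for x unfolding \<iota>_def using \<pi>(3)[OF that] by simp
  have NP: "(mat 1, x) \<in> P" if x: "x \<in> N" "snd x \<in> W" for x
  proof -
    have "(mat 1, x) \<in> T" using x(1) unfolding N_def by (simp add: \<iota>W[OF x(2)])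
    then show ?thesis unfolding T_def O1(2) O2(2) using x(2) SO3_one by (simp add: mem_Times_iff)
  qed
  have Hf: "H (mat 1, x) = f x" if x: "x \<in> N" "snd x \<in> W" for x
  proof -
    have "(mat 1, x) \<in> U" using x(1) unfolding N_def T_def by (simp add: \<iota>W[OF x(2)])
    then show ?thesis using FH NP[OF x] unfolding f_def \<iota>W[OF x(2)] by simp
  qed
  have gradW: "snd (grad f x) \<in> W" if x: "x \<in> N" for x
  proof -
    define q where "q u = (fst u :: real^3, \<pi> (snd u))" for u
    have "linear q" unfolding q_def using \<pi>(1) by (intro linearI) (simp_all add: linear_add linear_scale)
    then have q: "bounded_linear q" by (simp add: linear_conv_bounded_linear)
    have qx: "q x \<in> N" using x unfolding N_def \<iota>_def q_def vimage_def by (simp add: \<pi>(3)[OF \<pi>(2)])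
    have d: "(f has_derivative (\<lambda>v. inner (grad f x) v)) (at x)"
      by (rule has_derivative_grad[OF Cinf_on_has_derivative[OF f x]])
    have dq: "(f has_derivative (\<lambda>v. inner (grad f (q x)) v)) (at (q x))"
      by (rule has_derivative_grad[OF Cinf_on_has_derivative[OF f qx]])
    have fq: "f (q u) = f u" for u
      unfolding f_def \<iota>_def q_def fst_conv snd_conv \<pi>(3)[OF \<pi>(2)] ..
    have "((\<lambda>u. f (q u)) has_derivative (\<lambda>v. inner (grad f (q x)) (q v))) (at x)"
      using diff_chain_at[OF bounded_linear_imp_has_derivative[OF q] dq] unfolding o_def .
    then have "(f has_derivative (\<lambda>v. inner (grad f (q x)) (q v))) (at x)" unfolding fq .
    from has_derivative_unique[OF this d]
    have eq: "(\<lambda>v. inner (grad f (q x)) (q v)) = (\<lambda>v. inner (grad f x) v)" .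
    have *: "inner (grad f (q x)) (q (0, b)) = inner (grad f x) (0, b)" for b
      by (rule fun_cong[OF eq, of "(0, b)"])
    have "q (0, \<pi> b) = q (0, b)" for b unfolding q_def by (simp add: \<pi>(3)[OF \<pi>(2)])
    then have "inner (grad f x) (0, \<pi> b) = inner (grad f x) (0, b)" for b
      using *[of "\<pi> b"] *[of b] by metis
    note ** = this
    have "inner (\<pi> (snd (grad f x))) b = inner (snd (grad f x)) b" for b
    proof -
      have "inner (snd (grad f x)) (\<pi> b) = inner (snd (grad f x)) b"
        using **[of b] unfolding inner_prod_def by simp
      then show ?thesis using \<pi>(4)[of "snd (grad f x)" b] by (rule trans[rotated])
    qed
    then have "\<forall>b. inner (\<pi> (snd (grad f x))) b = inner (snd (grad f x)) b" by (rule allI)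
    then have "\<pi> (snd (grad f x)) = snd (grad f x)" by (rule iffD1[OF vector_eq_rdot])
    then show ?thesis using \<pi>(2)[of "snd (grad f x)"] by simp
  qed
  have diff: "H differentiable (at p within P)" if p: "p \<in> P" for p
  proof -
    obtain V G where V: "open V" "p \<in> V" "Cinf_on V G" "\<forall>y\<in>P \<inter> V. G y = H y"
      using smooth[unfolded smooth_on_def, rule_format, OF p] by blast
    show ?thesis
      by (rule differentiableI, rule has_derivative_transform_local[OF has_derivative_at_withinI[OF Cinf_on_has_derivative[OF V(3,2)]] V(1,2) p])
        (simp add: V(4))
  qed
  show thesis
  proof (rule that)
    show "equivariant_chart W S \<omega> P H N f"
      by (rule equivariant_chart.intro[OF W S symp P _ diff N f NP Hf gradW]) (simp add: inv)
    have "s0 \<in> W" using s0 unfolding O2(2) by simp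
    then show "(0, s0) \<in> N"
      unfolding N_def T_def using pP U(2) s0 unfolding O1(2) O2(2) by (simp add: \<iota>W)
  qed
qed

theorem theorem3p1:
  fixes W S :: "'v::euclidean_space set"
    and \<omega> :: "'v \<Rightarrow> 'v \<Rightarrow> 'v \<Rightarrow> real"
    and P :: "'v phase set"
    and H :: "'v phase \<Rightarrow> real"
    and g :: "real^3^3" and p0 :: "'v quot" and s0 :: 'v and \<xi> :: "real^3"
  assumes slice: "subspace W" "openin (top_of_set W) S" "symplectic_form_on W S \<omega>"
    and phase: "invariant_nbhd S P"
    and smooth: "smooth_on P H"
    and invariant: "\<forall>k\<in>SO3. \<forall>p\<in>P. H (act k p) = H p"
    and p0: "p0 = (0, s0)" "(g, p0) \<in> P"
    and rel_eq: "ham_field W \<omega> P H (g, p0) = generator \<xi> (g, p0)" "\<xi> \<noteq> 0"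
    and nondegenerate: "nondegenerate_on W (hessian_0 P H s0)"
  shows "\<exists>U a c.
     openin (top_of_set (orbit_space P)) U \<and> p0 \<in> U \<and>
     smooth_curve a c \<and> c 0 = p0 \<and>
     rel_equilibria W \<omega> P H \<inter> U = c ` {-a<..<a} \<and>
     (\<exists>\<delta>>0. \<forall>\<mu>. 0 < norm \<mu> \<and> norm \<mu> < \<delta> \<longrightarrow>
        card (c ` {-a<..<a} \<inter> reduced_space P \<mu>) = 2) \<and>
     (definite_on W (hessian_0 P H s0) \<longrightarrow>
        (\<exists>\<sigma>\<in>{1, -1}. \<exists>b\<in>{0<..a}.
           (\<forall>t\<in>{0<..<b}. lyapunov_stable W \<omega> P H (c (\<sigma> * t))) \<and>
           (\<not> rv_resonance W \<omega> P H s0 \<xi> \<longrightarrow>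
              (\<forall>t\<in>{0<..<b}. elliptic W \<omega> P H (c (- \<sigma> * t)))))) \<and>
     (strongly_stable_0 W \<omega> P H s0 \<and> \<not> rv_resonance W \<omega> P H s0 \<xi> \<longrightarrow>
        (\<exists>b\<in>{0<..a}. \<forall>t\<in>{-b<..<b}. elliptic W \<omega> P H (c t))) \<and>
     (lin_unstable W \<omega> P H p0 \<longrightarrow>
        (\<exists>b\<in>{0<..a}. \<forall>t\<in>{-b<..<b}. lin_unstable W \<omega> P H (c t)))"
proof -
  obtain N f where chart: "equivariant_chart W S \<omega> P H N f" and p0N: "(0, s0) \<in> N"
    using equivariant_chart_at_zero_momentum[OF slice phase smooth invariant p0(2)[unfolded p0(1)]] by blast
  interpret E: equivariant_chart W S \<omega> P H N f by (rule chart)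
  have g: "g \<in> SO3" and s0S: "s0 \<in> S" using E.PD[of g p0] p0 by simp_all
  have s0W: "s0 \<in> W" using s0S E.SW by blast
  let ?d = "snd (grad f (0, s0))"
  have field: "(g ** hat (E.ang (0, s0)), cross3 0 (E.ang (0, s0)), E.sharp s0 ?d) = (hat \<xi> ** g, 0, 0)"
    using E.ham_field_eq[OF g p0N] s0W rel_eq(1) unfolding p0(1) generator_def by simp
  have dW: "?d \<in> W" using E.gradW[OF p0N] s0W by simp
  \<comment> \<open>The slice component of the field vanishes, hence so does the differential it represents.\<close>
  have "inner ?d ?d = \<omega> s0 (E.sharp s0 ?d) ?d" by (rule E.sharp(2)[OF s0S dW, symmetric])
  also have "\<dots> = 0" using field bilinear_lzero[OF E.form(1)[OF s0S]] by simp
  finally have d0: "?d = 0" by simp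
  have "hat \<xi> ** g = hat (g *v E.ang (0, s0)) ** g"
    using field unfolding rotation_hat[OF g] prod.inject by (simp only:)
  then have "(hat \<xi> ** g) ** transpose g = (hat (g *v E.ang (0, s0)) ** g) ** transpose g" by simp
  moreover have "g ** transpose g = mat 1" using SO3_transpose[OF SO3_inverse[OF g]] by simp
  ultimately have "hat \<xi> = hat (g *v E.ang (0, s0))" by (simp add: matrix_mul_assoc[symmetric])
  then have "vee (hat \<xi>) = vee (hat (g *v E.ang (0, s0)))" by simp
  then have \<xi>: "\<xi> = g *v E.ang (0, s0)" unfolding vee_hat .
  have n\<xi>: "norm \<xi> = norm (E.ang (0, s0))" unfolding \<xi> by (rule SO3_norm[OF g])
  then have a0: "E.ang (0, s0) \<noteq> 0" using rel_eq(2) by auto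
  interpret R: relative_equilibrium_chart W S \<omega> P H N f s0
    by unfold_locales (fact p0N s0W d0 a0 nondegenerate)+
  show ?thesis
  proof (rule R.curve_exists)
    fix U a c assume U: "openin (top_of_set (orbit_space P)) U" "(0, s0) \<in> U" "smooth_curve a c" "c 0 = (0, s0)"
      "rel_equilibria W \<omega> P H \<inter> U = c ` {-a<..<a}"
      "\<exists>\<delta>>0. \<forall>\<mu>. 0 < norm \<mu> \<and> norm \<mu> < \<delta> \<longrightarrow> card (c ` {-a<..<a} \<inter> reduced_space P \<mu>) = 2"
    and c: "\<And>t. t \<in> {-a<..<a} \<Longrightarrow> c t \<in> N \<and> snd (c t) \<in> W \<and> snd (grad f (c t)) = 0 \<and> E.ang (c t) \<noteq> 0 \<and>
      fst (c t) = (t / (norm (E.ang (c t)))\<^sup>2) *\<^sub>R E.ang (c t) \<and> isCont c t"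
    have a: "a > 0" using U(3) unfolding smooth_curve_def by (rule conjunct1)
    have branch: "R.branch_point (c t) t" if "t \<in> {-a<..<a}" "t \<noteq> 0" for t
      using c[OF that(1)] that(2) unfolding R.branch_point_def by (simp only: simp_thms)
    have cont: "isCont c 0" using c[of 0] a by simp
    note stability = R.stability_along_curve[OF n\<xi> a U(4) branch cont]
    show ?thesis unfolding p0(1)
      by (rule exI[of _ U], rule exI[of _ a], rule exI[of _ c]) (intro conjI U stability)
  qed
qed

end
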